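(* Assume the process $\{F_j\}_{j\in\mathbb Z_+}$ is i.i.d. under $\mathbb P$ and satisfies the tail assumptions $$\int_0^\infty\bigl\{1-\mathbb E(F_0(x))\bigr\}^{1/2}dx<\infty,\qquad \int_0^\infty\operatorname*{ess\,sup}_{\mathbb P}(1-F_0(x))\,dx<\infty,$$ $$\int_{-\infty}^0\bigl(\mathbb E[F_0(x)]\bigr)^{1/2}dx<\infty,\qquad \int_{-\infty}^0\operatorname*{ess\,sup}_{\mathbb P}F_0(x)\,dx<\infty.$$ Then, as $\alpha\downarrow0$, $$\Psi(\alpha,1)=\mu+2\sigma\sqrt\alpha+o(\sqrt\alpha).$$
   Context: $\mathbb P$ is a probability measure on sequences $(F_j)_{j\in\mathbb Z_+}$ of Borel probability distributions on $\mathbb R$ (the environment), with expectation $\mathbb E$; $F_j(\cdot)$ also denotes the distribution function. Given $(F_j)$, the weights $\{X(i,j):(i,j)\in\mathbb Z_+^2\}$ are independent with $X(i,j)\sim F_j$. $T(k,\ell)$ is the maximum of $\sum_{z\in\pi}X(z)$ over all nearest-neighbor lattice paths $\pi$ from $(0,0)$ to $(k,\ell)$ with steps $(1,0)$ or $(0,1)$, the endpoint $(k,\ell)$ excluded. $\Psi(x,y)=\lim_{n\to\infty}\frac1nT(\lfloor nx\rfloor,\lfloor ny\rfloor)$, $(x,y)\in(0,\infty)^2$, is the deterministic limit, almost sure and in $L^1$ over environment and weights. $\mu_j$ and $\sigma_j^2$ denote the mean and variance of the (random) distribution $F_j$; $\mu=\mathbb E(\mu_0)$, $\sigma^2=\mathbb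 E(\sigma_0^2)$, $\sigma=\sqrt{\sigma^2}$. $\operatorname{ess\,sup}_{\mathbb P}f=\inf\{s\in\mathbb R:\mathbb P(f>s)=0\}$. *)

theory Defs
  imports "HOL-Probability.Probability" "HOL-Library.Landau_Symbols"
begin

section \<open>Last-passage times\<close>

definition lattice_paths :: "nat \<times> nat \<Rightarrow> (nat \<times> nat) list set" where
  "lattice_paths z = {\<pi>. \<pi> \<noteq> [] \<and> hd \<pi> = (0, 0) \<and> last \<pi> = z \<and>
     successively (\<lambda>(a, b) w. w = (a + 1, b) \<or> w = (a, b + 1)) \<pi>}"

text \<open>The last point of a path does not contribute to its weight, hence \<^const>\<open>butlast\<close>.
  The points of a path are distinct, so summing over the list is summing over the path.\<close>

definition last_passage :: "(nat \<times> nat \<Rightarrow> real) \<Rightarrow> nat \<Rightarrow> nat \<Rightarrow> real" where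
  "last_passage X k l = Max ((\<lambda>\<pi>. \<Sum>z\<leftarrow>butlast \<pi>. X z) ` lattice_paths (k, l))"

lemma lattice_path_bounds:
  assumes "successively (\<lambda>(a, b) w. w = (a + 1, b) \<or> w = (a, b + 1)) \<pi>" "\<pi> \<noteq> []"
  shows "set \<pi> \<subseteq> {fst (hd \<pi>)..fst (last \<pi>)} \<times> {snd (hd \<pi>)..snd (last \<pi>)} \<and>
         fst (last \<pi>) + snd (last \<pi>) = fst (hd \<pi>) + snd (hd \<pi>) + (length \<pi> - (1::nat))"
  using assms
proof (induction \<pi>)
  case Nil
  then show ?case by simp
next
  case (Cons z \<pi>)
  obtain a b where z: "z = (a, b)" by fastforce
  show ?case
  proof (cases "\<pi> = []")
    case True
    then show ?thesis by (simp add: z)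
  next
    case False
    from Cons.prems False have succ: "successively (\<lambda>(a, b) w. w = (a + 1, b) \<or> w = (a, b + 1)) \<pi>"
      and step: "hd \<pi> = (a + 1, b) \<or> hd \<pi> = (a, b + 1)"
      by (auto simp: successively_Cons z)
    note IH = Cons.IH[OF succ False]
    have len: "length \<pi> > 0" using False by simp
    have "hd \<pi> \<in> set \<pi>" using False by simp
    with IH have "hd \<pi> \<in> {fst (hd \<pi>)..fst (last \<pi>)} \<times> {snd (hd \<pi>)..snd (last \<pi>)}" by blast
    then have le: "fst (hd \<pi>) \<le> fst (last \<pi>)" "snd (hd \<pi>) \<le> snd (last \<pi>)"
      by (cases "hd \<pi>"; simp)+
    have "{fst (hd \<pi>)..fst (last \<pi>)} \<times> {snd (hd \<pi>)..snd (last \<pi>)}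
        \<subseteq> {a..fst (last \<pi>)} \<times> {b..snd (last \<pi>)}"
      using step by auto
    with IH have "set \<pi> \<subseteq> {a..fst (last \<pi>)} \<times> {b..snd (last \<pi>)}" by (meson subset_trans)
    moreover have "(a, b) \<in> {a..fst (last \<pi>)} \<times> {b..snd (last \<pi>)}"
      using le step by auto
    moreover have "fst (last \<pi>) + snd (last \<pi>) = a + b + length \<pi>"
      using IH step len by auto
    ultimately show ?thesis using False by (simp add: z)
  qed
qed

lemma finite_lattice_paths: "finite (lattice_paths z)"
proof (rule finite_subset)
  show "lattice_paths z \<subseteq>
      {\<pi>. set \<pi> \<subseteq> {0..fst z} \<times> {0..snd z} \<and> length \<pi> \<le> fst z + snd z + 1}"
  proof
    fix \<pi> assume "\<pi> \<in> lattice_paths z"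
    then show "\<pi> \<in> {\<pi>. set \<pi> \<subseteq> {0..fst z} \<times> {0..snd z} \<and> length \<pi> \<le> fst z + snd z + 1}"
      using lattice_path_bounds[of \<pi>] by (simp add: lattice_paths_def)
  qed
  show "finite {\<pi>. set \<pi> \<subseteq> {0..fst z} \<times> {0..snd z} \<and> length \<pi> \<le> fst z + snd z + 1}"
    by (intro finite_lists_length_le) auto
qed

lemma lattice_paths_nonempty: "lattice_paths (k, l) \<noteq> {}"
proof -
  have snoc: "\<pi> @ [w] \<in> lattice_paths w"
    if "\<pi> \<in> lattice_paths (a, b)" "w = (a + 1, b) \<or> w = (a, b + 1)" for \<pi> a b w
    using that by (auto simp: lattice_paths_def successively_append_iff)
  have "[(0, 0)] \<in> lattice_paths (0, 0)"
    by (simp add: lattice_paths_def)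
  then have "\<exists>\<pi>. \<pi> \<in> lattice_paths (k, 0)"
  proof (induction k)
    case (Suc k)
    then obtain \<pi> where "\<pi> \<in> lattice_paths (k, 0)" by blast
    from snoc[OF this] show ?case by auto
  qed blast
  then have "\<exists>\<pi>. \<pi> \<in> lattice_paths (k, l)"
  proof (induction l)
    case (Suc l)
    then obtain \<pi> where "\<pi> \<in> lattice_paths (k, l)" by blast
    from snoc[OF this] show ?case by auto
  qed
  then show ?thesis by blast
qed

section \<open>Environments and weights\<close>

text \<open>An environment is a sequence of elements of \<^term>\<open>prob_algebra (borel :: real measure)\<close>,
  the measurable space of Borel probability distributions on the real line.\<close>

definition env_space :: "(nat \<Rightarrow> real measure) measure" where
  "env_space = (\<Pi>\<^sub>M j\<in>UNIV. prob_algebra borel)"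

definition weight_space :: "(nat \<times> nat \<Rightarrow> real) measure" where
  "weight_space = (\<Pi>\<^sub>M z\<in>UNIV. borel)"

text \<open>The law of the weights given the environment \<open>F\<close>: the coordinates are independent and the
  one at \<open>(i, j)\<close> has distribution \<open>F j\<close>.\<close>

definition quenched_law :: "(nat \<Rightarrow> real measure) \<Rightarrow> (nat \<times> nat \<Rightarrow> real) measure" where
  "quenched_law F = (\<Pi>\<^sub>M (i, j)\<in>UNIV. F j)"

definition joint_law ::
  "(nat \<Rightarrow> real measure) measure \<Rightarrow> ((nat \<Rightarrow> real measure) \<times> (nat \<times> nat \<Rightarrow> real)) measure" where
  "joint_law P = P \<bind> (\<lambda>F. distr (quenched_law F) (env_space \<Otimes>\<^sub>M weight_space) (\<lambda>X. (F, X)))"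

lemma quenched_law_measurable: "quenched_law \<in> env_space \<rightarrow>\<^sub>M prob_algebra weight_space"
proof (rule measurable_prob_algebra_generated[where G = "prod_algebra UNIV (\<lambda>_. borel)"
      and \<Omega> = "\<Pi>\<^sub>E i\<in>UNIV. space borel"])
  show "sets weight_space =
      sigma_sets (\<Pi>\<^sub>E i\<in>UNIV. space borel) (prod_algebra UNIV (\<lambda>_::nat \<times> nat. borel :: real measure))"
    unfolding weight_space_def by (rule sets_PiM)
  fix F assume F: "F \<in> space env_space"
  then have F': "prob_space (F j)" "sets (F j) = sets borel" for j
    by (auto simp: env_space_def space_PiM PiE_iff space_prob_algebra)
  show "prob_space (quenched_law F)"
    unfolding quenched_law_def by (rule prob_space_PiM) (auto simp: F')
  show "sets (quenched_law F) = sets weight_space"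
    unfolding quenched_law_def weight_space_def by (rule sets_PiM_cong) (auto simp: F')
next
  fix A :: "(nat \<times> nat \<Rightarrow> real) set"
  assume "A \<in> prod_algebra UNIV (\<lambda>_. borel)"
  then obtain J E where A: "A = prod_emb UNIV (\<lambda>_. borel) J (Pi\<^sub>E J E)" "finite J"
    "\<And>i. i \<in> J \<Longrightarrow> E i \<in> sets borel"
    by (elim prod_algebraE) auto
  have "emeasure (quenched_law F) A = (\<Prod>z\<in>J. emeasure (F (snd z)) (E z))"
    if "F \<in> space env_space" for F
  proof -
    have F': "prob_space (F j)" "sets (F j) = sets borel" for j
      using that by (auto simp: env_space_def space_PiM PiE_iff space_prob_algebra)
    have "space (F j) = UNIV" for j
      using sets_eq_imp_space_eq[OF F'(2)] by simp
    then have "A = prod_emb UNIV (\<lambda>(i, j). F j) J (Pi\<^sub>E J E)"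
      by (auto simp: A(1) prod_emb_def)
    then show ?thesis
      unfolding quenched_law_def
      using emeasure_PiM_emb[of UNIV "\<lambda>(i, j). F j" J E] A(2,3) F' by (simp add: split_beta)
  qed
  moreover have "(\<lambda>F. \<Prod>z\<in>J. emeasure (F (snd z)) (E z)) \<in> borel_measurable env_space"
  proof (rule borel_measurable_prod_ennreal)
    fix z assume "z \<in> J"
    have "(\<lambda>F. F (snd z)) \<in> env_space \<rightarrow>\<^sub>M subprob_algebra borel"
      unfolding env_space_def by (intro measurable_prob_algebraD measurable_component_singleton) simp
    then show "(\<lambda>F. emeasure (F (snd z)) (E z)) \<in> borel_measurable env_space"
      by (rule measurable_compose) (intro measurable_emeasure_subprob_algebra A(3) \<open>z \<in> J\<close>)
  qed
  ultimately show "(\<lambda>F. emeasure (quenched_law F) A) \<in> borel_measurable env_space"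
    by (subst measurable_cong) auto
qed (auto simp: Int_stable_prod_algebra prod_algebra_sets_into_space[THEN subsetD])

lemma joint_kernel_measurable:
  "(\<lambda>F. distr (quenched_law F) (env_space \<Otimes>\<^sub>M weight_space) (\<lambda>X. (F, X)))
     \<in> env_space \<rightarrow>\<^sub>M prob_algebra (env_space \<Otimes>\<^sub>M weight_space)"
  by (rule measurable_distr_prob_space2[OF quenched_law_measurable]) simp

definition iid_env :: "(nat \<Rightarrow> real measure) measure \<Rightarrow> bool" where
  "iid_env P \<longleftrightarrow> prob_space P \<and> sets P = sets env_space \<and>
     prob_space.indep_vars P (\<lambda>_. prob_algebra borel) (\<lambda>j F. F j) UNIV \<and>
     (\<forall>j. distr P (prob_algebra borel) (\<lambda>F. F j) = distr P (prob_algebra borel) (\<lambda>F. F 0))"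

definition dist_mean :: "real measure \<Rightarrow> real" where
  "dist_mean D = (\<integral>x. x \<partial>D)"

definition dist_var :: "real measure \<Rightarrow> real" where
  "dist_var D = (\<integral>x. (x - dist_mean D)\<^sup>2 \<partial>D)"

definition tail_assumptions :: "(nat \<Rightarrow> real measure) measure \<Rightarrow> bool" where
  "tail_assumptions P \<longleftrightarrow>
     (\<integral>\<^sup>+x\<in>{0..}. ennreal (sqrt (1 - (\<integral>F. cdf (F 0) x \<partial>P))) \<partial>lborel) < \<infinity> \<and>
     (\<integral>\<^sup>+x\<in>{0..}. esssup P (\<lambda>F. ennreal (1 - cdf (F 0) x)) \<partial>lborel) < \<infinity> \<and>
     (\<integral>\<^sup>+x\<in>{..0}. ennreal (sqrt (\<integral>F. cdf (F 0) x \<partial>P)) \<partial>lborel) < \<infinity> \<and>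
     (\<integral>\<^sup>+x\<in>{..0}. esssup P (\<lambda>F. ennreal (cdf (F 0) x)) \<partial>lborel) < \<infinity>"

text \<open>\<open>\<Psi>\<close> is the deterministic limit of the rescaled last-passage times, almost surely and in
  \<open>L\<^sup>1\<close> under the joint law. Its values outside the open quadrant are irrelevant.\<close>

definition is_limit_shape ::
  "(nat \<Rightarrow> real measure) measure \<Rightarrow> (real \<Rightarrow> real \<Rightarrow> real) \<Rightarrow> bool" where
  "is_limit_shape P \<Psi> \<longleftrightarrow> (\<forall>x>0. \<forall>y>0.
     (AE (F, X) in joint_law P.
        (\<lambda>n. last_passage X (nat \<lfloor>real n * x\<rfloor>) (nat \<lfloor>real n * y\<rfloor>) / real n) \<longlonglongrightarrow> \<Psi> x y) \<and>
     (\<lambda>n. \<integral>\<^sup>+(F, X). ennreal \<bar>last_passage X (nat \<lfloor>real n * x\<rfloor>) (nat \<lfloor>real n * y\<rfloor>) / real n - \<Psi> x y\<bar>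
        \<partial>joint_law P) \<longlonglongrightarrow> 0)"

end

theory Submission
  imports Defs "HOL-Real_Asymp.Real_Asymp"
begin

text \<open>
  Near the axis a path makes few horizontal steps, so to leading order it collects one weight from
  every row, in weakly increasing columns. Truncating the weights at height \<open>M\<close> changes \<open>\<Psi> \<alpha> 1\<close> by the
  change of the mean plus \<open>O(\<tau> \<surd>\<alpha>) + o(\<surd>\<alpha>)\<close>, where \<open>\<tau>\<close> integrates the square root of the averaged
  tail beyond \<open>M\<close>: the excess over \<open>M\<close> is an integral of indicator weights, and indicators are
  Bernoulli weights.

  For bounded weights, subtracting the quenched means of the rows changes all paths by the same
  amount. The centered rows have uncorrelated entries, hence the first two moments of rows of
  independent signs. Lindeberg's replacement, one row at a time and applied to a smoothed maximum
  (a free energy), shows that signs give the same passage time up to \<open>o(\<surd>\<alpha>)\<close>. For signs, that is for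
  fair Bernoulli weights, the leading term comes from a stationary version of the model with
  geometric boundary weights, which has a Burke property. In the end \<open>\<alpha>\<close> tends to \<open>0\<close> first and \<open>M\<close>
  to infinity afterwards.
\<close>

text \<open>With about \<alpha> n columns and n rows, fluctuations are of order sqrt \<alpha> n;
  every error must be smaller or carry a factor that vanishes with the truncation height. An
  indicator weight of averaged probability p exceeds n p along the best path by at most 2 sqrt
  ((k+1) n p) in expectation. Integrated over levels this yields square roots of averaged tails,
  hence the first and third tail assumption. The k horizontal steps are charged to columns. In a
  fixed environment the columns are i.i.d., but one stationary parameter has to lie above all
  success probabilities of a column; this is where the essential suprema enter. Discarding an excess
  also needs a lower bound for the least excess along a path, and for indicators the complement
  turns this into an upper bound for a maximum. For fair bits the stationary model gives the upper
  bound at once. The lower bound has to exclude that the optimal path profits from the boundary: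
  concentration reduces this to expectations, and there the strict concavity of the square root
  forces the path to exit near the corner.\<close>

text \<open>\<open>prof w t n k\<close> is the maximum of \<open>t c\<^sub>0 + (\<Sum>j<n. w j (c j))\<close> over weakly increasing columns
  \<open>c\<^sub>0 \<le> c 0 \<le> \<dots> \<le> c (n - 1) \<le> k\<close>; \<open>low_prof\<close> is the corresponding minimum.\<close>

primrec row_step :: "(nat \<Rightarrow> real) \<Rightarrow> (nat \<Rightarrow> real) \<Rightarrow> nat \<Rightarrow> real" where
  "row_step x t 0 = t 0 + x 0"
| "row_step x t (Suc i) = max (row_step x t i) (t (Suc i) + x (Suc i))"

primrec prof :: "(nat \<Rightarrow> nat \<Rightarrow> real) \<Rightarrow> (nat \<Rightarrow> real) \<Rightarrow> nat \<Rightarrow> nat \<Rightarrow> real" where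
  "prof w t 0 = t"
| "prof w t (Suc n) = row_step (w n) (prof w t n)"

primrec low_step :: "(nat \<Rightarrow> real) \<Rightarrow> (nat \<Rightarrow> real) \<Rightarrow> nat \<Rightarrow> real" where
  "low_step x t 0 = t 0 + x 0"
| "low_step x t (Suc i) = min (low_step x t i) (t (Suc i) + x (Suc i))"

primrec low_prof :: "(nat \<Rightarrow> nat \<Rightarrow> real) \<Rightarrow> nat \<Rightarrow> nat \<Rightarrow> real" where
  "low_prof w 0 = (\<lambda>_. 0)"
| "low_prof w (Suc n) = low_step (w n) (low_prof w n)"

abbreviation passage :: "(nat \<Rightarrow> nat \<Rightarrow> real) \<Rightarrow> nat \<Rightarrow> nat \<Rightarrow> real" where
  "passage w \<equiv> prof w (\<lambda>_. 0)"

text \<open>A profile grows by its last row, whereas conditioning splits off the first row of an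
  i.i.d. sequence. Absorbing that row into the starting profile reconciles the two, which is why
  \<open>prof\<close> carries a general \<open>t\<close>.\<close>

lemma prof_Suc_first: "prof w t (Suc n) = prof (\<lambda>j. w (Suc j)) (row_step (w 0) t) n"
  by (induction n) auto

lemma row_step_mono:
  assumes "\<And>i. i \<le> k \<Longrightarrow> t i \<le> t' i" "\<And>i. i \<le> k \<Longrightarrow> x i \<le> x' i"
  shows "row_step x t k \<le> row_step x' t' k"
  using assms
proof (induction k)
  case (Suc k)
  have "t (Suc k) + x (Suc k) \<le> t' (Suc k) + x' (Suc k)" by (intro add_mono Suc.prems) auto
  moreover have "row_step x t k \<le> row_step x' t' k" by (rule Suc.IH) (use Suc.prems in auto)
  ultimately show ?case by (auto simp: le_max_iff_disj)
qed (auto intro!: add_mono)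

lemma prof_mono:
  assumes "\<And>i. i \<le> k \<Longrightarrow> t i \<le> t' i" "\<And>j i. j < n \<Longrightarrow> i \<le> k \<Longrightarrow> w j i \<le> w' j i"
  shows "prof w t n k \<le> prof w' t' n k"
  using assms
proof (induction n arbitrary: k)
  case (Suc n)
  then show ?case by (auto intro!: row_step_mono)
qed auto

lemma prof_cong:
  assumes "\<And>i. i \<le> k \<Longrightarrow> t i = t' i" "\<And>j i. j < n \<Longrightarrow> i \<le> k \<Longrightarrow> w j i = w' j i"
  shows "prof w t n k = prof w' t' n k"
  using assms by (intro antisym prof_mono) auto

lemma row_step_add_const: "row_step (\<lambda>i. x i + c) (\<lambda>i. t i + d) k = row_step x t k + (c + d)"
  by (induction k) (auto simp: algebra_simps max_add_distrib_left)

text \<open>Every competing sum uses exactly one weight from each row, so shifting a whole row is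
  common to all competitors. With the quenched mean as \<open>c j\<close> this is the centering of
  the rows.\<close>

lemma prof_add_const:
  "prof (\<lambda>j i. w j i + c j) (\<lambda>i. t i + d) n k = prof w t n k + (\<Sum>j<n. c j) + d"
proof (induction n arbitrary: k)
  case (Suc n)
  have "prof (\<lambda>j i. w j i + c j) (\<lambda>i. t i + d) n = (\<lambda>k. prof w t n k + ((\<Sum>j<n. c j) + d))"
    using Suc by (auto simp: add.assoc)
  then show ?case by (simp add: row_step_add_const)
qed auto

lemma row_step_mult: "a \<ge> 0 \<Longrightarrow> row_step (\<lambda>i. a * x i) (\<lambda>i. a * t i) k = a * row_step x t k"
  by (induction k) (auto simp: algebra_simps max_mult_distrib_left)

lemma prof_mult: "a \<ge> 0 \<Longrightarrow> prof (\<lambda>j i. a * w j i) (\<lambda>i. a * t i) n k = a * prof w t n k"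
proof (induction n arbitrary: k)
  case (Suc n)
  have "prof (\<lambda>j i. a * w j i) (\<lambda>i. a * t i) n = (\<lambda>k. a * prof w t n k)"
    using Suc by auto
  then show ?case using Suc.prems by (simp add: row_step_mult)
qed auto

lemma mono_row_step: "mono (row_step x t)"
  by (simp add: mono_iff_le_Suc)

lemma mono_prof: "mono t \<Longrightarrow> mono (prof w t n)"
  by (cases n) (auto simp: mono_row_step)

lemma row_step_ge: "t k + x k \<le> row_step x t k"
  by (cases k) auto

lemma low_prof_nonneg:
  assumes "\<And>j i. j < n \<Longrightarrow> i \<le> k \<Longrightarrow> 0 \<le> w j i"
  shows "0 \<le> low_prof w n k"
  using assms
proof (induction n arbitrary: k)
  case (Suc n)
  have "0 \<le> low_prof w n i + w n i" if "i \<le> k" for i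
    using Suc.IH[of i] Suc.prems that by (simp add: add_nonneg_nonneg)
  then have "0 \<le> low_step (w n) (low_prof w n) k"
    by (induction k) auto
  then show ?case by simp
qed auto

lemma passage_const: "passage (\<lambda>j i. c j) n k = (\<Sum>j<n. c j)"
  using prof_add_const[of "\<lambda>_ _. 0" c "\<lambda>_. 0" 0 n k] prof_mult[of 0 "\<lambda>_ _. 0" "\<lambda>_. 0" n k] by simp

lemma passage_nonneg:
  assumes "\<And>j i. j < n \<Longrightarrow> i \<le> k \<Longrightarrow> 0 \<le> w j i"
  shows "0 \<le> passage w n k"
  using prof_mono[of k "\<lambda>_. 0" "\<lambda>_. 0" n "\<lambda>_ _. 0" w] assms passage_const[of "\<lambda>_. 0" n k] by simp

text \<open>Minimising complements is maximising. For indicators and \<open>c = 1\<close> this makes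
  minima accessible to the stationary comparison, whose drift estimate for general rows bounds
  maxima from above.\<close>

lemma low_prof_complement: "low_prof (\<lambda>j i. c - w j i) n k = real n * c - passage w n k"
proof (induction n arbitrary: k)
  case (Suc n)
  have "low_step (\<lambda>i. c - w n i) (\<lambda>k. real n * c - passage w n k) k
      = real (Suc n) * c - row_step (w n) (passage w n) k"
  proof (induction k)
    case (Suc k)
    have "min (r - a) (r - b) = r - max a b" for r a b :: real by auto
    then show ?case using Suc by (simp add: algebra_simps)
  qed (simp add: algebra_simps)
  moreover have "low_prof (\<lambda>j i. c - w j i) n = (\<lambda>k. real n * c - passage w n k)"
    by (rule ext) (rule Suc)
  ultimately show ?case by (metis low_prof.simps(2) prof.simps(2))
qed simp

section \<open>Recursion for last-passage times\<close>

text \<open>The path is cut at its end because the endpoint carries no weight: one further step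
  collects exactly the weight of the former endpoint, which gives the recursion for
  \<open>last_passage\<close>.\<close>

lemma lattice_paths_snoc:
  "\<pi> \<in> lattice_paths (k, l) \<longleftrightarrow>
     (\<pi> = [(0, 0)] \<and> k = 0 \<and> l = 0) \<or>
     (\<exists>\<rho>. \<pi> = \<rho> @ [(k, l)] \<and> ((k > 0 \<and> \<rho> \<in> lattice_paths (k - 1, l)) \<or> (l > 0 \<and> \<rho> \<in> lattice_paths (k, l - 1))))"
proof (cases \<pi> rule: rev_cases)
  case Nil
  then show ?thesis by (auto simp: lattice_paths_def)
next
  case (snoc \<rho> z)
  show ?thesis
  proof (cases "\<rho> = []")
    case True
    have 0: "[] \<notin> lattice_paths w" for w by (simp add: lattice_paths_def)
    have 1: "\<pi> \<in> lattice_paths (k, l) \<longleftrightarrow> z = (0, 0) \<and> z = (k, l)"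
      using snoc True by (simp add: lattice_paths_def)
    have 2: "(\<exists>\<rho>'. \<pi> = \<rho>' @ [(k, l)] \<and> Q \<rho>') \<longleftrightarrow> z = (k, l) \<and> Q []" for Q
      using snoc True by simp
    have 3: "\<pi> = [(0, 0)] \<longleftrightarrow> z = (0, 0)" using snoc True by simp
    have 4: "z = (0, 0) \<and> z = (k, l) \<longleftrightarrow> z = (0, 0) \<and> k = 0 \<and> l = 0" by auto
    show ?thesis unfolding 1 2 3 4 using 0 by blast
  next
    case False
    obtain a b where ab: "last \<rho> = (a, b)" by fastforce
    define R where "R = successively (\<lambda>(a, b) w. w = (a + 1, b) \<or> w = (a, b + 1)) \<rho>"
    have 1: "\<pi> \<in> lattice_paths (k, l) \<longleftrightarrow> hd \<rho> = (0, 0) \<and> R \<and> z = (k, l) \<and> (z = (a + 1, b) \<or> z = (a, b + 1))"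
      using snoc False ab by (simp add: lattice_paths_def successively_append_iff R_def conj_ac)
    have 2: "\<rho> \<in> lattice_paths (x, y) \<longleftrightarrow> hd \<rho> = (0, 0) \<and> R \<and> a = x \<and> b = y" for x y
      using False ab by (simp add: lattice_paths_def R_def conj_ac)
    have 3: "(\<exists>\<rho>'. \<pi> = \<rho>' @ [(k, l)] \<and> Q \<rho>') \<longleftrightarrow> z = (k, l) \<and> Q \<rho>" for Q
      using snoc by simp
    have 4: "\<pi> \<noteq> [(0, 0)]" using snoc False by simp
    have 5: "(k, l) = (a + 1, b) \<longleftrightarrow> k > 0 \<and> a = k - 1 \<and> b = l" by auto
    have 6: "(k, l) = (a, b + 1) \<longleftrightarrow> l > 0 \<and> a = k \<and> b = l - 1" by auto
    show ?thesis unfolding 1 2 3 using 4 5 6 by blast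
  qed
qed

lemma sum_list_butlast_path:
  "(\<lambda>\<pi>. \<Sum>z\<leftarrow>butlast \<pi>. X z) ` {\<rho> @ [w] |\<rho>. \<rho> \<in> lattice_paths z} =
     (\<lambda>s. s + X z) ` (\<lambda>\<pi>. \<Sum>z\<leftarrow>butlast \<pi>. X z) ` lattice_paths z" for X :: "nat \<times> nat \<Rightarrow> real"
proof -
  have "(\<Sum>z\<leftarrow>\<rho>. X z) = (\<Sum>z\<leftarrow>butlast \<rho>. X z) + X z" if "\<rho> \<in> lattice_paths z" for \<rho>
  proof -
    have "\<rho> \<noteq> []" "last \<rho> = z" using that by (auto simp: lattice_paths_def)
    then obtain \<tau> where "\<rho> = \<tau> @ [z]" by (metis append_butlast_last_id)
    then show ?thesis by simp
  qed
  then have "(\<lambda>\<pi>. \<Sum>z\<leftarrow>\<pi>. X z) ` lattice_paths z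
      = (\<lambda>\<rho>. (\<Sum>z\<leftarrow>butlast \<rho>. X z) + X z) ` lattice_paths z"
    by (intro image_cong) auto
  then show ?thesis by (simp add: setcompr_eq_image image_image)
qed

lemma Max_add_right: "finite S \<Longrightarrow> S \<noteq> {} \<Longrightarrow> Max ((\<lambda>s. s + c) ` S) = Max S + (c::real)"
  using mono_Max_commute[of "\<lambda>s. s + c" S] by (simp add: mono_def)

lemma last_passage_step:
  "Max ((\<lambda>\<pi>. \<Sum>z\<leftarrow>butlast \<pi>. X z) ` {\<rho> @ [w] |\<rho>. \<rho> \<in> lattice_paths (k, l)}) = last_passage X k l + X (k, l)"
  unfolding sum_list_butlast_path last_passage_def
  by (rule Max_add_right) (auto simp: finite_lattice_paths lattice_paths_nonempty)

lemma last_passage_0_0 [simp]: "last_passage X 0 0 = 0"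
proof -
  have "lattice_paths (0, 0) = {[(0, 0)]}" by (intro set_eqI) (subst lattice_paths_snoc, simp)
  then show ?thesis by (simp add: last_passage_def)
qed

lemma last_passage_Suc_0 [simp]: "last_passage X (Suc k) 0 = last_passage X k 0 + X (k, 0)"
proof -
  have "lattice_paths (Suc k, 0) = {\<rho> @ [(Suc k, 0)] |\<rho>. \<rho> \<in> lattice_paths (k, 0)}"
    by (intro set_eqI, subst lattice_paths_snoc) auto
  then show ?thesis using last_passage_step by (subst last_passage_def) simp
qed

lemma last_passage_0_Suc [simp]: "last_passage X 0 (Suc l) = last_passage X 0 l + X (0, l)"
proof -
  have "lattice_paths (0, Suc l) = {\<rho> @ [(0, Suc l)] |\<rho>. \<rho> \<in> lattice_paths (0, l)}"
    by (intro set_eqI, subst lattice_paths_snoc) auto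
  then show ?thesis using last_passage_step by (subst last_passage_def) simp
qed

lemma last_passage_Suc_Suc [simp]: "last_passage X (Suc k) (Suc l) =
    max (last_passage X k (Suc l) + X (k, Suc l)) (last_passage X (Suc k) l + X (Suc k, l))"
proof -
  have eq: "lattice_paths (Suc k, Suc l) = {\<rho> @ [(Suc k, Suc l)] |\<rho>. \<rho> \<in> lattice_paths (k, Suc l)}
      \<union> {\<rho> @ [(Suc k, Suc l)] |\<rho>. \<rho> \<in> lattice_paths (Suc k, l)}"
    by (intro set_eqI, subst lattice_paths_snoc) auto
  show ?thesis
    unfolding last_passage_step[symmetric, where w = "(Suc k, Suc l)"]
    by (subst last_passage_def, subst eq, subst image_Un, rule Max_Un)
       (use lattice_paths_nonempty in \<open>auto simp: finite_lattice_paths setcompr_eq_image\<close>)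
qed

abbreviation rows :: "(nat \<times> nat \<Rightarrow> real) \<Rightarrow> nat \<Rightarrow> nat \<Rightarrow> real" where
  "rows X \<equiv> (\<lambda>j i. X (i, j))"

abbreviation cols :: "(nat \<times> nat \<Rightarrow> real) \<Rightarrow> nat \<Rightarrow> nat \<Rightarrow> real" where
  "cols X \<equiv> (\<lambda>i j. X (i, j))"

text \<open>Charge every counted site to the step that leaves it. Vertical steps leave each row
  \<open>j < n\<close> once, at weakly increasing columns; horizontal steps leave each column
  \<open>i < k\<close> once, at weakly increasing heights. Each of the two groups is at most its own
  maximum.\<close>

lemma last_passage_le: "last_passage X k n \<le> passage (rows X) n k + passage (cols X) k n"
proof (induction k arbitrary: n)
  case 0
  show ?case by (induction n) auto
next
  case (Suc k)
  show ?case
  proof (induction n)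
    case 0
    then show ?case using Suc[of 0] by simp
  next
    case (Suc n)
    have "last_passage X k (Suc n) + X (k, Suc n) \<le> passage (rows X) (Suc n) (Suc k) + passage (cols X) (Suc k) (Suc n)"
      using \<open>\<And>n. last_passage X k n \<le> passage (rows X) n k + passage (cols X) k n\<close>[of "Suc n"] by auto
    moreover have "last_passage X (Suc k) n + X (Suc k, n) \<le> passage (rows X) (Suc n) (Suc k) + passage (cols X) (Suc k) (Suc n)"
      using Suc by auto
    ultimately show ?case unfolding last_passage_Suc_Suc by linarith
  qed
qed

text \<open>Follow the columns that are optimal for the rows; the \<open>k\<close> horizontal steps
  needed to do so collect at least \<open>- M\<close> each.\<close>

lemma last_passage_ge:
  assumes "\<And>z. - M \<le> X z"
  shows "passage (rows X) n k - real k * M \<le> last_passage X k n"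
proof (induction k arbitrary: n)
  case 0
  show ?case by (induction n) auto
next
  case (Suc k)
  show ?case
  proof (induction n)
    case 0
    then show ?case using Suc[of 0] assms[of "(k, 0)"] by (simp add: algebra_simps)
  next
    case (Suc n)
    have "passage (rows X) (Suc n) k - real (Suc k) * M \<le> last_passage X (Suc k) (Suc n)"
      using \<open>\<And>n. passage (rows X) n k - real k * M \<le> last_passage X k n\<close>[of "Suc n"] assms[of "(k, Suc n)"]
      unfolding last_passage_Suc_Suc by (simp add: algebra_simps)
    moreover have "passage (rows X) n (Suc k) + X (Suc k, n) - real (Suc k) * M \<le> last_passage X (Suc k) (Suc n)"
      using Suc unfolding last_passage_Suc_Suc by (simp add: algebra_simps)
    ultimately show ?case by simp
  qed
qed

text \<open>A comparison principle: the recursion is monotone, so any supersolution dominates. It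
  replaces arguments with explicit paths in what follows.\<close>

lemma last_passage_rec_le:
  assumes "L 0 0 \<ge> 0"
    and "\<And>k. L k 0 + X (k, 0) \<le> L (Suc k) 0" "\<And>l. L 0 l + X (0, l) \<le> L 0 (Suc l)"
    and "\<And>k l. L k (Suc l) + X (k, Suc l) \<le> L (Suc k) (Suc l)" "\<And>k l. L (Suc k) l + X (Suc k, l) \<le> L (Suc k) (Suc l)"
  shows "last_passage X k l \<le> L k l"
proof (induction k arbitrary: l)
  case 0
  show ?case
  proof (induction l)
    case (Suc l) then show ?case using assms(3)[of l] by simp
  qed (use assms(1) in simp)
next
  case (Suc k)
  show ?case
  proof (induction l)
    case 0
    then show ?case using Suc[of 0] assms(2)[of k] by simp
  next
    case (Suc l)
    then show ?case using \<open>\<And>l. last_passage X k l \<le> L k l\<close>[of "Suc l"] assms(4,5)[where k=k and l=l] by simp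
  qed
qed

lemma last_passage_add_le: "last_passage (\<lambda>z. X z + Y z) k l \<le> last_passage X k l + last_passage Y k l"
  by (rule last_passage_rec_le) auto

text \<open>Whichever path is taken, its vertical steps collect at least the row minimum of
  \<open>Y\<close>, and its horizontal steps collect something nonnegative.\<close>

lemma last_passage_add_low:
  assumes Y: "\<And>z. 0 \<le> Y z"
  shows "last_passage X k l + low_prof (rows Y) l k \<le> last_passage (\<lambda>z. X z + Y z) k l"
proof -
  have "last_passage X k l \<le> last_passage (\<lambda>z. X z + Y z) k l - low_prof (rows Y) l k"
  proof (rule last_passage_rec_le)
    fix k
    show "last_passage (\<lambda>z. X z + Y z) k 0 - low_prof (rows Y) 0 k + X (k, 0)
      \<le> last_passage (\<lambda>z. X z + Y z) (Suc k) 0 - low_prof (rows Y) 0 (Suc k)"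
      using Y by simp
  next
    fix l
    show "last_passage (\<lambda>z. X z + Y z) 0 l - low_prof (rows Y) l 0 + X (0, l)
      \<le> last_passage (\<lambda>z. X z + Y z) 0 (Suc l) - low_prof (rows Y) (Suc l) 0"
      by simp
  next
    fix k l
    show "last_passage (\<lambda>z. X z + Y z) k (Suc l) - low_prof (rows Y) (Suc l) k + X (k, Suc l)
      \<le> last_passage (\<lambda>z. X z + Y z) (Suc k) (Suc l) - low_prof (rows Y) (Suc l) (Suc k)"
      using Y[of "(k, Suc l)"] by simp
    show "last_passage (\<lambda>z. X z + Y z) (Suc k) l - low_prof (rows Y) l (Suc k) + X (Suc k, l)
      \<le> last_passage (\<lambda>z. X z + Y z) (Suc k) (Suc l) - low_prof (rows Y) (Suc l) (Suc k)"
      by simp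
  qed simp
  then show ?thesis by simp
qed

text \<open>An added excess is bounded by its maximum and a discarded one by its minimum. The two
  bounds match to leading order once maximum and minimum of the same excess over the rows are both
  close to \<open>n\<close> times its mean.\<close>

lemma last_passage_decomp:
  assumes X: "\<And>z. X z = C z + P z - N z" and P: "\<And>z. 0 \<le> P z" and N: "\<And>z. 0 \<le> N z"
  shows "last_passage X k n \<le> last_passage C k n + passage (rows P) n k + passage (cols P) k n - low_prof (rows N) n k"
    and "last_passage C k n + low_prof (rows P) n k - passage (rows N) n k - passage (cols N) k n \<le> last_passage X k n"
proof -
  have "last_passage X k n + low_prof (rows N) n k \<le> last_passage (\<lambda>z. X z + N z) k n"
    by (rule last_passage_add_low[OF N])
  also have "(\<lambda>z. X z + N z) = (\<lambda>z. C z + P z)" using X by auto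
  also have "last_passage \<dots> k n \<le> last_passage C k n + last_passage P k n"
    by (rule last_passage_add_le)
  finally show "last_passage X k n \<le> last_passage C k n + passage (rows P) n k + passage (cols P) k n - low_prof (rows N) n k"
    using last_passage_le[of P k n] by simp
  have "last_passage C k n + low_prof (rows P) n k \<le> last_passage (\<lambda>z. C z + P z) k n"
    by (rule last_passage_add_low[OF P])
  also have "(\<lambda>z. C z + P z) = (\<lambda>z. X z + N z)" using X by auto
  also have "last_passage \<dots> k n \<le> last_passage X k n + last_passage N k n"
    by (rule last_passage_add_le)
  finally show "last_passage C k n + low_prof (rows P) n k - passage (rows N) n k - passage (cols N) k n \<le> last_passage X k n"
    using last_passage_le[of N k n] by simp
qed

section \<open>A Burke property for Bernoulli weights\<close>

text \<open>Passage value in the presence of a boundary row: the path leaves the profile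
  \<open>t\<close> in some column and then follows the weights \<open>U\<close> up to column
  \<open>k\<close>; see \<open>exit_max_exit\<close>. The boundary weights are natural numbers
  because their stationary law is geometric.\<close>

primrec exit_max :: "nat \<Rightarrow> (nat \<Rightarrow> nat) \<Rightarrow> (nat \<Rightarrow> real) \<Rightarrow> real" where
  "exit_max 0 U t = t 0 + real (U 0)"
| "exit_max (Suc k) U t = max (exit_max k U t) (t (Suc k)) + real (U (Suc k))"

text \<open>Moves the boundary down past one row of bits. Sites are treated from right to left:
  \<open>v\<close> enters a site from the right, and the bit handed on to the left is set if
  \<open>x\<close> is, or if \<open>v\<close> meets an empty boundary site. Truncated subtraction
  matters in that last case: the new boundary weight is 0 and the bit is passed on.\<close>

primrec burke :: "nat \<Rightarrow> (nat \<Rightarrow> nat) \<Rightarrow> (nat \<Rightarrow> bool) \<Rightarrow> bool \<Rightarrow> (nat \<Rightarrow> nat) \<times> bool" where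
  "burke 0 U x v = ((\<lambda>_. 0)(0 := U 0 + of_bool (x 0) - of_bool v), x 0 \<or> v \<and> U 0 = 0)"
| "burke (Suc k) U x v =
    (let (U', w) = burke k U x (x (Suc k) \<or> v \<and> U (Suc k) = 0)
     in (U'(Suc k := U (Suc k) + of_bool (x (Suc k)) - of_bool v), w))"

lemma burke_cong:
  assumes "\<And>i. i \<le> k \<Longrightarrow> U i = U' i" "\<And>i. i \<le> k \<Longrightarrow> x i = x' i"
  shows "burke k U x v = burke k U' x' v"
  using assms by (induction k arbitrary: v) (auto simp: Let_def)

lemma exit_max_cong:
  assumes "\<And>i. i \<le> k \<Longrightarrow> U i = U' i"
  shows "exit_max k U t = exit_max k U' t"
  using assms by (induction k) auto

lemma exit_max_ge: "t k \<le> exit_max k U t"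
  by (cases k) auto

lemma exit_max_mono:
  assumes "\<And>i. i \<le> k \<Longrightarrow> t i \<le> t' i"
  shows "exit_max k U t \<le> exit_max k U t'"
  using assms
proof (induction k)
  case (Suc k)
  have "exit_max k U t \<le> exit_max k U t'" by (rule Suc.IH) (use Suc.prems in auto)
  with Suc.prems[of "Suc k"] show ?case by auto
qed auto

text \<open>Pathwise form of the Burke property. The number \<open>c\<close> stands for the profile
  to the right of column \<open>k\<close>. In the induction \<open>t (Suc k)\<close> takes over this
  role for the columns up to \<open>k\<close>, and the bit handed on at \<open>Suc k\<close>
  replaces \<open>v\<close>; hence both are general.\<close>

lemma exit_max_burke:
  assumes "mono t" "t k \<le> c"
  shows "max (exit_max k U (row_step (\<lambda>i. of_bool (x i)) t)) (c + of_bool v)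
    = of_bool v + max (exit_max k (fst (burke k U x v)) t) c"
  using assms(2)
proof (induction k arbitrary: c v)
  case 0
  then show ?case by (cases "x 0"; cases v; cases "U 0") (auto simp: max_def)
next
  case (Suc k)
  define b where "b = (x (Suc k) \<or> v \<and> U (Suc k) = 0)"
  let ?R = "row_step (\<lambda>i. of_bool (x i)) t"
  define U' where "U' = fst (burke k U x b)"
  have tk: "t k \<le> t (Suc k)" using assms(1) by (simp add: monoD)
  have IH: "max (exit_max k U ?R) (t (Suc k) + of_bool b) = of_bool b + max (exit_max k U' t) (t (Suc k))"
    unfolding U'_def by (rule Suc.IH[OF tk])
  have ge: "?R k \<le> exit_max k U ?R" by (rule exit_max_ge)
  define u where "u = U (Suc k)"
  have fb: "fst (burke (Suc k) U x v) = U'(Suc k := u + of_bool (x (Suc k)) - of_bool v)"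
    by (simp add: U'_def b_def Let_def split_beta u_def)
  have em: "exit_max (Suc k) (fst (burke (Suc k) U x v)) t
      = max (exit_max k U' t) (t (Suc k)) + real (u + of_bool (x (Suc k)) - of_bool v)"
    using exit_max_cong[of k "U'(Suc k := u + of_bool (x (Suc k)) - of_bool v)" U' t] unfolding fb by simp
  have L: "exit_max (Suc k) U ?R = max (exit_max k U ?R) (t (Suc k) + of_bool (x (Suc k))) + real u"
    using ge by (auto simp: u_def)
  \<comment> \<open>Conservation at the site: incoming bit plus new boundary weight equals outgoing
    bit plus old boundary weight.\<close>
  have b: "of_bool v + real (u + of_bool (x (Suc k)) - of_bool v) = of_bool b + real u"
    by (cases v; cases "x (Suc k)"; cases u) (auto simp: b_def u_def)
  show ?case
    unfolding L em using IH b Suc.prems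
    by (cases v; cases "x (Suc k)"; cases u) (auto simp: b_def u_def max_def split: if_splits)
qed

context
  fixes p q r :: real
  assumes p: "0 \<le> p" "p \<le> 1" and q: "0 \<le> q" "q \<le> 1" and r: "0 \<le> r" "r < 1"
    and rel: "p * (1 - q) = r * q * (1 - p)"
begin

lemma pmf_geom: "pmf (geometric_pmf (1 - r)) n = r ^ n * (1 - r)"
  using r by (subst pmf_geometric) auto

text \<open>By \<open>rel\<close> the odds of \<open>p\<close> are \<open>r\<close> times the odds
  of \<open>q\<close>; here \<open>r\<close> is the ratio of the geometric law, whose stopping
  probability is \<open>1 - r\<close>. Under this balance the site map preserves the product law, so
  its two outputs are again independent. On point masses, \<open>(m, False)\<close> arises from two
  inputs whose weights add up by \<open>rel\<close>, and so does \<open>(m, True)\<close> for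
  positive \<open>m\<close>.\<close>

lemma burke_site:
  "do {v \<leftarrow> bernoulli_pmf q; u \<leftarrow> geometric_pmf (1 - r); x \<leftarrow> bernoulli_pmf p;
       return_pmf (u + of_bool x - of_bool v, x \<or> v \<and> u = 0)}
    = pair_pmf (geometric_pmf (1 - r)) (bernoulli_pmf q)" (is "?L = ?R")
proof (rule pmf_eqI)
  fix z :: "nat \<times> bool"
  obtain m w where z: "z = (m, w)" by (cases z)
  let ?g = "geometric_pmf (1 - r)"
  define h where "h v x = map_pmf (\<lambda>u. (u + of_bool x - of_bool v :: nat, x \<or> v \<and> u = 0)) ?g" for v x :: bool
  have "?L = do {v \<leftarrow> bernoulli_pmf q; x \<leftarrow> bernoulli_pmf p; h v x}"
    unfolding h_def map_pmf_def by (intro bind_pmf_cong refl bind_commute_pmf)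
  then have L: "pmf ?L z = q * (p * pmf (h True True) z + (1 - p) * pmf (h True False) z)
      + (1 - q) * (p * pmf (h False True) z + (1 - p) * pmf (h False False) z)"
    using p q by (simp add: pmf_bind algebra_simps)
  have h: "pmf (h v x) z = measure ?g {u. u + of_bool x - of_bool v = m \<and> (x \<or> v \<and> u = 0) = w}" for v x
    unfolding h_def pmf_map z by (rule arg_cong[where f = "measure ?g"]) auto
  have sing: "measure ?g {n} = r ^ n * (1 - r)" for n
    using pmf_geom[of n] by (simp add: measure_pmf_single)
  have 1: "pmf (h True True) z = of_bool w * (r ^ m * (1 - r))"
  proof -
    have "{u. u + of_bool True - of_bool True = m \<and> (True \<or> True \<and> u = 0) = w} = (if w then {m} else {})" by auto
    then show ?thesis unfolding h using sing by simp
  qed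
  have 2: "pmf (h False False) z = of_bool (\<not> w) * (r ^ m * (1 - r))"
  proof -
    have "{u. u + of_bool False - of_bool False = m \<and> (False \<or> False \<and> u = 0) = w} = (if w then {} else {m})" by auto
    then show ?thesis unfolding h using sing by simp
  qed
  have 3: "pmf (h False True) z = (if w \<and> m > 0 then r ^ (m - 1) * (1 - r) else 0)"
  proof -
    have "{u. u + of_bool True - of_bool False = m \<and> (True \<or> False \<and> u = 0) = w} = (if w \<and> m > 0 then {m - 1} else {})" by auto
    then show ?thesis unfolding h using sing by simp
  qed
  have 4: "pmf (h True False) z = (if w then if m = 0 then 1 - r else 0 else r ^ Suc m * (1 - r))"
  proof -
    have "{u. u + of_bool False - of_bool True = m \<and> (False \<or> True \<and> u = 0) = w}
        = (if w then if m = 0 then {0} else {} else {Suc m})" by auto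
    then show ?thesis unfolding h using sing[of 0] sing[of "Suc m"] by auto
  qed
  have R: "pmf ?R z = r ^ m * (1 - r) * (if w then q else 1 - q)"
    unfolding z pmf_pair pmf_geom using q by simp
  show "pmf ?L z = pmf ?R z"
  proof (cases w)
    case False
    have "pmf ?L z = r ^ m * (1 - r) * ((1 - p) * (1 - q) + r * q * (1 - p))"
      unfolding L 1 2 3 4 using False by (simp add: algebra_simps)
    also have "(1 - p) * (1 - q) + r * q * (1 - p) = 1 - q"
      unfolding rel[symmetric] by (simp add: algebra_simps)
    finally show ?thesis unfolding R using False by simp
  next
    case True
    show ?thesis
    proof (cases m)
      case 0
      then show ?thesis unfolding L R 1 2 3 4 using True by (simp add: algebra_simps)
    next
      case (Suc l)
      have "pmf ?L z = r ^ l * (1 - r) * (q * p * r + p * (1 - q))"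
        unfolding L 1 2 3 4 using True Suc by (simp add: algebra_simps)
      also have "q * p * r + p * (1 - q) = r * q"
        unfolding rel by (simp add: algebra_simps)
      finally show ?thesis unfolding R using True Suc by (simp add: algebra_simps)
    qed
  qed
qed

end

text \<open>The parameter may vary from site to site: when columns of a fixed environment play the
  part of rows, the success probability changes along them.\<close>

definition boundary_pmf :: "(nat \<Rightarrow> real) \<Rightarrow> nat \<Rightarrow> (nat \<Rightarrow> nat) pmf" where
  "boundary_pmf r k = Pi_pmf {..k} 0 (\<lambda>i. geometric_pmf (1 - r i))"

definition row_pmf :: "(nat \<Rightarrow> real) \<Rightarrow> nat \<Rightarrow> (nat \<Rightarrow> bool) pmf" where
  "row_pmf p k = Pi_pmf {..k} False (\<lambda>i. bernoulli_pmf (p i))"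

lemma boundary_pmf_Suc:
  "boundary_pmf r (Suc k) = do {u \<leftarrow> geometric_pmf (1 - r (Suc k)); U \<leftarrow> boundary_pmf r k; return_pmf (U(Suc k := u))}"
  unfolding boundary_pmf_def atMost_Suc by (subst Pi_pmf_insert') auto

lemma row_pmf_Suc:
  "row_pmf p (Suc k) = do {u \<leftarrow> bernoulli_pmf (p (Suc k)); U \<leftarrow> row_pmf p k; return_pmf (U(Suc k := u))}"
  unfolding row_pmf_def atMost_Suc by (subst Pi_pmf_insert') auto

lemma boundary_pmf_0: "boundary_pmf r 0 = do {u \<leftarrow> geometric_pmf (1 - r 0); return_pmf ((\<lambda>_. 0)(0 := u))}"
proof -
  have "boundary_pmf r 0 = Pi_pmf (insert 0 {}) 0 (\<lambda>i. geometric_pmf (1 - r i))"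
    by (simp add: boundary_pmf_def)
  also have "\<dots> = do {u \<leftarrow> geometric_pmf (1 - r 0); return_pmf ((\<lambda>_. 0)(0 := u))}"
    by (subst Pi_pmf_insert') (auto simp: bind_return_pmf)
  finally show ?thesis .
qed

lemma row_pmf_0: "row_pmf p 0 = do {u \<leftarrow> bernoulli_pmf (p 0); return_pmf ((\<lambda>_. False)(0 := u))}"
proof -
  have "row_pmf p 0 = Pi_pmf (insert 0 {}) False (\<lambda>i. bernoulli_pmf (p i))"
    by (simp add: row_pmf_def)
  also have "\<dots> = do {u \<leftarrow> bernoulli_pmf (p 0); return_pmf ((\<lambda>_. False)(0 := u))}"
    by (subst Pi_pmf_insert') (auto simp: bind_return_pmf)
  finally show ?thesis .
qed

text \<open>The bit leaving the rightmost site is again Bernoulli \<open>q\<close> and independent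
  of the new weight there, so it can serve as input for the remaining sites. One \<open>q\<close> is
  therefore shared by the whole row, while \<open>r i\<close> adapts to \<open>p i\<close>.\<close>

lemma burke_row:
  fixes p r :: "nat \<Rightarrow> real" and q :: real
  assumes p: "\<And>i. i \<le> k \<Longrightarrow> 0 \<le> p i \<and> p i \<le> 1" and q: "0 \<le> q" "q \<le> 1" and r: "\<And>i. i \<le> k \<Longrightarrow> 0 \<le> r i \<and> r i < 1"
    and rel: "\<And>i. i \<le> k \<Longrightarrow> p i * (1 - q) = r i * q * (1 - p i)"
  shows "do {v \<leftarrow> bernoulli_pmf q; U \<leftarrow> boundary_pmf r k; x \<leftarrow> row_pmf p k; return_pmf (burke k U x v)}
    = pair_pmf (boundary_pmf r k) (bernoulli_pmf q)"
  using p r rel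
proof (induction k)
  case 0
  have "do {v \<leftarrow> bernoulli_pmf q; U \<leftarrow> boundary_pmf r 0; x \<leftarrow> row_pmf p 0; return_pmf (burke 0 U x v)}
     = do {z \<leftarrow> do {v \<leftarrow> bernoulli_pmf q; u \<leftarrow> geometric_pmf (1 - r 0); x \<leftarrow> bernoulli_pmf (p 0);
       return_pmf (u + of_bool x - of_bool v, x \<or> v \<and> u = 0)}; return_pmf ((\<lambda>_. 0)(0 := fst z), snd z)}"
    by (simp add: boundary_pmf_0 row_pmf_0 bind_assoc_pmf bind_return_pmf)
  also have "\<dots> = pair_pmf (boundary_pmf r 0) (bernoulli_pmf q)"
    by (subst burke_site) (use 0 q in \<open>auto simp: boundary_pmf_0 pair_pmf_def bind_assoc_pmf bind_return_pmf\<close>)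
  finally show ?case .
next
  case (Suc k)
  define h where "h u v U x = map_pmf (\<lambda>z. ((fst z)(Suc k := u), snd z)) (return_pmf (burke k U x v))" for u U x v
  have burke_upd: "burke k (U(Suc k := u)) (x(Suc k := b)) v = burke k U x v" for U u x b v
    by (rule burke_cong) auto
  let ?g = "geometric_pmf (1 - r (Suc k))" and ?b = "bernoulli_pmf (p (Suc k))"
  have "do {v \<leftarrow> bernoulli_pmf q; U \<leftarrow> boundary_pmf r (Suc k); x \<leftarrow> row_pmf p (Suc k); return_pmf (burke (Suc k) U x v)}
     = do {v \<leftarrow> bernoulli_pmf q; u \<leftarrow> ?g; U \<leftarrow> boundary_pmf r k; b \<leftarrow> ?b; x \<leftarrow> row_pmf p k;
          h (u + of_bool b - of_bool v) (b \<or> v \<and> u = 0) U x}"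
    by (simp add: boundary_pmf_Suc row_pmf_Suc bind_assoc_pmf bind_return_pmf h_def Let_def split_beta burke_upd)
  also have "\<dots> = do {v \<leftarrow> bernoulli_pmf q; u \<leftarrow> ?g; b \<leftarrow> ?b; U \<leftarrow> boundary_pmf r k; x \<leftarrow> row_pmf p k;
          h (u + of_bool b - of_bool v) (b \<or> v \<and> u = 0) U x}"
    by (intro bind_pmf_cong refl bind_commute_pmf)
  also have "\<dots> = do {z \<leftarrow> do {v \<leftarrow> bernoulli_pmf q; u \<leftarrow> ?g; b \<leftarrow> ?b; return_pmf (u + of_bool b - of_bool v, b \<or> v \<and> u = 0)};
          U \<leftarrow> boundary_pmf r k; x \<leftarrow> row_pmf p k; h (fst z) (snd z) U x}"
    by (simp add: bind_assoc_pmf bind_return_pmf)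
  also have "\<dots> = do {z \<leftarrow> pair_pmf ?g (bernoulli_pmf q); U \<leftarrow> boundary_pmf r k; x \<leftarrow> row_pmf p k; h (fst z) (snd z) U x}"
    by (subst burke_site) (use Suc.prems q in auto)
  also have "\<dots> = do {u \<leftarrow> ?g; map_pmf (\<lambda>z. ((fst z)(Suc k := u), snd z))
      (do {v \<leftarrow> bernoulli_pmf q; U \<leftarrow> boundary_pmf r k; x \<leftarrow> row_pmf p k; return_pmf (burke k U x v)})}"
    by (simp add: pair_pmf_def bind_assoc_pmf bind_return_pmf h_def map_bind_pmf)
  also have "\<dots> = do {u \<leftarrow> ?g; map_pmf (\<lambda>z. ((fst z)(Suc k := u), snd z)) (pair_pmf (boundary_pmf r k) (bernoulli_pmf q))}"
    by (subst Suc.IH) (use Suc.prems in auto)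
  also have "\<dots> = pair_pmf (boundary_pmf r (Suc k)) (bernoulli_pmf q)"
    by (simp add: pair_pmf_def boundary_pmf_Suc bind_assoc_pmf bind_return_pmf map_bind_pmf)
  finally show ?case .
qed

text \<open>Taking expectations in \<open>exit_max_burke\<close> and using that the swapped boundary
  has its old law: one more row raises the stationary value by exactly the mean \<open>q\<close> of
  the entering bit.\<close>

lemma exit_max_row:
  fixes p r :: "nat \<Rightarrow> real" and q :: real
  assumes p: "\<And>i. i \<le> k \<Longrightarrow> 0 \<le> p i \<and> p i \<le> 1" and q: "0 \<le> q" "q \<le> 1" and r: "\<And>i. i \<le> k \<Longrightarrow> 0 \<le> r i \<and> r i < 1"
    and rel: "\<And>i. i \<le> k \<Longrightarrow> p i * (1 - q) = r i * q * (1 - p i)"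
    and t: "mono t" "0 \<le> t 0" "t k \<le> c"
  shows "(\<integral>\<^sup>+v. \<integral>\<^sup>+x. \<integral>\<^sup>+U. ennreal (max (exit_max k U (row_step (\<lambda>i. of_bool (x i)) t)) (c + of_bool v))
      \<partial>boundary_pmf r k \<partial>row_pmf p k \<partial>bernoulli_pmf q) = ennreal q + (\<integral>\<^sup>+U. ennreal (max (exit_max k U t) c) \<partial>boundary_pmf r k)"
proof -
  have c: "0 \<le> c" using t by (meson monoD le0 order_trans)
  have "(\<integral>\<^sup>+v. \<integral>\<^sup>+x. \<integral>\<^sup>+U. ennreal (max (exit_max k U (row_step (\<lambda>i. of_bool (x i)) t)) (c + of_bool v))
      \<partial>boundary_pmf r k \<partial>row_pmf p k \<partial>bernoulli_pmf q)
     = (\<integral>\<^sup>+v. \<integral>\<^sup>+x. \<integral>\<^sup>+U. ennreal (of_bool v) + ennreal (max (exit_max k (fst (burke k U x v)) t) c)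
      \<partial>boundary_pmf r k \<partial>row_pmf p k \<partial>bernoulli_pmf q)"
    using c by (simp add: exit_max_burke[OF t(1,3)] ennreal_plus[symmetric] le_max_iff_disj del: ennreal_plus)
  also have "\<dots> = (\<integral>\<^sup>+v. ennreal (of_bool v) \<partial>bernoulli_pmf q) +
      (\<integral>\<^sup>+v. \<integral>\<^sup>+x. \<integral>\<^sup>+U. ennreal (max (exit_max k (fst (burke k U x v)) t) c)
        \<partial>boundary_pmf r k \<partial>row_pmf p k \<partial>bernoulli_pmf q)"
    by (simp add: nn_integral_add)
  also have "(\<integral>\<^sup>+v. ennreal (of_bool v) \<partial>bernoulli_pmf q) = ennreal q"
    using q by simp
  also have "(\<integral>\<^sup>+v. \<integral>\<^sup>+x. \<integral>\<^sup>+U. ennreal (max (exit_max k (fst (burke k U x v)) t) c)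
        \<partial>boundary_pmf r k \<partial>row_pmf p k \<partial>bernoulli_pmf q)
      = (\<integral>\<^sup>+z. ennreal (max (exit_max k (fst z) t) c)
          \<partial>measure_pmf (do {v \<leftarrow> bernoulli_pmf q; x \<leftarrow> row_pmf p k; U \<leftarrow> boundary_pmf r k; return_pmf (burke k U x v)}))"
    by (simp add: nn_integral_bind_pmf)
  also have "do {v \<leftarrow> bernoulli_pmf q; x \<leftarrow> row_pmf p k; U \<leftarrow> boundary_pmf r k; return_pmf (burke k U x v)}
      = pair_pmf (boundary_pmf r k) (bernoulli_pmf q)"
    by (subst burke_row[OF p q r rel, symmetric]) (auto intro!: bind_pmf_cong bind_commute_pmf)
  also have "(\<integral>\<^sup>+z. ennreal (max (exit_max k (fst z) t) c) \<partial>pair_pmf (boundary_pmf r k) (bernoulli_pmf q))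
      = (\<integral>\<^sup>+U. ennreal (max (exit_max k U t) c) \<partial>boundary_pmf r k)"
    by (simp add: nn_integral_pair_pmf')
  finally show ?thesis .
qed

section \<open>Independent rows\<close>

lemma measurable_row_step [measurable (raw)]:
  assumes [measurable]: "\<And>i. (\<lambda>\<omega>. x \<omega> i) \<in> borel_measurable M" "\<And>i. (\<lambda>\<omega>. t \<omega> i) \<in> borel_measurable M"
  shows "(\<lambda>\<omega>. row_step (x \<omega>) (t \<omega>) k) \<in> borel_measurable M"
  by (induction k) simp_all

lemma measurable_prof [measurable (raw)]:
  assumes "\<And>j i. (\<lambda>\<omega>. w \<omega> j i) \<in> borel_measurable M" "\<And>i. (\<lambda>\<omega>. t \<omega> i) \<in> borel_measurable M"
  shows "(\<lambda>\<omega>. prof (w \<omega>) (t \<omega>) n k) \<in> borel_measurable M"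
proof (induction n arbitrary: k)
  case (Suc n)
  show ?case unfolding prof.simps by (rule measurable_row_step) (use Suc assms in auto)
qed (use assms in auto)

lemma measurable_low_prof [measurable (raw)]:
  assumes "\<And>j i. (\<lambda>\<omega>. w \<omega> j i) \<in> borel_measurable M"
  shows "(\<lambda>\<omega>. low_prof (w \<omega>) n k) \<in> borel_measurable M"
proof (induction n arbitrary: k)
  case (Suc n)
  have "(\<lambda>\<omega>. low_step (w \<omega> n) (low_prof (w \<omega>) n) k) \<in> borel_measurable M"
    using Suc assms by (induction k) auto
  then show ?case by simp
qed auto

lemma measurable_exit_max [measurable (raw)]:
  assumes [measurable]: "\<And>i. (\<lambda>\<omega>. t \<omega> i) \<in> borel_measurable M"
  shows "(\<lambda>\<omega>. exit_max k U (t \<omega>)) \<in> borel_measurable M"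
  by (induction k) simp_all

lemma nn_integral_pmf_countable:
  "(\<integral>\<^sup>+u. f u \<partial>measure_pmf p) = (\<integral>\<^sup>+u. ennreal (pmf p u) * f u \<partial>count_space (set_pmf p))"
  unfolding nn_integral_measure_pmf
  by (rule nn_integral_count_space_eq) (auto simp: set_pmf_iff)

lemma measurable_pair_countable:
  fixes f :: "'a \<Rightarrow> 'b \<Rightarrow> 'c::topological_space"
  assumes "countable A" "\<And>u. (\<lambda>\<omega>. f \<omega> u) \<in> borel_measurable M"
  shows "(\<lambda>(\<omega>, u). f \<omega> u) \<in> borel_measurable (M \<Otimes>\<^sub>M count_space A)"
proof -
  have "(\<lambda>z. f (snd z) (fst z)) \<in> borel_measurable (count_space A \<Otimes>\<^sub>M M)"
    by (rule measurable_pair_measure_countable1) (use assms in auto)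
  from measurable_compose[OF measurable_pair_swap' this] show ?thesis
    by (simp add: split_beta')
qed

text \<open>Restricting the inner integral to the countable support makes measurability in \<omega>
  for each fixed \<open>u\<close> sufficient.\<close>

lemma measurable_nn_integral_pmf [measurable (raw)]:
  assumes "\<And>u. (\<lambda>\<omega>. f \<omega> u) \<in> borel_measurable M"
  shows "(\<lambda>\<omega>. \<integral>\<^sup>+u. f \<omega> u \<partial>measure_pmf p) \<in> borel_measurable M"
proof -
  interpret sigma_finite_measure "count_space (set_pmf p)"
    by (rule sigma_finite_measure_count_space_countable) auto
  have "(\<lambda>(\<omega>, u). ennreal (pmf p u) * f \<omega> u) \<in> borel_measurable (M \<Otimes>\<^sub>M count_space (set_pmf p))"
    using assms by (intro measurable_pair_countable) auto
  from borel_measurable_nn_integral[OF this] show ?thesis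
    unfolding nn_integral_pmf_countable by simp
qed

text \<open>Only finitely many bit patterns live on columns up to \<open>k\<close>, so the integral
  is a finite sum over cylinder sets and \<open>f\<close> may be arbitrary. Cutting the pattern off
  with \<open>i \<le> k\<close> produces the default value \<open>False\<close> of
  \<open>row_pmf\<close>.\<close>

lemma nn_integral_row_pmf:
  fixes M :: "nat \<Rightarrow> 'a measure" and f :: "(nat \<Rightarrow> bool) \<Rightarrow> ennreal"
  assumes M: "\<And>i. prob_space (M i)" and E: "\<And>i. E i \<in> sets (M i)"
  shows "(\<integral>\<^sup>+\<omega>. f (\<lambda>i. i \<le> k \<and> \<omega> i \<in> E i) \<partial>PiM UNIV M) = (\<integral>\<^sup>+x. f x \<partial>row_pmf (\<lambda>i. measure (M i) (E i)) k)"
proof -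
  interpret M: prob_space "M i" for i by (rule M)
  interpret P: product_prob_space M UNIV ..
  define B where "B = (\<lambda>S i. i \<in> S) ` Pow {..k}"
  have B: "finite B" unfolding B_def by simp
  have inB: "x \<in> B" if "\<And>i. x i \<Longrightarrow> i \<le> k" for x :: "nat \<Rightarrow> bool"
    unfolding B_def using that by (intro image_eqI[of _ _ "{i. x i}"]) auto
  define F where "F b = (\<lambda>i. if b i then E i else space (M i) - E i)" for b :: "nat \<Rightarrow> bool"
  have F: "F b i \<in> sets (M i)" for b i unfolding F_def using E by auto
  define T where "T \<omega> = (\<lambda>i. i \<le> k \<and> \<omega> i \<in> E i)" for \<omega>
  define A where "A b = prod_emb UNIV M {..k} (PiE {..k} (F b))" for b
  have A: "A b \<in> sets (PiM UNIV M)" for b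
    unfolding A_def by (intro sets_PiM_I) (use F in auto)
  have eq: "T \<omega> = b \<longleftrightarrow> \<omega> \<in> A b" if "\<omega> \<in> space (PiM UNIV M)" "b \<in> B" for \<omega> b
  proof -
    have "\<omega> i \<in> space (M i)" for i using that(1) by (auto simp: space_PiM)
    moreover have "b i \<Longrightarrow> i \<le> k" for i using that(2) by (auto simp: B_def)
    ultimately show ?thesis
      by (auto simp: A_def T_def F_def prod_emb_def fun_eq_iff PiE_iff space_PiM extensional_def)
  qed
  have Tin: "T \<omega> \<in> B" for \<omega> by (rule inB) (auto simp: T_def)
  have "(\<integral>\<^sup>+\<omega>. f (T \<omega>) \<partial>PiM UNIV M) = (\<integral>\<^sup>+\<omega>. (\<Sum>b\<in>B. f b * indicator (A b) \<omega>) \<partial>PiM UNIV M)"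
  proof (rule nn_integral_cong)
    fix \<omega> assume \<omega>: "\<omega> \<in> space (PiM UNIV M)"
    have "(\<Sum>b\<in>B. f b * indicator (A b) \<omega>) = (\<Sum>b\<in>B. if b = T \<omega> then f b else 0)"
      by (intro sum.cong refl) (use eq[OF \<omega>] in \<open>auto simp: indicator_def\<close>)
    also have "\<dots> = f (T \<omega>)" using B Tin by simp
    finally show "f (T \<omega>) = (\<Sum>b\<in>B. f b * indicator (A b) \<omega>)" by simp
  qed
  also have "\<dots> = (\<Sum>b\<in>B. f b * emeasure (PiM UNIV M) (A b))"
    using A by (simp add: nn_integral_sum nn_integral_cmult_indicator)
  also have "\<dots> = (\<Sum>b\<in>B. f b * ennreal (pmf (row_pmf (\<lambda>i. measure (M i) (E i)) k) b))"
  proof (intro sum.cong refl arg_cong2[where f = "(*)"])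
    fix b assume b: "b \<in> B"
    have bk: "b i \<Longrightarrow> i \<le> k" for i using b by (auto simp: B_def)
    have "emeasure (PiM UNIV M) (A b) = (\<Prod>i\<in>{..k}. emeasure (M i) (F b i))"
      unfolding A_def by (rule emeasure_PiM_emb) (use F M in auto)
    also have "\<dots> = (\<Prod>i\<in>{..k}. ennreal (pmf (bernoulli_pmf (measure (M i) (E i))) (b i)))"
    proof (intro prod.cong refl)
      fix i
      have "measure (M i) (F b i) = pmf (bernoulli_pmf (measure (M i) (E i))) (b i)"
        using E by (cases "b i") (auto simp: F_def M.prob_compl)
      then show "emeasure (M i) (F b i) = ennreal (pmf (bernoulli_pmf (measure (M i) (E i))) (b i))"
        by (simp add: M.emeasure_eq_measure)
    qed
    also have "\<dots> = ennreal (pmf (row_pmf (\<lambda>i. measure (M i) (E i)) k) b)"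
      unfolding row_pmf_def using bk by (subst pmf_Pi) (auto simp: prod_ennreal)
    finally show "emeasure (PiM UNIV M) (A b) = ennreal (pmf (row_pmf (\<lambda>i. measure (M i) (E i)) k) b)" .
  qed
  also have "\<dots> = (\<integral>\<^sup>+x. f x \<partial>row_pmf (\<lambda>i. measure (M i) (E i)) k)"
  proof (rule nn_integral_measure_pmf_support[symmetric])
    fix x assume "x \<in> set_pmf (row_pmf (\<lambda>i. measure (M i) (E i)) k)" "x \<notin> B"
    moreover have "set_pmf (row_pmf (\<lambda>i. measure (M i) (E i)) k) \<subseteq> B"
      unfolding row_pmf_def using set_Pi_pmf_subset[of "{..k}"] by (fastforce intro!: inB)
    ultimately show "f x = 0" by auto
  qed (use B in auto)
  finally show ?thesis unfolding T_def .
qed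

text \<open>Conditioning on the first entry of an i.i.d. sequence; all row-by-row inductions rest on
  it.\<close>

lemma nn_integral_seq:
  assumes N: "prob_space N" and f: "f \<in> borel_measurable (PiM UNIV (\<lambda>_::nat. N))"
  shows "(\<integral>\<^sup>+\<omega>. f \<omega> \<partial>PiM UNIV (\<lambda>_::nat. N)) = (\<integral>\<^sup>+s. \<integral>\<^sup>+\<omega>. f (case_nat s \<omega>) \<partial>PiM UNIV (\<lambda>_::nat. N) \<partial>N)"
proof -
  interpret N: prob_space N by fact
  interpret sequence_space N ..
  have meas: "(\<lambda>(s, \<omega>). case_nat s \<omega>) \<in> N \<Otimes>\<^sub>M S \<rightarrow>\<^sub>M S" by measurable
  have "(\<integral>\<^sup>+\<omega>. f \<omega> \<partial>S) = (\<integral>\<^sup>+\<omega>. f \<omega> \<partial>distr (N \<Otimes>\<^sub>M S) S (\<lambda>(s, \<omega>). case_nat s \<omega>))"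
    by (simp add: PiM_iter)
  also have "\<dots> = (\<integral>\<^sup>+z. f (case z of (s, \<omega>) \<Rightarrow> case_nat s \<omega>) \<partial>(N \<Otimes>\<^sub>M S))"
    by (rule nn_integral_distr[OF meas]) (use f in simp)
  also have "\<dots> = (\<integral>\<^sup>+s. \<integral>\<^sup>+\<omega>. f (case_nat s \<omega>) \<partial>S \<partial>N)"
    by (subst P.nn_integral_fst[symmetric]) (use measurable_compose[OF meas f] in \<open>auto simp: split_beta'\<close>)
  finally show ?thesis .
qed

lemma prof_case_nat: "prof (\<lambda>j. x (case_nat s \<omega> j)) t (Suc n) = prof (\<lambda>j. x (\<omega> j)) (row_step (x s) t) n"
  unfolding prof_Suc_first by simp

lemma seq_component_measurable:
  assumes x: "x \<in> N \<rightarrow>\<^sub>M PiM UNIV (\<lambda>_::nat. borel)"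
  shows "(\<lambda>\<omega>. x (\<omega> j) i) \<in> borel_measurable (PiM UNIV (\<lambda>_::nat. N))"
  by (rule measurable_compose[OF measurable_component_singleton, of j]) (use x in \<open>auto intro: measurable_compose[OF x measurable_component_singleton]\<close>)

lemma prof_seq_measurable:
  assumes x: "x \<in> N \<rightarrow>\<^sub>M PiM UNIV (\<lambda>_::nat. borel)" and G: "G \<in> borel_measurable (PiM UNIV (\<lambda>_::nat. borel))"
  shows "(\<lambda>\<omega>. G (prof (\<lambda>j. x (\<omega> j)) t n)) \<in> borel_measurable (PiM UNIV (\<lambda>_::nat. N))"
proof (rule measurable_compose[OF _ G])
  show "(\<lambda>\<omega>. prof (\<lambda>j. x (\<omega> j)) t n) \<in> PiM UNIV (\<lambda>_. N) \<rightarrow>\<^sub>M PiM UNIV (\<lambda>_. borel)"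
    by (rule measurable_PiM_single', rule measurable_prof) (auto intro!: seq_component_measurable x)
qed

text \<open>A drift argument: \<open>G\<close> is a function of the current profile that gains at
  most \<open>c\<close> per row in conditional expectation. The drift is required only for monotone
  profiles that start nonnegative, a class that nonnegative rows preserve.\<close>

lemma nn_integral_chain_le:
  fixes G :: "(nat \<Rightarrow> real) \<Rightarrow> ennreal"
  assumes N: "prob_space N" and x: "x \<in> N \<rightarrow>\<^sub>M PiM UNIV (\<lambda>_::nat. borel)" and x0: "\<And>s i. 0 \<le> x s i"
    and G: "G \<in> borel_measurable (PiM UNIV (\<lambda>_::nat. borel))"
    and step: "\<And>t. mono t \<Longrightarrow> 0 \<le> t 0 \<Longrightarrow> (\<integral>\<^sup>+s. G (row_step (x s) t) \<partial>N) \<le> G t + c"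
    and t: "mono t" "0 \<le> t 0"
  shows "(\<integral>\<^sup>+\<omega>. G (prof (\<lambda>j. x (\<omega> j)) t n) \<partial>PiM UNIV (\<lambda>_::nat. N)) \<le> G t + of_nat n * c"
  using t
proof (induction n arbitrary: t)
  case 0
  interpret prob_space "PiM UNIV (\<lambda>_::nat. N)" by (intro prob_space_PiM N)
  show ?case by (simp add: emeasure_space_1)
next
  case (Suc n)
  interpret N: prob_space N by fact
  have "(\<integral>\<^sup>+\<omega>. G (prof (\<lambda>j. x (\<omega> j)) t (Suc n)) \<partial>PiM UNIV (\<lambda>_::nat. N))
      = (\<integral>\<^sup>+s. \<integral>\<^sup>+\<omega>. G (prof (\<lambda>j. x (\<omega> j)) (row_step (x s) t) n) \<partial>PiM UNIV (\<lambda>_::nat. N) \<partial>N)"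
    by (subst nn_integral_seq[OF N prof_seq_measurable[OF x G]]) (simp only: prof_case_nat)
  also have "\<dots> \<le> (\<integral>\<^sup>+s. G (row_step (x s) t) + of_nat n * c \<partial>N)"
    by (intro nn_integral_mono Suc.IH mono_row_step) (use Suc.prems x0 in auto)
  also have "\<dots> = (\<integral>\<^sup>+s. G (row_step (x s) t) \<partial>N) + of_nat n * c"
  proof (subst nn_integral_add)
    have "(\<lambda>s. row_step (x s) t) \<in> N \<rightarrow>\<^sub>M PiM UNIV (\<lambda>_. borel)"
      by (rule measurable_PiM_single', rule measurable_row_step) (auto intro!: measurable_compose[OF x measurable_component_singleton])
    then show "(\<lambda>s. G (row_step (x s) t)) \<in> borel_measurable N"
      by (rule measurable_compose[OF _ G])
  qed (auto simp: N.emeasure_space_1)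
  also have "\<dots> \<le> G t + c + of_nat n * c"
    by (intro add_right_mono step Suc.prems)
  finally show ?case by (simp add: algebra_simps)
qed

lemma nn_integral_chain_ge:
  fixes G :: "(nat \<Rightarrow> real) \<Rightarrow> ennreal"
  assumes N: "prob_space N" and x: "x \<in> N \<rightarrow>\<^sub>M PiM UNIV (\<lambda>_::nat. borel)" and x0: "\<And>s i. 0 \<le> x s i"
    and G: "G \<in> borel_measurable (PiM UNIV (\<lambda>_::nat. borel))"
    and step: "\<And>t. mono t \<Longrightarrow> 0 \<le> t 0 \<Longrightarrow> G t + c \<le> (\<integral>\<^sup>+s. G (row_step (x s) t) \<partial>N)"
    and t: "mono t" "0 \<le> t 0"
  shows "G t + of_nat n * c \<le> (\<integral>\<^sup>+\<omega>. G (prof (\<lambda>j. x (\<omega> j)) t n) \<partial>PiM UNIV (\<lambda>_::nat. N))"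
  using t
proof (induction n arbitrary: t)
  case 0
  interpret prob_space "PiM UNIV (\<lambda>_::nat. N)" by (intro prob_space_PiM N)
  show ?case by (simp add: emeasure_space_1)
next
  case (Suc n)
  interpret N: prob_space N by fact
  have "G t + of_nat (Suc n) * c = G t + c + of_nat n * c" by (simp add: algebra_simps)
  also have "\<dots> \<le> (\<integral>\<^sup>+s. G (row_step (x s) t) \<partial>N) + of_nat n * c"
    by (intro add_right_mono step Suc.prems)
  also have "\<dots> = (\<integral>\<^sup>+s. G (row_step (x s) t) + of_nat n * c \<partial>N)"
  proof (subst nn_integral_add)
    have "(\<lambda>s. row_step (x s) t) \<in> N \<rightarrow>\<^sub>M PiM UNIV (\<lambda>_. borel)"
      by (rule measurable_PiM_single', rule measurable_row_step) (auto intro!: measurable_compose[OF x measurable_component_singleton])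
    then show "(\<lambda>s. G (row_step (x s) t)) \<in> borel_measurable N"
      by (rule measurable_compose[OF _ G])
  qed (auto simp: N.emeasure_space_1)
  also have "\<dots> \<le> (\<integral>\<^sup>+s. \<integral>\<^sup>+\<omega>. G (prof (\<lambda>j. x (\<omega> j)) (row_step (x s) t) n) \<partial>PiM UNIV (\<lambda>_::nat. N) \<partial>N)"
    by (intro nn_integral_mono Suc.IH mono_row_step) (use Suc.prems x0 in auto)
  also have "\<dots> = (\<integral>\<^sup>+\<omega>. G (prof (\<lambda>j. x (\<omega> j)) t (Suc n)) \<partial>PiM UNIV (\<lambda>_::nat. N))"
    by (subst nn_integral_seq[OF N prof_seq_measurable[OF x G]]) (simp only: prof_case_nat)
  finally show ?case .
qed

section \<open>Upper bounds for Bernoulli weights\<close>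

text \<open>Averages over the boundary alone and keeps the profile as argument, so that it can be
  the drift function of \<open>nn_integral_chain_le\<close>.\<close>

definition exit_value :: "(nat \<Rightarrow> real) \<Rightarrow> nat \<Rightarrow> (nat \<Rightarrow> real) \<Rightarrow> ennreal" where
  "exit_value r k t = (\<integral>\<^sup>+U. ennreal (exit_max k U t) \<partial>boundary_pmf r k)"

lemma exit_value_measurable: "exit_value r k \<in> borel_measurable (PiM UNIV (\<lambda>_::nat. borel))"
  unfolding exit_value_def by (intro measurable_nn_integral_pmf measurable_compose[OF measurable_exit_max measurable_ennreal]) auto

lemma exit_value_ge: "ennreal (t k) \<le> exit_value r k t"
proof -
  have "ennreal (t k) = (\<integral>\<^sup>+U. ennreal (t k) \<partial>boundary_pmf r k)"
    by (simp add: measure_pmf.emeasure_space_1)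
  also have "\<dots> \<le> exit_value r k t"
    unfolding exit_value_def by (intro nn_integral_mono ennreal_leI exit_max_ge)
  finally show ?thesis .
qed

lemma exit_max_0: "exit_max k U (\<lambda>_. 0) = (\<Sum>i\<le>k. real (U i))"
  by (induction k) (auto simp: max_absorb1 sum_nonneg)

lemma nn_integral_geometric:
  assumes "0 \<le> r" "r < 1"
  shows "(\<integral>\<^sup>+u. ennreal (real u) \<partial>geometric_pmf (1 - r)) = ennreal (r / (1 - r))"
  using expectation_geometric_pmf[of "1 - r"] integrable_real_geometric_pmf[of "1 - r"] assms
  by (subst nn_integral_eq_integral) auto

lemma nn_integral_boundary_sum:
  assumes r: "\<And>i. i \<le> k \<Longrightarrow> 0 \<le> r i \<and> r i < 1" and J: "J \<subseteq> {..k}"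
  shows "(\<integral>\<^sup>+U. ennreal (\<Sum>i\<in>J. real (U i)) \<partial>boundary_pmf r k) = ennreal (\<Sum>i\<in>J. r i / (1 - r i))"
proof -
  have "(\<integral>\<^sup>+U. ennreal (\<Sum>i\<in>J. real (U i)) \<partial>boundary_pmf r k) = (\<Sum>i\<in>J. \<integral>\<^sup>+U. ennreal (real (U i)) \<partial>boundary_pmf r k)"
    by (simp add: nn_integral_sum sum_ennreal[symmetric] del: sum_ennreal)
  also have "\<dots> = (\<Sum>i\<in>J. ennreal (r i / (1 - r i)))"
  proof (intro sum.cong refl)
    fix i assume "i \<in> J"
    then have i: "i \<le> k" using J by auto
    have "(\<integral>\<^sup>+U. ennreal (real (U i)) \<partial>boundary_pmf r k) = (\<integral>\<^sup>+u. ennreal (real u) \<partial>map_pmf (\<lambda>U. U i) (boundary_pmf r k))"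
      by simp
    also have "map_pmf (\<lambda>U. U i) (boundary_pmf r k) = geometric_pmf (1 - r i)"
      unfolding boundary_pmf_def using i by (subst Pi_pmf_component) auto
    also have "(\<integral>\<^sup>+u. ennreal (real u) \<partial>geometric_pmf (1 - r i)) = ennreal (r i / (1 - r i))"
      using nn_integral_geometric r i by auto
    finally show "(\<integral>\<^sup>+U. ennreal (real (U i)) \<partial>boundary_pmf r k) = ennreal (r i / (1 - r i))" .
  qed
  also have "\<dots> = ennreal (\<Sum>i\<in>J. r i / (1 - r i))"
    using r J by (intro sum_ennreal) force
  finally show ?thesis .
qed

text \<open>The exact balance of \<open>exit_max_row\<close> with \<open>c = t k\<close>: the
  auxiliary bit to the right is added to the left side as a further competitor, and on the right
  side \<open>t k\<close> is absorbed by \<open>exit_max\<close>.\<close>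

lemma exit_value_row_le:
  fixes M :: "nat \<Rightarrow> 'a measure"
  assumes M: "\<And>i. prob_space (M i)" and E: "\<And>i. E i \<in> sets (M i)"
    and q: "0 \<le> q" "q \<le> 1" and r: "\<And>i. i \<le> k \<Longrightarrow> 0 \<le> r i \<and> r i < 1"
    and rel: "\<And>i. i \<le> k \<Longrightarrow> measure (M i) (E i) * (1 - q) = r i * q * (1 - measure (M i) (E i))"
    and t: "mono t" "0 \<le> t 0"
  shows "(\<integral>\<^sup>+s. exit_value r k (row_step (\<lambda>i. of_bool (s i \<in> E i)) t) \<partial>PiM UNIV M) \<le> exit_value r k t + ennreal q"
proof -
  interpret M: prob_space "M i" for i by (rule M)
  let ?p = "\<lambda>i. measure (M i) (E i)"
  let ?f = "\<lambda>x. exit_value r k (row_step (\<lambda>i. of_bool (x i)) t)"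
  \<comment> \<open>\<open>exit_max k\<close> sees only columns up to \<open>k\<close>, so the row
    may be replaced by its cut-off version.\<close>
  have trunc: "exit_max k U (row_step (\<lambda>i. of_bool (i \<le> k \<and> s i \<in> E i)) t) = exit_max k U (row_step (\<lambda>i. of_bool (s i \<in> E i)) t)" for U s
    by (intro antisym exit_max_mono row_step_mono) auto
  have "(\<integral>\<^sup>+s. exit_value r k (row_step (\<lambda>i. of_bool (s i \<in> E i)) t) \<partial>PiM UNIV M)
      = (\<integral>\<^sup>+s. ?f (\<lambda>i. i \<le> k \<and> s i \<in> E i) \<partial>PiM UNIV M)"
    unfolding exit_value_def trunc ..
  also have "\<dots> = (\<integral>\<^sup>+x. ?f x \<partial>row_pmf ?p k)"
    by (rule nn_integral_row_pmf[OF M E])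
  also have "\<dots> = (\<integral>\<^sup>+v. \<integral>\<^sup>+x. ?f x \<partial>row_pmf ?p k \<partial>bernoulli_pmf q)"
    by (simp add: measure_pmf.emeasure_space_1)
  also have "\<dots> \<le> (\<integral>\<^sup>+v. \<integral>\<^sup>+x. \<integral>\<^sup>+U. ennreal (max (exit_max k U (row_step (\<lambda>i. of_bool (x i)) t)) (t k + of_bool v))
      \<partial>boundary_pmf r k \<partial>row_pmf ?p k \<partial>bernoulli_pmf q)"
    unfolding exit_value_def by (intro nn_integral_mono ennreal_leI) auto
  also have "\<dots> = ennreal q + (\<integral>\<^sup>+U. ennreal (max (exit_max k U t) (t k)) \<partial>boundary_pmf r k)"
    by (rule exit_max_row) (use q r rel t in auto)
  also have "\<dots> = exit_value r k t + ennreal q"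
    unfolding exit_value_def using exit_max_ge[of t k] by (simp add: max_absorb1 add.commute)
  finally show ?thesis .
qed

text \<open>From the zero profile the stationary value is the sum of the boundary weights, with mean
  \<open>r i / (1 - r i)\<close> at each site; every row then adds at most \<open>c\<close>. The
  parameters remain free and are optimised in each application.\<close>

lemma nn_integral_passage_le:
  assumes N: "prob_space N" and x: "x \<in> N \<rightarrow>\<^sub>M PiM UNIV (\<lambda>_::nat. borel)" and x0: "\<And>s i. 0 \<le> x s i"
    and step: "\<And>t. mono t \<Longrightarrow> 0 \<le> t 0 \<Longrightarrow> (\<integral>\<^sup>+s. exit_value r k (row_step (x s) t) \<partial>N) \<le> exit_value r k t + c"
    and r: "\<And>i. i \<le> k \<Longrightarrow> 0 \<le> r i \<and> r i < 1"
  shows "(\<integral>\<^sup>+\<omega>. ennreal (passage (\<lambda>j. x (\<omega> j)) n k) \<partial>PiM UNIV (\<lambda>_::nat. N)) \<le> ennreal (\<Sum>i\<le>k. r i / (1 - r i)) + of_nat n * c"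
proof -
  have "(\<integral>\<^sup>+\<omega>. ennreal (passage (\<lambda>j. x (\<omega> j)) n k) \<partial>PiM UNIV (\<lambda>_::nat. N))
      \<le> (\<integral>\<^sup>+\<omega>. exit_value r k (passage (\<lambda>j. x (\<omega> j)) n) \<partial>PiM UNIV (\<lambda>_::nat. N))"
    by (intro nn_integral_mono exit_value_ge)
  also have "\<dots> \<le> exit_value r k (\<lambda>_. 0) + of_nat n * c"
    by (rule nn_integral_chain_le[OF N x x0 exit_value_measurable step]) (auto simp: mono_def)
  also have "exit_value r k (\<lambda>_. 0) = ennreal (\<Sum>i\<le>k. r i / (1 - r i))"
    unfolding exit_value_def exit_max_0 by (rule nn_integral_boundary_sum) (use r in auto)
  finally show ?thesis .
qed

section \<open>Concentration\<close>

lemma integrable_bounded: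
  fixes f :: "'a \<Rightarrow> real"
  assumes "prob_space M" "f \<in> borel_measurable M" "\<And>\<omega>. \<bar>f \<omega>\<bar> \<le> C"
  shows "integrable M f"
proof -
  interpret prob_space M by fact
  show ?thesis by (rule integrable_const_bound[of _ C]) (use assms in auto)
qed

lemma measurable_case_nat_seq:
  assumes "f \<in> borel_measurable (PiM UNIV (\<lambda>_::nat. N))"
  shows "(\<lambda>(s, \<omega>). f (case_nat s \<omega>)) \<in> borel_measurable (N \<Otimes>\<^sub>M PiM UNIV (\<lambda>_::nat. N))"
proof -
  have "(\<lambda>(s, \<omega>). case_nat s \<omega>) \<in> N \<Otimes>\<^sub>M PiM UNIV (\<lambda>_::nat. N) \<rightarrow>\<^sub>M PiM UNIV (\<lambda>_::nat. N)"
    by measurable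
  from measurable_compose[OF this assms] show ?thesis by (simp add: split_beta')
qed

lemma integral_seq:
  fixes f :: "(nat \<Rightarrow> 'a) \<Rightarrow> real"
  assumes N: "prob_space N" and f: "f \<in> borel_measurable (PiM UNIV (\<lambda>_::nat. N))" and b: "\<And>\<omega>. \<bar>f \<omega>\<bar> \<le> C"
  shows "(\<integral>\<omega>. f \<omega> \<partial>PiM UNIV (\<lambda>_::nat. N)) = (\<integral>s. \<integral>\<omega>. f (case_nat s \<omega>) \<partial>PiM UNIV (\<lambda>_::nat. N) \<partial>N)"
proof -
  interpret N: prob_space N by fact
  interpret sequence_space N ..
  interpret NS: pair_prob_space N S ..
  note meas = measurable_case_nat_seq[OF f]
  have "(\<integral>\<omega>. f \<omega> \<partial>S) = (\<integral>\<omega>. f \<omega> \<partial>distr (N \<Otimes>\<^sub>M S) S (\<lambda>(s, \<omega>). case_nat s \<omega>))"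
    by (simp add: PiM_iter)
  also have "\<dots> = (\<integral>z. f (case z of (s, \<omega>) \<Rightarrow> case_nat s \<omega>) \<partial>(N \<Otimes>\<^sub>M S))"
    by (rule integral_distr) (use f in auto)
  also have "\<dots> = (\<integral>z. (case z of (s, \<omega>) \<Rightarrow> f (case_nat s \<omega>)) \<partial>(N \<Otimes>\<^sub>M S))"
    by (simp add: split_beta')
  also have "\<dots> = (\<integral>s. \<integral>\<omega>. f (case_nat s \<omega>) \<partial>S \<partial>N)"
  proof -
    have "integrable (N \<Otimes>\<^sub>M S) (\<lambda>(s, \<omega>). f (case_nat s \<omega>))"
      by (rule integrable_bounded[OF _ meas, of C]) (use b in \<open>auto simp: NS.prob_space_axioms\<close>)
    from NS.integral_fst'[OF this] show ?thesis by simp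
  qed
  finally show ?thesis .
qed

text \<open>Hoeffding's lemma is applied conditionally, one row at a time.\<close>

lemma mgf_bounded_differences:
  fixes f :: "(nat \<Rightarrow> 'a) \<Rightarrow> real"
  assumes N: "prob_space N" and f: "f \<in> borel_measurable (PiM UNIV (\<lambda>_::nat. N))" and b: "\<And>\<omega>. \<bar>f \<omega>\<bar> \<le> C"
    and dep: "\<And>\<omega> \<omega>'. (\<And>j. j < n \<Longrightarrow> \<omega> j = \<omega>' j) \<Longrightarrow> f \<omega> = f \<omega>'"
    and diff: "\<And>\<omega> \<omega>' j. (\<And>i. i \<noteq> j \<Longrightarrow> \<omega> i = \<omega>' i) \<Longrightarrow> \<bar>f \<omega> - f \<omega>'\<bar> \<le> 1"
    and \<theta>: "\<theta> > 0"
  shows "(\<integral>\<^sup>+\<omega>. ennreal (exp (\<theta> * (f \<omega> - (\<integral>\<omega>. f \<omega> \<partial>PiM UNIV (\<lambda>_::nat. N))))) \<partial>PiM UNIV (\<lambda>_::nat. N))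
    \<le> ennreal (exp (\<theta>\<^sup>2 * real n / 2))"
  using f b dep diff
proof (induction n arbitrary: f)
  case 0
  interpret prob_space "PiM UNIV (\<lambda>_::nat. N)" by (intro prob_space_PiM N)
  have "f \<omega> = f undefined" for \<omega> using 0 by blast
  then have "f = (\<lambda>\<omega>. f undefined)" by auto
  then obtain c where "f = (\<lambda>_. c)" by blast
  then show ?case by (simp add: prob_space emeasure_space_1)
next
  case (Suc n)
  interpret N: prob_space N by fact
  let ?S = "PiM UNIV (\<lambda>_::nat. N)"
  interpret S: prob_space ?S by (intro prob_space_PiM N)
  define g where "g s = (\<integral>\<omega>. f (case_nat s \<omega>) \<partial>?S)" for s
  define m where "m = (\<integral>\<omega>. f \<omega> \<partial>?S)"
  have fm: "(\<lambda>\<omega>. f (case_nat s \<omega>)) \<in> borel_measurable ?S" if "s \<in> space N" for s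
    using measurable_compose[OF measurable_Pair1'[OF that] measurable_case_nat_seq[OF Suc.prems(1)]] by simp
  have gm: "g \<in> borel_measurable N"
    unfolding g_def using S.borel_measurable_lebesgue_integral[OF measurable_case_nat_seq[OF Suc.prems(1)]] by simp
  have fi: "integrable ?S (\<lambda>\<omega>. f (case_nat s \<omega>))" if "s \<in> space N" for s
    by (rule integrable_bounded[OF S.prob_space_axioms fm[OF that] Suc.prems(2)])
  have m: "m = N.expectation g"
    unfolding m_def g_def by (rule integral_seq[OF N Suc.prems(1,2)])
  obtain s0 where s0: "s0 \<in> space N" using N.not_empty by blast
  have gdiff: "\<bar>g s - g s0\<bar> \<le> 1" if s: "s \<in> space N" for s
  proof -
    have "\<bar>f (case_nat s \<omega>) - f (case_nat s0 \<omega>)\<bar> \<le> 1" for \<omega>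
      by (rule Suc.prems(4)[of 0]) (auto split: nat.split)
    moreover have "g s - g s0 = (\<integral>\<omega>. f (case_nat s \<omega>) - f (case_nat s0 \<omega>) \<partial>?S)"
      unfolding g_def using fi[OF s] fi[OF s0] by simp
    moreover have "integrable ?S (\<lambda>\<omega>. f (case_nat s \<omega>) - f (case_nat s0 \<omega>))"
      by (intro Bochner_Integration.integrable_diff fi s s0)
    moreover have "AE \<omega> in ?S. f (case_nat s \<omega>) - f (case_nat s0 \<omega>) \<le> 1" "AE \<omega> in ?S. - 1 \<le> f (case_nat s \<omega>) - f (case_nat s0 \<omega>)"
      using \<open>\<And>\<omega>. \<bar>f (case_nat s \<omega>) - f (case_nat s0 \<omega>)\<bar> \<le> 1\<close>
      by (auto simp: abs_le_iff) (smt (verit) AE_I2)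
    ultimately show ?thesis
      using S.integral_le_const[of "\<lambda>\<omega>. f (case_nat s \<omega>) - f (case_nat s0 \<omega>)" 1]
        S.integral_ge_const[of "\<lambda>\<omega>. f (case_nat s \<omega>) - f (case_nat s0 \<omega>)" "-1"]
      by linarith
  qed
  \<comment> \<open>Comparing with one fixed row \<open>s0\<close> confines \<open>g\<close> to an
    interval of length 2, so Hoeffding's lemma gives the exponent \<theta>^2 2^2 / 8 = \<theta>^2 /
    2 for each row.\<close>
  interpret I: interval_bounded_random_variable N g "g s0 - 1" "g s0 + 1"
  proof
    show "AE x in N. g x \<in> {g s0 - 1..g s0 + 1}"
      using gdiff by (intro AE_I2) (force simp: abs_le_iff)
  qed (rule gm)
  have hoeff: "(\<integral>\<^sup>+s. ennreal (exp (\<theta> * (g s - m))) \<partial>N) \<le> ennreal (exp (\<theta>\<^sup>2 / 2))"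
    using I.Hoeffdings_lemma_nn_integral[OF \<theta>] unfolding m by simp
  have "(\<lambda>\<omega>. ennreal (exp (\<theta> * (f \<omega> - m)))) \<in> borel_measurable ?S"
    using Suc.prems(1) by measurable
  then have "(\<integral>\<^sup>+\<omega>. ennreal (exp (\<theta> * (f \<omega> - m))) \<partial>?S)
      = (\<integral>\<^sup>+s. \<integral>\<^sup>+\<omega>. ennreal (exp (\<theta> * (f (case_nat s \<omega>) - m))) \<partial>?S \<partial>N)"
    by (rule nn_integral_seq[OF N])
  also have "\<dots> \<le> (\<integral>\<^sup>+s. ennreal (exp (\<theta> * (g s - m))) * ennreal (exp (\<theta>\<^sup>2 * real n / 2)) \<partial>N)"
  proof (rule nn_integral_mono)
    fix s assume s: "s \<in> space N"
    have "(\<integral>\<^sup>+\<omega>. ennreal (exp (\<theta> * (f (case_nat s \<omega>) - m))) \<partial>?S)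
        = (\<integral>\<^sup>+\<omega>. ennreal (exp (\<theta> * (g s - m))) * ennreal (exp (\<theta> * (f (case_nat s \<omega>) - g s))) \<partial>?S)"
      by (simp add: ennreal_mult[symmetric] exp_add[symmetric] algebra_simps)
    also have "\<dots> = ennreal (exp (\<theta> * (g s - m))) * (\<integral>\<^sup>+\<omega>. ennreal (exp (\<theta> * (f (case_nat s \<omega>) - g s))) \<partial>?S)"
    proof (rule nn_integral_cmult)
      define c where "c = g s"
      show "(\<lambda>\<omega>. ennreal (exp (\<theta> * (f (case_nat s \<omega>) - g s)))) \<in> borel_measurable ?S"
        unfolding c_def[symmetric] using fm[OF s] by measurable
    qed
    also have "(\<integral>\<^sup>+\<omega>. ennreal (exp (\<theta> * (f (case_nat s \<omega>) - g s))) \<partial>?S) \<le> ennreal (exp (\<theta>\<^sup>2 * real n / 2))"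
      unfolding g_def
    proof (rule Suc.IH[OF fm[OF s]])
      show "\<bar>f (case_nat s \<omega>)\<bar> \<le> C" for \<omega> by (rule Suc.prems(2))
      show "f (case_nat s \<omega>) = f (case_nat s \<omega>')" if "\<And>j. j < n \<Longrightarrow> \<omega> j = \<omega>' j" for \<omega> \<omega>'
        by (rule Suc.prems(3)) (use that in \<open>auto split: nat.split\<close>)
      show "\<bar>f (case_nat s \<omega>) - f (case_nat s \<omega>')\<bar> \<le> 1" if "\<And>i. i \<noteq> j \<Longrightarrow> \<omega> i = \<omega>' i" for \<omega> \<omega>' j
        by (rule Suc.prems(4)[of "Suc j"]) (use that in \<open>auto split: nat.split\<close>)
    qed
    finally show "(\<integral>\<^sup>+\<omega>. ennreal (exp (\<theta> * (f (case_nat s \<omega>) - m))) \<partial>?S)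
        \<le> ennreal (exp (\<theta> * (g s - m))) * ennreal (exp (\<theta>\<^sup>2 * real n / 2))"
      by (simp add: mult_left_mono)
  qed
  also have "\<dots> = (\<integral>\<^sup>+s. ennreal (exp (\<theta> * (g s - m))) \<partial>N) * ennreal (exp (\<theta>\<^sup>2 * real n / 2))"
    using gm by (intro nn_integral_multc) measurable
  also have "\<dots> \<le> ennreal (exp (\<theta>\<^sup>2 / 2)) * ennreal (exp (\<theta>\<^sup>2 * real n / 2))"
    by (intro mult_right_mono hoeff) auto
  also have "\<dots> = ennreal (exp (\<theta>\<^sup>2 * real (Suc n) / 2))"
    by (simp add: ennreal_mult[symmetric] exp_add[symmetric] field_simps)
  finally show ?case unfolding m_def .
qed

text \<open>The transform is \<open>exp (- \<theta> * u) / (1 - y)\<close> with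
  \<open>y = u * (exp \<theta> - 1)\<close>. The smallness condition keeps \<open>y\<close> below
  1/2, where \<open>- ln (1 - y)\<close> is at most y + 2 y^2. Inserting y \<le> u (\<theta> +
  \<theta>^2) and y \<le> 2 u \<theta> cancels the linear term and leaves (u + 8 u^2)
  \<theta>^2.\<close>

lemma geometric_mgf:
  assumes r: "0 \<le> r" "r < 1" and \<theta>: "0 < \<theta>" "\<theta> \<le> 1" and u: "u = r / (1 - r)" and small: "4 * u * \<theta> \<le> 1"
  shows "(\<integral>\<^sup>+n. ennreal (exp (\<theta> * (real n - u))) \<partial>geometric_pmf (1 - r)) \<le> ennreal (exp ((u + 8 * u\<^sup>2) * \<theta>\<^sup>2))"
proof -
  have u0: "0 \<le> u" using r u by simp
  define y where "y = u * (exp \<theta> - 1)"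
  have ex: "exp \<theta> - 1 \<le> \<theta> + \<theta>\<^sup>2" using exp_bound[of \<theta>] \<theta> by simp
  have \<theta>2: "\<theta>\<^sup>2 \<le> \<theta>" using \<theta> by (simp add: power2_eq_square mult_left_le)
  have y0: "0 \<le> y" unfolding y_def using u0 \<theta> by simp
  have y1: "y \<le> u * (\<theta> + \<theta>\<^sup>2)" unfolding y_def by (intro mult_left_mono ex u0)
  have y2: "y \<le> 2 * u * \<theta>" using y1 mult_left_mono[OF \<theta>2 u0] by (simp add: algebra_simps)
  have y3: "y \<le> 1 / 2" using y2 small by linarith
  have re: "1 - r * exp \<theta> = (1 - r) * (1 - y)"
    unfolding y_def u using r by (simp add: field_simps)
  have re_pos: "0 < 1 - r * exp \<theta>" unfolding re using r y3 by simp
  have "(\<integral>\<^sup>+n. ennreal (exp (\<theta> * (real n - u))) \<partial>geometric_pmf (1 - r))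
      = (\<integral>\<^sup>+n. ennreal (exp (- \<theta> * u) * (1 - r) * (r * exp \<theta>) ^ n) \<partial>count_space UNIV)"
    unfolding nn_integral_measure_pmf
  proof (rule nn_integral_cong)
    fix n :: nat
    have "r ^ n * (1 - r) * exp (\<theta> * (real n - u)) = exp (- \<theta> * u) * (1 - r) * (r ^ n * exp (real n * \<theta>))"
      by (simp add: algebra_simps exp_diff exp_minus divide_simps)
    also have "r ^ n * exp (real n * \<theta>) = (r * exp \<theta>) ^ n"
      by (simp add: exp_of_nat_mult power_mult_distrib)
    finally show "ennreal (pmf (geometric_pmf (1 - r)) n) * ennreal (exp (\<theta> * (real n - u))) = ennreal (exp (- \<theta> * u) * (1 - r) * (r * exp \<theta>) ^ n)"
      using r by (simp add: ennreal_mult[symmetric])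
  qed
  also have "\<dots> = (\<Sum>n. ennreal (exp (- \<theta> * u) * (1 - r) * (r * exp \<theta>) ^ n))"
    by (rule nn_integral_count_space_nat)
  also have "\<dots> = ennreal (\<Sum>n. exp (- \<theta> * u) * (1 - r) * (r * exp \<theta>) ^ n)"
    using r re_pos by (intro suminf_ennreal2) (auto intro!: summable_mult summable_geometric)
  also have "(\<Sum>n. exp (- \<theta> * u) * (1 - r) * (r * exp \<theta>) ^ n) = exp (- \<theta> * u) * (1 - r) / (1 - r * exp \<theta>)"
    using r re_pos by (subst suminf_mult) (auto simp: suminf_geometric intro!: summable_geometric)
  also have "\<dots> = exp (- \<theta> * u) * exp (- ln (1 - y))"
    using y3 r unfolding re by (simp add: exp_minus divide_simps)
  also have "\<dots> = exp (- \<theta> * u - ln (1 - y))" by (simp add: exp_add[symmetric])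
  also have "\<dots> \<le> exp ((u + 8 * u\<^sup>2) * \<theta>\<^sup>2)"
  proof (rule exp_le_cancel_iff[THEN iffD2])
    have "- ln (1 - y) \<le> y + 2 * y\<^sup>2" using ln_one_minus_pos_lower_bound[of y] y0 y3 by simp
    moreover have "y\<^sup>2 \<le> (2 * u * \<theta>)\<^sup>2" by (intro power_mono y2 y0)
    ultimately show "- \<theta> * u - ln (1 - y) \<le> (u + 8 * u\<^sup>2) * \<theta>\<^sup>2"
      using y1 by (simp add: algebra_simps power2_eq_square)
  qed
  finally show ?thesis by (simp add: ennreal_leI)
qed

text \<open>Independence factorises the transform. Sites outside \<open>J\<close> contribute the
  factor 1, which lies below the common bound, so the estimate is uniform in \<open>J\<close> and
  hence in the exit point.\<close>

lemma boundary_mgf: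
  assumes r: "0 \<le> r" "r < 1" and \<theta>: "0 < \<theta>" "\<theta> \<le> 1" and u: "u = r / (1 - r)" and small: "4 * u * \<theta> \<le> 1" and J: "J \<subseteq> {..k}"
  shows "(\<integral>\<^sup>+U. ennreal (exp (\<theta> * ((\<Sum>i\<in>J. real (U i)) - real (card J) * u))) \<partial>boundary_pmf (\<lambda>_. r) k)
    \<le> ennreal (exp (real (Suc k) * (u + 8 * u\<^sup>2) * \<theta>\<^sup>2))"
proof -
  have fin: "finite J" using J finite_subset by auto
  have u0: "0 \<le> u" using r u by simp
  let ?B = "ennreal (exp ((u + 8 * u\<^sup>2) * \<theta>\<^sup>2))"
  define f where "f i n = (if i \<in> J then ennreal (exp (\<theta> * (real n - u))) else 1)" for i n
  have "ennreal (exp (\<theta> * ((\<Sum>i\<in>J. real (U i)) - real (card J) * u))) = (\<Prod>i\<in>{..k}. f i (U i))" for U :: "nat \<Rightarrow> nat"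
  proof -
    have "\<theta> * ((\<Sum>i\<in>J. real (U i)) - real (card J) * u) = (\<Sum>i\<in>J. \<theta> * (real (U i) - u))"
      by (simp add: sum_subtractf sum_distrib_left[symmetric])
    then have "ennreal (exp (\<theta> * ((\<Sum>i\<in>J. real (U i)) - real (card J) * u))) = (\<Prod>i\<in>J. ennreal (exp (\<theta> * (real (U i) - u))))"
      using fin by (simp add: exp_sum prod_ennreal)
    also have "\<dots> = (\<Prod>i\<in>{..k}. f i (U i))"
      unfolding f_def using J by (simp add: prod.If_cases Int_absorb1)
    finally show ?thesis .
  qed
  then have "(\<integral>\<^sup>+U. ennreal (exp (\<theta> * ((\<Sum>i\<in>J. real (U i)) - real (card J) * u))) \<partial>boundary_pmf (\<lambda>_. r) k)
      = (\<Prod>i\<in>{..k}. \<integral>\<^sup>+n. f i n \<partial>geometric_pmf (1 - r))"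
    unfolding boundary_pmf_def by (simp add: nn_integral_prod_Pi_pmf)
  also have "\<dots> \<le> (\<Prod>i\<in>{..k}. ?B)"
  proof (intro prod_mono_ennreal)
    fix i show "(\<integral>\<^sup>+n. f i n \<partial>geometric_pmf (1 - r)) \<le> ?B"
      using geometric_mgf[OF r \<theta> u small] u0 \<theta>
      by (cases "i \<in> J") (auto simp: f_def measure_pmf.emeasure_space_1 one_le_exp_iff)
  qed
  also have "\<dots> = ennreal (exp (real (Suc k) * (u + 8 * u\<^sup>2) * \<theta>\<^sup>2))"
    by (simp only: prod_constant card_atMost ennreal_power[OF exp_ge_zero] exp_of_nat_mult[symmetric] mult.assoc)
  finally show ?thesis .
qed

section \<open>Exit points and bounded differences\<close>

lemma exit_max_exit: "\<exists>s\<le>k. exit_max k U t = t s + (\<Sum>i\<in>{s..k}. real (U i))"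
proof (induction k)
  case (Suc k)
  then obtain s where s: "s \<le> k" "exit_max k U t = t s + (\<Sum>i\<in>{s..k}. real (U i))" by blast
  show ?case
  proof (cases "exit_max k U t \<ge> t (Suc k)")
    case True
    then show ?thesis using s by (intro exI[of _ s]) (auto simp: max_def)
  next
    case False
    then show ?thesis by (intro exI[of _ "Suc k"]) auto
  qed
qed auto

text \<open>Here \<open>m\<close> is the number of rows passed before the path enters column
  \<open>Suc k\<close>: the exit point towards the right boundary.\<close>

lemma prof_exit_right: "\<exists>m\<le>n. passage w n (Suc k) = passage w m k + (\<Sum>j\<in>{m..<n}. w j (Suc k))"
proof (induction n)
  case (Suc n)
  then obtain m where m: "m \<le> n" "passage w n (Suc k) = passage w m k + (\<Sum>j\<in>{m..<n}. w j (Suc k))" by blast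
  show ?case
  proof (cases "passage w (Suc n) k \<le> passage w n (Suc k) + w n (Suc k)")
    case True
    then show ?thesis using m by (intro exI[of _ m]) (auto simp: max_def)
  next
    case False
    then show ?thesis by (intro exI[of _ "Suc n"]) auto
  qed
qed auto

text \<open>A path meets row \<open>j0\<close> only once, so changing that row by at most 1 changes
  every competing sum by at most 1.\<close>

lemma prof_bounded_difference:
  assumes "\<And>j i. \<bar>w j i - w' j i\<bar> \<le> of_bool (j = j0)"
  shows "\<bar>prof w t n k - prof w' t n k\<bar> \<le> 1"
proof -
  have *: "prof w t n k \<le> prof w' t n k + 1" if "\<And>j i. \<bar>w j i - w' j i\<bar> \<le> of_bool (j = j0)" for w w'
  proof -
    have "prof w t n k \<le> prof (\<lambda>j i. w' j i + of_bool (j = j0)) (\<lambda>i. t i + 0) n k"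
    proof (rule prof_mono)
      show "w j i \<le> w' j i + of_bool (j = j0)" for j i using that[of j i] by (simp add: abs_le_iff)
    qed simp
    also have "\<dots> = prof w' t n k + (\<Sum>j<n. of_bool (j = j0))"
      by (subst prof_add_const) simp
    also have "(\<Sum>j<n. of_bool (j = j0)) \<le> (1::real)"
      by (simp add: of_bool_def sum.delta)
    finally show ?thesis by simp
  qed
  have "\<bar>w' j i - w j i\<bar> \<le> of_bool (j = j0)" for j i using assms[of j i] by (simp add: abs_minus_commute)
  then have "prof w' t n k \<le> prof w t n k + 1" by (rule *)
  moreover have "prof w t n k \<le> prof w' t n k + 1" by (rule *) (rule assms)
  ultimately show ?thesis by linarith
qed

lemma passage_le_rows:
  assumes "\<And>j i. w j i \<le> 1"
  shows "passage w n k \<le> real n"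
  using prof_mono[of k "\<lambda>_. 0" "\<lambda>_. 0" n w "\<lambda>_ _. 1"] assms passage_const[of "\<lambda>_. 1" n k] by simp

lemma passage_ge_split:
  assumes "m \<le> n"
  shows "passage w m k + (\<Sum>j\<in>{m..<n}. w j k) \<le> passage w n k"
  using assms
proof (induction n)
  case (Suc n)
  show ?case
  proof (cases "m = Suc n")
    case False
    then have "passage w m k + (\<Sum>j\<in>{m..<n}. w j k) + w n k \<le> passage w (Suc n) k"
      using Suc row_step_ge[of "passage w n" k "w n"] by simp
    then show ?thesis using False Suc.prems by simp
  qed simp
qed auto

section \<open>Bernoulli weights with homogeneous rows\<close>

text \<open>The probability depends on the column so that the fair model and its extension by one
  Bernoulli \<open>q\<close> column fall under the same definition.\<close>

definition bern_rows :: "(nat \<Rightarrow> real) \<Rightarrow> (nat \<Rightarrow> bool) measure" where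
  "bern_rows p = PiM UNIV (\<lambda>i. measure_pmf (bernoulli_pmf (p i)))"

definition bern_env :: "(nat \<Rightarrow> real) \<Rightarrow> (nat \<Rightarrow> nat \<Rightarrow> bool) measure" where
  "bern_env p = PiM UNIV (\<lambda>_. bern_rows p)"

definition bits :: "(nat \<Rightarrow> nat \<Rightarrow> bool) \<Rightarrow> nat \<Rightarrow> nat \<Rightarrow> real" where
  "bits \<omega> j i = of_bool (\<omega> j i)"

definition ref_passage :: "(nat \<Rightarrow> real) \<Rightarrow> nat \<Rightarrow> nat \<Rightarrow> real" where
  "ref_passage p n k = (\<integral>\<omega>. passage (bits \<omega>) n k \<partial>bern_env p)"

lemma prob_space_bern_rows: "prob_space (bern_rows p)"
  unfolding bern_rows_def by (intro prob_space_PiM prob_space_measure_pmf)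

lemma prob_space_bern_env: "prob_space (bern_env p)"
  unfolding bern_env_def by (intro prob_space_PiM prob_space_bern_rows)

lemma row_bits_measurable: "(\<lambda>s i. of_bool (s i)) \<in> bern_rows p \<rightarrow>\<^sub>M PiM UNIV (\<lambda>_::nat. borel :: real measure)"
  unfolding bern_rows_def
  by (intro measurable_PiM_single' measurable_compose[OF measurable_component_singleton]) auto

lemma bits_eq: "bits \<omega> = (\<lambda>j. (\<lambda>s i. of_bool (s i)) (\<omega> j))"
  by (auto simp: bits_def fun_eq_iff)

lemma bits_measurable [measurable]: "(\<lambda>\<omega>. bits \<omega> j i) \<in> borel_measurable (bern_env p)"
  using seq_component_measurable[OF row_bits_measurable[of p], of j i] by (simp add: bits_def bern_env_def)

lemma passage_bits_measurable [measurable]: "(\<lambda>\<omega>. prof (bits \<omega>) t n k) \<in> borel_measurable (bern_env p)"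
  by (rule measurable_prof) auto

lemma bits_bounds: "0 \<le> bits \<omega> j i" "bits \<omega> j i \<le> 1"
  by (auto simp: bits_def)

lemma passage_bits_bounds: "0 \<le> passage (bits \<omega>) n k" "passage (bits \<omega>) n k \<le> real n"
  by (auto intro!: passage_nonneg passage_le_rows bits_bounds)

lemma passage_bits_integrable: "integrable (bern_env p) (\<lambda>\<omega>. passage (bits \<omega>) n k)"
  by (rule integrable_bounded[OF prob_space_bern_env, of _ _ "real n"]) (use passage_bits_bounds in auto)

lemma nn_integral_passage_bits: "(\<integral>\<^sup>+\<omega>. ennreal (passage (bits \<omega>) n k) \<partial>bern_env p) = ennreal (ref_passage p n k)"
  unfolding ref_passage_def
  by (rule nn_integral_eq_integral[OF passage_bits_integrable]) (use passage_bits_bounds in auto)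

lemma ref_passage_bounds: "0 \<le> ref_passage p n k" "ref_passage p n k \<le> real n"
proof -
  interpret prob_space "bern_env p" by (rule prob_space_bern_env)
  show "0 \<le> ref_passage p n k" "ref_passage p n k \<le> real n"
    unfolding ref_passage_def using passage_bits_bounds
    by (auto intro!: integral_ge_const integral_le_const passage_bits_integrable)
qed

lemma nn_integral_bern_rows:
  assumes "\<And>i. 0 \<le> p i \<and> p i \<le> 1" "\<And>s s'. (\<And>i. i \<le> k \<Longrightarrow> s i = s' i) \<Longrightarrow> f s = f s'"
  shows "(\<integral>\<^sup>+s. f s \<partial>bern_rows p) = (\<integral>\<^sup>+x. f x \<partial>row_pmf p k)"
proof -
  have p: "measure (measure_pmf (bernoulli_pmf (p i))) {True} = p i" for i
    using assms(1)[of i] by (simp add: measure_pmf_single)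
  have "(\<integral>\<^sup>+s. f s \<partial>bern_rows p) = (\<integral>\<^sup>+s. f (\<lambda>i. i \<le> k \<and> s i \<in> {True}) \<partial>bern_rows p)"
    by (intro nn_integral_cong assms(2)) auto
  also have "\<dots> = (\<integral>\<^sup>+x. f x \<partial>row_pmf (\<lambda>i. measure (measure_pmf (bernoulli_pmf (p i))) {True}) k)"
    unfolding bern_rows_def by (intro nn_integral_row_pmf prob_space_measure_pmf) auto
  finally show ?thesis unfolding p .
qed

lemma prof_bits_case_nat: "prof (bits (case_nat s \<omega>)) t (Suc n) = prof (bits \<omega>) (row_step (\<lambda>i. of_bool (s i)) t) n"
  unfolding prof_Suc_first by (simp add: bits_def[abs_def])

text \<open>Columns beyond \<open>k\<close> are invisible to the passage value. This lets
  expectations of the fair model be used under the measure that has the extra column.\<close>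

lemma ref_passage_cong:
  assumes p: "\<And>i. 0 \<le> p i \<and> p i \<le> 1" "\<And>i. 0 \<le> p' i \<and> p' i \<le> 1" and eq: "\<And>i. i \<le> k \<Longrightarrow> p i = p' i"
  shows "ref_passage p n k = ref_passage p' n k"
proof -
  let ?I = "\<lambda>p n t. \<integral>\<^sup>+\<omega>. ennreal (prof (bits \<omega>) t n k) \<partial>bern_env p"
  have "?I p n t = ?I p' n t" for t
  proof (induction n arbitrary: t)
    case 0
    interpret P: prob_space "bern_env p" for p by (rule prob_space_bern_env)
    show ?case by (simp add: P.emeasure_space_1)
  next
    case (Suc n)
    define F where "F s = ?I p' n (row_step (\<lambda>i. of_bool (s i)) t)" for s :: "nat \<Rightarrow> bool"
    have step: "?I p (Suc n) t = (\<integral>\<^sup>+s. ?I p n (row_step (\<lambda>i. of_bool (s i)) t) \<partial>bern_rows p)" for p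
    proof -
      have "(\<lambda>\<omega>. ennreal (prof (bits \<omega>) t (Suc n) k)) \<in> borel_measurable (bern_env p)"
        using passage_bits_measurable[of t "Suc n" k p] by measurable
      then show ?thesis
        unfolding bern_env_def by (subst nn_integral_seq[OF prob_space_bern_rows]) (simp_all only: prof_bits_case_nat)
    qed
    have dep: "F s = F s'" if "\<And>i. i \<le> k \<Longrightarrow> s i = s' i" for s s'
      unfolding F_def by (intro nn_integral_cong arg_cong[where f = ennreal] prof_cong antisym row_step_mono) (use that in auto)
    have "?I p (Suc n) t = (\<integral>\<^sup>+s. F s \<partial>bern_rows p)" unfolding step F_def by (simp add: Suc)
    also have "\<dots> = (\<integral>\<^sup>+x. F x \<partial>row_pmf p k)" by (rule nn_integral_bern_rows[OF p(1) dep])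
    also have "row_pmf p k = row_pmf p' k" unfolding row_pmf_def using eq by (intro Pi_pmf_cong) auto
    also have "(\<integral>\<^sup>+x. F x \<partial>row_pmf p' k) = (\<integral>\<^sup>+s. F s \<partial>bern_rows p')" by (rule nn_integral_bern_rows[OF p(2) dep, symmetric])
    also have "\<dots> = ?I p' (Suc n) t" unfolding step F_def ..
    finally show ?case .
  qed
  from this[of "\<lambda>_. 0"] show ?thesis unfolding nn_integral_passage_bits using ref_passage_bounds(1) by simp
qed

abbreviation "half \<equiv> (\<lambda>_::nat. 1 / 2 :: real)"

lemma ref_passage_mono:
  assumes "s \<le> k"
  shows "ref_passage p n s \<le> ref_passage p n k"
  unfolding ref_passage_def
  by (intro integral_mono passage_bits_integrable)
     (use mono_prof[of "\<lambda>_. 0"] assms in \<open>auto simp: mono_def\<close>)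

lemma integral_bits:
  assumes "\<And>i. 0 \<le> p i \<and> p i \<le> 1"
  shows "(\<integral>\<omega>. bits \<omega> j i \<partial>bern_env p) = p i"
proof -
  interpret R: product_prob_space "\<lambda>i. measure_pmf (bernoulli_pmf (p i))" UNIV ..
  interpret E: product_prob_space "\<lambda>_::nat. bern_rows p" UNIV
    by (intro product_prob_space.intro product_sigma_finite.intro product_prob_space_axioms.intro
        prob_space_imp_sigma_finite prob_space_bern_rows)
  have "(\<integral>\<omega>. bits \<omega> j i \<partial>bern_env p) = (\<integral>s. (of_bool (s i) :: real) \<partial>distr (bern_env p) (bern_rows p) (\<lambda>\<omega>. \<omega> j))"
    unfolding bits_def bern_env_def
    by (subst integral_distr) (auto intro: measurable_compose[OF row_bits_measurable measurable_component_singleton])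
  also have "distr (bern_env p) (bern_rows p) (\<lambda>\<omega>. \<omega> j) = bern_rows p"
    unfolding bern_env_def by (rule E.PiM_component) auto
  also have "(\<integral>s. (of_bool (s i) :: real) \<partial>bern_rows p) = (\<integral>b. (of_bool b :: real) \<partial>distr (bern_rows p) (measure_pmf (bernoulli_pmf (p i))) (\<lambda>s. s i))"
    unfolding bern_rows_def by (rule integral_distr[symmetric, where f = "of_bool :: bool \<Rightarrow> real" and g = "\<lambda>s. s i"]) auto
  also have "distr (bern_rows p) (measure_pmf (bernoulli_pmf (p i))) (\<lambda>s. s i) = measure_pmf (bernoulli_pmf (p i))"
    unfolding bern_rows_def by (rule R.PiM_component) auto
  also have "(\<integral>b. (of_bool b :: real) \<partial>measure_pmf (bernoulli_pmf (p i))) = p i"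
    using assms by simp
  finally show ?thesis .
qed

lemma bits_integrable: "integrable (bern_env p) (\<lambda>\<omega>. bits \<omega> j i)"
  by (rule integrable_bounded[OF prob_space_bern_env, of _ _ 1]) (use bits_bounds in auto)

text \<open>One competitor stays in column \<open>k\<close> for the last \<open>n - m\<close> rows
  and collects the mean 1/2 in each of them.\<close>

lemma ref_passage_split:
  assumes "m \<le> n"
  shows "ref_passage half m k + real (n - m) / 2 \<le> ref_passage half n k"
proof -
  have "(\<integral>\<omega>. passage (bits \<omega>) m k + (\<Sum>j\<in>{m..<n}. bits \<omega> j k) \<partial>bern_env half) \<le> ref_passage half n k"
    unfolding ref_passage_def
    by (intro integral_mono passage_bits_integrable Bochner_Integration.integrable_add Bochner_Integration.integrable_sum
        bits_integrable passage_ge_split assms)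
  also have "(\<integral>\<omega>. passage (bits \<omega>) m k + (\<Sum>j\<in>{m..<n}. bits \<omega> j k) \<partial>bern_env half)
      = ref_passage half m k + real (n - m) / 2"
    unfolding ref_passage_def
    by (subst Bochner_Integration.integral_add)
       (auto intro!: passage_bits_integrable bits_integrable simp: Bochner_Integration.integral_sum bits_integrable integral_bits)
  finally show ?thesis .
qed

text \<open>For \<open>p = 1 / 2\<close> the balance relation reads \<open>r = (1 - q) / q\<close>;
  with \<open>q = 1 / 2 + \<epsilon>\<close> the mean boundary weight is the displayed
  quotient.\<close>

lemma ref_passage_le_param:
  assumes \<epsilon>: "0 < \<epsilon>" "\<epsilon> < 1 / 2"
  shows "ref_passage half n k \<le> real (Suc k) * ((1 / 2 - \<epsilon>) / (2 * \<epsilon>)) + real n * (1 / 2 + \<epsilon>)"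
proof -
  define q where "q = 1 / 2 + \<epsilon>"
  define r where "r = (1 - q) / q"
  have q: "0 < q" "q < 1" "1 / 2 < q" using \<epsilon> by (auto simp: q_def)
  have r: "0 \<le> r" "r < 1" using q by (auto simp: r_def field_simps)
  have u: "r / (1 - r) = (1 / 2 - \<epsilon>) / (2 * \<epsilon>)"
  proof -
    have "r / (1 - r) = (1 - q) / (2 * q - 1)" using q by (simp add: r_def field_simps)
    also have "\<dots> = (1 / 2 - \<epsilon>) / (2 * \<epsilon>)" by (simp add: q_def)
    finally show ?thesis .
  qed
  have half: "measure (measure_pmf (bernoulli_pmf (1 / 2))) {True} = 1 / 2"
    by (simp add: measure_pmf_single)
  have "(\<integral>\<^sup>+\<omega>. ennreal (passage (\<lambda>j. (\<lambda>s i. of_bool (s i)) (\<omega> j)) n k) \<partial>PiM UNIV (\<lambda>_::nat. bern_rows half))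
      \<le> ennreal (\<Sum>i\<le>k. r / (1 - r)) + of_nat n * ennreal q"
  proof (rule nn_integral_passage_le[OF prob_space_bern_rows row_bits_measurable])
    fix t :: "nat \<Rightarrow> real" assume t: "mono t" "0 \<le> t 0"
    have "(\<integral>\<^sup>+s. exit_value (\<lambda>_. r) k (row_step (\<lambda>i. of_bool (s i \<in> {True})) t) \<partial>bern_rows half) \<le> exit_value (\<lambda>_. r) k t + ennreal q"
      unfolding bern_rows_def
      by (rule exit_value_row_le) (use r q t half in \<open>auto simp: prob_space_measure_pmf r_def\<close>)
    then show "(\<integral>\<^sup>+s. exit_value (\<lambda>_. r) k (row_step (\<lambda>i. of_bool (s i)) t) \<partial>bern_rows half) \<le> exit_value (\<lambda>_. r) k t + ennreal q"
      by simp
  qed (use r in auto)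
  then have "ennreal (ref_passage half n k) \<le> ennreal (real (Suc k) * (r / (1 - r)) + real n * q)"
    using r q unfolding bern_env_def[symmetric] bits_eq[symmetric] nn_integral_passage_bits
    by (simp add: ennreal_of_nat_eq_real_of_nat ennreal_mult[symmetric] ennreal_plus[symmetric] del: ennreal_plus)
  then have "ref_passage half n k \<le> real (Suc k) * (r / (1 - r)) + real n * q"
    using r q by (subst (asm) ennreal_le_iff) auto
  then show ?thesis unfolding u q_def .
qed

lemma ref_passage_le: "ref_passage half n k \<le> real n / 2 + sqrt (real n * real (Suc k))"
proof (cases "Suc k < n")
  case True
  \<comment> \<open>Balances the boundary cost \<open>real (Suc k) / (4 * \<epsilon>)\<close>
    against the excess drift \<open>real n * \<epsilon>\<close>.\<close>
  define \<epsilon> where "\<epsilon> = sqrt (real (Suc k) / real n) / 2"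
  have n: "0 < n" using True by simp
  have \<epsilon>: "0 < \<epsilon>" "\<epsilon> < 1 / 2" using True by (auto simp: \<epsilon>_def)
  define a b where "a = sqrt (real n)" and "b = sqrt (real (Suc k))"
  have ab: "a > 0" "b > 0" "real n = a * a" "real (Suc k) = b * b" using n by (auto simp: a_def b_def)
  have \<epsilon>_ab: "\<epsilon> = b / a / 2" by (simp add: \<epsilon>_def a_def b_def real_sqrt_divide)
  have s: "sqrt (real n * real (Suc k)) = a * b" by (simp only: a_def b_def real_sqrt_mult)
  have 1: "real n * \<epsilon> = sqrt (real n * real (Suc k)) / 2"
    unfolding s unfolding \<epsilon>_ab ab(3) using ab(1,2) by simp
  have 2: "real (Suc k) / (4 * \<epsilon>) = sqrt (real n * real (Suc k)) / 2"
    unfolding s unfolding \<epsilon>_ab ab(4) using ab(1,2) by simp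
  have 3: "real (Suc k) * ((1 / 2 - \<epsilon>) / (2 * \<epsilon>)) = real (Suc k) / (4 * \<epsilon>) - real (Suc k) / 2"
    using \<epsilon> by (simp add: field_simps)
  have "0 \<le> real (Suc k)" by simp
  moreover have "ref_passage half n k \<le> sqrt (real n * real (Suc k)) / 2 - real (Suc k) / 2 + (real n / 2 + sqrt (real n * real (Suc k)) / 2)"
    using ref_passage_le_param[OF \<epsilon>, of n k] unfolding 3 2 unfolding distrib_left 1 by simp
  ultimately show ?thesis by argo
next
  \<comment> \<open>The optimal \<epsilon> would reach 1/2; in this range the trivial bound
    \<open>n\<close> is already good enough.\<close>
  case False
  have "real n \<le> sqrt (real n * real (Suc k))"
    using False by (intro real_le_rsqrt) (simp add: power2_eq_square mult_left_mono)
  moreover have "0 \<le> real n" by simp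
  ultimately show ?thesis using ref_passage_bounds(2)[of half n k] by linarith
qed

text \<open>The stationary version: geometric weights along the top, \<open>Bernoulli q\<close> weights in an extra
  column on the right.\<close>

lemma stationary_ge:
  fixes q :: real and k :: nat
  assumes q: "1 / 2 < q" "q < 1"
  defines "p \<equiv> \<lambda>i. if i \<le> k then 1 / 2 else q" and "r \<equiv> (1 - q) / q"
  shows "ennreal (real (Suc k) * ((1 - q) / (2 * q - 1)) + real n * q)
    \<le> (\<integral>\<^sup>+\<omega>. \<integral>\<^sup>+U. ennreal (max (exit_max k U (passage (bits \<omega>) n)) (passage (bits \<omega>) n (Suc k))) \<partial>boundary_pmf (\<lambda>_. r) k \<partial>bern_env p)"
proof -
  define G where "G t = (\<integral>\<^sup>+U. ennreal (max (exit_max k U t) (t (Suc k))) \<partial>boundary_pmf (\<lambda>_. r) k)" for t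
  have r: "0 \<le> r" "r < 1" using q by (auto simp: r_def field_simps)
  have p: "0 \<le> p i \<and> p i \<le> 1" for i using q by (auto simp: p_def)
  have u: "r / (1 - r) = (1 - q) / (2 * q - 1)"
    using q by (simp add: r_def field_simps)
  have G: "G \<in> borel_measurable (PiM UNIV (\<lambda>_::nat. borel))"
    unfolding G_def by measurable
  have "G (\<lambda>_. 0) + of_nat n * ennreal q \<le> (\<integral>\<^sup>+\<omega>. G (passage (\<lambda>j. (\<lambda>s i. of_bool (s i)) (\<omega> j)) n) \<partial>PiM UNIV (\<lambda>_::nat. bern_rows p))"
  proof (rule nn_integral_chain_ge[OF prob_space_bern_rows row_bits_measurable _ G])
    fix t :: "nat \<Rightarrow> real" assume t: "mono t" "0 \<le> t 0"
    let ?f = "\<lambda>s. G (row_step (\<lambda>i. of_bool (s i)) t)"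
    have cong: "exit_max k U (row_step (\<lambda>i. of_bool (s i)) t) = exit_max k U (row_step (\<lambda>i. of_bool (s' i)) t)"
      if "\<And>i. i \<le> k \<Longrightarrow> s i = s' i" for s s' :: "nat \<Rightarrow> bool" and U
      by (intro antisym exit_max_mono row_step_mono) (use that in auto)
    \<comment> \<open>The value at column \<open>Suc k\<close> competes with
      \<open>row_step x t k\<close>, which \<open>exit_max\<close> dominates anyway. What remains
      has the shape of \<open>exit_max_row\<close> with \<open>c = t (Suc k)\<close>, the last bit
      of the row playing the entering bit.\<close>
    have mx: "max (exit_max k U (row_step x t)) (row_step x t (Suc k)) = max (exit_max k U (row_step x t)) (t (Suc k) + x (Suc k))" for U x
      using exit_max_ge[of "row_step x t" k U] by auto
    have "G t + ennreal q = (\<integral>\<^sup>+v. \<integral>\<^sup>+x. \<integral>\<^sup>+U. ennreal (max (exit_max k U (row_step (\<lambda>i. of_bool (x i)) t)) (t (Suc k) + of_bool v))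
      \<partial>boundary_pmf (\<lambda>_. r) k \<partial>row_pmf p k \<partial>bernoulli_pmf q)"
      unfolding G_def using q r t
      by (subst exit_max_row) (auto simp: p_def r_def field_simps add.commute monoD)
    also have "\<dots> = (\<integral>\<^sup>+x. ?f x \<partial>row_pmf p (Suc k))"
    proof -
      have "?f (x(Suc k := v)) = (\<integral>\<^sup>+U. ennreal (max (exit_max k U (row_step (\<lambda>i. of_bool (x i)) t)) (t (Suc k) + of_bool v)) \<partial>boundary_pmf (\<lambda>_. r) k)" for x v
        unfolding G_def mx by (subst cong[of "x(Suc k := v)" x]) auto
      moreover have "p (Suc k) = q" by (simp add: p_def)
      ultimately show ?thesis unfolding row_pmf_Suc by (simp add: nn_integral_bind_pmf)
    qed
    also have "\<dots> = (\<integral>\<^sup>+s. ?f s \<partial>bern_rows p)"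
    proof (rule nn_integral_bern_rows[symmetric, OF p])
      fix s s' :: "nat \<Rightarrow> bool" assume s: "\<And>i. i \<le> Suc k \<Longrightarrow> s i = s' i"
      have "exit_max k U (row_step (\<lambda>i. of_bool (s i)) t) = exit_max k U (row_step (\<lambda>i. of_bool (s' i)) t)" for U
        by (rule cong) (use s in auto)
      then show "?f s = ?f s'" unfolding G_def mx using s by simp
    qed
    finally show "G t + ennreal q \<le> (\<integral>\<^sup>+s. ?f s \<partial>bern_rows p)" by simp
  qed (auto simp: mono_def)
  moreover have "G (\<lambda>_. 0) = ennreal (real (Suc k) * ((1 - q) / (2 * q - 1)))"
  proof -
    have "G (\<lambda>_. 0) = (\<integral>\<^sup>+U. ennreal (\<Sum>i\<le>k. real (U i)) \<partial>boundary_pmf (\<lambda>_. r) k)"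
      unfolding G_def exit_max_0 by (simp add: max_absorb1 sum_nonneg)
    also have "\<dots> = ennreal (\<Sum>i\<le>k. r / (1 - r))"
      by (rule nn_integral_boundary_sum) (use r in auto)
    finally show ?thesis unfolding u by simp
  qed
  ultimately show ?thesis
    using q unfolding G_def bern_env_def[symmetric] bits_eq[symmetric]
    by (simp add: ennreal_of_nat_eq_real_of_nat ennreal_mult[symmetric] ennreal_plus[symmetric] del: ennreal_plus)
qed

text \<open>The tangent to the logarithm at \<open>c\<close>. Being linear in \<open>y\<close> it
  can be integrated directly and takes the place of Jensen's inequality.\<close>

lemma ln_le_scaled: "0 < y \<Longrightarrow> 0 < c \<Longrightarrow> ln y \<le> y / c - 1 + ln (c::real)"
  using ln_le_minus_one[of "y / c"] by (simp add: ln_div)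

text \<open>Row \<open>j\<close> influences only the passage term if \<open>j < m\<close> and only
  the column sum otherwise, so bounded differences apply with constant 1. Both kinds of exit are
  covered: \<open>m = n\<close> leaves the passage alone, smaller \<open>m\<close> adds the column
  \<open>l\<close>.\<close>

lemma passage_bits_mgf:
  assumes p: "\<And>i. 0 \<le> p i \<and> p i \<le> 1" and \<theta>: "\<theta> > 0" and "m \<le> n"
  shows "(\<integral>\<^sup>+\<omega>. ennreal (exp (\<theta> * (passage (bits \<omega>) m k + (\<Sum>j\<in>{m..<n}. bits \<omega> j l) - (ref_passage p m k + real (n - m) * p l)))) \<partial>bern_env p)
    \<le> ennreal (exp (\<theta>\<^sup>2 * real n / 2))"
proof -
  define f where "f \<omega> = passage (bits \<omega>) m k + (\<Sum>j\<in>{m..<n}. bits \<omega> j l)" for \<omega>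
  have fm: "f \<in> borel_measurable (bern_env p)"
    unfolding f_def by measurable
  have sum_le: "(\<Sum>j\<in>{m..<n}. bits \<omega> j l) \<le> real n" for \<omega>
  proof -
    have "(\<Sum>j\<in>{m..<n}. bits \<omega> j l) \<le> (\<Sum>j\<in>{m..<n}. 1)" by (intro sum_mono bits_bounds)
    then show ?thesis by simp
  qed
  have "0 \<le> f \<omega>" "f \<omega> \<le> 2 * real n" for \<omega>
    unfolding f_def using passage_bits_bounds[of \<omega> m k] sum_le[of \<omega>] assms(3)
    by (auto intro!: add_nonneg_nonneg sum_nonneg bits_bounds)
  then have fb: "\<bar>f \<omega>\<bar> \<le> 2 * real n" for \<omega> by (simp add: abs_le_iff)
  have Ef: "(\<integral>\<omega>. f \<omega> \<partial>bern_env p) = ref_passage p m k + real (n - m) * p l"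
    unfolding f_def ref_passage_def
    by (subst Bochner_Integration.integral_add)
       (auto intro!: passage_bits_integrable bits_integrable simp: Bochner_Integration.integral_sum bits_integrable integral_bits p)
  have diff: "\<bar>f \<omega> - f \<omega>'\<bar> \<le> 1" if eq: "\<And>i. i \<noteq> j \<Longrightarrow> \<omega> i = \<omega>' i" for \<omega> \<omega>' j
  proof (cases "j < m")
    case True
    have "(\<Sum>i\<in>{m..<n}. bits \<omega> i l) = (\<Sum>i\<in>{m..<n}. bits \<omega>' i l)"
      using True eq by (intro sum.cong refl) (auto simp: bits_def)
    moreover have "\<bar>passage (bits \<omega>) m k - passage (bits \<omega>') m k\<bar> \<le> 1"
      by (rule prof_bounded_difference[where ?j0.0 = j]) (use eq in \<open>auto simp: bits_def of_bool_def\<close>)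
    ultimately show ?thesis unfolding f_def by simp
  next
    case False
    have "passage (bits \<omega>) m k = passage (bits \<omega>') m k"
      by (rule prof_cong) (use False eq in \<open>auto simp: bits_def\<close>)
    moreover have "\<bar>(\<Sum>i\<in>{m..<n}. bits \<omega> i l - bits \<omega>' i l)\<bar> \<le> 1"
    proof -
      have "\<bar>(\<Sum>i\<in>{m..<n}. bits \<omega> i l - bits \<omega>' i l)\<bar> \<le> (\<Sum>i\<in>{m..<n}. \<bar>bits \<omega> i l - bits \<omega>' i l\<bar>)"
        by (rule sum_abs)
      also have "\<dots> \<le> (\<Sum>i\<in>{m..<n}. if i = j then 1 else 0)"
        using eq by (intro sum_mono) (auto simp: bits_def of_bool_def)
      also have "\<dots> \<le> 1" by (simp add: sum.delta)
      finally show ?thesis .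
    qed
    ultimately show ?thesis unfolding f_def by (simp add: sum_subtractf)
  qed
  have dep: "f \<omega> = f \<omega>'" if "\<And>j. j < n \<Longrightarrow> \<omega> j = \<omega>' j" for \<omega> \<omega>'
    unfolding f_def using that assms(3)
    by (intro arg_cong2[where f = "(+)"] prof_cong sum.cong) (auto simp: bits_def)
  have "(\<integral>\<^sup>+\<omega>. ennreal (exp (\<theta> * (f \<omega> - (\<integral>\<omega>. f \<omega> \<partial>bern_env p)))) \<partial>bern_env p) \<le> ennreal (exp (\<theta>\<^sup>2 * real n / 2))"
    unfolding bern_env_def
    by (rule mgf_bounded_differences[OF prob_space_bern_rows fm[unfolded bern_env_def] fb dep diff \<theta>])
  then show ?thesis unfolding Ef unfolding f_def .
qed

text \<open>The stationary value is a maximum over \<open>k + n + 2\<close> exits. The mean of such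
  a maximum exceeds the largest of the means by at most (ln N + B) / \<theta>, where N is the number
  of exits and B bounds each logarithmic moment generating function. As the stationary mean is
  known, some exit must have mean at least \<open>L\<close>.\<close>

lemma stationary_exit:
  fixes q \<theta> u :: real and k n :: nat
  assumes q: "1 / 2 < q" "q < 1" and u: "u = (1 - q) / (2 * q - 1)"
    and \<theta>: "0 < \<theta>" "\<theta> \<le> 1" "4 * u * \<theta> \<le> 1"
  defines "L \<equiv> real (Suc k) * u + real n * q
    - (ln (real (k + n + 2)) + \<theta>\<^sup>2 * (real n / 2 + real (Suc k) * (u + 8 * u\<^sup>2))) / \<theta>"
  shows "(\<exists>s\<le>k. L \<le> ref_passage half n s + real (Suc k - s) * u) \<or>
         (\<exists>m\<le>n. L \<le> ref_passage half m k + real (n - m) * q)"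
proof -
  define p where "p = (\<lambda>i. if i \<le> k then 1 / 2 else q)"
  define r where "r = (1 - q) / q"
  have p: "0 \<le> p i \<and> p i \<le> 1" for i using q by (auto simp: p_def)
  have r: "0 \<le> r" "r < 1" using q by (auto simp: r_def field_simps)
  have ur: "u = r / (1 - r)" using q by (simp add: u r_def field_simps)
  have u0: "0 \<le> u" using q by (simp add: u)
  have ref: "ref_passage p m s = ref_passage half m s" if "s \<le> k" for m s
    by (rule ref_passage_cong) (use that p in \<open>auto simp: p_def\<close>)
  define Z1 where "Z1 U \<omega> s = passage (bits \<omega>) n s + (\<Sum>i\<in>{s..k}. real (U i))" for U :: "nat \<Rightarrow> nat" and \<omega> s
  define E1 where "E1 s = ref_passage half n s + real (Suc k - s) * u" for s
  define Z2 where "Z2 \<omega> m = passage (bits \<omega>) m k + (\<Sum>j\<in>{m..<n}. bits \<omega> j (Suc k))" for \<omega> m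
  define E2 where "E2 m = ref_passage half m k + real (n - m) * q" for m
  define M where "M = Max (E1 ` {..k} \<union> E2 ` {..n})"
  have ME1: "E1 s \<le> M" if "s \<le> k" for s unfolding M_def using that by (intro Max_ge) auto
  have ME2: "E2 m \<le> M" if "m \<le> n" for m unfolding M_def using that by (intro Max_ge) auto
  have "M \<in> E1 ` {..k} \<union> E2 ` {..n}" unfolding M_def by (rule Max_in) auto
  then have M_ex: "(\<exists>s\<le>k. M = E1 s) \<or> (\<exists>m\<le>n. M = E2 m)" by auto
  have "0 \<le> E1 0" unfolding E1_def using u0 ref_passage_bounds(1) by (intro add_nonneg_nonneg) auto
  then have M0: "0 \<le> M" using ME1[of 0] by simp
  define H where "H U \<omega> = max (exit_max k U (passage (bits \<omega>) n)) (passage (bits \<omega>) n (Suc k))" for U \<omega>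
  define Y where "Y U \<omega> = (\<Sum>s\<le>k. exp (\<theta> * (Z1 U \<omega> s - E1 s))) + (\<Sum>m\<le>n. exp (\<theta> * (Z2 \<omega> m - E2 m)))" for U \<omega>
  define B where "B = \<theta>\<^sup>2 * (real n / 2 + real (Suc k) * (u + 8 * u\<^sup>2))"
  \<comment> \<open>An upper bound for the mean of \<open>Y\<close>: one \<open>exp B\<close> for
    each of the exits.\<close>
  define c where "c = real (k + n + 2) * exp B"
  have B0: "0 \<le> B" unfolding B_def using u0 by (intro mult_nonneg_nonneg add_nonneg_nonneg) auto
  have c0: "0 < c" unfolding c_def by simp
  have lnc: "ln c = ln (real (k + n + 2)) + B" unfolding c_def by (simp add: ln_mult)
  have lnc0: "0 \<le> ln c" unfolding lnc using B0 by simp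
  let ?A = "M + ln c / \<theta>"
  have A0: "0 \<le> ?A" using M0 lnc0 \<theta> by simp
  have H0: "0 \<le> H U \<omega>" for U \<omega>
    unfolding H_def using passage_bits_bounds(1)[of \<omega> n "Suc k"] by (simp add: le_max_iff_disj)
  \<comment> \<open>The exponential of the winning exit is one summand of \<open>Y\<close>; its
    logarithm is linearised at \<open>c\<close>. Since the mean of \<open>Y\<close> is at most
    \<open>c\<close>, the term with \<open>Y\<close> averages to at most 1 / \<theta> and cancels
    the summand on the left.\<close>
  have pt: "H U \<omega> + 1 / \<theta> \<le> ?A + Y U \<omega> / (c * \<theta>)" for U \<omega>
  proof -
    obtain z e where ze: "H U \<omega> = z" "e \<le> M" "exp (\<theta> * (z - e)) \<le> Y U \<omega>"
    proof -
      consider "H U \<omega> = exit_max k U (passage (bits \<omega>) n)" | "H U \<omega> = passage (bits \<omega>) n (Suc k)"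
        unfolding H_def by linarith
      then show thesis
      proof cases
        case 1
        obtain s where s: "s \<le> k" "exit_max k U (passage (bits \<omega>) n) = Z1 U \<omega> s"
          using exit_max_exit[of k U "passage (bits \<omega>) n"] unfolding Z1_def by blast
        have "exp (\<theta> * (Z1 U \<omega> s - E1 s)) \<le> (\<Sum>s\<le>k. exp (\<theta> * (Z1 U \<omega> s - E1 s)))"
          using s by (intro member_le_sum) auto
        also have "\<dots> \<le> Y U \<omega>" unfolding Y_def by (simp add: sum_nonneg)
        finally show thesis using 1 s ME1[of s] by (intro that[of "Z1 U \<omega> s" "E1 s"]) auto
      next
        case 2
        obtain m where m: "m \<le> n" "passage (bits \<omega>) n (Suc k) = Z2 \<omega> m"
          using prof_exit_right[of n "bits \<omega>" k] unfolding Z2_def by blast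
        have "exp (\<theta> * (Z2 \<omega> m - E2 m)) \<le> (\<Sum>m\<le>n. exp (\<theta> * (Z2 \<omega> m - E2 m)))"
          using m by (intro member_le_sum) auto
        also have "\<dots> \<le> Y U \<omega>" unfolding Y_def by (simp add: sum_nonneg)
        finally show thesis using 2 m ME2[of m] by (intro that[of "Z2 \<omega> m" "E2 m"]) auto
      qed
    qed
    have Y0: "0 < Y U \<omega>" using ze(3) exp_gt_zero less_le_trans by blast
    have "\<theta> * (z - e) \<le> ln (Y U \<omega>)" using ze(3) Y0 by (simp add: ln_ge_iff)
    also have "\<dots> \<le> Y U \<omega> / c - 1 + ln c" by (rule ln_le_scaled[OF Y0 c0])
    finally have "z - e \<le> (Y U \<omega> / c - 1 + ln c) / \<theta>" using \<theta>(1) by (simp add: field_simps)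
    also have "\<dots> = Y U \<omega> / (c * \<theta>) - 1 / \<theta> + ln c / \<theta>" by (simp add: add_divide_distrib diff_divide_distrib)
    finally show ?thesis using ze(1,2) by linarith
  qed
  interpret S: prob_space "bern_env p" by (rule prob_space_bern_env)
  let ?P = "boundary_pmf (\<lambda>_. r) k"
  have EB: "ennreal (exp (real (Suc k) * (u + 8 * u\<^sup>2) * \<theta>\<^sup>2)) * ennreal (exp (\<theta>\<^sup>2 * real n / 2)) = ennreal (exp B)"
    by (simp add: ennreal_mult[symmetric] exp_add[symmetric] B_def algebra_simps)
  have T1: "(\<integral>\<^sup>+\<omega>. \<integral>\<^sup>+U. ennreal (exp (\<theta> * (Z1 U \<omega> s - E1 s))) \<partial>?P \<partial>bern_env p) \<le> ennreal (exp B)" if s: "s \<le> k" for s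
  proof -
    \<comment> \<open>The empty sum over \<open>{n..<n}\<close> presents this exit as the case
      \<open>m = n\<close> of \<open>passage_bits_mgf\<close>.\<close>
    have "(\<integral>\<^sup>+\<omega>. \<integral>\<^sup>+U. ennreal (exp (\<theta> * (Z1 U \<omega> s - E1 s))) \<partial>?P \<partial>bern_env p)
      = (\<integral>\<^sup>+\<omega>. \<integral>\<^sup>+U. ennreal (exp (\<theta> * ((\<Sum>i\<in>{s..k}. real (U i)) - real (card {s..k}) * u))) *
          ennreal (exp (\<theta> * (passage (bits \<omega>) n s + (\<Sum>j\<in>{n..<n}. bits \<omega> j 0) - (ref_passage p n s + real (n - n) * p 0)))) \<partial>?P \<partial>bern_env p)"
      unfolding ref[OF s] Z1_def E1_def by (simp add: ennreal_mult[symmetric] exp_add[symmetric] algebra_simps)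
    also have "\<dots> = (\<integral>\<^sup>+U. ennreal (exp (\<theta> * ((\<Sum>i\<in>{s..k}. real (U i)) - real (card {s..k}) * u))) \<partial>?P) *
        (\<integral>\<^sup>+\<omega>. ennreal (exp (\<theta> * (passage (bits \<omega>) n s + (\<Sum>j\<in>{n..<n}. bits \<omega> j 0) - (ref_passage p n s + real (n - n) * p 0)))) \<partial>bern_env p)"
      by (subst nn_integral_multc, simp, subst nn_integral_cmult) auto
    also have "\<dots> \<le> ennreal (exp (real (Suc k) * (u + 8 * u\<^sup>2) * \<theta>\<^sup>2)) * ennreal (exp (\<theta>\<^sup>2 * real n / 2))"
      by (intro mult_mono boundary_mgf passage_bits_mgf) (use r \<theta> ur p in auto)
    finally show ?thesis unfolding EB .
  qed
  have T2: "(\<integral>\<^sup>+\<omega>. \<integral>\<^sup>+U. ennreal (exp (\<theta> * (Z2 \<omega> m - E2 m))) \<partial>?P \<partial>bern_env p) \<le> ennreal (exp B)" if m: "m \<le> n" for m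
  proof -
    have "p (Suc k) = q" by (simp add: p_def)
    then have "(\<integral>\<^sup>+\<omega>. \<integral>\<^sup>+U. ennreal (exp (\<theta> * (Z2 \<omega> m - E2 m))) \<partial>?P \<partial>bern_env p)
      = (\<integral>\<^sup>+\<omega>. ennreal (exp (\<theta> * (passage (bits \<omega>) m k + (\<Sum>j\<in>{m..<n}. bits \<omega> j (Suc k)) - (ref_passage p m k + real (n - m) * p (Suc k))))) \<partial>bern_env p)"
      unfolding Z2_def E2_def ref[OF order_refl] by (simp add: measure_pmf.emeasure_space_1)
    also have "\<dots> \<le> ennreal (exp (\<theta>\<^sup>2 * real n / 2))"
      by (intro passage_bits_mgf p \<theta> m)
    also have "\<dots> \<le> ennreal (exp B)"
      unfolding B_def using u0 by (intro ennreal_leI) (simp add: algebra_simps)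
    finally show ?thesis .
  qed
  have meas1: "(\<lambda>\<omega>. ennreal (exp (\<theta> * (Z1 U \<omega> s - E1 s)))) \<in> borel_measurable (bern_env p)" for U s
    unfolding Z1_def by measurable
  have meas2: "(\<lambda>\<omega>. ennreal (exp (\<theta> * (Z2 \<omega> m - E2 m)))) \<in> borel_measurable (bern_env p)" for m
    unfolding Z2_def by measurable
  have EY: "(\<integral>\<^sup>+\<omega>. \<integral>\<^sup>+U. ennreal (Y U \<omega>) \<partial>?P \<partial>bern_env p) \<le> ennreal c"
  proof -
    have "(\<integral>\<^sup>+\<omega>. \<integral>\<^sup>+U. ennreal (Y U \<omega>) \<partial>?P \<partial>bern_env p)
      = (\<integral>\<^sup>+\<omega>. \<integral>\<^sup>+U. (\<Sum>s\<le>k. ennreal (exp (\<theta> * (Z1 U \<omega> s - E1 s)))) + (\<Sum>m\<le>n. ennreal (exp (\<theta> * (Z2 \<omega> m - E2 m)))) \<partial>?P \<partial>bern_env p)"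
      unfolding Y_def by (simp add: sum_nonneg)
    also have "\<dots> = (\<integral>\<^sup>+\<omega>. (\<Sum>s\<le>k. \<integral>\<^sup>+U. ennreal (exp (\<theta> * (Z1 U \<omega> s - E1 s))) \<partial>?P) + (\<Sum>m\<le>n. \<integral>\<^sup>+U. ennreal (exp (\<theta> * (Z2 \<omega> m - E2 m))) \<partial>?P) \<partial>bern_env p)"
      by (simp add: nn_integral_add nn_integral_sum del: nn_integral_const sum_ennreal)
    also have "\<dots> = (\<Sum>s\<le>k. \<integral>\<^sup>+\<omega>. \<integral>\<^sup>+U. ennreal (exp (\<theta> * (Z1 U \<omega> s - E1 s))) \<partial>?P \<partial>bern_env p)
        + (\<Sum>m\<le>n. \<integral>\<^sup>+\<omega>. \<integral>\<^sup>+U. ennreal (exp (\<theta> * (Z2 \<omega> m - E2 m))) \<partial>?P \<partial>bern_env p)"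
      using meas1 meas2 by (subst nn_integral_add; (subst nn_integral_sum)?; (subst nn_integral_sum)?)
        (auto intro!: measurable_nn_integral_pmf borel_measurable_sum simp del: nn_integral_const)
    also have "\<dots> \<le> (\<Sum>s\<le>k. ennreal (exp B)) + (\<Sum>m\<le>n. ennreal (exp B))"
      by (intro add_mono sum_mono T1 T2) auto
    also have "\<dots> = ennreal c"
    proof -
      have "(\<Sum>s\<le>k. ennreal (exp B)) = ennreal (real (Suc k) * exp B)"
        by (subst sum_ennreal) auto
      moreover have "(\<Sum>m\<le>n. ennreal (exp B)) = ennreal (real (Suc n) * exp B)"
        by (subst sum_ennreal) auto
      moreover have "real (Suc k) * exp B + real (Suc n) * exp B = c"
        by (simp add: c_def algebra_simps)
      ultimately show ?thesis by (simp add: ennreal_plus[symmetric] del: ennreal_plus of_nat_Suc)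
    qed
    finally show ?thesis .
  qed
  have "ennreal (real (Suc k) * u + real n * q) + ennreal (1 / \<theta>)
      \<le> (\<integral>\<^sup>+\<omega>. \<integral>\<^sup>+U. ennreal (H U \<omega>) \<partial>?P \<partial>bern_env p) + ennreal (1 / \<theta>)"
    using stationary_ge[OF q, of k n] unfolding H_def p_def r_def u by (intro add_right_mono)
  also have "\<dots> = (\<integral>\<^sup>+\<omega>. \<integral>\<^sup>+U. ennreal (H U \<omega> + 1 / \<theta>) \<partial>?P \<partial>bern_env p)"
  proof -
    have "(\<lambda>\<omega>. \<integral>\<^sup>+U. ennreal (H U \<omega>) \<partial>?P) \<in> borel_measurable (bern_env p)"
      unfolding H_def by measurable
    then show ?thesis using H0 \<theta>
      by (simp add: ennreal_plus nn_integral_add S.emeasure_space_1 measure_pmf.emeasure_space_1)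
  qed
  also have "\<dots> \<le> (\<integral>\<^sup>+\<omega>. \<integral>\<^sup>+U. ennreal ?A + ennreal (1 / (c * \<theta>)) * ennreal (Y U \<omega>) \<partial>?P \<partial>bern_env p)"
  proof (intro nn_integral_mono)
    fix \<omega> U
    have Y0: "0 \<le> Y U \<omega>" unfolding Y_def by (intro add_nonneg_nonneg sum_nonneg) auto
    have "ennreal ?A + ennreal (1 / (c * \<theta>)) * ennreal (Y U \<omega>) = ennreal (?A + Y U \<omega> / (c * \<theta>))"
      using A0 Y0 c0 \<theta> by (simp add: ennreal_mult[symmetric] ennreal_plus[symmetric] del: ennreal_plus)
    then show "ennreal (H U \<omega> + 1 / \<theta>) \<le> ennreal ?A + ennreal (1 / (c * \<theta>)) * ennreal (Y U \<omega>)"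
      using pt[of U \<omega>] by (simp add: ennreal_leI)
  qed
  also have "\<dots> = ennreal ?A + ennreal (1 / (c * \<theta>)) * (\<integral>\<^sup>+\<omega>. \<integral>\<^sup>+U. ennreal (Y U \<omega>) \<partial>?P \<partial>bern_env p)"
  proof -
    have "(\<lambda>\<omega>. \<integral>\<^sup>+U. ennreal (Y U \<omega>) \<partial>?P) \<in> borel_measurable (bern_env p)"
      unfolding Y_def Z1_def Z2_def by measurable
    then show ?thesis
      by (simp add: nn_integral_add nn_integral_cmult S.emeasure_space_1 measure_pmf.emeasure_space_1)
  qed
  also have "\<dots> \<le> ennreal ?A + ennreal (1 / (c * \<theta>)) * ennreal c"
    by (intro add_left_mono mult_left_mono EY) auto
  also have "\<dots> = ennreal (?A + 1 / \<theta>)"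
    using A0 c0 \<theta> by (simp add: ennreal_mult[symmetric] ennreal_plus[symmetric] del: ennreal_plus)
  finally have "ennreal (real (Suc k) * u + real n * q + 1 / \<theta>) \<le> ennreal (?A + 1 / \<theta>)"
    using q u0 \<theta> by (subst ennreal_plus) (auto intro!: add_nonneg_nonneg mult_nonneg_nonneg)
  then have "real (Suc k) * u + real n * q + 1 / \<theta> \<le> ?A + 1 / \<theta>"
    using A0 \<theta> by (subst (asm) ennreal_le_iff) auto
  then have "L \<le> M"
    unfolding L_def lnc B_def by simp
  then show ?thesis using M_ex unfolding E1_def E2_def by auto
qed

text \<open>The boundary grows along the tangent of a sqrt x at x = b^2, and the concave curve lies
  below this tangent by a (b - c)^2 / (2 b). An exit at c^2 that loses at most \<open>R\<close>
  therefore has a (b - c) \<le> sqrt (2 R a b), and its boundary part is at most a (b - c).\<close>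

lemma exit_drop:
  fixes a b c R :: real
  assumes "0 < a" "0 < b" "0 \<le> c" "c \<le> b" and drop: "a * b - R \<le> a * c + (b\<^sup>2 - c\<^sup>2) * (a / (2 * b))"
  shows "(b\<^sup>2 - c\<^sup>2) * (a / (2 * b)) \<le> sqrt (2 * R * (a * b))"
proof -
  have "(a / (2 * b)) * (b - c)\<^sup>2 = a * b - a * c - (b\<^sup>2 - c\<^sup>2) * (a / (2 * b))"
    using assms by (simp add: field_simps power2_eq_square)
  then have "(a / (2 * b)) * (b - c)\<^sup>2 \<le> R" using drop by linarith
  then have "(2 * a * b) * ((a / (2 * b)) * (b - c)\<^sup>2) \<le> (2 * a * b) * R"
    using assms by (intro mult_left_mono) auto
  moreover have "(2 * a * b) * ((a / (2 * b)) * (b - c)\<^sup>2) = (a * (b - c))\<^sup>2"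
    using assms by (simp add: power2_eq_square)
  ultimately have "a * (b - c) \<le> sqrt (2 * R * (a * b))"
    by (intro real_le_rsqrt) (simp add: mult_ac)
  moreover have "(b\<^sup>2 - c\<^sup>2) * (a / (2 * b)) \<le> a * (b - c)"
  proof -
    have "(b\<^sup>2 - c\<^sup>2) * (a / (2 * b)) = (a * (b - c)) * ((b + c) / (2 * b))"
      by (simp add: power2_eq_square algebra_simps)
    also have "\<dots> \<le> (a * (b - c)) * 1"
      using assms by (intro mult_left_mono) auto
    finally show ?thesis by simp
  qed
  ultimately show ?thesis by linarith
qed

text \<open>Some exit is nearly optimal in expectation. The upper bound
  \<open>ref_passage_le\<close> at this exit and \<open>exit_drop\<close> show that its boundary
  part is small, so almost all of its value comes from the fair model. Monotonicity in the column,
  or \<open>ref_passage_split\<close> in the rows, carries this back to the corner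
  \<open>(k, n)\<close>.\<close>

lemma ref_passage_ge:
  fixes n k :: nat
  assumes k: "3 \<le> k" "Suc k < n"
  defines "A \<equiv> sqrt (real n * real (Suc k))"
  defines "R \<equiv> real (Suc k) / 2 + sqrt (real n) * (ln (real (k + n + 2)) + 3) + A / (2 * real (Suc k))"
  shows "real n / 2 + A - R - sqrt (2 * R * A) \<le> ref_passage half n k"
proof -
  define a b where "a = sqrt (real n)" and "b = sqrt (real (Suc k))"
  have ab: "0 < a" "0 < b" "real n = a\<^sup>2" "real (Suc k) = b\<^sup>2" using k by (auto simp: a_def b_def)
  have A: "A = a * b" by (simp only: A_def a_def b_def real_sqrt_mult)
  have "b < a" using k by (simp add: a_def b_def)
  \<comment> \<open>The requirement \<open>3 \<le> k\<close> enters here; it gives 4 u \<theta>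
    \<le> 2 / b \<le> 1 further down.\<close>
  have b2: "2 \<le> b" unfolding b_def using k by (intro real_le_rsqrt) auto
  \<comment> \<open>The optimal parameter of \<open>ref_passage_le\<close>; with it the stationary
    model has the corner as its characteristic exit.\<close>
  define \<epsilon> where "\<epsilon> = b / (2 * a)"
  define q where "q = 1 / 2 + \<epsilon>"
  define u where "u = (1 - q) / (2 * q - 1)"
  have \<epsilon>: "0 < \<epsilon>" "\<epsilon> < 1 / 2" using ab \<open>b < a\<close> by (auto simp: \<epsilon>_def)
  have q: "1 / 2 < q" "q < 1" using \<epsilon> by (auto simp: q_def)
  have u_eq: "u = a / (2 * b) - 1 / 2"
  proof -
    have "u = (1 / 2 - \<epsilon>) / (2 * \<epsilon>)" by (simp add: u_def q_def)
    also have "\<dots> = 1 / (4 * \<epsilon>) - 1 / 2" using \<epsilon>(1) by (simp add: diff_divide_distrib)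
    also have "1 / (4 * \<epsilon>) = a / (2 * b)" by (simp add: \<epsilon>_def)
    finally show ?thesis .
  qed
  have u_le: "u \<le> a / (2 * b)" by (simp add: u_eq)
  have u0: "0 \<le> u" using q by (simp add: u_def)
  define D where "D = a * (ln (real (k + n + 2)) + 3)"
  \<comment> \<open>Up to the logarithm, 1 / sqrt n balances the entropy term ln N / \<theta> and
    the variance term of order n \<theta>.\<close>
  define \<theta> where "\<theta> = 1 / a"
  have "1 \<le> a" using b2 \<open>b < a\<close> by simp
  have \<theta>: "0 < \<theta>" "\<theta> \<le> 1" using ab \<open>1 \<le> a\<close> by (auto simp: \<theta>_def)
  have "4 * u * \<theta> \<le> 4 * (a / (2 * b)) * \<theta>" using \<theta> by (intro mult_right_mono mult_left_mono u_le) auto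
  also have "\<dots> \<le> 1" using ab b2 by (simp add: \<theta>_def)
  finally have \<theta>u: "4 * u * \<theta> \<le> 1" .
  have Dle: "(ln (real (k + n + 2)) + \<theta>\<^sup>2 * (real n / 2 + real (Suc k) * (u + 8 * u\<^sup>2))) / \<theta> \<le> D"
  proof -
    have "u\<^sup>2 \<le> (a / (2 * b))\<^sup>2" by (intro power_mono u_le u0)
    then have "b\<^sup>2 * (u + 8 * u\<^sup>2) \<le> b\<^sup>2 * (a / (2 * b) + 8 * (a / (2 * b))\<^sup>2)"
      using u_le by (intro mult_left_mono add_mono) auto
    also have "\<dots> = a * b / 2 + 2 * a\<^sup>2" using ab(1,2) by (simp add: field_simps power2_eq_square)
    also have "\<dots> \<le> a * a / 2 + 2 * a\<^sup>2" using ab(1) \<open>b < a\<close> by (intro add_right_mono divide_right_mono mult_left_mono) auto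
    finally have *: "a\<^sup>2 / 2 + b\<^sup>2 * (u + 8 * u\<^sup>2) \<le> 3 * a\<^sup>2" by (simp add: power2_eq_square)
    have "(ln (real (k + n + 2)) + \<theta>\<^sup>2 * (real n / 2 + real (Suc k) * (u + 8 * u\<^sup>2))) / \<theta>
      = a * ln (real (k + n + 2)) + (a\<^sup>2 / 2 + b\<^sup>2 * (u + 8 * u\<^sup>2)) / a"
      unfolding ab(3,4) \<theta>_def using ab(1) by (simp add: field_simps power2_eq_square)
    also have "\<dots> \<le> a * ln (real (k + n + 2)) + (3 * a\<^sup>2) / a"
      using ab(1) * by (intro add_left_mono divide_right_mono) auto
    also have "\<dots> = D" using ab(1) by (simp add: D_def algebra_simps power2_eq_square)
    finally show ?thesis .
  qed
  \<comment> \<open>The three parts of \<open>R\<close>: the loss of the stationary mean from the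
    \<open>- 1 / 2\<close> in \<open>u\<close>, the fluctuation cost \<open>D\<close>, and one
    surplus boundary site in the first kind of exit.\<close>
  have R: "R = b\<^sup>2 / 2 + D + a / (2 * b)"
    unfolding R_def A ab(4) D_def a_def[symmetric] using ab(2) by (simp add: power2_eq_square)
  have st: "real (Suc k) * u + real n * q = a\<^sup>2 / 2 + a * b - b\<^sup>2 / 2"
    unfolding ab(3,4) u_eq q_def \<epsilon>_def using ab(1,2) by (simp add: field_simps power2_eq_square)
  define L where "L = a\<^sup>2 / 2 + a * b - b\<^sup>2 / 2 - D"
  from stationary_exit[OF q u_def \<theta> \<theta>u, of k n]
  have "(\<exists>s\<le>k. L \<le> ref_passage half n s + real (Suc k - s) * u) \<or> (\<exists>m\<le>n. L \<le> ref_passage half m k + real (n - m) * q)"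
    unfolding st L_def using Dle by (smt (verit))
  then show ?thesis
  proof
    assume "\<exists>s\<le>k. L \<le> ref_passage half n s + real (Suc k - s) * u"
    then obtain s where s: "s \<le> k" "L \<le> ref_passage half n s + real (Suc k - s) * u" by blast
    define c where "c = sqrt (real (Suc s))"
    have c: "0 \<le> c" "c \<le> b" "real (Suc s) = c\<^sup>2" using s by (auto simp: c_def b_def)
    \<comment> \<open>An exit in column \<open>s\<close> uses \<open>k + 1 - s\<close> boundary
      sites, while the upper bound involves \<open>Suc s\<close>; the mismatch of one site is the
      last part of \<open>R\<close>.\<close>
    have "real (Suc k - s) = b\<^sup>2 - c\<^sup>2 + 1" using s ab(4) c(3) by (simp add: of_nat_diff)
    then have "real (Suc k - s) * u \<le> (b\<^sup>2 - c\<^sup>2 + 1) * (a / (2 * b))"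
      using u_le c(1,2) by (simp only:) (intro mult_left_mono, auto intro: power_mono)
    then have su: "real (Suc k - s) * u \<le> (b\<^sup>2 - c\<^sup>2) * (a / (2 * b)) + a / (2 * b)"
      by (simp only: distrib_right mult_1)
    have "ref_passage half n s \<le> a\<^sup>2 / 2 + a * c"
    proof -
      have "sqrt (real n * real (Suc s)) = a * c" by (simp only: a_def c_def real_sqrt_mult)
      then show ?thesis using ref_passage_le[of n s] ab(3) by linarith
    qed
    then have "a * b - R \<le> a * c + (b\<^sup>2 - c\<^sup>2) * (a / (2 * b))"
      using s(2) su unfolding L_def R by linarith
    from exit_drop[OF ab(1,2) c(1,2) this]
    have "(b\<^sup>2 - c\<^sup>2) * (a / (2 * b)) \<le> sqrt (2 * R * (a * b))" .
    then show ?thesis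
      using s(2) su ref_passage_mono[OF s(1), of half n] unfolding A ab(3) L_def R by linarith
  next
    assume "\<exists>m\<le>n. L \<le> ref_passage half m k + real (n - m) * q"
    then obtain m where m: "m \<le> n" "L \<le> ref_passage half m k + real (n - m) * q" by blast
    define c where "c = sqrt (real m)"
    have c: "0 \<le> c" "c \<le> a" "real m = c\<^sup>2" using m by (auto simp: c_def a_def)
    have nm: "real (n - m) = a\<^sup>2 - c\<^sup>2" using m ab(3) c(3) by (simp add: of_nat_diff)
    have q_eq: "q = 1 / 2 + b / (2 * a)" by (simp add: q_def \<epsilon>_def)
    have nmq: "real (n - m) * q = (a\<^sup>2 - c\<^sup>2) / 2 + (a\<^sup>2 - c\<^sup>2) * (b / (2 * a))"
      unfolding nm q_eq distrib_left by simp
    have "ref_passage half m k \<le> c\<^sup>2 / 2 + c * b"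
    proof -
      have "sqrt (real m * real (Suc k)) = c * b" by (simp only: b_def c_def real_sqrt_mult)
      then show ?thesis using ref_passage_le[of m k] c(3) by linarith
    qed
    moreover have "0 \<le> a / (2 * b)" using ab by simp
    ultimately have "b * a - R \<le> b * c + (a\<^sup>2 - c\<^sup>2) * (b / (2 * a))"
      using m(2) unfolding nmq L_def R by argo
    from exit_drop[OF ab(2,1) c(1,2) this]
    have "(a\<^sup>2 - c\<^sup>2) * (b / (2 * a)) \<le> sqrt (2 * R * (a * b))" by (simp add: mult.commute)
    then show ?thesis
      using m(2) ref_passage_split[OF m(1), of k] \<open>0 \<le> a / (2 * b)\<close> unfolding A nmq unfolding ab(3) nm L_def R by linarith
  qed
qed

section \<open>Exchanging the distribution of the rows\<close>

text \<open>Along t the logarithm of the sum of \<open>c i * exp (t * x i)\<close> is a cumulant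
  generating function. Expansion at 0 to second order gives mean and variance under the weights
  \<open>c i / s\<close>; the remainder is a third cumulant divided by 6.\<close>

lemma log_sum_exp_taylor:
  fixes c x :: "nat \<Rightarrow> real"
  assumes c: "\<And>i. i \<le> k \<Longrightarrow> 0 \<le> c i" "0 < c k" and x: "\<And>i. i \<le> k \<Longrightarrow> \<bar>x i\<bar> \<le> M"
  defines "s \<equiv> \<Sum>i\<le>k. c i"
  shows "\<bar>ln (\<Sum>i\<le>k. c i * exp (x i)) - (ln s + (\<Sum>i\<le>k. c i / s * x i) +
      ((\<Sum>i\<le>k. c i / s * (x i)\<^sup>2) - (\<Sum>i\<le>k. c i / s * x i)\<^sup>2) / 2)\<bar> \<le> M ^ 3"
proof -
  define S where "S m t = (\<Sum>i\<le>k. c i * x i ^ m * exp (t * x i))" for m t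
  have S0: "0 < S 0 t" for t
  proof -
    have "0 < c k * exp (t * x k)" using c by simp
    also have "\<dots> \<le> S 0 t" unfolding S_def using c by (simp) (rule member_le_sum[of k "{..k}" "\<lambda>i. c i * exp (t * x i)"], auto)
    finally show ?thesis .
  qed
  have M0: "0 \<le> M" using x[of 0] by simp
  have Sm: "\<bar>S m t\<bar> \<le> M ^ m * S 0 t" for m t
  proof -
    have "\<bar>S m t\<bar> \<le> (\<Sum>i\<le>k. \<bar>c i * x i ^ m * exp (t * x i)\<bar>)" unfolding S_def by (rule sum_abs)
    also have "\<dots> \<le> (\<Sum>i\<le>k. M ^ m * (c i * exp (t * x i)))"
    proof (rule sum_mono)
      fix i assume "i \<in> {..k}"
      then have i: "i \<le> k" by simp
      have "\<bar>x i\<bar> ^ m \<le> M ^ m" by (intro power_mono x i) auto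
      then have "c i * exp (t * x i) * \<bar>x i\<bar> ^ m \<le> c i * exp (t * x i) * M ^ m"
        using c(1)[OF i] by (intro mult_left_mono) auto
      then show "\<bar>c i * x i ^ m * exp (t * x i)\<bar> \<le> M ^ m * (c i * exp (t * x i))"
        using c(1)[OF i] by (simp add: abs_mult power_abs mult_ac)
    qed
    also have "\<dots> = M ^ m * S 0 t" by (simp add: S_def sum_distrib_left)
    finally show ?thesis .
  qed
  have dS: "(S m has_real_derivative S (Suc m) t) (at t)" for m t
    unfolding S_def by (auto intro!: derivative_eq_intros sum.cong simp: mult_ac)
  \<comment> \<open>The moment of order \<open>m\<close> of \<open>x\<close> under the weights
    tilted by \<open>exp (t * x i)\<close>; the functions \<open>D\<close> are the cumulants built
    from these moments.\<close>
  define R where "R m t = S m t / S 0 t" for m t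
  have R: "\<bar>R m t\<bar> \<le> M ^ m" for m t
    using Sm[of m t] S0[of t] by (simp add: R_def field_simps)
  have dR: "(R m has_real_derivative R (Suc m) t - R m t * R 1 t) (at t)" for m t
    unfolding R_def using S0[of t]
    by (auto intro!: derivative_eq_intros dS simp: field_simps)
  define D where "D j t = (if j = 0 then ln (S 0 t) else if j = 1 then R 1 t
     else if j = 2 then R 2 t - (R 1 t)\<^sup>2 else R 3 t - 3 * R 1 t * R 2 t + 2 * R 1 t ^ 3)" for j :: nat and t
  have "\<exists>t>0. t < 1 \<and> ln (S 0 1) = (\<Sum>m<3. D m 0 / fact m * 1 ^ m) + D 3 t / fact 3 * 1 ^ 3"
  proof (rule Maclaurin)
    show "D 0 = (\<lambda>t. ln (S 0 t))" by (simp add: D_def fun_eq_iff)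
    have "(D m has_real_derivative D (Suc m) t) (at t)" if m: "m < 3" for m t
    proof -
      consider "m = 0" | "m = 1" | "m = 2" using m by linarith
      then show ?thesis
      proof cases
        case 1
        have "((\<lambda>t. ln (S 0 t)) has_real_derivative R 1 t) (at t)"
          unfolding R_def using S0[of t] by (auto intro!: derivative_eq_intros dS)
        then show ?thesis unfolding 1 by (simp add: D_def[abs_def])
      next
        case 2
        have "(R 1 has_real_derivative R 2 t - (R 1 t)\<^sup>2) (at t)"
          using dR[of 1 t] by (simp add: power2_eq_square numeral_2_eq_2)
        then show ?thesis unfolding 2 by (simp add: D_def[abs_def] numeral_2_eq_2)
      next
        case 3
        have "((\<lambda>t. R 2 t - (R 1 t)\<^sup>2) has_real_derivative (R 3 t - R 2 t * R 1 t) - 2 * R 1 t * (R 2 t - R 1 t * R 1 t)) (at t)"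
          using dR[of 1 t] dR[of 2 t]
          by (auto intro!: derivative_eq_intros simp: numeral_2_eq_2 numeral_3_eq_3)
        moreover have "(R 3 t - R 2 t * R 1 t) - 2 * R 1 t * (R 2 t - R 1 t * R 1 t) = D 3 t"
          by (simp add: D_def algebra_simps power3_eq_cube)
        moreover have "D 2 = (\<lambda>t. R 2 t - (R 1 t)\<^sup>2)" by (simp add: D_def fun_eq_iff)
        moreover have "Suc 2 = 3" by simp
        ultimately show ?thesis unfolding 3 by (simp only:)
      qed
    qed
    then show "\<forall>m t. m < 3 \<and> 0 \<le> t \<and> t \<le> 1 \<longrightarrow> (D m has_real_derivative D (Suc m) t) (at t)" by blast
  qed auto
  then obtain t where t: "ln (S 0 1) = (\<Sum>m<3. D m 0 / fact m) + D 3 t / 6"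
    by (auto simp: fact_numeral)
  \<comment> \<open>The coefficients 1, 3 and 2 add up to 6, which the 3! of the Taylor remainder
    cancels.\<close>
  have "\<bar>D 3 t\<bar> \<le> \<bar>R 3 t\<bar> + 3 * (\<bar>R 1 t\<bar> * \<bar>R 2 t\<bar>) + 2 * \<bar>R 1 t\<bar> ^ 3"
    unfolding D_def by (simp add: abs_mult[symmetric] power_abs[symmetric])
  also have "\<dots> \<le> M ^ 3 + 3 * (M ^ 1 * M ^ 2) + 2 * (M ^ 1) ^ 3"
    using M0 by (intro add_mono mult_left_mono mult_mono power_mono R) auto
  also have "\<dots> = 6 * M ^ 3" by (simp add: power3_eq_cube power2_eq_square)
  finally have "\<bar>D 3 t / 6\<bar> \<le> M ^ 3" by simp
  moreover have "(\<Sum>m<3. D m 0 / fact m) = ln (S 0 0) + R 1 0 + (R 2 0 - (R 1 0)\<^sup>2) / 2"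
    by (simp add: D_def numeral_3_eq_3 fact_2)
  moreover have "S 0 0 = s" "S 0 1 = (\<Sum>i\<le>k. c i * exp (x i))"
    by (simp_all add: S_def s_def)
  moreover have "R m 0 = (\<Sum>i\<le>k. c i / s * x i ^ m)" for m
    unfolding R_def \<open>S 0 0 = s\<close> by (simp add: S_def sum_divide_distrib)
  ultimately show ?thesis using t by simp
qed

text \<open>The expansion is quadratic in the row, so its expectation involves only means and
  pairwise products. Uncorrelated entries suffice, and the result depends on the distribution
  through \<open>v\<close> alone.\<close>

lemma lindeberg_row:
  fixes x :: "'a \<Rightarrow> nat \<Rightarrow> real" and c :: "nat \<Rightarrow> real"
  assumes N: "prob_space N" and xm: "\<And>i. (\<lambda>s. x s i) \<in> borel_measurable N" and xb: "\<And>s i. \<bar>x s i\<bar> \<le> M"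
    and m1: "\<And>i. (\<integral>s. x s i \<partial>N) = 0" and m2: "\<And>i j. (\<integral>s. x s i * x s j \<partial>N) = (if i = j then v else 0)"
    and c: "\<And>i. i \<le> k \<Longrightarrow> 0 \<le> c i" "0 < c k"
  shows "\<bar>(\<integral>s. ln (\<Sum>i\<le>k. c i * exp (x s i)) \<partial>N) -
    (ln (\<Sum>i\<le>k. c i) + (v * (\<Sum>i\<le>k. c i / (\<Sum>i\<le>k. c i)) - v * (\<Sum>i\<le>k. (c i / (\<Sum>i\<le>k. c i))\<^sup>2)) / 2)\<bar> \<le> M ^ 3"
proof -
  interpret N: prob_space N by fact
  define S where "S = (\<Sum>i\<le>k. c i)"
  define w where "w i = c i / S" for i
  define T where "T s = ln S + (\<Sum>i\<le>k. w i * x s i) + ((\<Sum>i\<le>k. w i * (x s i)\<^sup>2) - (\<Sum>i\<le>k. w i * x s i)\<^sup>2) / 2" for s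
  have M0: "0 \<le> M" using xb[of undefined 0] by linarith
  have ix: "integrable N (\<lambda>s. x s i)" for i by (rule integrable_bounded[OF N xm xb])
  have ixx: "integrable N (\<lambda>s. x s i * x s j)" for i j
  proof (rule integrable_bounded[OF N])
    show "\<bar>x s i * x s j\<bar> \<le> M * M" for s unfolding abs_mult by (intro mult_mono xb) (use M0 in auto)
  qed (use xm in measurable)
  have sq: "(\<Sum>i\<le>k. w i * x s i)\<^sup>2 = (\<Sum>i\<le>k. \<Sum>j\<le>k. w i * w j * (x s i * x s j))" for s
    by (simp add: power2_eq_square sum_product mult_ac)
  have T_eq: "T s = ln S + (\<Sum>i\<le>k. w i * x s i) + ((\<Sum>i\<le>k. w i * (x s i * x s i)) - (\<Sum>i\<le>k. \<Sum>j\<le>k. w i * w j * (x s i * x s j))) / 2" for s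
    unfolding T_def sq by (simp add: power2_eq_square)
  have iT: "integrable N T"
    unfolding T_eq[abs_def] by (intro Bochner_Integration.integrable_add Bochner_Integration.integrable_diff integrable_divide_zero
       Bochner_Integration.integrable_sum integrable_mult_right ix ixx N.integrable_const)
  have ET: "(\<integral>s. T s \<partial>N) = ln S + (v * (\<Sum>i\<le>k. w i) - v * (\<Sum>i\<le>k. (w i)\<^sup>2)) / 2"
  proof -
    have "(\<integral>s. T s \<partial>N) = ln S + (\<Sum>i\<le>k. w i * (\<integral>s. x s i \<partial>N)) + ((\<Sum>i\<le>k. w i * (\<integral>s. x s i * x s i \<partial>N))
        - (\<Sum>i\<le>k. \<Sum>j\<le>k. w i * w j * (\<integral>s. x s i * x s j \<partial>N))) / 2"
      unfolding T_eq by (simp add: ix ixx N.prob_space)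
    also have "\<dots> = ln S + (v * (\<Sum>i\<le>k. w i) - v * (\<Sum>i\<le>k. (w i)\<^sup>2)) / 2"
      unfolding m1 m2 by (simp add: if_distrib cong: if_cong) (simp add: sum_distrib_left power2_eq_square mult_ac)
    finally show ?thesis .
  qed
  define f where "f s = ln (\<Sum>i\<le>k. c i * exp (x s i))" for s
  have close: "\<bar>f s - T s\<bar> \<le> M ^ 3" for s
    unfolding f_def T_def w_def S_def by (rule log_sum_exp_taylor) (use c xb in auto)
  have fm: "f \<in> borel_measurable N" unfolding f_def using xm by measurable
  have "integrable N (\<lambda>s. f s - T s)"
    by (rule integrable_bounded[OF N _ close]) (use fm iT in measurable)
  from Bochner_Integration.integrable_add[OF this iT] have iF: "integrable N f" by simp
  have "\<bar>(\<integral>s. f s - T s \<partial>N)\<bar> \<le> (\<integral>s. M ^ 3 \<partial>N)"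
    by (rule order_trans[OF integral_abs_bound integral_mono]) (use iF iT close in auto)
  then have "\<bar>(\<integral>s. f s \<partial>N) - (\<integral>s. T s \<partial>N)\<bar> \<le> M ^ 3"
    using iF iT by (simp add: N.prob_space)
  then show ?thesis unfolding ET unfolding f_def w_def S_def .
qed

section \<open>The partition function as a smoothed maximum\<close>

primrec zstep :: "(nat \<Rightarrow> real) \<Rightarrow> (nat \<Rightarrow> real) \<Rightarrow> nat \<Rightarrow> real" where
  "zstep x z 0 = z 0 * exp (x 0)"
| "zstep x z (Suc i) = zstep x z i + z (Suc i) * exp (x (Suc i))"

text \<open>The recursion of \<open>prof\<close> with maximum and sum replaced by sum and product: a
  polymer partition function, whose logarithm is the free energy.\<close>

primrec zprof :: "(nat \<Rightarrow> nat \<Rightarrow> real) \<Rightarrow> (nat \<Rightarrow> real) \<Rightarrow> nat \<Rightarrow> nat \<Rightarrow> real" where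
  "zprof w z 0 = z"
| "zprof w z (Suc n) = zstep (w n) (zprof w z n)"

lemma zprof_Suc_first: "zprof w z (Suc n) = zprof (\<lambda>j. w (Suc j)) (zstep (w 0) z) n"
  by (induction n) auto

lemma zstep_sum: "zstep x z k = (\<Sum>i\<le>k. z i * exp (x i))"
  by (induction k) auto

lemma measurable_zprof [measurable (raw)]:
  assumes "\<And>j i. (\<lambda>\<omega>. w \<omega> j i) \<in> borel_measurable M" "\<And>i. (\<lambda>\<omega>. z \<omega> i) \<in> borel_measurable M"
  shows "(\<lambda>\<omega>. zprof (w \<omega>) (z \<omega>) n k) \<in> borel_measurable M"
proof (induction n arbitrary: k)
  case (Suc n)
  then show ?case unfolding zprof.simps zstep_sum
    by (intro borel_measurable_sum borel_measurable_times measurable_compose[OF assms(1) borel_measurable_exp]) auto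
qed (use assms in auto)

text \<open>Each path meets the first row once, so the partition function is linear in the
  exponentials of that row, with coefficients that depend on the later rows only. This is the form
  that \<open>lindeberg_row\<close> expects.\<close>

lemma zprof_first_row:
  assumes z: "\<And>i. 0 < z i"
  shows "\<exists>c. (\<forall>i. 0 \<le> c i) \<and> 0 < c k \<and> (\<forall>i>k. c i = 0) \<and> (\<forall>x. zprof w (zstep x z) n k = (\<Sum>i\<le>k. c i * exp (x i)))"
proof (induction n arbitrary: k)
  case 0
  show ?case
    by (rule exI[of _ "\<lambda>i. if i \<le> k then z i else 0"]) (use z in \<open>auto simp: zstep_sum less_imp_le\<close>)
next
  case (Suc n)
  then obtain C where C: "\<And>l i. 0 \<le> C l i" "\<And>l. 0 < C l l" "\<And>l i. i > l \<Longrightarrow> C l i = 0"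
    "\<And>l x. zprof w (zstep x z) n l = (\<Sum>i\<le>l. C l i * exp (x i))"
    by metis
  define c where "c i = (\<Sum>l\<le>k. exp (w n l) * C l i)" for i
  have "zprof w (zstep x z) (Suc n) k = (\<Sum>i\<le>k. c i * exp (x i))" for x
  proof -
    have "zprof w (zstep x z) n l = (\<Sum>i\<le>k. C l i * exp (x i))" if "l \<le> k" for l
      unfolding C(4) using that C(3) by (intro sum.mono_neutral_left) auto
    then have "zprof w (zstep x z) (Suc n) k = (\<Sum>l\<le>k. (\<Sum>i\<le>k. C l i * exp (x i)) * exp (w n l))"
      by (simp add: zstep_sum)
    also have "\<dots> = (\<Sum>l\<le>k. \<Sum>i\<le>k. exp (w n l) * C l i * exp (x i))"
      by (simp add: sum_distrib_left sum_distrib_right mult_ac)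
    also have "\<dots> = (\<Sum>i\<le>k. \<Sum>l\<le>k. exp (w n l) * C l i * exp (x i))" by (rule sum.swap)
    finally show ?thesis by (simp add: c_def sum_distrib_right)
  qed
  moreover have "0 \<le> c i" for i unfolding c_def using C(1) by (intro sum_nonneg) auto
  moreover have "0 < c k"
  proof -
    have "0 < exp (w n k) * C k k" using C(2) by simp
    also have "\<dots> \<le> c k" unfolding c_def using C(1) by (intro member_le_sum) auto
    finally show ?thesis .
  qed
  moreover have "c i = 0" if "i > k" for i unfolding c_def using C(3) that by simp
  ultimately show ?case by blast
qed

lemma zprof_bounds:
  assumes z: "\<And>i. i \<le> k \<Longrightarrow> 0 < z i" and M: "0 \<le> M"
  shows "\<exists>a b. 0 < a \<and> (\<forall>w. (\<forall>j i. \<bar>w j i\<bar> \<le> M) \<longrightarrow> (\<forall>i\<le>k. a \<le> zprof w z n i \<and> zprof w z n i \<le> b))"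
proof (induction n)
  case 0
  show ?case
    by (rule exI[of _ "Min (z ` {..k})"], rule exI[of _ "Max (z ` {..k})"]) (use z in auto)
next
  case (Suc n)
  then obtain a b where ab: "0 < a" "\<And>w i. (\<And>j i. \<bar>w j i\<bar> \<le> M) \<Longrightarrow> i \<le> k \<Longrightarrow> a \<le> zprof w z n i \<and> zprof w z n i \<le> b"
    by blast
  have "a * exp (- M) \<le> zprof w z (Suc n) i \<and> zprof w z (Suc n) i \<le> real (Suc k) * (b * exp M)"
    if w: "\<And>j i. \<bar>w j i\<bar> \<le> M" and i: "i \<le> k" for w i
  proof -
    have wb: "- M \<le> w n l" "w n l \<le> M" for l using w[of n l] by (auto simp: abs_le_iff)
    have zl: "0 < zprof w z n l" "a \<le> zprof w z n l" "zprof w z n l \<le> b" if "l \<le> k" for l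
    proof -
      have "a \<le> zprof w z n l \<and> zprof w z n l \<le> b" by (rule ab(2)) (use w that in auto)
      then show "0 < zprof w z n l" "a \<le> zprof w z n l" "zprof w z n l \<le> b" using ab(1) by auto
    qed
    have "a * exp (- M) \<le> zprof w z n i * exp (w n i)"
      using zl[OF i] wb ab(1) by (intro mult_mono) auto
    also have "\<dots> \<le> (\<Sum>l\<le>i. zprof w z n l * exp (w n l))"
      using i zl(1) by (intro member_le_sum) (auto intro!: mult_nonneg_nonneg less_imp_le)
    finally have 1: "a * exp (- M) \<le> zprof w z (Suc n) i" by (simp add: zstep_sum)
    have b0: "0 \<le> b" using zl[OF i] by linarith
    have "(\<Sum>l\<le>i. zprof w z n l * exp (w n l)) \<le> (\<Sum>l\<le>i. b * exp M)"
      using i zl wb b0 by (intro sum_mono mult_mono) auto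
    also have "\<dots> \<le> real (Suc k) * (b * exp M)"
      using i b0 by (simp add: mult_right_mono del: of_nat_Suc)
    finally have 2: "zprof w z (Suc n) i \<le> real (Suc k) * (b * exp M)" by (simp add: zstep_sum)
    show ?thesis using 1 2 by blast
  qed
  then show ?case using ab(1) by (intro exI[of _ "a * exp (- M)"] exI[of _ "real (Suc k) * (b * exp M)"]) auto
qed

text \<open>Serves integrability of the free energy; the size of the constant never enters an
  estimate.\<close>

lemma ln_zprof_bounded:
  assumes z: "\<And>i. 0 < z i" and M: "0 \<le> M"
  shows "\<exists>C. \<forall>w. (\<forall>j i. \<bar>w j i\<bar> \<le> M) \<longrightarrow> \<bar>ln (zprof w z n k)\<bar> \<le> C"
proof -
  obtain a b where ab: "0 < a" "\<And>w. (\<And>j i. \<bar>w j i\<bar> \<le> M) \<Longrightarrow> a \<le> zprof w z n k \<and> zprof w z n k \<le> b"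
    using zprof_bounds[of k z M n] z M by blast
  have "\<bar>ln (zprof w z n k)\<bar> \<le> \<bar>ln a\<bar> + \<bar>ln b\<bar>" if "\<And>j i. \<bar>w j i\<bar> \<le> M" for w
  proof -
    have *: "a \<le> zprof w z n k" "zprof w z n k \<le> b" using ab(2)[of w] that by auto
    have "ln a \<le> ln (zprof w z n k)" "ln (zprof w z n k) \<le> ln b"
      using * ab(1) by (auto intro!: ln_mono)
    then show ?thesis by linarith
  qed
  then show ?thesis by blast
qed

lemma zstep_pos: "(\<And>i. 0 < z i) \<Longrightarrow> 0 < zstep x z i"
  by (induction i) (auto intro: add_pos_pos)

lemma zprof_case_nat: "zprof (\<lambda>j. x (case_nat s \<omega> j)) z (Suc n) = zprof (\<lambda>j. x (\<omega> j)) (zstep (x s) z) n"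
  unfolding zprof_Suc_first by simp

lemma exp_row_step_le: "(\<And>i. exp (t i) \<le> z i) \<Longrightarrow> exp (row_step x t k) \<le> zstep x z k"
proof (induction k)
  case 0
  then show ?case by (simp add: exp_add)
next
  case (Suc k)
  have IH: "exp (row_step x t k) \<le> zstep x z k" using Suc by blast
  have 1: "exp (t (Suc k) + x (Suc k)) \<le> z (Suc k) * exp (x (Suc k))"
    using Suc.prems[of "Suc k"] by (simp add: exp_add)
  have "0 \<le> zstep x z k" using IH exp_gt_zero[of "row_step x t k"] by linarith
  moreover have "0 \<le> z (Suc k) * exp (x (Suc k))" using 1 exp_gt_zero[of "t (Suc k) + x (Suc k)"] by linarith
  ultimately show ?case using IH 1 by (auto simp: max_def)
qed

lemma exp_passage_le_zprof: "exp (passage w n k) \<le> zprof w (\<lambda>_. 1) n k"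
  by (induction n arbitrary: k) (auto intro: exp_row_step_le)

text \<open>The number of summands in the partition function is \<open>n + k choose k\<close>; the bound
  \<open>y\<^sup>-\<^sup>k (1 - y)\<^sup>-\<^sup>n\<close> is the one that the recursion preserves.\<close>

lemma zprof_le_exp_passage:
  assumes y: "0 < y" "y < 1"
  shows "zprof w (\<lambda>_. 1) n k \<le> exp (passage w n k) * ((1 / y) ^ k * (1 / (1 - y)) ^ n)"
proof (induction n arbitrary: k)
  case 0
  show ?case using y by (simp add: one_le_power)
next
  case (Suc n)
  define Y where "Y n k = (1 / y) ^ k * (1 / (1 - y)) ^ n" for n k :: nat
  have Y0: "0 \<le> Y n k" for n k using y by (simp add: Y_def)
  \<comment> \<open>The two factors \<open>y\<close> and \<open>1 - y\<close> add up to 1, and so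
    the two terms of the recursion recombine without loss.\<close>
  have Y: "Y (Suc n) k = y * Y (Suc n) (Suc k)" "Y n k = (1 - y) * Y (Suc n) k" for k
    using y by (simp_all add: Y_def)
  have IH: "zprof w (\<lambda>_. 1) n i \<le> exp (passage w n i) * Y n i" for i using Suc by (simp add: Y_def)
  have "zstep (w n) (zprof w (\<lambda>_. 1) n) k \<le> exp (row_step (w n) (passage w n) k) * Y (Suc n) k"
  proof (induction k)
    case 0
    have "zprof w (\<lambda>_. 1) n 0 * exp (w n 0) \<le> exp (passage w n 0) * Y n 0 * exp (w n 0)"
      by (intro mult_right_mono IH) auto
    also have "\<dots> = exp (passage w n 0 + w n 0) * Y n 0" by (simp add: exp_add)
    also have "\<dots> \<le> exp (passage w n 0 + w n 0) * Y (Suc n) 0"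
      unfolding Y(2) using y Y0 by (intro mult_left_mono) (auto intro: mult_left_le_one_le)
    finally show ?case by simp
  next
    case (Suc k)
    let ?e = "exp (row_step (w n) (passage w n) (Suc k))"
    have "zprof w (\<lambda>_. 1) n (Suc k) * exp (w n (Suc k)) \<le> exp (passage w n (Suc k)) * Y n (Suc k) * exp (w n (Suc k))"
      by (intro mult_right_mono IH) auto
    also have "\<dots> = exp (passage w n (Suc k) + w n (Suc k)) * Y n (Suc k)" by (simp add: exp_add)
    also have "\<dots> \<le> ?e * Y n (Suc k)" using Y0 by (intro mult_right_mono) auto
    finally have 1: "zprof w (\<lambda>_. 1) n (Suc k) * exp (w n (Suc k)) \<le> ?e * ((1 - y) * Y (Suc n) (Suc k))" unfolding Y(2) .
    have "zstep (w n) (zprof w (\<lambda>_. 1) n) k \<le> ?e * Y (Suc n) k"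
      using Suc by (rule order_trans) (intro mult_right_mono Y0, simp)
    then have 2: "zstep (w n) (zprof w (\<lambda>_. 1) n) k \<le> ?e * (y * Y (Suc n) (Suc k))" unfolding Y(1)[of k] .
    have "?e * (y * Y (Suc n) (Suc k)) + ?e * ((1 - y) * Y (Suc n) (Suc k)) = ?e * Y (Suc n) (Suc k)"
      by (simp add: algebra_simps)
    then show ?case using 1 2 unfolding zstep.simps by linarith
  qed
  then show ?case by (simp add: Y_def)
qed

text \<open>A hybrid argument by induction. For a fixed first row the later rows are exchanged by
  the induction hypothesis, which must therefore allow any positive starting values; then the first
  row is exchanged while the others already come from \<open>N'\<close>. Fubini moves the integral
  over the first row inside.\<close>

lemma lindeberg_chain:
  fixes x :: "'a \<Rightarrow> nat \<Rightarrow> real" and x' :: "'b \<Rightarrow> nat \<Rightarrow> real"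
  assumes N: "prob_space N" and xm: "x \<in> N \<rightarrow>\<^sub>M PiM UNIV (\<lambda>_::nat. borel)" and xb: "\<And>s i. \<bar>x s i\<bar> \<le> M"
    and m1: "\<And>i. (\<integral>s. x s i \<partial>N) = 0" and m2: "\<And>i j. (\<integral>s. x s i * x s j \<partial>N) = (if i = j then v else 0)"
    and N': "prob_space N'" and xm': "x' \<in> N' \<rightarrow>\<^sub>M PiM UNIV (\<lambda>_::nat. borel)" and xb': "\<And>s i. \<bar>x' s i\<bar> \<le> M"
    and m1': "\<And>i. (\<integral>s. x' s i \<partial>N') = 0" and m2': "\<And>i j. (\<integral>s. x' s i * x' s j \<partial>N') = (if i = j then v else 0)"
    and z: "\<And>i. 0 < z i"
  shows "\<bar>(\<integral>\<omega>. ln (zprof (\<lambda>j. x (\<omega> j)) z n k) \<partial>PiM UNIV (\<lambda>_::nat. N))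
    - (\<integral>\<omega>. ln (zprof (\<lambda>j. x' (\<omega> j)) z n k) \<partial>PiM UNIV (\<lambda>_::nat. N'))\<bar> \<le> real n * (2 * M ^ 3)"
  using z
proof (induction n arbitrary: z)
  case 0
  interpret S: prob_space "PiM UNIV (\<lambda>_::nat. N)" by (intro prob_space_PiM N)
  interpret S': prob_space "PiM UNIV (\<lambda>_::nat. N')" by (intro prob_space_PiM N')
  show ?case by (simp add: S.prob_space S'.prob_space)
next
  case (Suc n)
  interpret N: prob_space N by fact
  interpret N': prob_space N' by fact
  let ?S = "PiM UNIV (\<lambda>_::nat. N)" and ?S' = "PiM UNIV (\<lambda>_::nat. N')"
  interpret S: prob_space ?S by (intro prob_space_PiM N)
  interpret S': prob_space ?S' by (intro prob_space_PiM N')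
  have M0: "0 \<le> M" using xb[of undefined 0] by linarith
  have xi: "(\<lambda>s. x s i) \<in> borel_measurable N" for i by (rule measurable_compose[OF xm measurable_component_singleton]) auto
  have xi': "(\<lambda>s. x' s i) \<in> borel_measurable N'" for i by (rule measurable_compose[OF xm' measurable_component_singleton]) auto
  note xS = seq_component_measurable[OF xm] and xS' = seq_component_measurable[OF xm']
  obtain C where C: "\<And>w. (\<And>j i. \<bar>w j i\<bar> \<le> M) \<Longrightarrow> \<bar>ln (zprof w z (Suc n) k)\<bar> \<le> C"
    using ln_zprof_bounded[of z M "Suc n" k] Suc.prems M0 by blast
  have C1: "\<bar>ln (zprof w (zstep y z) n k)\<bar> \<le> C" if "\<And>j i. \<bar>w j i\<bar> \<le> M" "\<And>i. \<bar>y i\<bar> \<le> M" for w y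
    using C[of "case_nat y w"] that unfolding zprof_Suc_first by (simp split: nat.split)
  define F where "F y \<omega> = ln (zprof (\<lambda>j. x' (\<omega> j)) (zstep y z) n k)" for y \<omega>
  have FC: "\<bar>F y \<omega>\<bar> \<le> C" if "\<And>i. \<bar>y i\<bar> \<le> M" for y \<omega> unfolding F_def by (rule C1) (use xb' that in auto)
  have Fm: "(\<lambda>(s, \<omega>). F (y s) \<omega>) \<in> borel_measurable (L \<Otimes>\<^sub>M ?S')"
    if y: "\<And>i. (\<lambda>s. y s i) \<in> borel_measurable L" for y :: "'c \<Rightarrow> nat \<Rightarrow> real" and L
  proof -
    have "(\<lambda>z. x' (snd z j) i) \<in> borel_measurable (L \<Otimes>\<^sub>M ?S')" for j i
      by (rule measurable_compose[OF measurable_snd xS'])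
    moreover have "(\<lambda>u. zstep (y (fst u)) z i) \<in> borel_measurable (L \<Otimes>\<^sub>M ?S')" for i
      unfolding zstep_sum
      by (intro borel_measurable_sum borel_measurable_times measurable_compose[OF measurable_compose[OF measurable_fst y] borel_measurable_exp]) auto
    ultimately show ?thesis unfolding F_def split_beta'
      by (intro borel_measurable_ln measurable_zprof) auto
  qed
  have swap: "(\<integral>s. \<integral>\<omega>. F (y s) \<omega> \<partial>?S' \<partial>L) = (\<integral>\<omega>. \<integral>s. F (y s) \<omega> \<partial>L \<partial>?S')"
    and int: "integrable ?S' (\<lambda>\<omega>. \<integral>s. F (y s) \<omega> \<partial>L)" and int2: "integrable L (\<lambda>s. \<integral>\<omega>. F (y s) \<omega> \<partial>?S')"
    if L: "prob_space L" and y: "\<And>i. (\<lambda>s. y s i) \<in> borel_measurable L" "\<And>s i. \<bar>y s i\<bar> \<le> M" for y :: "'c \<Rightarrow> nat \<Rightarrow> real" and L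
  proof -
    interpret L: prob_space L by fact
    interpret LS: pair_prob_space L ?S' ..
    have "integrable (L \<Otimes>\<^sub>M ?S') (\<lambda>(s, \<omega>). F (y s) \<omega>)"
      by (rule integrable_bounded[OF _ Fm[OF y(1)]]) (use FC y(2) LS.prob_space_axioms in auto)
    from LS.Fubini_integral[OF this] LS.integrable_snd[OF this] LS.integrable_fst[OF this]
    show "(\<integral>s. \<integral>\<omega>. F (y s) \<omega> \<partial>?S' \<partial>L) = (\<integral>\<omega>. \<integral>s. F (y s) \<omega> \<partial>L \<partial>?S')"
      "integrable ?S' (\<lambda>\<omega>. \<integral>s. F (y s) \<omega> \<partial>L)" "integrable L (\<lambda>s. \<integral>\<omega>. F (y s) \<omega> \<partial>?S')" by simp_all
  qed
  have pos: "0 < zstep y z i" for y i by (rule zstep_pos) (rule Suc.prems)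
  \<comment> \<open>For fixed later rows the coefficients are the same for both distributions, so
    both expectations are within M^3 of one number \<open>Q\<close>.\<close>
  have inner: "\<bar>(\<integral>s. F (x s) \<omega> \<partial>N) - (\<integral>s. F (x' s) \<omega> \<partial>N')\<bar> \<le> 2 * M ^ 3" for \<omega>
  proof -
    obtain c where c: "\<And>i. 0 \<le> c i" "0 < c k" "\<And>y. zprof (\<lambda>j. x' (\<omega> j)) (zstep y z) n k = (\<Sum>i\<le>k. c i * exp (y i))"
      using zprof_first_row[where z = z and k = k and w = "\<lambda>j. x' (\<omega> j)" and n = n] Suc.prems by blast
    define Q where "Q = ln (\<Sum>i\<le>k. c i) + (v * (\<Sum>i\<le>k. c i / (\<Sum>i\<le>k. c i)) - v * (\<Sum>i\<le>k. (c i / (\<Sum>i\<le>k. c i))\<^sup>2)) / 2"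
    have "\<bar>(\<integral>s. ln (\<Sum>i\<le>k. c i * exp (x s i)) \<partial>N) - Q\<bar> \<le> M ^ 3"
      unfolding Q_def by (rule lindeberg_row[OF N xi xb m1 m2]) (use c(1,2) in auto)
    moreover have "\<bar>(\<integral>s. ln (\<Sum>i\<le>k. c i * exp (x' s i)) \<partial>N') - Q\<bar> \<le> M ^ 3"
      unfolding Q_def by (rule lindeberg_row[OF N' xi' xb' m1' m2']) (use c(1,2) in auto)
    ultimately show ?thesis unfolding F_def c(3) by linarith
  qed
  have "(\<lambda>\<omega>. ln (zprof (\<lambda>j. x (\<omega> j)) z (Suc n) k)) \<in> borel_measurable ?S"
    by (intro borel_measurable_ln measurable_zprof xS) auto
  moreover have "\<bar>ln (zprof (\<lambda>j. x (\<omega> j)) z (Suc n) k)\<bar> \<le> C" for \<omega> by (rule C) (rule xb)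
  ultimately have 1: "(\<integral>\<omega>. ln (zprof (\<lambda>j. x (\<omega> j)) z (Suc n) k) \<partial>?S) = (\<integral>s. \<integral>\<omega>. ln (zprof (\<lambda>j. x (\<omega> j)) (zstep (x s) z) n k) \<partial>?S \<partial>N)"
    unfolding zprof_case_nat[symmetric] by (rule integral_seq[OF N])
  have "(\<lambda>\<omega>. ln (zprof (\<lambda>j. x' (\<omega> j)) z (Suc n) k)) \<in> borel_measurable ?S'"
    by (intro borel_measurable_ln measurable_zprof xS') auto
  moreover have "\<bar>ln (zprof (\<lambda>j. x' (\<omega> j)) z (Suc n) k)\<bar> \<le> C" for \<omega> by (rule C) (rule xb')
  ultimately have 2: "(\<integral>\<omega>. ln (zprof (\<lambda>j. x' (\<omega> j)) z (Suc n) k) \<partial>?S') = (\<integral>s. \<integral>\<omega>. F (x' s) \<omega> \<partial>?S' \<partial>N')"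
    unfolding F_def zprof_case_nat[symmetric] by (rule integral_seq[OF N'])
  \<comment> \<open>\<open>g\<close> draws the later rows from \<open>N\<close> and
    \<open>g'\<close> draws them from \<open>N'\<close>, with the same first row from
    \<open>N\<close>.\<close>
  define g where "g s = (\<integral>\<omega>. ln (zprof (\<lambda>j. x (\<omega> j)) (zstep (x s) z) n k) \<partial>?S)" for s
  define g' where "g' s = (\<integral>\<omega>. F (x s) \<omega> \<partial>?S')" for s
  have gg: "\<bar>g s - g' s\<bar> \<le> real n * (2 * M ^ 3)" for s
    unfolding g_def g'_def F_def by (rule Suc.IH) (rule pos)
  have ig': "integrable N g'" unfolding g'_def by (rule int2[OF N xi xb])
  have gm: "g \<in> borel_measurable N"
  proof -
    have "(\<lambda>u. x (snd u j) i) \<in> borel_measurable (N \<Otimes>\<^sub>M ?S)" for j i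
      by (rule measurable_compose[OF measurable_snd xS])
    moreover have "(\<lambda>u. zstep (x (fst u)) z i) \<in> borel_measurable (N \<Otimes>\<^sub>M ?S)" for i
      unfolding zstep_sum
      by (intro borel_measurable_sum borel_measurable_times measurable_compose[OF measurable_compose[OF measurable_fst xi] borel_measurable_exp]) auto
    ultimately have "(\<lambda>(s, \<omega>). ln (zprof (\<lambda>j. x (\<omega> j)) (zstep (x s) z) n k)) \<in> borel_measurable (N \<Otimes>\<^sub>M ?S)"
      unfolding split_beta' by (intro borel_measurable_ln measurable_zprof) auto
    from S.borel_measurable_lebesgue_integral[OF this] show ?thesis unfolding g_def by simp
  qed
  have id: "integrable N (\<lambda>s. g s - g' s)"
    by (rule integrable_bounded[OF N _ gg]) (use gm ig' in measurable)
  have "\<bar>(\<integral>s. g s - g' s \<partial>N)\<bar> \<le> (\<integral>s. real n * (2 * M ^ 3) \<partial>N)"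
    by (rule order_trans[OF integral_abs_bound integral_mono]) (use id gg in auto)
  moreover have "(\<integral>s. g s - g' s \<partial>N) = (\<integral>s. g s \<partial>N) - (\<integral>s. g' s \<partial>N)"
  proof -
    have "integrable N (\<lambda>s. (g s - g' s) + g' s)" by (rule Bochner_Integration.integrable_add[OF id ig'])
    then have "integrable N g" by simp
    then show ?thesis using ig' by simp
  qed
  ultimately have A: "\<bar>(\<integral>s. g s \<partial>N) - (\<integral>s. g' s \<partial>N)\<bar> \<le> real n * (2 * M ^ 3)" by (simp add: N.prob_space)
  have "\<bar>(\<integral>\<omega>. (\<integral>s. F (x s) \<omega> \<partial>N) - (\<integral>s. F (x' s) \<omega> \<partial>N') \<partial>?S')\<bar> \<le> (\<integral>\<omega>. 2 * M ^ 3 \<partial>?S')"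
    by (rule order_trans[OF integral_abs_bound integral_mono]) (use inner int[OF N xi xb] int[OF N' xi' xb'] in auto)
  then have B: "\<bar>(\<integral>s. g' s \<partial>N) - (\<integral>s. \<integral>\<omega>. F (x' s) \<omega> \<partial>?S' \<partial>N')\<bar> \<le> 2 * M ^ 3"
    unfolding g'_def swap[OF N xi xb] swap[OF N' xi' xb'] using int[OF N xi xb] int[OF N' xi' xb'] by (simp add: S'.prob_space)
  show ?case unfolding 1 2 using A B unfolding g_def[symmetric] by (simp add: algebra_simps)
qed

text \<open>Free energy minus maximum lies between 0 and the logarithm of the number of paths, which
  is bounded by the term with \<open>y\<close>. The exchange of rows is done on the free
  energies.\<close>

lemma lindeberg_passage:
  fixes x :: "'a \<Rightarrow> nat \<Rightarrow> real" and x' :: "'b \<Rightarrow> nat \<Rightarrow> real"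
  assumes N: "prob_space N" and xm: "x \<in> N \<rightarrow>\<^sub>M PiM UNIV (\<lambda>_::nat. borel)" and xb: "\<And>s i. \<bar>x s i\<bar> \<le> M"
    and m1: "\<And>i. (\<integral>s. x s i \<partial>N) = 0" and m2: "\<And>i j. (\<integral>s. x s i * x s j \<partial>N) = (if i = j then v else 0)"
    and N': "prob_space N'" and xm': "x' \<in> N' \<rightarrow>\<^sub>M PiM UNIV (\<lambda>_::nat. borel)" and xb': "\<And>s i. \<bar>x' s i\<bar> \<le> M"
    and m1': "\<And>i. (\<integral>s. x' s i \<partial>N') = 0" and m2': "\<And>i j. (\<integral>s. x' s i * x' s j \<partial>N') = (if i = j then v else 0)"
    and y: "0 < y" "y < 1"
  shows "\<bar>(\<integral>\<omega>. passage (\<lambda>j. x (\<omega> j)) n k \<partial>PiM UNIV (\<lambda>_::nat. N)) - (\<integral>\<omega>. passage (\<lambda>j. x' (\<omega> j)) n k \<partial>PiM UNIV (\<lambda>_::nat. N'))\<bar>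
    \<le> real n * (2 * M ^ 3) + (real k * ln (1 / y) + real n * ln (1 / (1 - y)))"
proof -
  define c where "c = real k * ln (1 / y) + real n * ln (1 / (1 - y))"
  have M0: "0 \<le> M" using xb[of undefined 0] by linarith
  obtain C where C: "\<And>w. (\<And>j i. \<bar>w j i\<bar> \<le> M) \<Longrightarrow> \<bar>ln (zprof w (\<lambda>_. 1) n k)\<bar> \<le> C"
    using ln_zprof_bounded[of "\<lambda>_. 1" M n k] M0 by auto
  have zpos: "0 < zprof w (\<lambda>_. 1) n k" for w
    using exp_passage_le_zprof[of w n k] exp_gt_zero less_le_trans by blast
  have lo: "passage w n k \<le> ln (zprof w (\<lambda>_. 1) n k)" for w
    using exp_passage_le_zprof[of w n k] zpos by (simp add: ln_ge_iff)
  have hi: "ln (zprof w (\<lambda>_. 1) n k) \<le> passage w n k + c" for w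
  proof -
    have "ln (zprof w (\<lambda>_. 1) n k) \<le> ln (exp (passage w n k) * ((1 / y) ^ k * (1 / (1 - y)) ^ n))"
      using zpos zprof_le_exp_passage[OF y, of w n k] by (intro ln_mono) auto
    also have "\<dots> = passage w n k + c"
      using y by (simp add: ln_mult ln_realpow c_def del: power_divide power_one_over)
    finally show ?thesis .
  qed
  have sand: "(\<integral>\<omega>. passage (\<lambda>j. x (\<omega> j)) n k \<partial>PiM UNIV (\<lambda>_::nat. N)) \<le> (\<integral>\<omega>. ln (zprof (\<lambda>j. x (\<omega> j)) (\<lambda>_. 1) n k) \<partial>PiM UNIV (\<lambda>_::nat. N))"
    "(\<integral>\<omega>. ln (zprof (\<lambda>j. x (\<omega> j)) (\<lambda>_. 1) n k) \<partial>PiM UNIV (\<lambda>_::nat. N)) \<le> (\<integral>\<omega>. passage (\<lambda>j. x (\<omega> j)) n k \<partial>PiM UNIV (\<lambda>_::nat. N)) + c"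
    if N: "prob_space N" and xm: "x \<in> N \<rightarrow>\<^sub>M PiM UNIV (\<lambda>_::nat. borel)" and xb: "\<And>s i. \<bar>x s i\<bar> \<le> M"
    for N :: "'c measure" and x :: "'c \<Rightarrow> nat \<Rightarrow> real"
  proof -
    let ?S = "PiM UNIV (\<lambda>_::nat. N)"
    interpret S: prob_space ?S by (intro prob_space_PiM N)
    note xS = seq_component_measurable[OF xm]
    have Pm: "(\<lambda>\<omega>. passage (\<lambda>j. x (\<omega> j)) n k) \<in> borel_measurable ?S"
      by (intro measurable_prof xS) auto
    have Zm: "(\<lambda>\<omega>. ln (zprof (\<lambda>j. x (\<omega> j)) (\<lambda>_. 1) n k)) \<in> borel_measurable ?S"
      by (intro borel_measurable_ln measurable_zprof xS) auto
    have iZ: "integrable ?S (\<lambda>\<omega>. ln (zprof (\<lambda>j. x (\<omega> j)) (\<lambda>_. 1) n k))"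
      by (rule integrable_bounded[OF S.prob_space_axioms Zm C]) (rule xb)
    have iP: "integrable ?S (\<lambda>\<omega>. passage (\<lambda>j. x (\<omega> j)) n k)"
    proof (rule integrable_bounded[OF S.prob_space_axioms Pm])
      fix \<omega>
      have "\<bar>ln (zprof (\<lambda>j. x (\<omega> j)) (\<lambda>_. 1) n k)\<bar> \<le> C" by (rule C) (rule xb)
      with lo[of "\<lambda>j. x (\<omega> j)"] hi[of "\<lambda>j. x (\<omega> j)"]
      show "\<bar>passage (\<lambda>j. x (\<omega> j)) n k\<bar> \<le> C + \<bar>c\<bar>" by linarith
    qed
    show "(\<integral>\<omega>. passage (\<lambda>j. x (\<omega> j)) n k \<partial>?S) \<le> (\<integral>\<omega>. ln (zprof (\<lambda>j. x (\<omega> j)) (\<lambda>_. 1) n k) \<partial>?S)"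
      by (intro integral_mono iP iZ lo)
    have "(\<integral>\<omega>. ln (zprof (\<lambda>j. x (\<omega> j)) (\<lambda>_. 1) n k) \<partial>?S) \<le> (\<integral>\<omega>. passage (\<lambda>j. x (\<omega> j)) n k + c \<partial>?S)"
      by (intro integral_mono iZ hi Bochner_Integration.integrable_add iP) auto
    then show "(\<integral>\<omega>. ln (zprof (\<lambda>j. x (\<omega> j)) (\<lambda>_. 1) n k) \<partial>?S) \<le> (\<integral>\<omega>. passage (\<lambda>j. x (\<omega> j)) n k \<partial>?S) + c"
      using iP by (simp add: S.prob_space)
  qed
  \<comment> \<open>Both smoothing errors have the same sign, so comparing the two models costs
    \<open>c\<close> only once.\<close>
  show ?thesis
    using sand[OF N xm xb] sand[OF N' xm' xb'] unfolding c_def[symmetric]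
    using lindeberg_chain[OF N xm xb m1 m2 N' xm' xb' m1' m2', of "\<lambda>_. 1" n k] by simp
qed

section \<open>The weights as independent rows and as independent columns\<close>

abbreviation row_space :: "(nat \<Rightarrow> real) measure" where
  "row_space \<equiv> PiM UNIV (\<lambda>_. borel)"

lemma space_borelD: "sets D = sets (borel :: 'a::topological_space measure) \<Longrightarrow> space D = UNIV"
  using sets_eq_imp_space_eq[of D borel] by simp

lemma space_env: "F \<in> space env_space \<longleftrightarrow> (\<forall>j. prob_space (F j) \<and> sets (F j) = sets borel)"
  by (auto simp: env_space_def space_PiM PiE_iff space_prob_algebra)

lemma emeasure_PiM_rect:
  fixes M :: "'i \<Rightarrow> 'a measure" and c :: "'k \<Rightarrow> 'i"
  assumes M: "\<And>i. prob_space (M i)" and sp: "\<And>i. space (M i) = UNIV"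
    and L: "finite L" "inj_on c L" and A: "\<And>z. z \<in> L \<Longrightarrow> A z \<in> sets (M (c z))"
  shows "emeasure (PiM UNIV M) {x. \<forall>z\<in>L. x (c z) \<in> A z} = (\<Prod>z\<in>L. emeasure (M (c z)) (A z))"
    and "{x. \<forall>z\<in>L. x (c z) \<in> A z} \<in> sets (PiM UNIV M)"
proof -
  define E where "E i = A (the_inv_into L c i)" for i
  have E: "E (c z) = A z" if "z \<in> L" for z unfolding E_def using the_inv_into_f_f[OF L(2) that] by simp
  have eq: "{x. \<forall>z\<in>L. x (c z) \<in> A z} = prod_emb UNIV M (c ` L) (PiE (c ` L) E)"
    using E by (auto simp: prod_emb_def sp PiE_iff)
  show "{x. \<forall>z\<in>L. x (c z) \<in> A z} \<in> sets (PiM UNIV M)"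
    unfolding eq using L A E by (intro sets_PiM_I) auto
  have "emeasure (PiM UNIV M) {x. \<forall>z\<in>L. x (c z) \<in> A z} = (\<Prod>i\<in>c ` L. emeasure (M i) (E i))"
    unfolding eq using L A E by (intro emeasure_PiM_emb M) auto
  also have "\<dots> = (\<Prod>z\<in>L. emeasure (M (c z)) (A z))"
    using E by (simp add: prod.reindex[OF L(2)])
  finally show "emeasure (PiM UNIV M) {x. \<forall>z\<in>L. x (c z) \<in> A z} = (\<Prod>z\<in>L. emeasure (M (c z)) (A z))" .
qed

lemma space_row_space: "space row_space = UNIV"
  by (auto simp: space_PiM)

lemma weight_space_eqI:
  assumes "sets P = sets weight_space" "sets Q = sets weight_space" "finite_measure P"
    and "\<And>K A. finite K \<Longrightarrow> (\<And>z. z \<in> K \<Longrightarrow> A z \<in> sets borel) \<Longrightarrow>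
      emeasure P {X. \<forall>z\<in>K. X z \<in> A z} = emeasure Q {X. \<forall>z\<in>K. X z \<in> A z}"
  shows "P = Q"
proof (rule measure_eqI_PiM_infinite)
  show "sets P = sets (PiM UNIV (\<lambda>_. borel))" "sets Q = sets (PiM UNIV (\<lambda>_. borel))" "finite_measure P"
    using assms unfolding weight_space_def by auto
  fix A :: "nat \<times> nat \<Rightarrow> real set" and J assume J: "finite J" "\<And>i. i \<in> J \<Longrightarrow> A i \<in> sets borel"
  have "prod_emb UNIV (\<lambda>_. borel) J (PiE J A) = {X. \<forall>z\<in>J. X z \<in> A z}"
    by (auto simp: prod_emb_def PiE_iff)
  then show "emeasure P (prod_emb UNIV (\<lambda>_. borel) J (PiE J A)) = emeasure Q (prod_emb UNIV (\<lambda>_. borel) J (PiE J A))"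
    using assms(4)[OF J] by simp
qed

lemma rect_weight_space:
  assumes "finite K" "\<And>z. z \<in> K \<Longrightarrow> A z \<in> sets borel"
  shows "{X. \<forall>z\<in>K. X z \<in> A z} \<in> sets weight_space"
proof -
  \<comment> \<open>A product of point masses has the right sigma-algebra and also satisfies the
    probability hypothesis of \<open>emeasure_PiM_rect\<close>.\<close>
  have "sets (PiM UNIV (\<lambda>_::nat \<times> nat. return borel (0 :: real))) = sets weight_space"
    unfolding weight_space_def by (rule sets_PiM_cong) auto
  moreover have "{x. \<forall>z\<in>K. x z \<in> A z} \<in> sets (PiM UNIV (\<lambda>_. return borel (0 :: real)))"
    by (rule emeasure_PiM_rect(2)[where c = "\<lambda>z. z"]) (use assms in \<open>auto simp: prob_space_return\<close>)
  ultimately show ?thesis by simp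
qed

lemma rect_row_space:
  assumes "finite K" "inj_on c K" "\<And>z. z \<in> K \<Longrightarrow> A z \<in> sets borel"
  shows "{x. \<forall>z\<in>K. x (c z) \<in> A z} \<in> sets row_space"
proof -
  have "sets (PiM UNIV (\<lambda>_::nat. return borel (0 :: real))) = sets row_space"
    by (rule sets_PiM_cong) auto
  moreover have "{x. \<forall>z\<in>K. x (c z) \<in> A z} \<in> sets (PiM UNIV (\<lambda>_. return borel (0 :: real)))"
    by (rule emeasure_PiM_rect(2)) (use assms in \<open>auto simp: prob_space_return\<close>)
  ultimately show ?thesis by simp
qed

lemma flatten_measurable:
  assumes "sets \<rho> = sets row_space"
  shows "(\<lambda>\<omega> z. \<omega> (r z) (c z)) \<in> PiM UNIV (\<lambda>_::nat. \<rho>) \<rightarrow>\<^sub>M weight_space"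
  unfolding weight_space_def
proof (rule measurable_PiM_single')
  fix z
  have "(\<lambda>x. x (c z)) \<in> \<rho> \<rightarrow>\<^sub>M borel"
    using measurable_component_singleton[of "c z" UNIV "\<lambda>_. borel"] assms by (simp cong: measurable_cong_sets)
  then show "(\<lambda>\<omega>. \<omega> (r z) (c z)) \<in> PiM UNIV (\<lambda>_::nat. \<rho>) \<rightarrow>\<^sub>M borel"
    by (rule measurable_compose[rotated]) (rule measurable_component_singleton, simp)
qed auto

text \<open>The coordinate maps \<open>r\<close> and \<open>c\<close> stay general because the array
  is read both as a sequence of columns, with \<open>r = fst\<close>, and as a sequence of rows,
  with \<open>r = snd\<close>.\<close>

lemma emeasure_rows_rect:
  assumes \<rho>: "prob_space \<rho>" "sets \<rho> = sets row_space"
    and K: "finite K" "\<And>j. inj_on c {z \<in> K. r z = j}" and A: "\<And>z. z \<in> K \<Longrightarrow> A z \<in> sets borel"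
  shows "emeasure (distr (PiM UNIV (\<lambda>_::nat. \<rho>)) weight_space (\<lambda>\<omega> z. \<omega> (r z) (c z))) {X. \<forall>z\<in>K. X z \<in> A z}
    = (\<Prod>j\<in>r ` K. emeasure \<rho> {x. \<forall>z\<in>{z \<in> K. r z = j}. x (c z) \<in> A z})"
proof -
  have sp: "space \<rho> = UNIV" using sets_eq_imp_space_eq[OF \<rho>(2)] space_row_space by simp
  have sps: "space (PiM UNIV (\<lambda>_::nat. \<rho>)) = UNIV" by (auto simp: space_PiM sp)
  have row: "{x. \<forall>z\<in>{z \<in> K. r z = j}. x (c z) \<in> A z} \<in> sets \<rho>" for j
    unfolding \<rho>(2) by (rule rect_row_space) (use K A in auto)
  have "emeasure (distr (PiM UNIV (\<lambda>_::nat. \<rho>)) weight_space (\<lambda>\<omega> z. \<omega> (r z) (c z))) {X. \<forall>z\<in>K. X z \<in> A z}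
     = emeasure (PiM UNIV (\<lambda>_::nat. \<rho>)) {\<omega>. \<forall>j\<in>r ` K. \<omega> j \<in> {x. \<forall>z\<in>{z \<in> K. r z = j}. x (c z) \<in> A z}}"
    by (subst emeasure_distr[OF flatten_measurable[OF \<rho>(2)] rect_weight_space[OF K(1) A]])
       (auto simp: sps intro!: arg_cong2[where f = emeasure])
  also have "\<dots> = (\<Prod>j\<in>r ` K. emeasure \<rho> {x. \<forall>z\<in>{z \<in> K. r z = j}. x (c z) \<in> A z})"
    by (rule emeasure_PiM_rect[where c = "\<lambda>j. j"])
       (use \<rho>(1) sp K(1) row in simp_all)
  finally show ?thesis .
qed

text \<open>For a fixed environment the rows have different laws, but every column is a copy of the
  product of all \<open>F j\<close>. This identity in law makes row estimates applicable to
  horizontal steps.\<close>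

lemma quenched_law_eq_columns:
  assumes F: "\<And>j. prob_space (F j)" "\<And>j. sets (F j) = sets borel"
  shows "quenched_law F = distr (PiM UNIV (\<lambda>_::nat. PiM UNIV F)) weight_space (\<lambda>\<omega> z. \<omega> (fst z) (snd z))" (is "_ = ?R")
proof (rule weight_space_eqI)
  have sp: "space (F j) = UNIV" for j by (rule space_borelD[OF F(2)])
  have P: "prob_space (PiM UNIV F)" by (intro prob_space_PiM F)
  have sR: "sets (PiM UNIV F) = sets row_space" by (rule sets_PiM_cong) (auto simp: F)
  interpret Q: prob_space "quenched_law F"
    unfolding quenched_law_def by (rule prob_space_PiM) (auto simp: F split: prod.split)
  show "finite_measure (quenched_law F)" by (rule Q.finite_measure_axioms)
  show "sets (quenched_law F) = sets weight_space"
    unfolding quenched_law_def weight_space_def by (rule sets_PiM_cong) (auto simp: F)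
  show "sets ?R = sets weight_space" by simp
  fix K and A :: "nat \<times> nat \<Rightarrow> real set" assume K: "finite K" and A: "\<And>z. z \<in> K \<Longrightarrow> A z \<in> sets borel"
  have "emeasure (quenched_law F) {X. \<forall>z\<in>K. X z \<in> A z} = (\<Prod>z\<in>K. emeasure (F (snd z)) (A z))"
    unfolding quenched_law_def split_beta
    by (rule emeasure_PiM_rect[where c = "\<lambda>z. z"]) (use F sp K A in auto)
  also have "\<dots> = (\<Prod>i\<in>fst ` K. \<Prod>z\<in>{z \<in> K. fst z = i}. emeasure (F (snd z)) (A z))"
    by (rule prod.image_gen[OF K])
  also have "\<dots> = (\<Prod>i\<in>fst ` K. emeasure (PiM UNIV F) {x. \<forall>z\<in>{z \<in> K. fst z = i}. x (snd z) \<in> A z})"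
  proof (intro prod.cong refl)
    fix i
    show "(\<Prod>z\<in>{z \<in> K. fst z = i}. emeasure (F (snd z)) (A z)) = emeasure (PiM UNIV F) {x. \<forall>z\<in>{z \<in> K. fst z = i}. x (snd z) \<in> A z}"
      by (rule emeasure_PiM_rect(1)[symmetric]) (use F sp K A in \<open>auto simp: inj_on_def\<close>)
  qed
  also have "\<dots> = emeasure ?R {X. \<forall>z\<in>K. X z \<in> A z}"
    by (rule emeasure_rows_rect[OF P sR K _ A, symmetric]) (auto simp: inj_on_def)
  finally show "emeasure (quenched_law F) {X. \<forall>z\<in>K. X z \<in> A z} = emeasure ?R {X. \<forall>z\<in>K. X z \<in> A z}" .
qed

lemma iid_row_measurable: "(\<lambda>D. PiM UNIV (\<lambda>_::nat. D)) \<in> prob_algebra borel \<rightarrow>\<^sub>M prob_algebra row_space"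
proof (rule measurable_prob_algebra_generated[where G = "prod_algebra UNIV (\<lambda>_. borel)" and \<Omega> = "\<Pi>\<^sub>E i\<in>UNIV. space borel"])
  show "sets row_space = sigma_sets (\<Pi>\<^sub>E i\<in>UNIV. space borel) (prod_algebra UNIV (\<lambda>_::nat. borel :: real measure))"
    by (rule sets_PiM)
  fix D :: "real measure" assume D: "D \<in> space (prob_algebra borel)"
  then show "prob_space (PiM UNIV (\<lambda>_::nat. D))" "sets (PiM UNIV (\<lambda>_::nat. D)) = sets row_space"
    by (auto simp: space_prob_algebra intro!: prob_space_PiM sets_PiM_cong)
next
  fix A :: "(nat \<Rightarrow> real) set" assume "A \<in> prod_algebra UNIV (\<lambda>_. borel)"
  then obtain J E where A: "A = prod_emb UNIV (\<lambda>_. borel) J (Pi\<^sub>E J E)" "finite J" "\<And>i. i \<in> J \<Longrightarrow> E i \<in> sets borel"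
    by (elim prod_algebraE) auto
  have "emeasure (PiM UNIV (\<lambda>_::nat. D)) A = (\<Prod>i\<in>J. emeasure D (E i))" if "D \<in> space (prob_algebra borel)" for D
  proof -
    have D: "prob_space D" "sets D = sets borel" using that by (auto simp: space_prob_algebra)
    have "A = {x. \<forall>i\<in>J. x i \<in> E i}" by (auto simp: A(1) prod_emb_def PiE_iff)
    then show ?thesis
      using emeasure_PiM_rect(1)[of "\<lambda>_. D" J "\<lambda>i. i" E] D space_borelD[OF D(2)] A by simp
  qed
  moreover have "(\<lambda>D. \<Prod>i\<in>J. emeasure D (E i)) \<in> borel_measurable (prob_algebra borel)"
    by (intro borel_measurable_prod_ennreal measurable_compose[OF measurable_prob_algebraD[OF measurable_ident_sets[OF refl]] measurable_emeasure_subprob_algebra] A(3))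
  ultimately show "(\<lambda>D. emeasure (PiM UNIV (\<lambda>_::nat. D)) A) \<in> borel_measurable (prob_algebra borel)"
    by (subst measurable_cong) auto
qed (auto simp: Int_stable_prod_algebra prod_algebra_sets_into_space[THEN subsetD])

section \<open>The i.i.d. rows of the averaged weights\<close>

definition env_law :: "(nat \<Rightarrow> real measure) measure \<Rightarrow> real measure measure" where
  "env_law P = distr P (prob_algebra borel) (\<lambda>F. F 0)"

text \<open>The transformation may depend on the distribution of its row, which permits centering by
  the quenched mean; for level sets it is the identity.\<close>

definition row_kernel :: "(real measure \<Rightarrow> real \<Rightarrow> real) \<Rightarrow> real measure \<Rightarrow> (nat \<Rightarrow> real) measure" where
  "row_kernel \<psi> D = distr (PiM UNIV (\<lambda>_::nat. D)) row_space (\<lambda>x i. \<psi> D (x i))"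

definition row_law :: "(nat \<Rightarrow> real measure) measure \<Rightarrow> (real measure \<Rightarrow> real \<Rightarrow> real) \<Rightarrow> (nat \<Rightarrow> real) measure" where
  "row_law P \<psi> = env_law P \<bind> row_kernel \<psi>"

lemma map_row_measurable:
  assumes \<psi>: "case_prod \<psi> \<in> prob_algebra borel \<Otimes>\<^sub>M borel \<rightarrow>\<^sub>M borel"
  shows "(\<lambda>(D, x) i. \<psi> D (x i)) \<in> prob_algebra borel \<Otimes>\<^sub>M row_space \<rightarrow>\<^sub>M row_space"
proof (rule measurable_PiM_single')
  fix i :: nat
  have "(\<lambda>z. (fst z, snd z i)) \<in> prob_algebra borel \<Otimes>\<^sub>M row_space \<rightarrow>\<^sub>M prob_algebra borel \<Otimes>\<^sub>M borel" by measurable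
  from measurable_compose[OF this \<psi>]
  show "(\<lambda>z. (case z of (D, x) \<Rightarrow> \<lambda>i. \<psi> D (x i)) i) \<in> borel_measurable (prob_algebra borel \<Otimes>\<^sub>M row_space)"
    by (simp add: split_beta')
qed auto

lemma row_kernel_measurable:
  assumes "case_prod \<psi> \<in> prob_algebra borel \<Otimes>\<^sub>M borel \<rightarrow>\<^sub>M borel"
  shows "row_kernel \<psi> \<in> prob_algebra borel \<rightarrow>\<^sub>M prob_algebra row_space"
  unfolding row_kernel_def[abs_def]
  by (rule measurable_distr_prob_space2[OF iid_row_measurable map_row_measurable[OF assms]])

context
  fixes P :: "(nat \<Rightarrow> real measure) measure"
  assumes iid: "iid_env P"
begin

lemma iidD: "prob_space P" "sets P = sets env_space"
    "prob_space.indep_vars P (\<lambda>_. prob_algebra borel) (\<lambda>j F. F j) UNIV"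
    "\<And>j. distr P (prob_algebra borel) (\<lambda>F. F j) = env_law P"
  using iid unfolding iid_env_def env_law_def by auto

lemma env_space_P: "space P = space env_space"
  by (rule sets_eq_imp_space_eq[OF iidD(2)])

lemma env_component_measurable: "(\<lambda>F. F j) \<in> P \<rightarrow>\<^sub>M prob_algebra borel"
  using measurable_component_singleton[of j UNIV "\<lambda>_. prob_algebra borel"]
  by (simp add: env_space_def measurable_cong_sets[OF iidD(2)[unfolded env_space_def] refl])

lemma prob_space_env_law: "prob_space (env_law P)"
  unfolding env_law_def by (intro prob_space.prob_space_distr iidD(1) env_component_measurable)

lemma sets_env_law [measurable_cong]: "sets (env_law P) = sets (prob_algebra borel)"
  by (simp add: env_law_def)

lemma space_env_law: "space (env_law P) = space (prob_algebra borel)"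
  by (simp add: env_law_def)

lemma env_law_in: "env_law P \<in> space (prob_algebra (prob_algebra borel))"
  using prob_space_env_law sets_env_law by (simp add: space_prob_algebra)

lemma nn_integral_env_law:
  assumes "h \<in> borel_measurable (prob_algebra borel)"
  shows "(\<integral>\<^sup>+F. h (F j) \<partial>P) = (\<integral>\<^sup>+D. h D \<partial>env_law P)"
  unfolding iidD(4)[of j, symmetric] by (subst nn_integral_distr[OF env_component_measurable]) (use assms in simp_all)

lemma joint_law_measure:
  "sets (joint_law P) = sets (env_space \<Otimes>\<^sub>M weight_space)" "prob_space (joint_law P)"
  "\<And>f. f \<in> borel_measurable (env_space \<Otimes>\<^sub>M weight_space) \<Longrightarrow> (\<integral>\<^sup>+z. f z \<partial>joint_law P) = (\<integral>\<^sup>+F. \<integral>\<^sup>+X. f (F, X) \<partial>quenched_law F \<partial>P)"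
proof -
  let ?k = "\<lambda>F. distr (quenched_law F) (env_space \<Otimes>\<^sub>M weight_space) (\<lambda>X. (F, X))"
  have Pin: "P \<in> space (prob_algebra env_space)" using iidD(1,2) by (simp add: space_prob_algebra)
  show "sets (joint_law P) = sets (env_space \<Otimes>\<^sub>M weight_space)"
    unfolding joint_law_def by (rule sets_bind'[OF Pin joint_kernel_measurable])
  show "prob_space (joint_law P)"
    unfolding joint_law_def by (rule prob_space_bind'[OF Pin joint_kernel_measurable])
  fix f :: "_ \<Rightarrow> ennreal" assume f: "f \<in> borel_measurable (env_space \<Otimes>\<^sub>M weight_space)"
  have k: "?k \<in> P \<rightarrow>\<^sub>M subprob_algebra (env_space \<Otimes>\<^sub>M weight_space)"
    using measurable_prob_algebraD[OF joint_kernel_measurable] by (simp add: measurable_cong_sets[OF iidD(2) refl])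
  have "(\<integral>\<^sup>+z. f z \<partial>joint_law P) = (\<integral>\<^sup>+F. \<integral>\<^sup>+z. f z \<partial>?k F \<partial>P)"
    unfolding joint_law_def by (rule nn_integral_bind[OF f k])
  also have "\<dots> = (\<integral>\<^sup>+F. \<integral>\<^sup>+X. f (F, X) \<partial>quenched_law F \<partial>P)"
  proof (rule nn_integral_cong)
    fix F assume "F \<in> space P"
    then have F: "F \<in> space env_space" by (simp add: env_space_P)
    have "sets (quenched_law F) = sets weight_space"
      using measurable_space[OF quenched_law_measurable F] by (simp add: space_prob_algebra)
    then have "(\<lambda>X. (F, X)) \<in> quenched_law F \<rightarrow>\<^sub>M env_space \<Otimes>\<^sub>M weight_space"
      using F by (simp cong: measurable_cong_sets)
    then show "(\<integral>\<^sup>+z. f z \<partial>?k F) = (\<integral>\<^sup>+X. f (F, X) \<partial>quenched_law F)"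
      by (rule nn_integral_distr) (use f in simp)
  qed
  finally show "(\<integral>\<^sup>+z. f z \<partial>joint_law P) = (\<integral>\<^sup>+F. \<integral>\<^sup>+X. f (F, X) \<partial>quenched_law F \<partial>P)" .
qed

context
  fixes \<psi> :: "real measure \<Rightarrow> real \<Rightarrow> real"
  assumes \<psi>: "case_prod \<psi> \<in> prob_algebra borel \<Otimes>\<^sub>M borel \<rightarrow>\<^sub>M borel"
begin

lemma row_law_measure: "prob_space (row_law P \<psi>)" "sets (row_law P \<psi>) = sets row_space"
  unfolding row_law_def
  by (rule prob_space_bind'[OF env_law_in row_kernel_measurable[OF \<psi>]], rule sets_bind'[OF env_law_in row_kernel_measurable[OF \<psi>]])

lemma psi_measurable: "D \<in> space (prob_algebra borel) \<Longrightarrow> \<psi> D \<in> borel_measurable borel"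
  using measurable_compose[OF measurable_Pair1' \<psi>] by auto

lemma nn_integral_row_law:
  assumes f: "f \<in> borel_measurable row_space"
  shows "(\<integral>\<^sup>+x. f x \<partial>row_law P \<psi>) = (\<integral>\<^sup>+D. \<integral>\<^sup>+x. f (\<lambda>i. \<psi> D (x i)) \<partial>PiM UNIV (\<lambda>_::nat. D) \<partial>env_law P)"
proof -
  have k: "row_kernel \<psi> \<in> env_law P \<rightarrow>\<^sub>M subprob_algebra row_space"
    using measurable_prob_algebraD[OF row_kernel_measurable[OF \<psi>]] by (simp add: measurable_cong_sets[OF sets_env_law refl])
  have "(\<integral>\<^sup>+x. f x \<partial>row_law P \<psi>) = (\<integral>\<^sup>+D. \<integral>\<^sup>+x. f x \<partial>row_kernel \<psi> D \<partial>env_law P)"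
    unfolding row_law_def by (rule nn_integral_bind[OF f k])
  also have "\<dots> = (\<integral>\<^sup>+D. \<integral>\<^sup>+x. f (\<lambda>i. \<psi> D (x i)) \<partial>PiM UNIV (\<lambda>_::nat. D) \<partial>env_law P)"
  proof (rule nn_integral_cong)
    fix D assume "D \<in> space (env_law P)"
    then have D: "D \<in> space (prob_algebra borel)" by (simp add: space_env_law)
    have s: "sets (PiM UNIV (\<lambda>_::nat. D)) = sets row_space" using D by (intro sets_PiM_cong) (auto simp: space_prob_algebra)
    have "(\<lambda>x i. \<psi> D (x i)) \<in> row_space \<rightarrow>\<^sub>M row_space"
      using measurable_compose[OF measurable_Pair1'[OF D] map_row_measurable[OF \<psi>]] by simp
    then have "(\<lambda>x i. \<psi> D (x i)) \<in> PiM UNIV (\<lambda>_::nat. D) \<rightarrow>\<^sub>M row_space"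
      by (simp add: measurable_cong_sets[OF s refl])
    then show "(\<integral>\<^sup>+x. f x \<partial>row_kernel \<psi> D) = (\<integral>\<^sup>+x. f (\<lambda>i. \<psi> D (x i)) \<partial>PiM UNIV (\<lambda>_::nat. D))"
      unfolding row_kernel_def by (rule nn_integral_distr) (use f in simp)
  qed
  finally show ?thesis .
qed

lemma psi_joint_measurable: "(\<lambda>(F, X) z. \<psi> (F (snd z)) (X z)) \<in> env_space \<Otimes>\<^sub>M weight_space \<rightarrow>\<^sub>M weight_space"
  unfolding weight_space_def
proof (rule measurable_PiM_single')
  fix z :: "nat \<times> nat"
  have "(\<lambda>u. (fst u (snd z), snd u z)) \<in> env_space \<Otimes>\<^sub>M PiM UNIV (\<lambda>_. borel) \<rightarrow>\<^sub>M prob_algebra borel \<Otimes>\<^sub>M borel"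
    unfolding env_space_def by measurable
  from measurable_compose[OF this \<psi>]
  show "(\<lambda>u. (case u of (F, X) \<Rightarrow> \<lambda>z. \<psi> (F (snd z)) (X z)) z) \<in> borel_measurable (env_space \<Otimes>\<^sub>M PiM UNIV (\<lambda>_. borel))"
    by (simp add: split_beta')
qed auto

text \<open>Averaging over an i.i.d. environment makes whole rows i.i.d.; within one row the entries
  stay independent only given its distribution. Both sides are compared on finite
  rectangles.\<close>

lemma joint_law_rows:
  "distr (joint_law P) weight_space (\<lambda>(F, X) z. \<psi> (F (snd z)) (X z))
    = distr (PiM UNIV (\<lambda>_::nat. row_law P \<psi>)) weight_space (\<lambda>\<omega> z. \<omega> (snd z) (fst z))" (is "?L = ?R")
proof (rule weight_space_eqI)
  interpret J: prob_space "joint_law P" by (rule joint_law_measure(2))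
  interpret P: prob_space P by (rule iidD(1))
  have Ym: "(\<lambda>(F, X) z. \<psi> (F (snd z)) (X z)) \<in> joint_law P \<rightarrow>\<^sub>M weight_space"
    using psi_joint_measurable by (simp add: measurable_cong_sets[OF joint_law_measure(1) refl])
  interpret L: prob_space ?L by (rule J.prob_space_distr[OF Ym])
  show "finite_measure ?L" by (rule L.finite_measure_axioms)
  show "sets ?L = sets weight_space" "sets ?R = sets weight_space" by simp_all
  fix K and A :: "nat \<times> nat \<Rightarrow> real set" assume K: "finite K" and A: "\<And>z. z \<in> K \<Longrightarrow> A z \<in> sets borel"
  define R where "R = {X :: nat \<times> nat \<Rightarrow> real. \<forall>z\<in>K. X z \<in> A z}"
  have R: "R \<in> sets weight_space" unfolding R_def by (rule rect_weight_space[OF K A])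
  define h where "h j D = (\<Prod>z\<in>{z \<in> K. snd z = j}. emeasure D (\<psi> D -` A z))" for j D
  have Dpsi: "\<psi> D -` A z \<in> sets borel" if "D \<in> space (prob_algebra borel)" "z \<in> K" for D z
    using measurable_sets[OF psi_measurable[OF that(1)] A[OF that(2)]] by simp
  have "emeasure ?L R = (\<integral>\<^sup>+u. indicator R u \<partial>?L)"
    using R by simp
  also have "\<dots> = (\<integral>\<^sup>+u. indicator R ((\<lambda>(F, X) z. \<psi> (F (snd z)) (X z)) u) \<partial>joint_law P)"
    by (rule nn_integral_distr[OF Ym]) (use R in auto)
  also have "\<dots> = (\<integral>\<^sup>+F. \<integral>\<^sup>+X. indicator R ((\<lambda>(F, X) z. \<psi> (F (snd z)) (X z)) (F, X)) \<partial>quenched_law F \<partial>P)"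
    by (rule joint_law_measure(3)) (intro measurable_compose[OF psi_joint_measurable] borel_measurable_indicator R)
  also have "\<dots> = (\<integral>\<^sup>+F. (\<Prod>j\<in>snd ` K. h j (F j)) \<partial>P)"
  proof (rule nn_integral_cong)
    fix F assume "F \<in> space P"
    then have F: "prob_space (F j)" "sets (F j) = sets borel" for j by (auto simp: env_space_P space_env)
    have Fin: "F j \<in> space (prob_algebra borel)" for j using F by (simp add: space_prob_algebra)
    have "(\<integral>\<^sup>+X. indicator R ((\<lambda>(F, X) z. \<psi> (F (snd z)) (X z)) (F, X)) \<partial>quenched_law F)
        = (\<integral>\<^sup>+X. indicator {X. \<forall>z\<in>K. X z \<in> \<psi> (F (snd z)) -` A z} X \<partial>quenched_law F)"
      by (intro nn_integral_cong) (auto simp: R_def indicator_def)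
    also have "\<dots> = (\<Prod>z\<in>K. emeasure (F (snd z)) (\<psi> (F (snd z)) -` A z))"
    proof -
      have sp: "space (F j) = UNIV" for j by (rule space_borelD[OF F(2)])
      have set: "\<psi> (F (snd z)) -` A z \<in> sets (F (snd z))" if "z \<in> K" for z using Dpsi[OF Fin that] F by simp
      have "{X. \<forall>z\<in>K. X z \<in> \<psi> (F (snd z)) -` A z} \<in> sets (quenched_law F)"
        unfolding quenched_law_def split_beta
        by (rule emeasure_PiM_rect(2)[where c = "\<lambda>z. z"]) (use F(1) K sp set in simp_all)
      moreover have "emeasure (quenched_law F) {X. \<forall>z\<in>K. X z \<in> \<psi> (F (snd z)) -` A z} = (\<Prod>z\<in>K. emeasure (F (snd z)) (\<psi> (F (snd z)) -` A z))"
        unfolding quenched_law_def split_beta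
        by (rule emeasure_PiM_rect(1)[where c = "\<lambda>z. z"]) (use F(1) K sp set in simp_all)
      ultimately show ?thesis by (simp only: nn_integral_indicator)
    qed
    also have "\<dots> = (\<Prod>j\<in>snd ` K. \<Prod>z\<in>{z \<in> K. snd z = j}. emeasure (F (snd z)) (\<psi> (F (snd z)) -` A z))"
      by (rule prod.image_gen[OF K])
    also have "\<dots> = (\<Prod>j\<in>snd ` K. h j (F j))"
      unfolding h_def by (intro prod.cong refl) auto
    finally show "(\<integral>\<^sup>+X. indicator R ((\<lambda>(F, X) z. \<psi> (F (snd z)) (X z)) (F, X)) \<partial>quenched_law F) = (\<Prod>j\<in>snd ` K. h j (F j))" .
  qed
  \<comment> \<open>Independence of the environment enters here: each factor \<open>h j\<close>
    looks at a single \<open>F j\<close>.\<close>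
  also have "\<dots> = (\<Prod>j\<in>snd ` K. \<integral>\<^sup>+D. h j D \<partial>env_law P)"
  proof -
    have hm: "h j \<in> borel_measurable (prob_algebra borel)" for j
      unfolding h_def
    proof (intro borel_measurable_prod_ennreal)
      fix z assume z: "z \<in> {z \<in> K. snd z = j}"
      have "(\<lambda>D. distr D borel (\<psi> D)) \<in> prob_algebra borel \<rightarrow>\<^sub>M prob_algebra borel"
        using measurable_distr_prob_space2[OF measurable_ident_sets[OF refl] \<psi>] by simp
      from measurable_compose[OF measurable_prob_algebraD[OF this] measurable_emeasure_subprob_algebra[OF A]] z
      have "(\<lambda>D. emeasure (distr D borel (\<psi> D)) (A z)) \<in> borel_measurable (prob_algebra borel)" by auto
      moreover have "emeasure (distr D borel (\<psi> D)) (A z) = emeasure D (\<psi> D -` A z)" if "D \<in> space (prob_algebra borel)" for D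
      proof -
        have s: "sets D = sets borel" using that by (simp add: space_prob_algebra)
        have "\<psi> D \<in> D \<rightarrow>\<^sub>M borel" using psi_measurable[OF that] by (simp add: measurable_cong_sets[OF s refl])
        then show ?thesis using A z space_borelD[OF s] by (simp add: emeasure_distr)
      qed
      ultimately show "(\<lambda>D. emeasure D (\<psi> D -` A z)) \<in> borel_measurable (prob_algebra borel)"
        by (subst measurable_cong[where g = "\<lambda>D. emeasure (distr D borel (\<psi> D)) (A z)"]) auto
    qed
    have "P.indep_vars (\<lambda>_. borel) (\<lambda>j F. h j (F j)) UNIV"
      by (rule P.indep_vars_compose2[OF iidD(3) hm])
    then have "P.indep_vars (\<lambda>_. borel) (\<lambda>j F. h j (F j)) (snd ` K)"
      by (rule P.indep_vars_subset) simp
    from P.indep_vars_nn_integral[OF _ this]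
    have "(\<integral>\<^sup>+F. (\<Prod>j\<in>snd ` K. h j (F j)) \<partial>P) = (\<Prod>j\<in>snd ` K. \<integral>\<^sup>+F. h j (F j) \<partial>P)" using K by auto
    then show ?thesis by (simp add: nn_integral_env_law[OF hm])
  qed
  also have "\<dots> = (\<Prod>j\<in>snd ` K. emeasure (row_law P \<psi>) {x. \<forall>z\<in>{z \<in> K. snd z = j}. x (fst z) \<in> A z})"
  proof (intro prod.cong refl)
    fix j
    let ?K = "{z \<in> K. snd z = j}" and ?B = "{x. \<forall>z\<in>{z \<in> K. snd z = j}. x (fst z) \<in> A z}"
    have inj: "inj_on fst ?K" by (auto simp: inj_on_def)
    have B: "?B \<in> sets row_space" by (rule rect_row_space) (use K A inj in auto)
    have "emeasure (row_law P \<psi>) ?B = (\<integral>\<^sup>+x. indicator ?B x \<partial>row_law P \<psi>)"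
      using B by (simp add: row_law_measure)
    also have "\<dots> = (\<integral>\<^sup>+D. \<integral>\<^sup>+x. indicator ?B (\<lambda>i. \<psi> D (x i)) \<partial>PiM UNIV (\<lambda>_::nat. D) \<partial>env_law P)"
      by (rule nn_integral_row_law) (use B in auto)
    also have "\<dots> = (\<integral>\<^sup>+D. h j D \<partial>env_law P)"
    proof (rule nn_integral_cong)
      fix D assume "D \<in> space (env_law P)"
      then have Din: "D \<in> space (prob_algebra borel)" by (simp add: space_env_law)
      then have D: "prob_space D" "sets D = sets borel" by (auto simp: space_prob_algebra)
      have "(\<integral>\<^sup>+x. indicator ?B (\<lambda>i. \<psi> D (x i)) \<partial>PiM UNIV (\<lambda>_::nat. D))
          = (\<integral>\<^sup>+x. indicator {x. \<forall>z\<in>?K. x (fst z) \<in> \<psi> D -` A z} x \<partial>PiM UNIV (\<lambda>_::nat. D))"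
        by (intro nn_integral_cong) (auto simp: indicator_def)
      also have "\<dots> = h j D"
      proof -
        have sp: "space D = UNIV" by (rule space_borelD[OF D(2)])
        have set: "\<psi> D -` A z \<in> sets D" if "z \<in> ?K" for z using Dpsi[OF Din] D that by simp
        have "{x. \<forall>z\<in>?K. x (fst z) \<in> \<psi> D -` A z} \<in> sets (PiM UNIV (\<lambda>_::nat. D))"
          by (rule emeasure_PiM_rect(2)[where c = fst]) (use D(1) K sp set inj in simp_all)
        moreover have "emeasure (PiM UNIV (\<lambda>_::nat. D)) {x. \<forall>z\<in>?K. x (fst z) \<in> \<psi> D -` A z} = h j D"
          unfolding h_def
          by (rule emeasure_PiM_rect(1)[where c = fst and M = "\<lambda>_. D"]) (use D(1) K sp set inj in simp_all)
        ultimately show ?thesis by (simp only: nn_integral_indicator)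
      qed
      finally show "(\<integral>\<^sup>+x. indicator ?B (\<lambda>i. \<psi> D (x i)) \<partial>PiM UNIV (\<lambda>_::nat. D)) = h j D" .
    qed
    finally show "(\<integral>\<^sup>+D. h j D \<partial>env_law P) = emeasure (row_law P \<psi>) ?B" by simp
  qed
  also have "\<dots> = emeasure ?R R"
    unfolding R_def by (rule emeasure_rows_rect[OF row_law_measure K _ A, symmetric]) (auto simp: inj_on_def)
  finally show "emeasure ?L {X. \<forall>z\<in>K. X z \<in> A z} = emeasure ?R {X. \<forall>z\<in>K. X z \<in> A z}"
    unfolding R_def .
qed

end

end

section \<open>Level sets of the weights\<close>

text \<open>The minimum of B e + C / e lies at e = sqrt (C / B). If \<open>B\<close> or
  \<open>C\<close> is zero the infimum need not be attained and is approached instead.\<close>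

lemma ennreal_le_optimize:
  fixes A B C :: real
  assumes le: "\<And>e. 0 < e \<Longrightarrow> y \<le> ennreal (A + B * e + C / e)" and nn: "0 \<le> A" "0 \<le> B" "0 \<le> C"
  shows "y \<le> ennreal (A + 2 * sqrt (B * C))"
proof (cases "B = 0 \<or> C = 0")
  case False
  then have pos: "0 < B" "0 < C" using nn by auto
  define a b where "a = sqrt B" and "b = sqrt C"
  have ab: "0 < a" "0 < b" "B = a * a" "C = b * b" using pos by (auto simp: a_def b_def)
  have "A + B * (b / a) + C / (b / a) = A + 2 * (a * b)" using ab(1,2) unfolding ab(3,4) by (simp add: field_simps)
  moreover have "sqrt (B * C) = a * b" by (simp add: a_def b_def real_sqrt_mult)
  moreover have "y \<le> ennreal (A + B * (b / a) + C / (b / a))" by (rule le) (use ab in simp)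
  ultimately show ?thesis by (simp only:)
next
  case True
  show ?thesis
  proof (rule ennreal_le_epsilon)
    fix e :: real assume e: "0 < e"
    have "\<exists>e'>0. A + B * e' + C / e' \<le> A + 2 * sqrt (B * C) + e"
    proof (cases "C = 0")
      case True
      have "B * (e / (B + 1)) \<le> e" using nn e by (simp add: field_simps)
      then show ?thesis using True nn e by (intro exI[of _ "e / (B + 1)"]) auto
    next
      case False
      then have "B = 0" using True by (metis \<open>B = 0 \<or> C = 0\<close>)
      then show ?thesis using False nn e by (intro exI[of _ "C / e"]) auto
    qed
    then obtain e' where "0 < e'" "A + B * e' + C / e' \<le> A + 2 * sqrt (B * C) + e" by blast
    then have "y \<le> ennreal (A + 2 * sqrt (B * C) + e)"
      using le[of e'] by (meson ennreal_leI order_trans)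
    also have "\<dots> = ennreal (A + 2 * sqrt (B * C)) + ennreal e"
      using nn e by (intro ennreal_plus) auto
    finally show "y \<le> ennreal (A + 2 * sqrt (B * C)) + ennreal e" .
  qed
qed

lemma indicator_row_measurable:
  assumes "E \<in> sets (borel :: real measure)" "sets \<rho> = sets row_space"
  shows "(\<lambda>s i. of_bool (s i \<in> E)) \<in> \<rho> \<rightarrow>\<^sub>M PiM UNIV (\<lambda>_::nat. borel :: real measure)"
proof -
  have "(\<lambda>s i. of_bool (s i \<in> E)) \<in> row_space \<rightarrow>\<^sub>M PiM UNIV (\<lambda>_::nat. borel :: real measure)"
  proof (rule measurable_PiM_single')
    fix i :: nat
    have "(\<lambda>v. of_bool (v \<in> E) :: real) = indicator E" by (auto simp: indicator_def)
    then have "(\<lambda>v. of_bool (v \<in> E) :: real) \<in> borel_measurable borel" using assms(1) by simp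
    then show "(\<lambda>s. of_bool (s i \<in> E) :: real) \<in> borel_measurable row_space"
      by (rule measurable_compose[rotated]) (rule measurable_component_singleton, simp)
  qed auto
  then show ?thesis by (simp add: measurable_cong_sets[OF assms(2) refl])
qed

lemma weight_indicator_measurable:
  assumes "E \<in> sets (borel :: real measure)"
  shows "(\<lambda>X. of_bool (X z \<in> E) :: real) \<in> borel_measurable weight_space"
proof -
  have "(\<lambda>v. of_bool (v \<in> E) :: real) = indicator E" by (auto simp: indicator_def)
  then have "(\<lambda>v. of_bool (v \<in> E) :: real) \<in> borel_measurable borel" using assms(1) by simp
  then show ?thesis unfolding weight_space_def
    by (rule measurable_compose[rotated]) (rule measurable_component_singleton, simp)
qed

lemma measure_prob_measurable:
  assumes "E \<in> sets borel"
  shows "(\<lambda>D. measure D E) \<in> borel_measurable (prob_algebra (borel :: real measure))"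
  by (rule measurable_compose[OF measurable_prob_algebraD[OF measurable_ident_sets[OF refl]] measurable_measure_subprob_algebra]) (rule assms)

definition mean_prob :: "(nat \<Rightarrow> real measure) measure \<Rightarrow> real set \<Rightarrow> real" where
  "mean_prob P E = (\<integral>D. measure D E \<partial>env_law P)"

context
  fixes P :: "(nat \<Rightarrow> real measure) measure"
  assumes iid: "iid_env P"
begin

interpretation EL: prob_space "env_law P" by (rule prob_space_env_law[OF iid])
interpretation P: prob_space P by (rule iidD(1)[OF iid])
interpretation J: prob_space "joint_law P" by (rule joint_law_measure(2)[OF iid])

lemma psi_id: "case_prod (\<lambda>D x :: real. x) \<in> prob_algebra borel \<Otimes>\<^sub>M borel \<rightarrow>\<^sub>M borel"
  by (simp add: split_beta')

lemma joint_snd_measurable: "snd \<in> joint_law P \<rightarrow>\<^sub>M weight_space"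
  by (simp add: measurable_cong_sets[OF joint_law_measure(1)[OF iid] refl])

lemma joint_comp_measurable:
  assumes "f \<in> weight_space \<rightarrow>\<^sub>M N"
  shows "(\<lambda>u. f (snd u)) \<in> joint_law P \<rightarrow>\<^sub>M N"
  using measurable_compose[OF joint_snd_measurable assms] by simp

lemma nn_integral_joint_rows:
  assumes \<psi>: "case_prod \<psi> \<in> prob_algebra borel \<Otimes>\<^sub>M borel \<rightarrow>\<^sub>M borel" and f: "f \<in> borel_measurable weight_space"
  shows "(\<integral>\<^sup>+u. f (\<lambda>z. \<psi> (fst u (snd z)) (snd u z)) \<partial>joint_law P)
    = (\<integral>\<^sup>+\<omega>. f (\<lambda>z. \<omega> (snd z) (fst z)) \<partial>PiM UNIV (\<lambda>_::nat. row_law P \<psi>))"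
proof -
  have Ym: "(\<lambda>(F, X) z. \<psi> (F (snd z)) (X z)) \<in> joint_law P \<rightarrow>\<^sub>M weight_space"
    using psi_joint_measurable[OF iid \<psi>] by (simp add: measurable_cong_sets[OF joint_law_measure(1)[OF iid] refl])
  have "(\<integral>\<^sup>+u. f (\<lambda>z. \<psi> (fst u (snd z)) (snd u z)) \<partial>joint_law P)
      = (\<integral>\<^sup>+X. f X \<partial>distr (joint_law P) weight_space (\<lambda>(F, X) z. \<psi> (F (snd z)) (X z)))"
    by (subst nn_integral_distr[OF Ym]) (use f in \<open>simp_all add: split_beta'\<close>)
  also have "\<dots> = (\<integral>\<^sup>+\<omega>. f (\<lambda>z. \<omega> (snd z) (fst z)) \<partial>PiM UNIV (\<lambda>_::nat. row_law P \<psi>))"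
    unfolding joint_law_rows[OF iid \<psi>]
    by (subst nn_integral_distr[OF flatten_measurable[OF row_law_measure(2)[OF iid \<psi>]]]) (use f in simp_all)
  finally show ?thesis .
qed

lemma nn_integral_joint_snd:
  assumes "f \<in> borel_measurable weight_space"
  shows "(\<integral>\<^sup>+u. f (snd u) \<partial>joint_law P) = (\<integral>\<^sup>+F. \<integral>\<^sup>+X. f X \<partial>quenched_law F \<partial>P)"
  using joint_law_measure(3)[OF iid measurable_compose[OF measurable_snd assms]] by simp

lemma mean_prob_integrable: "E \<in> sets borel \<Longrightarrow> integrable (env_law P) (\<lambda>D. measure D E)"
proof (rule EL.integrable_const_bound[where B = 1])
  assume E: "E \<in> sets borel"
  show "AE D in env_law P. norm (measure D E) \<le> 1"
    by (rule AE_I2) (auto simp: space_env_law[OF iid] space_prob_algebra prob_space.prob_le_1)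
  show "(\<lambda>D. measure D E) \<in> borel_measurable (env_law P)"
    using measure_prob_measurable[OF E] by (simp add: measurable_cong_sets[OF sets_env_law[OF iid] refl])
qed

lemma mean_prob_bounds: "E \<in> sets borel \<Longrightarrow> 0 \<le> mean_prob P E" "E \<in> sets borel \<Longrightarrow> mean_prob P E \<le> 1"
proof -
  assume E: "E \<in> sets borel"
  show "0 \<le> mean_prob P E" unfolding mean_prob_def by (rule integral_nonneg_AE) simp
  show "mean_prob P E \<le> 1" unfolding mean_prob_def
    by (rule EL.integral_le_const[OF mean_prob_integrable[OF E]])
       (rule AE_I2, auto simp: space_env_law[OF iid] space_prob_algebra prob_space.prob_le_1)
qed

lemma nn_integral_mean_prob:
  assumes E: "E \<in> sets borel"
  shows "(\<integral>\<^sup>+D. ennreal (measure D E) \<partial>env_law P) = ennreal (mean_prob P E)"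
  unfolding mean_prob_def by (rule nn_integral_eq_integral[OF mean_prob_integrable[OF E]]) simp

text \<open>The boundary must be the same for all rows, so \<open>r\<close> is fixed and the balance
  relation is solved for \<open>q\<close>, which becomes a function of the random row. The drift per
  row is its average over the environment.\<close>

lemma nn_integral_passage_indicator:
  assumes E: "E \<in> sets borel" and r: "0 < r" "r < 1"
  shows "(\<integral>\<^sup>+u. ennreal (passage (\<lambda>j i. of_bool (snd u (i, j) \<in> E)) n k) \<partial>joint_law P)
    \<le> ennreal (real (Suc k) * (r / (1 - r)))
      + of_nat n * (\<integral>\<^sup>+D. ennreal (measure D E / (measure D E + r * (1 - measure D E))) \<partial>env_law P)"
proof -
  let ?x = "\<lambda>s i. of_bool (s i \<in> E) :: real"
  let ?\<rho> = "row_law P (\<lambda>D x. x)"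
  define q where "q D = measure D E / (measure D E + r * (1 - measure D E))" for D
  have pm: "(\<lambda>D. measure D E) \<in> borel_measurable (env_law P)"
    using measure_prob_measurable[OF E] by (simp add: measurable_cong_sets[OF sets_env_law[OF iid] refl])
  have qm: "q \<in> borel_measurable (env_law P)" unfolding q_def using pm by measurable
  note \<rho> = row_law_measure[OF iid psi_id]
  have fm: "(\<lambda>X. ennreal (passage (\<lambda>j i. of_bool (X (i, j) \<in> E)) n k)) \<in> borel_measurable weight_space"
    by (intro measurable_compose[OF measurable_prof measurable_ennreal] weight_indicator_measurable E) auto
  have "(\<integral>\<^sup>+u. ennreal (passage (\<lambda>j i. of_bool (snd u (i, j) \<in> E)) n k) \<partial>joint_law P)
      = (\<integral>\<^sup>+\<omega>. ennreal (passage (\<lambda>j. ?x (\<omega> j)) n k) \<partial>PiM UNIV (\<lambda>_::nat. ?\<rho>))"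
    using nn_integral_joint_rows[OF psi_id fm] by simp
  also have "\<dots> \<le> ennreal (\<Sum>i\<le>k. r / (1 - r)) + of_nat n * (\<integral>\<^sup>+D. ennreal (q D) \<partial>env_law P)"
  proof (rule nn_integral_passage_le[OF \<rho>(1) indicator_row_measurable[OF E \<rho>(2)]])
    fix t :: "nat \<Rightarrow> real" assume t: "mono t" "0 \<le> t 0"
    let ?f = "\<lambda>s. exit_value (\<lambda>_. r) k (row_step (?x s) t)"
    have "(\<lambda>s. row_step (?x s) t) \<in> row_space \<rightarrow>\<^sub>M PiM UNIV (\<lambda>_. borel)"
      by (rule measurable_PiM_single', rule measurable_row_step)
         (auto intro!: measurable_compose[OF indicator_row_measurable[OF E refl] measurable_component_singleton])
    then have f: "?f \<in> borel_measurable row_space"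
      by (rule measurable_compose[OF _ exit_value_measurable])
    have "(\<integral>\<^sup>+s. ?f s \<partial>?\<rho>) = (\<integral>\<^sup>+D. \<integral>\<^sup>+s. ?f s \<partial>PiM UNIV (\<lambda>_::nat. D) \<partial>env_law P)"
      using nn_integral_row_law[OF iid psi_id f] by simp
    also have "\<dots> \<le> (\<integral>\<^sup>+D. exit_value (\<lambda>_. r) k t + ennreal (q D) \<partial>env_law P)"
    proof (rule nn_integral_mono)
      fix D assume "D \<in> space (env_law P)"
      then have D: "prob_space D" "sets D = sets borel" by (auto simp: space_env_law[OF iid] space_prob_algebra)
      interpret D: prob_space D by fact
      define p where "p = measure D E"
      have p: "0 \<le> p" "p \<le> 1" by (auto simp: p_def)
      have den: "0 < p + r * (1 - p)"
      proof (cases "p = 0")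
        case False
        then show ?thesis using p r by (intro add_pos_nonneg) auto
      qed (use r in simp)
      have q: "q D = p / (p + r * (1 - p))" by (simp add: q_def p_def)
      have q1: "1 - q D = r * (1 - p) / (p + r * (1 - p))" unfolding q using den by (simp add: field_simps)
      show "(\<integral>\<^sup>+s. ?f s \<partial>PiM UNIV (\<lambda>_::nat. D)) \<le> exit_value (\<lambda>_. r) k t + ennreal (q D)"
      proof (rule exit_value_row_le)
        show "0 \<le> q D" unfolding q using p den by (intro divide_nonneg_pos)
        have "0 \<le> r * (1 - p) / (p + r * (1 - p))" using p r den by (intro divide_nonneg_pos) auto
        then show "q D \<le> 1" using q1 by simp
        show "measure D E * (1 - q D) = r * q D * (1 - measure D E)"
          unfolding p_def[symmetric] q1 unfolding q by simp
      qed (use D E r t in auto)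
    qed
    also have "\<dots> = exit_value (\<lambda>_. r) k t + (\<integral>\<^sup>+D. ennreal (q D) \<partial>env_law P)"
      using qm by (subst nn_integral_add) (auto simp: EL.emeasure_space_1)
    finally show "(\<integral>\<^sup>+s. ?f s \<partial>?\<rho>) \<le> exit_value (\<lambda>_. r) k t + (\<integral>\<^sup>+D. ennreal (q D) \<partial>env_law P)" .
  qed (use r in auto)
  finally show ?thesis by (simp add: q_def)
qed

lemma passage_indicator_le:
  assumes E: "E \<in> sets borel"
  shows "(\<integral>\<^sup>+u. ennreal (passage (\<lambda>j i. of_bool (snd u (i, j) \<in> E)) n k) \<partial>joint_law P)
    \<le> ennreal (real n * mean_prob P E + 2 * sqrt (real (Suc k) * (real n * mean_prob P E)))"
proof (rule ennreal_le_optimize)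
  fix s :: real assume s: "0 < s"
  \<comment> \<open>Makes the boundary mean r / (1 - r) equal to \<open>s\<close> and 1 / r equal to
    1 + 1 / s. With the bound p / r for the drift, the total takes the form needed for the
    optimisation.\<close>
  define r where "r = s / (1 + s)"
  have r: "0 < r" "r < 1" using s by (auto simp: r_def)
  have rs: "r / (1 - r) = s" using s by (simp add: r_def field_simps)
  have "(\<integral>\<^sup>+D. ennreal (measure D E / (measure D E + r * (1 - measure D E))) \<partial>env_law P) \<le> (\<integral>\<^sup>+D. ennreal (1 / r) * ennreal (measure D E) \<partial>env_law P)"
  proof (rule nn_integral_mono)
    fix D assume "D \<in> space (env_law P)"
    then interpret D: prob_space D by (auto simp: space_env_law[OF iid] space_prob_algebra)
    have "r * measure D E \<le> measure D E" using r by (intro mult_left_le_one_le) auto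
    then have "r \<le> measure D E + r * (1 - measure D E)" by (simp add: algebra_simps)
    then have "measure D E / (measure D E + r * (1 - measure D E)) \<le> measure D E / r"
      using r by (intro divide_left_mono mult_pos_pos) auto
    then show "ennreal (measure D E / (measure D E + r * (1 - measure D E))) \<le> ennreal (1 / r) * ennreal (measure D E)"
      using r by (simp add: ennreal_mult[symmetric] ennreal_leI)
  qed
  also have "\<dots> = ennreal (1 / r) * ennreal (mean_prob P E)"
    using measure_prob_measurable[OF E]
    by (subst nn_integral_cmult) (auto simp: nn_integral_mean_prob[OF E] measurable_cong_sets[OF sets_env_law[OF iid] refl])
  finally have le: "(\<integral>\<^sup>+D. ennreal (measure D E / (measure D E + r * (1 - measure D E))) \<partial>env_law P) \<le> ennreal (mean_prob P E / r)"
    using r mean_prob_bounds[OF E] by (simp add: ennreal_mult[symmetric])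
  have "(\<integral>\<^sup>+u. ennreal (passage (\<lambda>j i. of_bool (snd u (i, j) \<in> E)) n k) \<partial>joint_law P)
    \<le> ennreal (real (Suc k) * s) + of_nat n * ennreal (mean_prob P E / r)"
    using nn_integral_passage_indicator[OF E r, of n k] le unfolding rs by (meson add_left_mono mult_left_mono order_trans zero_le)
  also have "\<dots> = ennreal (real (Suc k) * s + real n * (mean_prob P E / r))"
    using s r mean_prob_bounds[OF E]
    by (simp add: ennreal_of_nat_eq_real_of_nat ennreal_mult[symmetric] ennreal_plus[symmetric] del: ennreal_plus of_nat_Suc)
  also have "real (Suc k) * s + real n * (mean_prob P E / r) = real n * mean_prob P E + real (Suc k) * s + real n * mean_prob P E / s"
    using s by (simp add: r_def field_simps)
  finally show "(\<integral>\<^sup>+u. ennreal (passage (\<lambda>j i. of_bool (snd u (i, j) \<in> E)) n k) \<partial>joint_law P)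
    \<le> ennreal (real n * mean_prob P E + real (Suc k) * s + real n * mean_prob P E / s)" .
qed (use mean_prob_bounds[OF E] in auto)

text \<open>The minimum is \<open>n\<close> minus a maximum for the complement, whose drift (1 - p)
  / (1 - p + r p) is at most 1 - r p. With r = 1 - \<delta> the loss is at most \<delta> c + (k + 1)
  / \<delta>, where c is the mean. The additive form avoids subtraction of extended reals.\<close>

lemma low_indicator_ge:
  assumes E: "E \<in> sets borel"
  shows "ennreal (real n * mean_prob P E)
    \<le> (\<integral>\<^sup>+u. ennreal (low_prof (\<lambda>j i. of_bool (snd u (i, j) \<in> E)) n k) \<partial>joint_law P)
      + ennreal (2 * sqrt (real (Suc k) * (real n * mean_prob P E)))" (is "_ \<le> ?low + _")
proof -
  define c where "c = real n * mean_prob P E"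
  have c0: "0 \<le> c" using mean_prob_bounds[OF E] by (simp add: c_def)
  have E': "- E \<in> sets borel" using E by simp
  have *: "ennreal c \<le> ?low + ennreal (\<delta> * c + real (Suc k) / \<delta>)" if \<delta>: "0 < \<delta>" "\<delta> < 1" for \<delta>
  proof -
    define r where "r = 1 - \<delta>"
    have r: "0 < r" "r < 1" using \<delta> by (auto simp: r_def)
    let ?up = "\<integral>\<^sup>+u. ennreal (passage (\<lambda>j i. of_bool (snd u (i, j) \<in> - E)) n k) \<partial>joint_law P"
    have lp: "low_prof (\<lambda>j i. of_bool (X (i, j) \<in> E)) n k = real n - passage (\<lambda>j i. of_bool (X (i, j) \<in> - E)) n k" for X
    proof -
      have "low_prof (\<lambda>j i. 1 - of_bool (X (i, j) \<in> - E)) n k = real n * 1 - passage (\<lambda>j i. of_bool (X (i, j) \<in> - E)) n k"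
        by (rule low_prof_complement)
      moreover have "(\<lambda>j i. 1 - of_bool (X (i, j) \<in> - E)) = (\<lambda>j i. of_bool (X (i, j) \<in> E) :: real)" by (auto simp: fun_eq_iff)
      ultimately show ?thesis by simp
    qed
    have pb: "0 \<le> passage (\<lambda>j i. of_bool (X (i, j) \<in> - E)) n k" "passage (\<lambda>j i. of_bool (X (i, j) \<in> - E)) n k \<le> real n" for X
      by (auto intro!: passage_nonneg passage_le_rows)
    have upm: "(\<lambda>u. ennreal (passage (\<lambda>j i. of_bool (snd u (i, j) \<in> - E)) n k)) \<in> borel_measurable (joint_law P)"
      by (intro joint_comp_measurable measurable_compose[OF measurable_prof measurable_ennreal] weight_indicator_measurable E') auto
    have "ennreal (real n) = (\<integral>\<^sup>+u. ennreal (low_prof (\<lambda>j i. of_bool (snd u (i, j) \<in> E)) n k) + ennreal (passage (\<lambda>j i. of_bool (snd u (i, j) \<in> - E)) n k) \<partial>joint_law P)"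
      unfolding lp using pb by (simp add: ennreal_plus[symmetric] J.emeasure_space_1 del: ennreal_plus)
    also have "\<dots> = ?low + ?up"
      by (rule nn_integral_add[OF _ upm])
         (intro joint_comp_measurable measurable_compose[OF measurable_low_prof measurable_ennreal] weight_indicator_measurable E)
    finally have split: "ennreal (real n) = ?low + ?up" .
    have "(\<integral>\<^sup>+D. ennreal (measure D (- E) / (measure D (- E) + r * (1 - measure D (- E)))) \<partial>env_law P) \<le> (\<integral>\<^sup>+D. ennreal (1 - r * measure D E) \<partial>env_law P)"
    proof (rule nn_integral_mono, rule ennreal_leI)
      fix D assume "D \<in> space (env_law P)"
      then have D: "prob_space D" "sets D = sets borel" by (auto simp: space_env_law[OF iid] space_prob_algebra)
      interpret D: prob_space D by fact
      define p where "p = measure D E"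
      have p: "0 \<le> p" "p \<le> 1" by (auto simp: p_def)
      have cp: "measure D (- E) = 1 - p"
        using D.prob_compl[of E] E D space_borelD[OF D(2)] by (simp add: p_def Compl_eq_Diff_UNIV)
      show "measure D (- E) / (measure D (- E) + r * (1 - measure D (- E))) \<le> 1 - r * measure D E"
      proof (cases "1 - p + r * p = 0")
        case True
        have "r * p \<le> 1" using r p by (simp add: mult_le_one)
        then show ?thesis unfolding cp using True by (simp add: p_def[symmetric])
      next
        case False
        then have den: "0 < 1 - p + r * p" using p r by (smt (verit) mult_nonneg_nonneg)
        have "(1 - p + r * p) * (1 - r * p) - (1 - p) = r * p * p * (1 - r)"
          by (simp add: algebra_simps)
        moreover have "0 \<le> r * p * p * (1 - r)" using r p by simp
        ultimately have "1 - p \<le> (1 - r * p) * (1 - p + r * p)" by (simp add: mult.commute)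
        then show ?thesis unfolding cp using den by (simp add: p_def[symmetric] pos_divide_le_eq)
      qed
    qed
    also have "\<dots> = ennreal (1 - r * mean_prob P E)"
    proof -
      have "integrable (env_law P) (\<lambda>D. 1 - r * measure D E)" using mean_prob_integrable[OF E] by simp
      moreover have "AE D in env_law P. 0 \<le> 1 - r * measure D E"
        using r by (intro AE_I2) (auto simp: space_env_law[OF iid] space_prob_algebra prob_space.prob_le_1 mult_le_one)
      ultimately show ?thesis
        by (subst nn_integral_eq_integral) (auto simp: mean_prob_def mean_prob_integrable[OF E] EL.prob_space)
    qed
    finally have q: "(\<integral>\<^sup>+D. ennreal (measure D (- E) / (measure D (- E) + r * (1 - measure D (- E)))) \<partial>env_law P) \<le> ennreal (1 - r * mean_prob P E)" .
    have rm: "r * mean_prob P E \<le> 1" using r mean_prob_bounds[OF E] by (simp add: mult_le_one)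
    have "?up \<le> ennreal (real (Suc k) * (r / (1 - r))) + of_nat n * ennreal (1 - r * mean_prob P E)"
      using nn_integral_passage_indicator[OF E' r, of n k] q by (meson add_left_mono mult_left_mono order_trans zero_le)
    also have "\<dots> = ennreal (real (Suc k) * (r / (1 - r)) + real n * (1 - r * mean_prob P E))"
      using r rm by (simp add: ennreal_of_nat_eq_real_of_nat ennreal_mult[symmetric] ennreal_plus[symmetric] del: ennreal_plus of_nat_Suc)
    finally have up: "?up \<le> ennreal (real (Suc k) * (r / (1 - r)) + real n * (1 - r * mean_prob P E))" .
    have "real (Suc k) * (r / (1 - r)) \<le> real (Suc k) / \<delta>"
    proof -
      have "r / (1 - r) \<le> 1 / \<delta>" using \<delta> by (simp add: r_def field_simps)
      then have "real (Suc k) * (r / (1 - r)) \<le> real (Suc k) * (1 / \<delta>)" by (rule mult_left_mono) simp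
      then show ?thesis by simp
    qed
    then have up2: "real (Suc k) * (r / (1 - r)) + real n * (1 - r * mean_prob P E) \<le> real n - c + (\<delta> * c + real (Suc k) / \<delta>)"
      by (simp add: r_def c_def algebra_simps)
    have cn: "c \<le> real n" using mean_prob_bounds[OF E] by (simp add: c_def mult_left_le)
    have d0: "0 \<le> \<delta> * c + real (Suc k) / \<delta>" using \<delta> c0 by simp
    have "ennreal (real n) \<le> ?low + ennreal (real n - c + (\<delta> * c + real (Suc k) / \<delta>))"
      unfolding split by (intro add_left_mono order_trans[OF up] ennreal_leI up2)
    also have "\<dots> = (?low + ennreal (\<delta> * c + real (Suc k) / \<delta>)) + ennreal (real n - c)"
      using cn d0 by (subst ennreal_plus) (auto simp: ac_simps)
    finally have "ennreal c + ennreal (real n - c) \<le> (?low + ennreal (\<delta> * c + real (Suc k) / \<delta>)) + ennreal (real n - c)"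
      using c0 cn by (simp add: ennreal_plus[symmetric] del: ennreal_plus)
    then show ?thesis by (simp add: ennreal_add_left_cancel_le add.commute[of _ "ennreal (real n - c)"])
  qed
  \<comment> \<open>The optimal \<delta> is sqrt ((k + 1) / c), admissible if it is below 1. If
    \<open>c\<close> is at most \<open>k + 1\<close>, the error term alone already exceeds
    \<open>c\<close>.\<close>
  show ?thesis
  proof (cases "c \<le> real (Suc k)")
    case True
    have "c \<le> sqrt (real (Suc k) * c)" using True c0 by (intro real_le_rsqrt) (simp add: power2_eq_square mult_right_mono)
    then have "ennreal c \<le> ennreal (2 * sqrt (real (Suc k) * c))" using c0 by (intro ennreal_leI) simp
    then show ?thesis unfolding c_def[symmetric] by (meson add_increasing zero_le)
  next
    case False
    define a b where "a = sqrt c" and "b = sqrt (real (Suc k))"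
    have ab: "0 < a" "0 < b" "c = a * a" "real (Suc k) = b * b" using False by (auto simp: a_def b_def)
    have "b < a" using False by (simp add: a_def b_def)
    have s: "sqrt (real (Suc k) * c) = b * a" by (simp only: a_def b_def real_sqrt_mult)
    have "(b / a) * c + real (Suc k) / (b / a) = 2 * (b * a)"
      unfolding ab(3,4) using ab(1,2) by (simp add: field_simps)
    then show ?thesis using *[of "b / a"] ab(1,2) \<open>b < a\<close> unfolding c_def[symmetric] s by simp
  qed
qed

text \<open>In a fixed environment the success probabilities p_j vary along a column. The common
  \<open>q = b + e\<close> lies above all of them and is the drift per column; the adapted
  parameters \<open>r j\<close> have boundary means at most p_j / e. Averaging turns each p_j into
  \<open>mean_prob\<close>, and \<open>e\<close> is optimised last.\<close>

lemma columns_indicator_le: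
  assumes E: "E \<in> sets borel" and b: "AE D in env_law P. measure D E \<le> b" "0 \<le> b"
  shows "(\<integral>\<^sup>+u. ennreal (passage (\<lambda>i j. of_bool (snd u (i, j) \<in> E)) k n) \<partial>joint_law P)
    \<le> ennreal (real k * b + 2 * sqrt (real k * (real (Suc n) * mean_prob P E)))"
proof (rule ennreal_le_optimize)
  fix e :: real assume e: "0 < e"
  let ?x = "\<lambda>s i. of_bool (s i \<in> E) :: real"
  have fm: "(\<lambda>X. ennreal (passage (\<lambda>i j. of_bool (X (i, j) \<in> E)) k n)) \<in> borel_measurable weight_space"
    by (intro measurable_compose[OF measurable_prof measurable_ennreal] weight_indicator_measurable E) auto
  have pm: "(\<lambda>F. measure (F j) E) \<in> borel_measurable P" for j
    by (rule measurable_compose[OF env_component_measurable[OF iid] measure_prob_measurable[OF E]])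
  have "AE F in P. measure (F j) E \<le> b" for j
  proof -
    have "AE D in distr P (prob_algebra borel) (\<lambda>F. F j). measure D E \<le> b" using b(1) unfolding iidD(4)[OF iid] .
    then show ?thesis by (rule AE_distrD[OF env_component_measurable[OF iid]])
  qed
  then have AE_all: "AE F in P. \<forall>j. measure (F j) E \<le> b" by (simp add: AE_all_countable)
  have "(\<integral>\<^sup>+u. ennreal (passage (\<lambda>i j. of_bool (snd u (i, j) \<in> E)) k n) \<partial>joint_law P)
      = (\<integral>\<^sup>+F. \<integral>\<^sup>+X. ennreal (passage (\<lambda>i j. of_bool (X (i, j) \<in> E)) k n) \<partial>quenched_law F \<partial>P)"
    by (rule nn_integral_joint_snd[OF fm])
  also have "\<dots> \<le> (\<integral>\<^sup>+F. ennreal (real k * (b + e)) + (\<Sum>j\<le>n. ennreal (measure (F j) E / e)) \<partial>P)"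
  proof (rule nn_integral_mono_AE)
    show "AE F in P. (\<integral>\<^sup>+X. ennreal (passage (\<lambda>i j. of_bool (X (i, j) \<in> E)) k n) \<partial>quenched_law F)
        \<le> ennreal (real k * (b + e)) + (\<Sum>j\<le>n. ennreal (measure (F j) E / e))"
      using AE_all
    proof (rule AE_mp, intro AE_I2 impI)
      fix F assume "F \<in> space P" and Fb: "\<forall>j. measure (F j) E \<le> b"
      then have F: "prob_space (F j)" "sets (F j) = sets borel" for j by (auto simp: env_space_P[OF iid] space_env)
      let ?N = "PiM UNIV F"
      have N: "prob_space ?N" by (intro prob_space_PiM F)
      have sN: "sets ?N = sets row_space" by (rule sets_PiM_cong) (auto simp: F)
      have "(\<integral>\<^sup>+X. ennreal (passage (\<lambda>i j. of_bool (X (i, j) \<in> E)) k n) \<partial>quenched_law F)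
          = (\<integral>\<^sup>+\<omega>. ennreal (passage (\<lambda>i. ?x (\<omega> i)) k n) \<partial>PiM UNIV (\<lambda>_::nat. ?N))"
        unfolding quenched_law_eq_columns[OF F]
        by (subst nn_integral_distr[OF flatten_measurable[OF sN]]) (use fm in simp_all)
      also have "\<dots> \<le> ennreal (real k * (b + e)) + (\<Sum>j\<le>n. ennreal (measure (F j) E / e))"
      proof (cases "b + e < 1")
        \<comment> \<open>No Bernoulli parameter below 1 is available, but then the trivial bound
          \<open>k\<close> is at most \<open>k * (b + e)\<close>.\<close>
        case False
        interpret S: prob_space "PiM UNIV (\<lambda>_::nat. ?N)" by (intro prob_space_PiM N)
        have "(\<integral>\<^sup>+\<omega>. ennreal (passage (\<lambda>i. ?x (\<omega> i)) k n) \<partial>PiM UNIV (\<lambda>_::nat. ?N)) \<le> (\<integral>\<^sup>+\<omega>. ennreal (real k) \<partial>PiM UNIV (\<lambda>_::nat. ?N))"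
          by (intro nn_integral_mono ennreal_leI passage_le_rows) auto
        also have "\<dots> = ennreal (real k)" by (simp add: S.emeasure_space_1)
        also have "\<dots> \<le> ennreal (real k * (b + e))" using False by (intro ennreal_leI) (simp add: mult_le_cancel_left1)
        finally show ?thesis by (intro add_increasing2) auto
      next
        case True
        define q where "q = b + e"
        have q: "0 < q" "q < 1" using True b e by (auto simp: q_def)
        define r where "r j = measure (F j) E * (1 - q) / (q * (1 - measure (F j) E))" for j
        have pj: "0 \<le> measure (F j) E" "measure (F j) E \<le> b" "measure (F j) E < q" for j using Fb e by (auto simp: q_def le_less_trans[of _ b])
        have pq: "measure (F j) E * (1 - q) < q * (1 - measure (F j) E)" for j using pj(3)[of j] by (simp add: algebra_simps)
        have den: "0 < q * (1 - measure (F j) E)" for j using q pj(3)[of j] by simp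
        have r: "0 \<le> r j" "r j < 1" for j unfolding r_def using pj(1)[of j] q den[of j] pq[of j] by (auto simp: divide_less_eq)
        have ratio: "r j / (1 - r j) \<le> measure (F j) E / e" for j
        proof -
          let ?p = "measure (F j) E"
          have "1 - r j = (q * (1 - ?p) - ?p * (1 - q)) / (q * (1 - ?p))"
            unfolding r_def by (simp only: diff_divide_distrib divide_self[OF less_imp_neq[OF den[of j], symmetric]])
          also have "q * (1 - ?p) - ?p * (1 - q) = q - ?p" by (simp add: algebra_simps)
          finally have "1 - r j = (q - ?p) / (q * (1 - ?p))" .
          then have "r j / (1 - r j) = (?p * (1 - q) / (q * (1 - ?p))) / ((q - ?p) / (q * (1 - ?p)))"
            by (simp only: r_def)
          also have "\<dots> = ?p * (1 - q) / (q - ?p)"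
          proof -
            have "x / d / (y / d) = x / y" if "0 < d" for x y d :: real using that by simp
            then show ?thesis using den[of j] by blast
          qed
          also have "\<dots> \<le> ?p * 1 / e" using pj[of j] q e by (intro frac_le mult_left_mono mult_nonneg_nonneg) (auto simp: q_def)
          finally show ?thesis by simp
        qed
        have "(\<integral>\<^sup>+\<omega>. ennreal (passage (\<lambda>i. ?x (\<omega> i)) k n) \<partial>PiM UNIV (\<lambda>_::nat. ?N)) \<le> ennreal (\<Sum>j\<le>n. r j / (1 - r j)) + of_nat k * ennreal q"
        proof (rule nn_integral_passage_le[OF N indicator_row_measurable[OF E sN]])
          fix t :: "nat \<Rightarrow> real" assume t: "mono t" "0 \<le> t 0"
          show "(\<integral>\<^sup>+s. exit_value r n (row_step (?x s) t) \<partial>?N) \<le> exit_value r n t + ennreal q"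
          proof (rule exit_value_row_le)
            show "measure (F i) E * (1 - q) = r i * q * (1 - measure (F i) E)" for i
              unfolding r_def using q pj(3)[of i] by (simp add: field_simps)
          qed (use F E q r t in auto)
        qed (use r in auto)
        also have "\<dots> = (\<Sum>j\<le>n. ennreal (r j / (1 - r j))) + ennreal (real k * q)"
          using r q by (simp add: ennreal_of_nat_eq_real_of_nat ennreal_mult[symmetric] less_imp_le)
        also have "\<dots> \<le> (\<Sum>j\<le>n. ennreal (measure (F j) E / e)) + ennreal (real k * (b + e))"
          unfolding q_def by (intro add_right_mono sum_mono ennreal_leI ratio)
        finally show ?thesis by (simp add: add.commute)
      qed
      finally show "(\<integral>\<^sup>+X. ennreal (passage (\<lambda>i j. of_bool (X (i, j) \<in> E)) k n) \<partial>quenched_law F)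
        \<le> ennreal (real k * (b + e)) + (\<Sum>j\<le>n. ennreal (measure (F j) E / e))" .
    qed
  qed
  also have "\<dots> = ennreal (real k * (b + e)) + (\<Sum>j\<le>n. ennreal (mean_prob P E / e))"
  proof -
    have "(\<integral>\<^sup>+F. ennreal (measure (F j) E / e) \<partial>P) = ennreal (mean_prob P E / e)" for j
    proof -
      have "(\<integral>\<^sup>+F. ennreal (measure (F j) E / e) \<partial>P) = (\<integral>\<^sup>+D. ennreal (measure D E / e) \<partial>env_law P)"
        by (rule nn_integral_env_law[OF iid, of "\<lambda>D. ennreal (measure D E / e)"]) (use measure_prob_measurable[OF E] in measurable)
      also have "\<dots> = ennreal (\<integral>D. measure D E / e \<partial>env_law P)"
        using mean_prob_integrable[OF E] e by (intro nn_integral_eq_integral) auto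
      finally show ?thesis by (simp add: mean_prob_def)
    qed
    then show ?thesis using pm by (subst nn_integral_add) (auto simp: nn_integral_sum P.emeasure_space_1)
  qed
  also have "\<dots> = ennreal (real k * b + real k * e + real (Suc n) * mean_prob P E / e)"
  proof -
    have "(\<Sum>j\<le>n. ennreal (mean_prob P E / e)) = ennreal (real (Suc n) * mean_prob P E / e)"
      using mean_prob_bounds[OF E] e by (subst sum_ennreal) auto
    then show ?thesis using b e mean_prob_bounds[OF E]
      by (simp add: ennreal_plus[symmetric] distrib_left del: ennreal_plus of_nat_Suc)
  qed
  finally show "(\<integral>\<^sup>+u. ennreal (passage (\<lambda>i j. of_bool (snd u (i, j) \<in> E)) k n) \<partial>joint_law P)
    \<le> ennreal (real k * b + real k * e + real (Suc n) * mean_prob P E / e)" .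
qed (use b mean_prob_bounds[OF E] in auto)

end

section \<open>Truncation\<close>

lemma measurable_last_passage:
  assumes "\<And>z. (\<lambda>u. X u z) \<in> borel_measurable M"
  shows "(\<lambda>u. last_passage (X u) k n) \<in> borel_measurable M"
proof (induction k arbitrary: n)
  case 0
  show ?case using assms by (induction n) simp_all
next
  case (Suc k)
  show ?case
  proof (induction n)
    case 0
    then show ?case using assms Suc[of 0] by simp
  next
    case (Suc n)
    then show ?case
      using assms \<open>\<And>n. (\<lambda>u. last_passage (X u) k n) \<in> borel_measurable M\<close>[of "Suc n"] by simp
  qed
qed

lemma low_prof_le_passage:
  assumes "\<And>i j. 0 \<le> w j i"
  shows "low_prof w n k \<le> passage w n k"
proof (induction n arbitrary: k)
  case (Suc n)
  have "low_step (w n) (low_prof w n) k \<le> row_step (w n) (passage w n) k"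
  proof (cases k)
    case 0
    then show ?thesis using Suc[of 0] by simp
  next
    case (Suc l)
    have "low_step (w n) (low_prof w n) k \<le> low_prof w n k + w n k" using Suc by simp
    also have "\<dots> \<le> passage w n k + w n k" using \<open>\<And>k. low_prof w n k \<le> passage w n k\<close> by simp
    also have "\<dots> \<le> row_step (w n) (passage w n) k" by (rule row_step_ge)
    finally show ?thesis .
  qed
  then show ?case by simp
qed simp

text \<open>A maximum of integrals is at most the integral of the maximum, applied at every step of
  the recursion. Jensen for a sublinear function, hence valid for measures of any total mass such as
  the one over levels.\<close>

lemma passage_integral_le:
  fixes W :: "'x \<Rightarrow> nat \<Rightarrow> nat \<Rightarrow> real"
  assumes V: "\<And>j i. 0 \<le> V j i" and W: "\<And>x j i. 0 \<le> W x j i" and Wm: "\<And>j i. (\<lambda>x. W x j i) \<in> borel_measurable \<mu>"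
    and VW: "\<And>j i. ennreal (V j i) = (\<integral>\<^sup>+x. ennreal (W x j i) \<partial>\<mu>)"
  shows "ennreal (passage V n k) \<le> (\<integral>\<^sup>+x. ennreal (passage (W x) n k) \<partial>\<mu>)"
proof (induction n arbitrary: k)
  case (Suc n)
  have Pm: "(\<lambda>x. passage (W x) n i) \<in> borel_measurable \<mu>" for n i by (rule measurable_prof[OF Wm]) auto
  have P0: "0 \<le> passage (W x) n i" "0 \<le> passage V n i" for x n i by (auto intro!: passage_nonneg W V)
  have step: "ennreal (passage V n i + V n i) \<le> (\<integral>\<^sup>+x. ennreal (passage (W x) (Suc n) i) \<partial>\<mu>)" for i
  proof -
    have "ennreal (passage V n i + V n i) \<le> (\<integral>\<^sup>+x. ennreal (passage (W x) n i) \<partial>\<mu>) + (\<integral>\<^sup>+x. ennreal (W x n i) \<partial>\<mu>)"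
      using Suc[of i] P0 V by (simp add: ennreal_plus VW[symmetric] add_right_mono)
    also have "\<dots> = (\<integral>\<^sup>+x. ennreal (passage (W x) n i) + ennreal (W x n i) \<partial>\<mu>)"
      using Pm Wm by (intro nn_integral_add[symmetric]) auto
    also have "\<dots> \<le> (\<integral>\<^sup>+x. ennreal (passage (W x) (Suc n) i) \<partial>\<mu>)"
      using P0 W row_step_ge[of "passage (W _) n" i "W _ n"]
      by (intro nn_integral_mono) (simp add: ennreal_plus[symmetric] ennreal_leI del: ennreal_plus)
    finally show ?thesis .
  qed
  have "ennreal (row_step (V n) (passage V n) k) \<le> (\<integral>\<^sup>+x. ennreal (passage (W x) (Suc n) k) \<partial>\<mu>)"
  proof (induction k)
    case 0
    then show ?case using step[of 0] by simp
  next
    case (Suc k)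
    have "(\<integral>\<^sup>+x. ennreal (passage (W x) (Suc n) k) \<partial>\<mu>) \<le> (\<integral>\<^sup>+x. ennreal (passage (W x) (Suc n) (Suc k)) \<partial>\<mu>)"
      by (intro nn_integral_mono ennreal_leI) simp
    with Suc step[of "Suc k"] show ?case by (auto simp: max_def simp del: prof.simps intro: order_trans)
  qed
  then show ?case by simp
qed simp

lemma low_prof_integral_ge:
  fixes W :: "'x \<Rightarrow> nat \<Rightarrow> nat \<Rightarrow> real"
  assumes V: "\<And>j i. 0 \<le> V j i" and W: "\<And>x j i. 0 \<le> W x j i" and Wm: "\<And>j i. (\<lambda>x. W x j i) \<in> borel_measurable \<mu>"
    and VW: "\<And>j i. ennreal (V j i) = (\<integral>\<^sup>+x. ennreal (W x j i) \<partial>\<mu>)"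
  shows "(\<integral>\<^sup>+x. ennreal (low_prof (W x) n k) \<partial>\<mu>) \<le> ennreal (low_prof V n k)"
proof (induction n arbitrary: k)
  case (Suc n)
  have Pm: "(\<lambda>x. low_prof (W x) n i) \<in> borel_measurable \<mu>" for n i by (rule measurable_low_prof[OF Wm])
  have P0: "0 \<le> low_prof (W x) n i" "0 \<le> low_prof V n i" for x n i by (auto intro!: low_prof_nonneg W V)
  have low_step_le: "low_step x t i \<le> t i + x i" for x t i by (cases i) auto
  have step: "(\<integral>\<^sup>+x. ennreal (low_prof (W x) (Suc n) i) \<partial>\<mu>) \<le> ennreal (low_prof V n i + V n i)" for i
  proof -
    have "(\<integral>\<^sup>+x. ennreal (low_prof (W x) (Suc n) i) \<partial>\<mu>) \<le> (\<integral>\<^sup>+x. ennreal (low_prof (W x) n i) + ennreal (W x n i) \<partial>\<mu>)"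
      using P0 W low_step_le[of "W _ n" "low_prof (W _) n" i]
      by (intro nn_integral_mono) (simp add: ennreal_plus[symmetric] ennreal_leI del: ennreal_plus)
    also have "\<dots> = (\<integral>\<^sup>+x. ennreal (low_prof (W x) n i) \<partial>\<mu>) + (\<integral>\<^sup>+x. ennreal (W x n i) \<partial>\<mu>)"
      using Pm Wm by (intro nn_integral_add) auto
    also have "\<dots> \<le> ennreal (low_prof V n i + V n i)"
      using Suc[of i] P0 V by (simp add: ennreal_plus VW[symmetric] add_right_mono)
    finally show ?thesis .
  qed
  have "(\<integral>\<^sup>+x. ennreal (low_prof (W x) (Suc n) k) \<partial>\<mu>) \<le> ennreal (low_step (V n) (low_prof V n) k)"
  proof (induction k)
    case 0
    then show ?case using step[of 0] by simp
  next
    case (Suc k)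
    have "(\<integral>\<^sup>+x. ennreal (low_prof (W x) (Suc n) (Suc k)) \<partial>\<mu>) \<le> (\<integral>\<^sup>+x. ennreal (low_prof (W x) (Suc n) k) \<partial>\<mu>)"
      by (intro nn_integral_mono ennreal_leI) simp
    with Suc step[of "Suc k"] show ?case by (auto simp: min_def simp del: low_prof.simps intro: order_trans)
  qed
  then show ?case by simp
qed simp

text \<open>The sign \<open>s\<close>, either 1 or -1, selects the upper or the lower tail, so that
  both are handled by the same lemmas.\<close>

definition excess :: "real \<Rightarrow> real \<Rightarrow> real \<Rightarrow> real" where
  "excess s M v = max (s * v - M) 0"

definition tail_set :: "real \<Rightarrow> real \<Rightarrow> real set" where
  "tail_set s x = {v. x < s * v}"

lemma tail_set_borel [measurable]: "tail_set s x \<in> sets borel"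
  unfolding tail_set_def by measurable

lemma excess_nonneg: "0 \<le> excess s M v"
  by (simp add: excess_def)

lemma excess_measurable [measurable]: "excess s M \<in> borel_measurable borel"
  unfolding excess_def[abs_def] by measurable

lemma excess_layers: "ennreal (excess s M v) = (\<integral>\<^sup>+x. ennreal (of_bool (M \<le> x \<and> v \<in> tail_set s x)) \<partial>lborel)"
proof -
  have "(\<integral>\<^sup>+x. ennreal (of_bool (M \<le> x \<and> v \<in> tail_set s x)) \<partial>lborel) = (\<integral>\<^sup>+x. indicator {M..<s * v} x \<partial>lborel)"
    by (intro nn_integral_cong) (auto simp: indicator_def tail_set_def)
  also have "\<dots> = ennreal (excess s M v)"
    by (cases "M \<le> s * v") (auto simp: excess_def)
  finally show ?thesis by simp
qed

definition tail_prob :: "(nat \<Rightarrow> real measure) measure \<Rightarrow> real \<Rightarrow> real \<Rightarrow> real" where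
  "tail_prob P s x = mean_prob P (tail_set s x)"

definition tail_sup :: "(nat \<Rightarrow> real measure) measure \<Rightarrow> real \<Rightarrow> real \<Rightarrow> real" where
  "tail_sup P s x = enn2real (esssup P (\<lambda>F. ennreal (measure (F 0) (tail_set s x))))"

definition tail_mean :: "(nat \<Rightarrow> real measure) measure \<Rightarrow> real \<Rightarrow> real \<Rightarrow> ennreal" where
  "tail_mean P s M = (\<integral>\<^sup>+x\<in>{M..}. ennreal (tail_prob P s x) \<partial>lborel)"

text \<open>The square root comes from the fluctuation bound of one level, which is proportional to
  the root of its probability. The quantity at height \<open>M\<close> governs the truncation error
  and tends to 0 with growing \<open>M\<close>.\<close>

definition tail_sqrt :: "(nat \<Rightarrow> real measure) measure \<Rightarrow> real \<Rightarrow> real \<Rightarrow> ennreal" where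
  "tail_sqrt P s M = (\<integral>\<^sup>+x\<in>{M..}. ennreal (sqrt (tail_prob P s x)) \<partial>lborel)"

definition tail_supint :: "(nat \<Rightarrow> real measure) measure \<Rightarrow> real \<Rightarrow> real \<Rightarrow> ennreal" where
  "tail_supint P s M = (\<integral>\<^sup>+x\<in>{M..}. ennreal (tail_sup P s x) \<partial>lborel)"

definition clip :: "real \<Rightarrow> real \<Rightarrow> real" where
  "clip M v = max (- M) (min M v)"

lemma clip_excess: "0 \<le> M \<Longrightarrow> v = clip M v + excess 1 M v - excess (- 1) M v"
  by (auto simp: clip_def excess_def)

lemma clip_bound: "0 \<le> M \<Longrightarrow> \<bar>clip M v\<bar> \<le> M"
  by (auto simp: clip_def)

lemma clip_measurable [measurable]: "clip M \<in> borel_measurable borel"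
  unfolding clip_def[abs_def] by measurable

lemma antimono_borel: "antimono f \<Longrightarrow> (f :: real \<Rightarrow> real) \<in> borel_measurable borel"
proof -
  assume "antimono f"
  then have "(\<lambda>x. - f x) \<in> borel_measurable borel" by (intro borel_measurable_mono) (auto simp: mono_def antimono_def)
  from borel_measurable_uminus[OF this] show "f \<in> borel_measurable borel" by simp
qed

context
  fixes P :: "(nat \<Rightarrow> real measure) measure"
  assumes iid: "iid_env P"
begin

interpretation EL: prob_space "env_law P" by (rule prob_space_env_law[OF iid])
interpretation P: prob_space P by (rule iidD(1)[OF iid])
interpretation J: prob_space "joint_law P" by (rule joint_law_measure(2)[OF iid])

lemma tail_prob_bounds: "0 \<le> tail_prob P s x" "tail_prob P s x \<le> 1"
  unfolding tail_prob_def using mean_prob_bounds[OF iid] by auto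

lemma tail_prob_antimono: "antimono (tail_prob P s)"
proof
  fix x y :: real assume "x \<le> y"
  then have sub: "tail_set s y \<subseteq> tail_set s x" by (auto simp: tail_set_def)
  show "tail_prob P s y \<le> tail_prob P s x"
    unfolding tail_prob_def mean_prob_def
  proof (rule integral_mono_AE)
    show "AE D in env_law P. measure D (tail_set s y) \<le> measure D (tail_set s x)"
    proof (rule AE_I2)
      fix D assume "D \<in> space (env_law P)"
      then have D: "prob_space D" "sets D = sets borel" by (auto simp: space_env_law[OF iid] space_prob_algebra)
      interpret D: prob_space D by fact
      show "measure D (tail_set s y) \<le> measure D (tail_set s x)"
        using sub D by (intro D.finite_measure_mono) auto
    qed
  qed (auto intro: mean_prob_integrable[OF iid])
qed

lemma tail_prob_measurable [measurable]: "tail_prob P s \<in> borel_measurable borel"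
  by (rule antimono_borel[OF tail_prob_antimono])

lemma env_measure_measurable: "E \<in> sets borel \<Longrightarrow> (\<lambda>F. measure (F 0) E) \<in> borel_measurable P"
  by (rule measurable_compose[OF env_component_measurable[OF iid] measure_prob_measurable])

lemma env_measure_le_1: "F \<in> space P \<Longrightarrow> measure (F j) E \<le> 1"
  by (auto simp: env_space_P[OF iid] space_env prob_space.prob_le_1)

lemma tail_esssup_le_1: "esssup P (\<lambda>F. ennreal (measure (F 0) (tail_set s x))) \<le> 1"
  by (rule esssup_I) (use env_measure_measurable env_measure_le_1 in auto)

lemma ennreal_tail_sup: "ennreal (tail_sup P s x) = esssup P (\<lambda>F. ennreal (measure (F 0) (tail_set s x)))"
  unfolding tail_sup_def using tail_esssup_le_1[of s x] by (intro ennreal_enn2real) (auto intro: le_less_trans)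

lemma tail_sup_nonneg: "0 \<le> tail_sup P s x"
  by (simp add: tail_sup_def)

lemma tail_sup_AE: "AE D in env_law P. measure D (tail_set s x) \<le> tail_sup P s x"
proof -
  have "AE F in P. measure (F 0) (tail_set s x) \<le> tail_sup P s x"
    using esssup_AE[where M = P and f = "\<lambda>F. ennreal (measure (F 0) (tail_set s x))"]
    unfolding ennreal_tail_sup[symmetric] using tail_sup_nonneg by (simp add: ennreal_le_iff)
  then show ?thesis
    unfolding env_law_def
    by (subst AE_distr_iff[OF env_component_measurable[OF iid]])
       (use measure_prob_measurable[OF tail_set_borel] in \<open>auto intro!: borel_measurable_le\<close>)
qed

lemma tail_sup_antimono: "antimono (tail_sup P s)"
proof
  fix x y :: real assume "x \<le> y"
  then have sub: "tail_set s y \<subseteq> tail_set s x" by (auto simp: tail_set_def)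
  have "esssup P (\<lambda>F. ennreal (measure (F 0) (tail_set s y))) \<le> esssup P (\<lambda>F. ennreal (measure (F 0) (tail_set s x)))"
  proof (rule esssup_AE_mono)
    show "AE F in P. ennreal (measure (F 0) (tail_set s y)) \<le> ennreal (measure (F 0) (tail_set s x))"
    proof (rule AE_I2, rule ennreal_leI)
      fix F assume "F \<in> space P"
      then have D: "prob_space (F 0)" "sets (F 0) = sets borel" by (auto simp: env_space_P[OF iid] space_env)
      interpret D: prob_space "F 0" by fact
      show "measure (F 0) (tail_set s y) \<le> measure (F 0) (tail_set s x)"
        using sub D by (intro D.finite_measure_mono) auto
    qed
  qed (use env_measure_measurable in auto)
  then show "tail_sup P s y \<le> tail_sup P s x"
    using tail_sup_nonneg[of s x] by (simp add: ennreal_tail_sup[symmetric] ennreal_le_iff)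
qed

lemma tail_sup_measurable [measurable]: "tail_sup P s \<in> borel_measurable borel"
  by (rule antimono_borel[OF tail_sup_antimono])

lemma layer_measurable:
  "(\<lambda>(u, x). of_bool (M \<le> x \<and> snd u z \<in> tail_set s x) :: real) \<in> borel_measurable (joint_law P \<Otimes>\<^sub>M lborel)"
proof -
  have "(\<lambda>u. snd u z) \<in> borel_measurable (joint_law P)"
    by (rule joint_comp_measurable[OF iid]) (simp add: weight_space_def)
  then have [measurable]: "(\<lambda>q. snd (fst q) z) \<in> borel_measurable (joint_law P \<Otimes>\<^sub>M lborel)"
    using measurable_compose[OF measurable_fst] by auto
  have "Measurable.pred (joint_law P \<Otimes>\<^sub>M lborel) (\<lambda>q. M \<le> snd q \<and> snd q < s * snd (fst q) z)"
    by measurable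
  then show ?thesis unfolding tail_set_def split_beta' by simp
qed

text \<open>One Fubini argument for the maximum over rows, the minimum over rows and the maximum
  over columns. The constraint \<open>M \<le> x\<close> sits inside the indicator until
  \<open>L0\<close> allows it to become the domain of integration.\<close>

lemma joint_layers:
  fixes L :: "(nat \<Rightarrow> nat \<Rightarrow> real) \<Rightarrow> real"
  assumes Lm: "\<And>w :: ((nat \<Rightarrow> real measure) \<times> (nat \<times> nat \<Rightarrow> real)) \<times> real \<Rightarrow> nat \<Rightarrow> nat \<Rightarrow> real.
      (\<And>j i. (\<lambda>q. w q j i) \<in> borel_measurable (joint_law P \<Otimes>\<^sub>M lborel)) \<Longrightarrow> (\<lambda>q. L (w q)) \<in> borel_measurable (joint_law P \<Otimes>\<^sub>M lborel)"
    and L0: "L (\<lambda>_ _. 0) = 0"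
  shows "(\<integral>\<^sup>+u. \<integral>\<^sup>+x. ennreal (L (\<lambda>j i. of_bool (M \<le> x \<and> snd u (f j i) \<in> tail_set s x))) \<partial>lborel \<partial>joint_law P)
    = (\<integral>\<^sup>+x\<in>{M..}. (\<integral>\<^sup>+u. ennreal (L (\<lambda>j i. of_bool (snd u (f j i) \<in> tail_set s x))) \<partial>joint_law P) \<partial>lborel)"
proof -
  interpret pair_sigma_finite "joint_law P" lborel ..
  have "(\<lambda>q. L (\<lambda>j i. of_bool (M \<le> snd q \<and> snd (fst q) (f j i) \<in> tail_set s (snd q)))) \<in> borel_measurable (joint_law P \<Otimes>\<^sub>M lborel)"
    by (rule Lm) (use layer_measurable in \<open>simp add: split_beta'\<close>)
  then have "(\<lambda>(u, x). ennreal (L (\<lambda>j i. of_bool (M \<le> x \<and> snd u (f j i) \<in> tail_set s x)))) \<in> borel_measurable (joint_law P \<Otimes>\<^sub>M lborel)"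
    by (simp add: split_beta')
  from Fubini'[OF this]
  have "(\<integral>\<^sup>+u. \<integral>\<^sup>+x. ennreal (L (\<lambda>j i. of_bool (M \<le> x \<and> snd u (f j i) \<in> tail_set s x))) \<partial>lborel \<partial>joint_law P)
    = (\<integral>\<^sup>+x. \<integral>\<^sup>+u. ennreal (L (\<lambda>j i. of_bool (M \<le> x \<and> snd u (f j i) \<in> tail_set s x))) \<partial>joint_law P \<partial>lborel)" by simp
  also have "\<dots> = (\<integral>\<^sup>+x\<in>{M..}. (\<integral>\<^sup>+u. ennreal (L (\<lambda>j i. of_bool (snd u (f j i) \<in> tail_set s x))) \<partial>joint_law P) \<partial>lborel)"
    by (intro nn_integral_cong) (auto simp: indicator_def L0)
  finally show ?thesis .
qed

lemma layer_slice_measurable: "(\<lambda>x. of_bool (M \<le> x \<and> v \<in> tail_set s x) :: real) \<in> borel_measurable lborel"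
  unfolding tail_set_def by measurable

lemma nn_integral_tail_comb:
  assumes "0 \<le> a" "0 \<le> b" and [measurable]: "g \<in> borel_measurable borel" and "\<And>x. 0 \<le> g x"
  shows "(\<integral>\<^sup>+x\<in>{M..}. ennreal (a * g x + b * sqrt (tail_prob P s x)) \<partial>lborel)
    = ennreal a * (\<integral>\<^sup>+x\<in>{M..}. ennreal (g x) \<partial>lborel) + ennreal b * tail_sqrt P s M"
proof -
  have "(\<integral>\<^sup>+x\<in>{M..}. ennreal (a * g x + b * sqrt (tail_prob P s x)) \<partial>lborel)
      = (\<integral>\<^sup>+x. ennreal a * (ennreal (g x) * indicator {M..} x) + ennreal b * (ennreal (sqrt (tail_prob P s x)) * indicator {M..} x) \<partial>lborel)"
    using assms(1,2,4) tail_prob_bounds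
    by (intro nn_integral_cong) (auto simp: indicator_def ennreal_mult[symmetric] ennreal_plus[symmetric] simp del: ennreal_plus)
  also have "\<dots> = ennreal a * (\<integral>\<^sup>+x\<in>{M..}. ennreal (g x) \<partial>lborel) + ennreal b * tail_sqrt P s M"
    unfolding tail_sqrt_def by (subst nn_integral_add) (auto simp: nn_integral_cmult)
  finally show ?thesis .
qed

text \<open>The excess is a superposition of indicator weights over the levels
  \<open>x \<ge> M\<close>; each level obeys \<open>passage_indicator_le\<close>, and its two terms
  integrate to \<open>tail_mean\<close> and \<open>tail_sqrt\<close>.\<close>

lemma excess_passage_le:
  "(\<integral>\<^sup>+u. ennreal (passage (\<lambda>j i. excess s M (snd u (i, j))) n k) \<partial>joint_law P)
    \<le> ennreal (real n) * tail_mean P s M + ennreal (2 * sqrt (real n * real (Suc k))) * tail_sqrt P s M"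
proof -
  have "(\<integral>\<^sup>+u. ennreal (passage (\<lambda>j i. excess s M (snd u (i, j))) n k) \<partial>joint_law P)
    \<le> (\<integral>\<^sup>+u. \<integral>\<^sup>+x. ennreal (passage (\<lambda>j i. of_bool (M \<le> x \<and> snd u (i, j) \<in> tail_set s x)) n k) \<partial>lborel \<partial>joint_law P)"
    by (intro nn_integral_mono passage_integral_le excess_nonneg layer_slice_measurable excess_layers) auto
  also have "\<dots> = (\<integral>\<^sup>+x\<in>{M..}. (\<integral>\<^sup>+u. ennreal (passage (\<lambda>j i. of_bool (snd u (i, j) \<in> tail_set s x)) n k) \<partial>joint_law P) \<partial>lborel)"
    by (rule joint_layers[where L = "\<lambda>w. passage w n k" and f = "\<lambda>j i. (i, j)"])
       (auto intro: measurable_prof simp: passage_const)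
  also have "\<dots> \<le> (\<integral>\<^sup>+x\<in>{M..}. ennreal (real n * tail_prob P s x + 2 * sqrt (real n * real (Suc k)) * sqrt (tail_prob P s x)) \<partial>lborel)"
  proof (intro nn_integral_mono mult_right_mono)
    fix x
    have "sqrt (real (Suc k) * (real n * tail_prob P s x)) = sqrt (real n * real (Suc k)) * sqrt (tail_prob P s x)"
      by (simp only: real_sqrt_mult mult_ac)
    then show "(\<integral>\<^sup>+u. ennreal (passage (\<lambda>j i. of_bool (snd u (i, j) \<in> tail_set s x)) n k) \<partial>joint_law P)
        \<le> ennreal (real n * tail_prob P s x + 2 * sqrt (real n * real (Suc k)) * sqrt (tail_prob P s x))"
      using passage_indicator_le[OF iid tail_set_borel, of s x n k] unfolding tail_prob_def[symmetric] by (simp only: mult.assoc)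
  qed auto
  also have "\<dots> = ennreal (real n) * tail_mean P s M + ennreal (2 * sqrt (real n * real (Suc k))) * tail_sqrt P s M"
    unfolding tail_mean_def by (rule nn_integral_tail_comb) (auto simp: tail_prob_bounds)
  finally show ?thesis .
qed

lemma excess_low_ge:
  "ennreal (real n) * tail_mean P s M
    \<le> (\<integral>\<^sup>+u. ennreal (low_prof (\<lambda>j i. excess s M (snd u (i, j))) n k) \<partial>joint_law P)
      + ennreal (2 * sqrt (real n * real (Suc k))) * tail_sqrt P s M"
proof -
  define low where "low x = (\<integral>\<^sup>+u. ennreal (low_prof (\<lambda>j i. of_bool (snd u (i, j) \<in> tail_set s x)) n k) \<partial>joint_law P)" for x
  let ?c = "2 * sqrt (real n * real (Suc k))"
  have L0: "low_prof (\<lambda>_ _. 0) n k = 0"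
    using low_prof_complement[of 0 "\<lambda>_ _. 0" n k] passage_const[of "\<lambda>_. 0" n k] by simp
  have lm: "low \<in> borel_measurable borel"
  proof -
    have "(\<lambda>(x, u). ennreal (low_prof (\<lambda>j i. of_bool (snd u (i, j) \<in> tail_set s x)) n k)) \<in> borel_measurable (borel \<Otimes>\<^sub>M joint_law P)"
    proof -
      have "(\<lambda>q. of_bool (snd (snd q) z \<in> tail_set s (fst q)) :: real) \<in> borel_measurable (borel \<Otimes>\<^sub>M joint_law P)" for z
      proof -
        have "(\<lambda>u. snd u z) \<in> borel_measurable (joint_law P)"
          by (rule joint_comp_measurable[OF iid]) (simp add: weight_space_def)
        then have [measurable]: "(\<lambda>q. snd (snd q) z) \<in> borel_measurable (borel \<Otimes>\<^sub>M joint_law P)"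
          using measurable_compose[OF measurable_snd] by auto
        have "Measurable.pred (borel \<Otimes>\<^sub>M joint_law P) (\<lambda>q. fst q < s * snd (snd q) z)" by measurable
        then show ?thesis unfolding tail_set_def by simp
      qed
      then show ?thesis unfolding split_beta'
        by (intro measurable_compose[OF measurable_low_prof measurable_ennreal])
    qed
    from J.borel_measurable_nn_integral[OF this] show ?thesis unfolding low_def by simp
  qed
  have "ennreal (real n) * tail_mean P s M = (\<integral>\<^sup>+x\<in>{M..}. ennreal (real n * tail_prob P s x) \<partial>lborel)"
    unfolding tail_mean_def
    by (subst nn_integral_cmult[symmetric]) (auto intro!: nn_integral_cong simp: indicator_def ennreal_mult tail_prob_bounds)
  also have "\<dots> \<le> (\<integral>\<^sup>+x. low x * indicator {M..} x + ennreal ?c * (ennreal (sqrt (tail_prob P s x)) * indicator {M..} x) \<partial>lborel)"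
  proof (rule nn_integral_mono)
    fix x
    have "sqrt (real (Suc k) * (real n * tail_prob P s x)) = sqrt (real n * real (Suc k)) * sqrt (tail_prob P s x)"
      by (simp only: real_sqrt_mult mult_ac)
    then have "ennreal (real n * tail_prob P s x) \<le> low x + ennreal (?c * sqrt (tail_prob P s x))"
      using low_indicator_ge[OF iid tail_set_borel, of n s x k] unfolding tail_prob_def[symmetric] low_def by (simp only: mult.assoc)
    also have "ennreal (?c * sqrt (tail_prob P s x)) = ennreal ?c * ennreal (sqrt (tail_prob P s x))"
      by (rule ennreal_mult) (auto simp: tail_prob_bounds)
    finally show "ennreal (real n * tail_prob P s x) * indicator {M..} x
      \<le> low x * indicator {M..} x + ennreal ?c * (ennreal (sqrt (tail_prob P s x)) * indicator {M..} x)"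
      by (auto simp: indicator_def)
  qed
  also have "\<dots> = (\<integral>\<^sup>+x\<in>{M..}. low x \<partial>lborel) + ennreal ?c * tail_sqrt P s M"
    unfolding tail_sqrt_def using lm by (subst nn_integral_add) (auto simp: nn_integral_cmult)
  also have "(\<integral>\<^sup>+x\<in>{M..}. low x \<partial>lborel) = (\<integral>\<^sup>+u. \<integral>\<^sup>+x. ennreal (low_prof (\<lambda>j i. of_bool (M \<le> x \<and> snd u (i, j) \<in> tail_set s x)) n k) \<partial>lborel \<partial>joint_law P)"
    unfolding low_def
    by (rule joint_layers[where L = "\<lambda>w. low_prof w n k" and f = "\<lambda>j i. (i, j)", symmetric])
       (auto intro: measurable_low_prof simp: L0)
  also have "\<dots> \<le> (\<integral>\<^sup>+u. ennreal (low_prof (\<lambda>j i. excess s M (snd u (i, j))) n k) \<partial>joint_law P)"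
    by (intro nn_integral_mono low_prof_integral_ge excess_nonneg layer_slice_measurable excess_layers) auto
  finally show ?thesis by (simp add: add_right_mono)
qed

text \<open>The same superposition for the horizontal steps. The almost sure bound \<open>b\<close>
  of a level is its essential supremum, which integrates to \<open>tail_supint\<close>.\<close>

lemma excess_columns_le:
  "(\<integral>\<^sup>+u. ennreal (passage (\<lambda>i j. excess s M (snd u (i, j))) k n) \<partial>joint_law P)
    \<le> ennreal (real k) * tail_supint P s M + ennreal (2 * sqrt (real k * real (Suc n))) * tail_sqrt P s M"
proof -
  have "(\<integral>\<^sup>+u. ennreal (passage (\<lambda>i j. excess s M (snd u (i, j))) k n) \<partial>joint_law P)
    \<le> (\<integral>\<^sup>+u. \<integral>\<^sup>+x. ennreal (passage (\<lambda>i j. of_bool (M \<le> x \<and> snd u (i, j) \<in> tail_set s x)) k n) \<partial>lborel \<partial>joint_law P)"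
    by (intro nn_integral_mono passage_integral_le excess_nonneg layer_slice_measurable excess_layers) auto
  also have "\<dots> = (\<integral>\<^sup>+x\<in>{M..}. (\<integral>\<^sup>+u. ennreal (passage (\<lambda>i j. of_bool (snd u (i, j) \<in> tail_set s x)) k n) \<partial>joint_law P) \<partial>lborel)"
    by (rule joint_layers[where L = "\<lambda>w. passage w k n" and f = "\<lambda>i j. (i, j)"])
       (auto intro: measurable_prof simp: passage_const)
  also have "\<dots> \<le> (\<integral>\<^sup>+x\<in>{M..}. ennreal (real k * tail_sup P s x + 2 * sqrt (real k * real (Suc n)) * sqrt (tail_prob P s x)) \<partial>lborel)"
  proof (intro nn_integral_mono mult_right_mono)
    fix x
    have "sqrt (real k * (real (Suc n) * tail_prob P s x)) = sqrt (real k * real (Suc n)) * sqrt (tail_prob P s x)"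
      by (simp only: real_sqrt_mult mult_ac)
    then show "(\<integral>\<^sup>+u. ennreal (passage (\<lambda>i j. of_bool (snd u (i, j) \<in> tail_set s x)) k n) \<partial>joint_law P)
        \<le> ennreal (real k * tail_sup P s x + 2 * sqrt (real k * real (Suc n)) * sqrt (tail_prob P s x))"
      using columns_indicator_le[OF iid tail_set_borel tail_sup_AE tail_sup_nonneg, of s x k n] unfolding tail_prob_def[symmetric] by (simp only: mult.assoc)
  qed auto
  also have "\<dots> = ennreal (real k) * tail_supint P s M + ennreal (2 * sqrt (real k * real (Suc n))) * tail_sqrt P s M"
    unfolding tail_supint_def by (rule nn_integral_tail_comb) (auto simp: tail_sup_nonneg)
  finally show ?thesis .
qed

lemma tail_mean_le_sqrt: "tail_mean P s M \<le> tail_sqrt P s M"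
  unfolding tail_mean_def tail_sqrt_def
proof (intro nn_integral_mono mult_right_mono ennreal_leI)
  fix x show "tail_prob P s x \<le> sqrt (tail_prob P s x)"
    using tail_prob_bounds[of s x] by (intro real_le_rsqrt) (simp add: power2_eq_square mult_left_le)
qed auto

lemma ennreal_integrable_le:
  assumes m: "f \<in> borel_measurable M" and nn: "\<And>u. 0 \<le> f u" and le: "(\<integral>\<^sup>+u. ennreal (f u) \<partial>M) \<le> ennreal c" and c: "0 \<le> c"
  shows "integrable M f" "(\<integral>u. f u \<partial>M) \<le> c"
proof -
  show i: "integrable M f" using m nn le by (intro integrableI_nonneg) (auto intro: le_less_trans)
  have "ennreal (\<integral>u. f u \<partial>M) \<le> ennreal c" using le nn_integral_eq_integral[OF i] nn by simp
  then show "(\<integral>u. f u \<partial>M) \<le> c" using c by simp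
qed

text \<open>Along every path the two excesses contribute their means to leading order, whence the
  centering by \<open>tail_mean\<close>. Maximum and minimum over the rows deviate from it by the
  first square root times \<tau>; horizontal steps cost the second square root times \<tau> and
  \<open>real k * \<beta>\<close>.\<close>

lemma last_passage_truncation:
  assumes M: "0 \<le> M" and fin: "\<And>s. s = 1 \<or> s = - 1 \<Longrightarrow> tail_sqrt P s M < \<infinity> \<and> tail_supint P s M < \<infinity>"
  defines "\<tau> \<equiv> enn2real (tail_sqrt P 1 M) + enn2real (tail_sqrt P (- 1) M)"
    and "\<beta> \<equiv> enn2real (tail_supint P 1 M) + enn2real (tail_supint P (- 1) M)"
  assumes Cint: "integrable (joint_law P) (\<lambda>u. last_passage (\<lambda>z. clip M (snd u z)) k n)"
  shows "\<bar>(\<integral>u. last_passage (snd u) k n \<partial>joint_law P) - (\<integral>u. last_passage (\<lambda>z. clip M (snd u z)) k n \<partial>joint_law P)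
      - real n * (enn2real (tail_mean P 1 M) - enn2real (tail_mean P (- 1) M))\<bar>
    \<le> (2 * sqrt (real n * real (Suc k)) + 2 * sqrt (real k * real (Suc n))) * \<tau> + real k * \<beta>"
proof -
  define t where "t s = enn2real (tail_sqrt P s M)" for s
  define b where "b s = enn2real (tail_supint P s M)" for s
  define m where "m s = enn2real (tail_mean P s M)" for s
  have t: "tail_sqrt P s M = ennreal (t s)" "tail_supint P s M = ennreal (b s)" "tail_mean P s M = ennreal (m s)"
    if "s = 1 \<or> s = - 1" for s
  proof -
    have "tail_mean P s M < \<infinity>" using fin[OF that] tail_mean_le_sqrt[of s M] by (auto intro: le_less_trans)
    then show "tail_sqrt P s M = ennreal (t s)" "tail_supint P s M = ennreal (b s)" "tail_mean P s M = ennreal (m s)"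
      unfolding t_def b_def m_def using fin[OF that] by (simp_all add: ennreal_enn2real)
  qed
  have nn: "0 \<le> t s" "0 \<le> b s" "0 \<le> m s" for s by (auto simp: t_def b_def m_def)
  let ?A = "\<lambda>s u. passage (\<lambda>j i. excess s M (snd u (i, j))) n k"
  let ?B = "\<lambda>s u. passage (\<lambda>i j. excess s M (snd u (i, j))) k n"
  let ?L = "\<lambda>s u. low_prof (\<lambda>j i. excess s M (snd u (i, j))) n k"
  let ?T = "\<lambda>u. last_passage (snd u) k n" and ?C = "\<lambda>u. last_passage (\<lambda>z. clip M (snd u z)) k n"
  define c where "c = 2 * sqrt (real n * real (Suc k))"
  define c' where "c' = 2 * sqrt (real k * real (Suc n))"
  have c0: "0 \<le> c" "0 \<le> c'" by (auto simp: c_def c'_def)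
  have Xm: "(\<lambda>u. snd u z) \<in> borel_measurable (joint_law P)" for z
    by (rule joint_comp_measurable[OF iid]) (simp add: weight_space_def)
  have em: "(\<lambda>u. excess s M (snd u z)) \<in> borel_measurable (joint_law P)" for s z
    by (rule measurable_compose[OF Xm excess_measurable])
  have Am: "?A s \<in> borel_measurable (joint_law P)" and Bm: "?B s \<in> borel_measurable (joint_law P)"
    and Lm: "?L s \<in> borel_measurable (joint_law P)" for s
    by (rule measurable_prof measurable_low_prof; use em in simp)+
  have A0: "0 \<le> ?A s u" "0 \<le> ?B s u" "0 \<le> ?L s u" "?L s u \<le> ?A s u" for s u
    by (auto intro!: passage_nonneg low_prof_nonneg low_prof_le_passage excess_nonneg)
  have A: "integrable (joint_law P) (?A s)" "(\<integral>u. ?A s u \<partial>joint_law P) \<le> real n * m s + c * t s" if s: "s = 1 \<or> s = - 1" for s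
  proof -
    have "(\<integral>\<^sup>+u. ennreal (?A s u) \<partial>joint_law P) \<le> ennreal (real n * m s + c * t s)"
      using excess_passage_le[of s M n k] nn[of s] c0 unfolding t[OF s] c_def[symmetric]
      by (simp add: ennreal_mult ennreal_plus)
    from ennreal_integrable_le[OF Am A0(1) this]
    show "integrable (joint_law P) (?A s)" "(\<integral>u. ?A s u \<partial>joint_law P) \<le> real n * m s + c * t s"
      using nn c0 by auto
  qed
  have B: "integrable (joint_law P) (?B s)" "(\<integral>u. ?B s u \<partial>joint_law P) \<le> real k * b s + c' * t s" if s: "s = 1 \<or> s = - 1" for s
  proof -
    have "(\<integral>\<^sup>+u. ennreal (?B s u) \<partial>joint_law P) \<le> ennreal (real k * b s + c' * t s)"
      using excess_columns_le[of s M k n] nn[of s] c0 unfolding t[OF s] c'_def[symmetric]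
      by (simp add: ennreal_mult ennreal_plus)
    from ennreal_integrable_le[OF Bm A0(2) this]
    show "integrable (joint_law P) (?B s)" "(\<integral>u. ?B s u \<partial>joint_law P) \<le> real k * b s + c' * t s"
      using nn c0 by auto
  qed
  have L: "integrable (joint_law P) (?L s)" "real n * m s - c * t s \<le> (\<integral>u. ?L s u \<partial>joint_law P)" if s: "s = 1 \<or> s = - 1" for s
  proof -
    show i: "integrable (joint_law P) (?L s)"
      by (rule Bochner_Integration.integrable_bound[OF A(1)[OF s] Lm]) (use A0 in auto)
    have eq: "(\<integral>\<^sup>+u. ennreal (?L s u) \<partial>joint_law P) = ennreal (\<integral>u. ?L s u \<partial>joint_law P)"
      by (rule nn_integral_eq_integral[OF i]) (use A0(3) in auto)
    have "ennreal (real n * m s) \<le> ennreal (\<integral>u. ?L s u \<partial>joint_law P) + ennreal (c * t s)"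
      using excess_low_ge[of n s M k] nn[of s] c0 unfolding t[OF s] c_def[symmetric] eq
      by (simp add: ennreal_mult)
    also have "\<dots> = ennreal ((\<integral>u. ?L s u \<partial>joint_law P) + c * t s)"
      using A0(3) c0 nn by (intro ennreal_plus[symmetric]) (auto intro!: integral_nonneg_AE)
    finally show "real n * m s - c * t s \<le> (\<integral>u. ?L s u \<partial>joint_law P)"
      using A0(3) c0 nn by (subst (asm) ennreal_le_iff) (auto intro!: integral_nonneg_AE add_nonneg_nonneg)
  qed
  have dec: "?T u \<le> ?C u + ?A 1 u + ?B 1 u - ?L (- 1) u" "?C u + ?L 1 u - ?A (- 1) u - ?B (- 1) u \<le> ?T u" for u
    using last_passage_decomp[of "snd u" "\<lambda>z. clip M (snd u z)" "\<lambda>z. excess 1 M (snd u z)" "\<lambda>z. excess (- 1) M (snd u z)" k n]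
      clip_excess[OF M] excess_nonneg by auto
  have Tm: "?T \<in> borel_measurable (joint_law P)"
    by (rule measurable_last_passage) (rule Xm)
  have iU: "integrable (joint_law P) (\<lambda>u. ?C u + ?A 1 u + ?B 1 u - ?L (- 1) u)"
    by (intro Bochner_Integration.integrable_diff Bochner_Integration.integrable_add Cint A B L; simp)
  have iD: "integrable (joint_law P) (\<lambda>u. ?C u + ?L 1 u - ?A (- 1) u - ?B (- 1) u)"
    by (intro Bochner_Integration.integrable_diff Bochner_Integration.integrable_add Cint A B L; simp)
  have iT: "integrable (joint_law P) ?T"
  proof (rule Bochner_Integration.integrable_bound)
    show "integrable (joint_law P) (\<lambda>u. \<bar>?C u + ?A 1 u + ?B 1 u - ?L (- 1) u\<bar> + \<bar>?C u + ?L 1 u - ?A (- 1) u - ?B (- 1) u\<bar>)"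
      using iU iD by (intro Bochner_Integration.integrable_add integrable_abs)
    show "AE u in joint_law P. norm (?T u) \<le> norm (\<bar>?C u + ?A 1 u + ?B 1 u - ?L (- 1) u\<bar> + \<bar>?C u + ?L 1 u - ?A (- 1) u - ?B (- 1) u\<bar>)"
    proof (rule AE_I2)
      fix u show "norm (?T u) \<le> norm (\<bar>?C u + ?A 1 u + ?B 1 u - ?L (- 1) u\<bar> + \<bar>?C u + ?L 1 u - ?A (- 1) u - ?B (- 1) u\<bar>)"
        using dec[of u] unfolding real_norm_def by linarith
    qed
  qed (rule Tm)
  have up: "(\<integral>u. ?T u \<partial>joint_law P) \<le> (\<integral>u. ?C u \<partial>joint_law P) + (\<integral>u. ?A 1 u \<partial>joint_law P) + (\<integral>u. ?B 1 u \<partial>joint_law P) - (\<integral>u. ?L (- 1) u \<partial>joint_law P)"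
  proof -
    have "(\<integral>u. ?T u \<partial>joint_law P) \<le> (\<integral>u. ?C u + ?A 1 u + ?B 1 u - ?L (- 1) u \<partial>joint_law P)"
      by (intro integral_mono iT iU dec)
    also have "\<dots> = (\<integral>u. ?C u \<partial>joint_law P) + (\<integral>u. ?A 1 u \<partial>joint_law P) + (\<integral>u. ?B 1 u \<partial>joint_law P) - (\<integral>u. ?L (- 1) u \<partial>joint_law P)"
      by (simp add: Cint A(1) B(1) L(1))
    finally show ?thesis .
  qed
  have dn: "(\<integral>u. ?C u \<partial>joint_law P) + (\<integral>u. ?L 1 u \<partial>joint_law P) - (\<integral>u. ?A (- 1) u \<partial>joint_law P) - (\<integral>u. ?B (- 1) u \<partial>joint_law P) \<le> (\<integral>u. ?T u \<partial>joint_law P)"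
  proof -
    have "(\<integral>u. ?C u + ?L 1 u - ?A (- 1) u - ?B (- 1) u \<partial>joint_law P) \<le> (\<integral>u. ?T u \<partial>joint_law P)"
      by (intro integral_mono iT iD dec)
    moreover have "(\<integral>u. ?C u + ?L 1 u - ?A (- 1) u - ?B (- 1) u \<partial>joint_law P) = (\<integral>u. ?C u \<partial>joint_law P) + (\<integral>u. ?L 1 u \<partial>joint_law P) - (\<integral>u. ?A (- 1) u \<partial>joint_law P) - (\<integral>u. ?B (- 1) u \<partial>joint_law P)"
      by (simp add: Cint A(1) B(1) L(1))
    ultimately show ?thesis by simp
  qed
  have pos: "0 \<le> real k * b 1" "0 \<le> real k * b (- 1)" "0 \<le> c' * t 1" "0 \<le> c' * t (- 1)" "0 \<le> c * t 1" "0 \<le> c * t (- 1)"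
    using nn c0 by auto
  have r1: "(\<integral>u. ?T u \<partial>joint_law P) - (\<integral>u. ?C u \<partial>joint_law P) - real n * (m 1 - m (- 1)) \<le> (c + c') * (t 1 + t (- 1)) + real k * (b 1 + b (- 1))"
    using up A(2)[of 1] B(2)[of 1] L(2)[of "- 1"] pos by (simp add: algebra_simps)
  have r2: "- ((\<integral>u. ?T u \<partial>joint_law P) - (\<integral>u. ?C u \<partial>joint_law P) - real n * (m 1 - m (- 1))) \<le> (c + c') * (t 1 + t (- 1)) + real k * (b 1 + b (- 1))"
    using dn A(2)[of "- 1"] B(2)[of "- 1"] L(2)[of 1] pos by (simp add: algebra_simps)
  show ?thesis using r1 r2 unfolding \<tau>_def \<beta>_def t_def b_def m_def c_def c'_def by (simp only: abs_le_iff)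
qed

end

section \<open>Bounded weights\<close>

lemma indep_vars_PiM_coordinates:
  assumes M: "\<And>i. prob_space (M i)"
  shows "prob_space.indep_vars (PiM UNIV M) M (\<lambda>i \<omega>. \<omega> i) UNIV"
proof -
  interpret M: prob_space "M i" for i by (rule M)
  interpret P: product_prob_space M UNIV ..
  have "distr (PiM UNIV M) (PiM UNIV M) (\<lambda>\<omega>. \<lambda>i\<in>UNIV. \<omega> i) = PiM UNIV M"
    using distr_id2[OF refl, of "PiM UNIV M"] by (simp add: restrict_UNIV)
  also have "\<dots> = PiM UNIV (\<lambda>i. distr (PiM UNIV M) (M i) (\<lambda>\<omega>. \<omega> i))"
    by (rule PiM_cong) (simp_all add: P.PiM_component)
  finally show ?thesis by (subst P.indep_vars_iff_distr_eq_PiM) auto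
qed

lemma integral_PiM_component:
  fixes M :: "'i \<Rightarrow> 'a measure" and f :: "'a \<Rightarrow> real"
  assumes M: "\<And>i. prob_space (M i)" and f: "f \<in> borel_measurable (M l)"
  shows "(\<integral>\<omega>. f (\<omega> l) \<partial>PiM UNIV M) = (\<integral>v. f v \<partial>M l)"
proof -
  interpret M: prob_space "M i" for i by (rule M)
  interpret P: product_prob_space M UNIV ..
  have "(\<integral>v. f v \<partial>distr (PiM UNIV M) (M l) (\<lambda>\<omega>. \<omega> l)) = (\<integral>\<omega>. f (\<omega> l) \<partial>PiM UNIV M)"
    by (rule integral_distr) (use f in auto)
  then show ?thesis by (simp add: P.PiM_component)
qed

lemma integral_PiM_two_components:
  fixes N :: "'i \<Rightarrow> 'a measure" and f g :: "'a \<Rightarrow> real"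
  assumes N: "\<And>i. prob_space (N i)" and f: "f \<in> borel_measurable (N a)" and fb: "\<And>v. \<bar>f v\<bar> \<le> C"
    and ab: "a \<noteq> b" and g: "g \<in> borel_measurable (N b)" and gb: "\<And>v. \<bar>g v\<bar> \<le> C"
  shows "(\<integral>\<omega>. f (\<omega> a) * g (\<omega> b) \<partial>PiM UNIV N) = (\<integral>v. f v \<partial>N a) * (\<integral>v. g v \<partial>N b)"
proof -
  define h where "h l = (if l = a then f else g)" for l
  have ha: "h a = f" and hb: "h b = g" using ab by (simp_all add: h_def)
  have h_meas: "h l \<in> borel_measurable (N l)" if "l \<in> {a, b}" for l
  proof (cases "l = a")
    case True
    show ?thesis unfolding True ha by (rule f)
  next
    case False
    then have "l = b" using that by simp
    show ?thesis unfolding \<open>l = b\<close> hb by (rule g)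
  qed
  have h_bound: "\<bar>h l v\<bar> \<le> C" for l v using fb gb by (simp add: h_def)
  interpret P: prob_space "PiM UNIV N" by (rule prob_space_PiM) (rule N)
  have "P.indep_vars N (\<lambda>l \<omega>. \<omega> l) {a, b}"
    by (rule P.indep_vars_subset[OF indep_vars_PiM_coordinates[OF N]]) simp
  then have ind: "P.indep_vars (\<lambda>_. borel) (\<lambda>l \<omega>. h l (\<omega> l)) {a, b}"
    by (rule P.indep_vars_compose2) (rule h_meas)
  have "(\<integral>\<omega>. (\<Prod>l\<in>{a, b}. h l (\<omega> l)) \<partial>PiM UNIV N) = (\<Prod>l\<in>{a, b}. \<integral>\<omega>. h l (\<omega> l) \<partial>PiM UNIV N)"
  proof (rule P.indep_vars_lebesgue_integral[OF _ ind])
    fix l assume "l \<in> {a, b}"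
    then have "(\<lambda>\<omega>. h l (\<omega> l)) \<in> borel_measurable (PiM UNIV N)"
      by (rule measurable_compose[rotated, OF h_meas]) (rule measurable_component_singleton, simp)
    then show "integrable (PiM UNIV N) (\<lambda>\<omega>. h l (\<omega> l))"
      by (rule integrable_bounded[OF P.prob_space_axioms, of _ C]) (rule h_bound)
  qed simp
  moreover have "(\<integral>\<omega>. f (\<omega> a) \<partial>PiM UNIV N) = (\<integral>v. f v \<partial>N a)" by (rule integral_PiM_component[OF N]) (rule f)
  moreover have "(\<integral>\<omega>. g (\<omega> b) \<partial>PiM UNIV N) = (\<integral>v. g v \<partial>N b)" by (rule integral_PiM_component[OF N]) (rule g)
  ultimately show ?thesis using ab by (simp add: ha hb)
qed

definition clip_mean :: "real \<Rightarrow> real measure \<Rightarrow> real" where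
  "clip_mean M D = (\<integral>v. clip M v \<partial>D)"

definition clip_var :: "real \<Rightarrow> real measure \<Rightarrow> real" where
  "clip_var M D = (\<integral>v. (clip M v - clip_mean M D)\<^sup>2 \<partial>D)"

lemma integral_prob_measurable:
  fixes f :: "real \<Rightarrow> real"
  assumes "f \<in> borel_measurable borel"
  shows "(\<lambda>D. \<integral>v. f v \<partial>D) \<in> borel_measurable (prob_algebra borel)"
  by (rule measurable_compose[OF measurable_prob_algebraD[OF measurable_ident_sets[OF refl]] integral_measurable_subprob_algebra]) (rule assms)

lemma clip_mean_measurable [measurable]: "clip_mean M \<in> borel_measurable (prob_algebra borel)"
  unfolding clip_mean_def[abs_def] by (rule integral_prob_measurable) measurable

context
  fixes D :: "real measure" and M :: real
  assumes D: "prob_space D" "sets D = sets borel" and M: "0 \<le> M"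
begin

interpretation D: prob_space D by (rule D)

lemma borel_D: "f \<in> borel_measurable borel \<Longrightarrow> (f :: real \<Rightarrow> real) \<in> borel_measurable D"
  by (simp add: measurable_cong_sets[OF D(2) refl])

lemma clip_integrable: "integrable D (clip M)"
  by (rule integrable_bounded[OF D(1) borel_D[OF clip_measurable] clip_bound[OF M]])

lemma clip_mean_bound: "\<bar>clip_mean M D\<bar> \<le> M"
proof -
  have b: "- M \<le> clip M v" "clip M v \<le> M" for v using clip_bound[OF M, of v] by (simp_all add: abs_le_iff)
  have "clip_mean M D \<le> M" unfolding clip_mean_def by (rule D.integral_le_const[OF clip_integrable]) (simp add: b)
  moreover have "- M \<le> clip_mean M D" unfolding clip_mean_def by (rule D.integral_ge_const[OF clip_integrable]) (simp add: b)
  ultimately show ?thesis by simp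
qed

lemma clip_dev_bound: "\<bar>clip M v - clip_mean M D\<bar> \<le> 2 * M"
  using clip_bound[OF M, of v] clip_mean_bound by linarith

lemma clip_sq_integrable: "integrable D (\<lambda>v. (clip M v)\<^sup>2)"
proof (rule integrable_bounded[OF D(1), of _ "M\<^sup>2"])
  show "\<bar>(clip M v)\<^sup>2\<bar> \<le> M\<^sup>2" for v using power_mono[OF clip_bound[OF M, of v], of 2] by simp
  show "(\<lambda>v. (clip M v)\<^sup>2) \<in> borel_measurable D" by (rule borel_D) measurable
qed

lemma clip_var_eq: "clip_var M D = (\<integral>v. (clip M v)\<^sup>2 \<partial>D) - (clip_mean M D)\<^sup>2"
  unfolding clip_var_def clip_mean_def by (rule D.variance_eq[OF clip_integrable clip_sq_integrable])

lemma clip_var_bounds: "0 \<le> clip_var M D" "clip_var M D \<le> (2 * M)\<^sup>2"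
proof -
  show "0 \<le> clip_var M D" unfolding clip_var_def by simp
  have le: "(clip M v - clip_mean M D)\<^sup>2 \<le> (2 * M)\<^sup>2" for v
    using power_mono[OF clip_dev_bound[of v], of 2] by simp
  have "integrable D (\<lambda>v. (clip M v - clip_mean M D)\<^sup>2)"
  proof (rule integrable_bounded[OF D(1), of _ "(2 * M)\<^sup>2"])
    show "\<bar>(clip M v - clip_mean M D)\<^sup>2\<bar> \<le> (2 * M)\<^sup>2" for v using le[of v] by simp
    show "(\<lambda>v. (clip M v - clip_mean M D)\<^sup>2) \<in> borel_measurable D" by (rule borel_D) measurable
  qed
  then show "clip_var M D \<le> (2 * M)\<^sup>2" unfolding clip_var_def
    by (rule D.integral_le_const) (use le in auto)
qed

end

definition env_clip_mean :: "(nat \<Rightarrow> real measure) measure \<Rightarrow> real \<Rightarrow> real" where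
  "env_clip_mean P M = (\<integral>D. clip_mean M D \<partial>env_law P)"

text \<open>The mean of the quenched variances, not the variance of the averaged law: the randomness
  of the row means leaves with the centering and does not affect the coefficient of the square
  root.\<close>

definition env_clip_var :: "(nat \<Rightarrow> real measure) measure \<Rightarrow> real \<Rightarrow> real" where
  "env_clip_var P M = (\<integral>D. clip_var M D \<partial>env_law P)"

text \<open>Signs of size \<open>b\<close>: the simplest rows with prescribed second moment
  \<open>b\<^sup>2\<close>, and an affine image of fair bits.\<close>

lemma scaled_bits_moments:
  fixes b :: real
  defines "x' \<equiv> \<lambda>s :: nat \<Rightarrow> bool. \<lambda>i. b * (2 * of_bool (s i) - 1)"
  shows "x' \<in> bern_rows half \<rightarrow>\<^sub>M row_space"
    and "(\<integral>s. x' s i \<partial>bern_rows half) = 0"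
    and "(\<integral>s. x' s i * x' s j \<partial>bern_rows half) = (if i = j then b\<^sup>2 else 0)"
proof -
  have m: "(\<lambda>s. x' s i) \<in> borel_measurable (bern_rows half)" for i
    using measurable_compose[OF row_bits_measurable measurable_component_singleton, of i]
    unfolding x'_def by (intro borel_measurable_times borel_measurable_diff) auto
  show "x' \<in> bern_rows half \<rightarrow>\<^sub>M row_space"
    by (rule measurable_PiM_single'[where f = "\<lambda>i s. x' s i", simplified]) (use m in auto)
  have P: "prob_space (measure_pmf (bernoulli_pmf (1 / 2)))" by (rule prob_space_measure_pmf)
  have b: "\<bar>b * (2 * of_bool v - 1)\<bar> \<le> \<bar>b\<bar>" for v by (auto simp: abs_mult)
  show 1: "(\<integral>s. x' s i \<partial>bern_rows half) = 0"
    unfolding x'_def bern_rows_def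
    by (subst integral_PiM_component[where f = "\<lambda>v. b * (2 * of_bool v - 1)"]) (use P in auto)
  show "(\<integral>s. x' s i * x' s j \<partial>bern_rows half) = (if i = j then b\<^sup>2 else 0)"
  proof (cases "i = j")
    case True
    interpret B: prob_space "bern_rows half" by (rule prob_space_bern_rows)
    have "x' s j * x' s j = b\<^sup>2" for s by (simp add: x'_def power2_eq_square)
    then show ?thesis using True by (simp add: B.prob_space)
  next
    case False
    then show ?thesis
      unfolding x'_def bern_rows_def
      by (subst integral_PiM_two_components[where f = "\<lambda>v. b * (2 * of_bool v - 1)" and g = "\<lambda>v. b * (2 * of_bool v - 1)" and C = "\<bar>b\<bar>"])
         (use P b in auto)
  qed
qed

context
  fixes P :: "(nat \<Rightarrow> real measure) measure"
  assumes iid: "iid_env P"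
begin

interpretation EL: prob_space "env_law P" by (rule prob_space_env_law[OF iid])
interpretation P: prob_space P by (rule iidD(1)[OF iid])
interpretation J: prob_space "joint_law P" by (rule joint_law_measure(2)[OF iid])

lemma env_law_D: "D \<in> space (env_law P) \<Longrightarrow> prob_space D \<and> sets D = sets borel"
  by (auto simp: space_env_law[OF iid] space_prob_algebra)

lemma env_law_measurable: "f \<in> borel_measurable (prob_algebra borel) \<Longrightarrow> (f :: _ \<Rightarrow> real) \<in> borel_measurable (env_law P)"
  by (simp add: measurable_cong_sets[OF sets_env_law[OF iid] refl])

lemma clip_mean_integrable: "0 \<le> M \<Longrightarrow> integrable (env_law P) (clip_mean M)"
proof (rule EL.integrable_const_bound[where B = M])
  assume M: "0 \<le> M"
  show "AE D in env_law P. norm (clip_mean M D) \<le> M"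
  proof (rule AE_I2)
    fix D assume "D \<in> space (env_law P)"
    then show "norm (clip_mean M D) \<le> M" using clip_mean_bound[of D M] env_law_D[of D] M by simp
  qed
qed (rule env_law_measurable[OF clip_mean_measurable])

lemma clip_var_measurable: "0 \<le> M \<Longrightarrow> clip_var M \<in> borel_measurable (env_law P)"
proof -
  assume M: "0 \<le> M"
  have "(\<lambda>D. (\<integral>v. (clip M v)\<^sup>2 \<partial>D) - (clip_mean M D)\<^sup>2) \<in> borel_measurable (env_law P)"
    by (intro env_law_measurable borel_measurable_diff integral_prob_measurable borel_measurable_power clip_mean_measurable) measurable
  then show "clip_var M \<in> borel_measurable (env_law P)"
    by (subst measurable_cong) (use clip_var_eq env_law_D M in auto)
qed

lemma clip_var_integrable: "0 \<le> M \<Longrightarrow> integrable (env_law P) (clip_var M)"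
proof (rule EL.integrable_const_bound[where B = "(2 * M)\<^sup>2"])
  assume M: "0 \<le> M"
  show "AE D in env_law P. norm (clip_var M D) \<le> (2 * M)\<^sup>2"
  proof (rule AE_I2)
    fix D assume "D \<in> space (env_law P)"
    then show "norm (clip_var M D) \<le> (2 * M)\<^sup>2" using clip_var_bounds[of D M] env_law_D[of D] M by simp
  qed
qed (rule clip_var_measurable)

lemma env_clip_var_bounds:
  assumes "0 \<le> M"
  shows "0 \<le> env_clip_var P M" "env_clip_var P M \<le> (2 * M)\<^sup>2"
proof -
  have b: "0 \<le> clip_var M D \<and> clip_var M D \<le> (2 * M)\<^sup>2" if "D \<in> space (env_law P)" for D
    using clip_var_bounds[of D M] env_law_D[OF that] assms by auto
  show "0 \<le> env_clip_var P M" unfolding env_clip_var_def by (rule integral_nonneg_AE) (use b in auto)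
  show "env_clip_var P M \<le> (2 * M)\<^sup>2" unfolding env_clip_var_def
    by (rule EL.integral_le_const[OF clip_var_integrable[OF assms]]) (use b in auto)
qed

lemma integral_row_law:
  assumes \<psi>: "case_prod \<psi> \<in> prob_algebra borel \<Otimes>\<^sub>M borel \<rightarrow>\<^sub>M borel" and f: "f \<in> borel_measurable row_space" and b: "\<And>x. \<bar>f x\<bar> \<le> (C :: real)"
  shows "(\<integral>x. f x \<partial>row_law P \<psi>) = (\<integral>D. \<integral>x. f (\<lambda>i. \<psi> D (x i)) \<partial>PiM UNIV (\<lambda>_::nat. D) \<partial>env_law P)"
proof -
  have k: "row_kernel \<psi> \<in> env_law P \<rightarrow>\<^sub>M subprob_algebra row_space"
    using measurable_prob_algebraD[OF row_kernel_measurable[OF \<psi>]] by (simp add: measurable_cong_sets[OF sets_env_law[OF iid] refl])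
  have "(\<integral>x. f x \<partial>row_law P \<psi>) = (\<integral>D. \<integral>x. f x \<partial>row_kernel \<psi> D \<partial>env_law P)"
    unfolding row_law_def
  proof (rule integral_bind[OF f _ k, where B' = 1])
    show "finite_measure (env_law P)" by (rule EL.finite_measure_axioms)
    show "AE D in env_law P. emeasure (row_kernel \<psi> D) (space (row_kernel \<psi> D)) \<le> ennreal 1"
      using measurable_space[OF k] by (intro AE_I2) (auto simp: space_subprob_algebra subprob_space.emeasure_space_le_1)
  qed (use b in auto)
  also have "\<dots> = (\<integral>D. \<integral>x. f (\<lambda>i. \<psi> D (x i)) \<partial>PiM UNIV (\<lambda>_::nat. D) \<partial>env_law P)"
  proof (rule Bochner_Integration.integral_cong[OF refl])
    fix D assume "D \<in> space (env_law P)"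
    then have D: "D \<in> space (prob_algebra borel)" by (simp add: space_env_law[OF iid])
    have s: "sets (PiM UNIV (\<lambda>_::nat. D)) = sets row_space" using D by (intro sets_PiM_cong) (auto simp: space_prob_algebra)
    have "(\<lambda>x i. \<psi> D (x i)) \<in> row_space \<rightarrow>\<^sub>M row_space"
      using measurable_compose[OF measurable_Pair1'[OF D] map_row_measurable[OF \<psi>]] by simp
    then have "(\<lambda>x i. \<psi> D (x i)) \<in> PiM UNIV (\<lambda>_::nat. D) \<rightarrow>\<^sub>M row_space"
      by (simp add: measurable_cong_sets[OF s refl])
    then show "(\<integral>x. f x \<partial>row_kernel \<psi> D) = (\<integral>x. f (\<lambda>i. \<psi> D (x i)) \<partial>PiM UNIV (\<lambda>_::nat. D))"
      unfolding row_kernel_def by (rule integral_distr[OF _ f])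
  qed
  finally show ?thesis .
qed

lemma integral_joint_rows:
  assumes \<psi>: "case_prod \<psi> \<in> prob_algebra borel \<Otimes>\<^sub>M borel \<rightarrow>\<^sub>M borel" and f: "(f :: _ \<Rightarrow> real) \<in> borel_measurable weight_space"
  shows "(\<integral>u. f (\<lambda>z. \<psi> (fst u (snd z)) (snd u z)) \<partial>joint_law P)
    = (\<integral>\<omega>. f (\<lambda>z. \<omega> (snd z) (fst z)) \<partial>PiM UNIV (\<lambda>_::nat. row_law P \<psi>))"
proof -
  have Ym: "(\<lambda>(F, X) z. \<psi> (F (snd z)) (X z)) \<in> joint_law P \<rightarrow>\<^sub>M weight_space"
    using psi_joint_measurable[OF iid \<psi>] by (simp add: measurable_cong_sets[OF joint_law_measure(1)[OF iid] refl])
  have "(\<integral>u. f (\<lambda>z. \<psi> (fst u (snd z)) (snd u z)) \<partial>joint_law P)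
      = (\<integral>X. f X \<partial>distr (joint_law P) weight_space (\<lambda>(F, X) z. \<psi> (F (snd z)) (X z)))"
    by (subst integral_distr[OF Ym f]) (simp add: split_beta')
  also have "\<dots> = (\<integral>\<omega>. f (\<lambda>z. \<omega> (snd z) (fst z)) \<partial>PiM UNIV (\<lambda>_::nat. row_law P \<psi>))"
    unfolding joint_law_rows[OF iid \<psi>]
    by (subst integral_distr[OF flatten_measurable[OF row_law_measure(2)[OF iid \<psi>]] f]) simp
  finally show ?thesis .
qed

lemma integral_joint_env:
  assumes f: "f \<in> borel_measurable (prob_algebra borel)" and b: "\<And>D. D \<in> space (prob_algebra borel) \<Longrightarrow> \<bar>f D\<bar> \<le> (C :: real)"
  shows "(\<integral>u. f (fst u j) \<partial>joint_law P) = (\<integral>D. f D \<partial>env_law P)" "integrable (joint_law P) (\<lambda>u. f (fst u j))"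
proof -
  have Fm: "(\<lambda>u. fst u j) \<in> joint_law P \<rightarrow>\<^sub>M prob_algebra borel"
    unfolding measurable_cong_sets[OF joint_law_measure(1)[OF iid] refl] env_space_def by measurable
  have law: "distr (joint_law P) (prob_algebra borel) (\<lambda>u. fst u j) = env_law P"
  proof (rule measure_eqI)
    fix A assume "A \<in> sets (distr (joint_law P) (prob_algebra borel) (\<lambda>u. fst u j))"
    then have A: "A \<in> sets (prob_algebra borel)" by simp
    have "emeasure (distr (joint_law P) (prob_algebra borel) (\<lambda>u. fst u j)) A = (\<integral>\<^sup>+D. indicator A D \<partial>distr (joint_law P) (prob_algebra borel) (\<lambda>u. fst u j))"
      using A by simp
    also have "\<dots> = (\<integral>\<^sup>+u. indicator A (fst u j) \<partial>joint_law P)"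
      by (rule nn_integral_distr[OF Fm]) (use A in simp)
    also have "\<dots> = (\<integral>\<^sup>+F. \<integral>\<^sup>+X. indicator A (F j) \<partial>quenched_law F \<partial>P)"
    proof -
      have "(\<lambda>u. indicator A (fst u j) :: ennreal) \<in> borel_measurable (env_space \<Otimes>\<^sub>M weight_space)"
        using measurable_compose[OF Fm borel_measurable_indicator[OF A]]
        by (simp add: measurable_cong_sets[OF joint_law_measure(1)[OF iid] refl])
      from joint_law_measure(3)[OF iid this] show ?thesis by simp
    qed
    also have "\<dots> = (\<integral>\<^sup>+F. indicator A (F j) \<partial>P)"
    proof (rule nn_integral_cong)
      fix F assume "F \<in> space P"
      then have "F \<in> space env_space" by (simp add: env_space_P[OF iid])
      from measurable_space[OF quenched_law_measurable this]
      interpret Q: prob_space "quenched_law F" by (simp add: space_prob_algebra)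
      show "(\<integral>\<^sup>+X. indicator A (F j) \<partial>quenched_law F) = (indicator A (F j) :: ennreal)"
        by (simp add: Q.emeasure_space_1)
    qed
    also have "\<dots> = emeasure (env_law P) A"
      using A by (subst nn_integral_env_law[OF iid]) (auto simp: sets_env_law[OF iid])
    finally show "emeasure (distr (joint_law P) (prob_algebra borel) (\<lambda>u. fst u j)) A = emeasure (env_law P) A" .
  qed (simp add: sets_env_law[OF iid])
  show "(\<integral>u. f (fst u j) \<partial>joint_law P) = (\<integral>D. f D \<partial>env_law P)"
    unfolding law[symmetric] by (rule integral_distr[OF Fm f, symmetric])
  show "integrable (joint_law P) (\<lambda>u. f (fst u j))"
    by (rule J.integrable_const_bound[where B = C])
       (use b measurable_space[OF Fm] measurable_compose[OF Fm f] in auto)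
qed

lemma passage_abs_le:
  assumes "\<And>j i. \<bar>w j i\<bar> \<le> M"
  shows "\<bar>passage w n k\<bar> \<le> real n * M"
proof -
  have w: "w j i \<le> M" "- M \<le> w j i" for j i using assms[of j i] by (auto simp: abs_le_iff)
  have "passage w n k \<le> passage (\<lambda>_ _. M) n k" by (rule prof_mono) (use w in auto)
  moreover have "passage (\<lambda>_ _. - M) n k \<le> passage w n k" by (rule prof_mono) (use w in auto)
  ultimately show ?thesis using passage_const[of "\<lambda>_. M" n k] passage_const[of "\<lambda>_. - M" n k] by (simp add: abs_le_iff)
qed

text \<open>Here \<beta> is an inverse temperature. The weights are scaled by it before the exchange
  and the result is divided by it, so the exchange costs order n \<beta>^2 and the smoothing costs
  the path entropy divided by \<beta>. The choice of \<beta> is left open.\<close>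

lemma centered_passage:
  assumes M: "0 \<le> M" and \<beta>: "0 < \<beta>" and y: "0 < y" "y < 1"
  shows "\<bar>(\<integral>u. passage (\<lambda>j i. clip M (snd u (i, j)) - clip_mean M (fst u j)) n k \<partial>joint_law P)
      - sqrt (env_clip_var P M) * (2 * ref_passage half n k - real n)\<bar>
    \<le> (real n * (2 * (2 * M * \<beta>) ^ 3) + (real k * ln (1 / y) + real n * ln (1 / (1 - y)))) / \<beta>"
proof -
  define M' where "M' = 2 * M * \<beta>"
  have M'0: "0 \<le> M'" using M \<beta> by (simp add: M'_def)
  define \<psi> where "\<psi> D v = \<beta> * (clip M v - clip_mean M D)" for D v
  have \<psi>: "case_prod \<psi> \<in> prob_algebra borel \<Otimes>\<^sub>M borel \<rightarrow>\<^sub>M borel"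
    unfolding \<psi>_def split_beta' by measurable
  have \<psi>b: "\<bar>\<psi> D v\<bar> \<le> M'" if "D \<in> space (prob_algebra borel)" for D v
    using clip_dev_bound[of D M v] that M \<beta> by (simp add: \<psi>_def M'_def abs_mult space_prob_algebra)
  have \<psi>clip: "clip M' (\<psi> D v) = \<psi> D v" if "D \<in> space (prob_algebra borel)" for D v
    using \<psi>b[OF that, of v] by (auto simp: clip_def)
  let ?N = "row_law P \<psi>"
  note N = row_law_measure[OF iid \<psi>]
  \<comment> \<open>\<open>lindeberg_passage\<close> wants a bound at every point of the row space.
    Clipping at \<open>M'\<close> provides one and changes nothing on the values that \<psi>
    takes.\<close>
  define x where "x s i = clip M' (s i)" for s :: "nat \<Rightarrow> real" and i
  have xm0: "x \<in> row_space \<rightarrow>\<^sub>M row_space"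
    unfolding x_def
  proof (rule measurable_PiM_single')
    show "(\<lambda>s. clip M' (s i)) \<in> borel_measurable row_space" for i
      by (rule measurable_compose[OF _ clip_measurable]) (rule measurable_component_singleton, simp)
  qed auto
  then have xm: "x \<in> ?N \<rightarrow>\<^sub>M row_space" by (simp add: measurable_cong_sets[OF N(2) refl])
  have xi: "(\<lambda>s. x s i) \<in> borel_measurable row_space" for i
    by (rule measurable_compose[OF xm0 measurable_component_singleton]) simp
  have xb: "\<bar>x s i\<bar> \<le> M'" for s i unfolding x_def by (rule clip_bound[OF M'0])
  define v where "v = \<beta>\<^sup>2 * env_clip_var P M"
  have mom: "(\<integral>v. \<psi> D v \<partial>D) = 0" "(\<integral>v. \<psi> D v * \<psi> D v \<partial>D) = \<beta>\<^sup>2 * clip_var M D" "\<psi> D \<in> borel_measurable D"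
    if Din: "D \<in> space (env_law P)" for D
  proof -
    have D: "prob_space D" "sets D = sets borel" using env_law_D[OF Din] by auto
    interpret D: prob_space D by fact
    show "\<psi> D \<in> borel_measurable D" unfolding \<psi>_def by (rule borel_D[OF D M]) measurable
    show "(\<integral>v. \<psi> D v \<partial>D) = 0"
      unfolding \<psi>_def using clip_integrable[OF D M] by (simp add: D.prob_space clip_mean_def[symmetric])
    have "(\<integral>v. \<psi> D v * \<psi> D v \<partial>D) = (\<integral>v. \<beta>\<^sup>2 * (clip M v - clip_mean M D)\<^sup>2 \<partial>D)"
      by (simp add: \<psi>_def power2_eq_square mult_ac)
    then show "(\<integral>v. \<psi> D v * \<psi> D v \<partial>D) = \<beta>\<^sup>2 * clip_var M D" by (simp add: clip_var_def)
  qed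
  have m1: "(\<integral>s. x s i \<partial>?N) = 0" for i
  proof -
    have "(\<integral>s. x s i \<partial>?N) = (\<integral>D. \<integral>s. x (\<lambda>i. \<psi> D (s i)) i \<partial>PiM UNIV (\<lambda>_::nat. D) \<partial>env_law P)"
      by (rule integral_row_law[OF \<psi> xi xb])
    also have "\<dots> = (\<integral>D. 0 \<partial>env_law P)"
    proof (rule Bochner_Integration.integral_cong[OF refl])
      fix D assume Din: "D \<in> space (env_law P)"
      then have Din': "D \<in> space (prob_algebra borel)" by (simp add: space_env_law[OF iid])
      have "(\<integral>s. x (\<lambda>i. \<psi> D (s i)) i \<partial>PiM UNIV (\<lambda>_::nat. D)) = (\<integral>s. \<psi> D (s i) \<partial>PiM UNIV (\<lambda>_::nat. D))"
        by (simp add: x_def \<psi>clip[OF Din'])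
      also have "\<dots> = (\<integral>v. \<psi> D v \<partial>D)"
        by (rule integral_PiM_component) (use env_law_D[OF Din] mom(3)[OF Din] in auto)
      finally show "(\<integral>s. x (\<lambda>i. \<psi> D (s i)) i \<partial>PiM UNIV (\<lambda>_::nat. D)) = 0" using mom(1)[OF Din] by simp
    qed
    finally show ?thesis by simp
  qed
  have m2: "(\<integral>s. x s i * x s j \<partial>?N) = (if i = j then v else 0)" for i j
  proof -
    have bb: "\<bar>x s i * x s j\<bar> \<le> M' * M'" for s unfolding abs_mult by (intro mult_mono xb) (use M'0 in auto)
    have "(\<integral>s. x s i * x s j \<partial>?N) = (\<integral>D. \<integral>s. x (\<lambda>i. \<psi> D (s i)) i * x (\<lambda>i. \<psi> D (s i)) j \<partial>PiM UNIV (\<lambda>_::nat. D) \<partial>env_law P)"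
      by (rule integral_row_law[OF \<psi> _ bb]) (intro borel_measurable_times xi)
    also have "\<dots> = (\<integral>D. (if i = j then \<beta>\<^sup>2 * clip_var M D else 0) \<partial>env_law P)"
    proof (rule Bochner_Integration.integral_cong[OF refl])
      fix D assume Din: "D \<in> space (env_law P)"
      then have Din': "D \<in> space (prob_algebra borel)" by (simp add: space_env_law[OF iid])
      have eq: "(\<integral>s. x (\<lambda>i. \<psi> D (s i)) i * x (\<lambda>i. \<psi> D (s i)) j \<partial>PiM UNIV (\<lambda>_::nat. D)) = (\<integral>s. \<psi> D (s i) * \<psi> D (s j) \<partial>PiM UNIV (\<lambda>_::nat. D))"
        by (simp add: x_def \<psi>clip[OF Din'])
      show "(\<integral>s. x (\<lambda>i. \<psi> D (s i)) i * x (\<lambda>i. \<psi> D (s i)) j \<partial>PiM UNIV (\<lambda>_::nat. D)) = (if i = j then \<beta>\<^sup>2 * clip_var M D else 0)"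
      proof (cases "i = j")
        case True
        have "(\<integral>s. \<psi> D (s j) * \<psi> D (s j) \<partial>PiM UNIV (\<lambda>_::nat. D)) = (\<integral>v. \<psi> D v * \<psi> D v \<partial>D)"
        proof (rule integral_PiM_component[where f = "\<lambda>v. \<psi> D v * \<psi> D v"])
          show "(\<lambda>v. \<psi> D v * \<psi> D v) \<in> borel_measurable D" by (intro borel_measurable_times mom(3)[OF Din])
        qed (use env_law_D[OF Din] in auto)
        then show ?thesis using True mom(2)[OF Din] eq by simp
      next
        case False
        have "(\<integral>s. \<psi> D (s i) * \<psi> D (s j) \<partial>PiM UNIV (\<lambda>_::nat. D)) = (\<integral>v. \<psi> D v \<partial>D) * (\<integral>v. \<psi> D v \<partial>D)"
          by (rule integral_PiM_two_components[where C = M' and f = "\<psi> D" and g = "\<psi> D"])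
             (use env_law_D[OF Din] mom(3)[OF Din] \<psi>b[OF Din'] False in auto)
        then show ?thesis using False mom(1)[OF Din] eq by simp
      qed
    qed
    also have "\<dots> = (if i = j then v else 0)" by (simp add: v_def env_clip_var_def)
    finally show ?thesis .
  qed
  \<comment> \<open>The size of the signs is chosen to match the second moment
    \<open>v\<close>.\<close>
  define b where "b = \<beta> * sqrt (env_clip_var P M)"
  have b0: "0 \<le> b" using \<beta> env_clip_var_bounds[OF M] by (simp add: b_def)
  have bv: "b\<^sup>2 = v" using env_clip_var_bounds[OF M] by (simp add: b_def v_def power_mult_distrib)
  have "sqrt (env_clip_var P M) \<le> 2 * M" using env_clip_var_bounds[OF M] M by (intro real_le_lsqrt) auto
  then have bM: "b \<le> M'" using \<beta> by (simp add: b_def M'_def mult.commute[of _ \<beta>] mult_left_mono)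
  define x' where "x' s i = b * (2 * of_bool (s i) - 1)" for s :: "nat \<Rightarrow> bool" and i
  note sb = scaled_bits_moments[of b, folded x'_def]
  have xb': "\<bar>x' s i\<bar> \<le> M'" for s i using b0 bM by (auto simp: x'_def abs_mult)
  have lin: "\<bar>(\<integral>\<omega>. passage (\<lambda>j. x (\<omega> j)) n k \<partial>PiM UNIV (\<lambda>_::nat. ?N)) - (\<integral>\<omega>. passage (\<lambda>j. x' (\<omega> j)) n k \<partial>PiM UNIV (\<lambda>_::nat. bern_rows half))\<bar>
    \<le> real n * (2 * M' ^ 3) + (real k * ln (1 / y) + real n * ln (1 / (1 - y)))"
    by (rule lindeberg_passage[OF N(1) xm xb m1 m2 prob_space_bern_rows sb(1) xb' sb(2) sb(3)[unfolded bv] y])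
  have ref: "(\<integral>\<omega>. passage (\<lambda>j. x' (\<omega> j)) n k \<partial>PiM UNIV (\<lambda>_::nat. bern_rows half)) = b * (2 * ref_passage half n k - real n)"
  proof -
    interpret B: prob_space "bern_env half" by (rule prob_space_bern_env)
    have "passage (\<lambda>j. x' (\<omega> j)) n k = b * (2 * passage (bits \<omega>) n k - real n)" for \<omega>
    proof -
      have "passage (\<lambda>j. x' (\<omega> j)) n k = prof (\<lambda>j i. b * (2 * bits \<omega> j i + - 1)) (\<lambda>i. b * (2 * 0 + 0)) n k"
        unfolding x'_def[abs_def] bits_def[abs_def] by simp
      also have "\<dots> = b * (prof (\<lambda>j i. 2 * bits \<omega> j i + - 1) (\<lambda>i. 2 * 0 + 0) n k)" by (rule prof_mult[OF b0])
      also have "prof (\<lambda>j i. 2 * bits \<omega> j i + - 1) (\<lambda>i. 2 * 0 + 0) n k = prof (\<lambda>j i. 2 * bits \<omega> j i) (\<lambda>i. 2 * 0) n k + (\<Sum>j<n. - 1) + 0"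
        by (rule prof_add_const)
      also have "prof (\<lambda>j i. 2 * bits \<omega> j i) (\<lambda>i. 2 * 0) n k = 2 * passage (bits \<omega>) n k" by (rule prof_mult) simp
      finally show ?thesis by simp
    qed
    then show ?thesis
      unfolding bern_env_def[symmetric] using passage_bits_integrable[of half n k]
      by (simp add: ref_passage_def B.prob_space)
  qed
  have link: "(\<integral>\<omega>. passage (\<lambda>j. x (\<omega> j)) n k \<partial>PiM UNIV (\<lambda>_::nat. ?N))
      = \<beta> * (\<integral>u. passage (\<lambda>j i. clip M (snd u (i, j)) - clip_mean M (fst u j)) n k \<partial>joint_law P)"
  proof -
    have fm: "(\<lambda>X. passage (\<lambda>j i. clip M' (X (i, j))) n k) \<in> borel_measurable weight_space"
    proof (rule measurable_prof)
      show "(\<lambda>X. clip M' (X (i, j))) \<in> borel_measurable weight_space" for j i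
        unfolding weight_space_def by (rule measurable_compose[OF _ clip_measurable]) (rule measurable_component_singleton, simp)
    qed auto
    have "(\<integral>\<omega>. passage (\<lambda>j. x (\<omega> j)) n k \<partial>PiM UNIV (\<lambda>_::nat. ?N)) = (\<integral>u. passage (\<lambda>j i. clip M' (\<psi> (fst u j) (snd u (i, j)))) n k \<partial>joint_law P)"
      using integral_joint_rows[OF \<psi> fm] by (simp add: x_def[abs_def])
    also have "\<dots> = (\<integral>u. \<beta> * passage (\<lambda>j i. clip M (snd u (i, j)) - clip_mean M (fst u j)) n k \<partial>joint_law P)"
    proof (rule Bochner_Integration.integral_cong[OF refl])
      fix u assume "u \<in> space (joint_law P)"
      then have "fst u \<in> space env_space"
        using sets_eq_imp_space_eq[OF joint_law_measure(1)[OF iid]] by (auto simp: space_pair_measure)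
      then have "fst u j \<in> space (prob_algebra borel)" for j by (auto simp: space_env space_prob_algebra)
      then have "passage (\<lambda>j i. clip M' (\<psi> (fst u j) (snd u (i, j)))) n k = prof (\<lambda>j i. \<beta> * (clip M (snd u (i, j)) - clip_mean M (fst u j))) (\<lambda>i. \<beta> * 0) n k"
        by (simp add: \<psi>clip) (simp add: \<psi>_def)
      also have "\<dots> = \<beta> * passage (\<lambda>j i. clip M (snd u (i, j)) - clip_mean M (fst u j)) n k"
        by (rule prof_mult) (use \<beta> in simp)
      finally show "passage (\<lambda>j i. clip M' (\<psi> (fst u j) (snd u (i, j)))) n k = \<beta> * passage (\<lambda>j i. clip M (snd u (i, j)) - clip_mean M (fst u j)) n k" .
    qed
    finally show ?thesis by simp
  qed
  let ?I = "\<integral>u. passage (\<lambda>j i. clip M (snd u (i, j)) - clip_mean M (fst u j)) n k \<partial>joint_law P"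
  let ?R = "sqrt (env_clip_var P M) * (2 * ref_passage half n k - real n)"
  have "\<beta> * \<bar>?I - ?R\<bar> = \<bar>\<beta> * (?I - ?R)\<bar>" using \<beta> by (simp add: abs_mult)
  also have "\<beta> * (?I - ?R) = \<beta> * ?I - b * (2 * ref_passage half n k - real n)"
    unfolding b_def right_diff_distrib mult.assoc ..
  also have "\<bar>\<dots>\<bar> \<le> real n * (2 * M' ^ 3) + (real k * ln (1 / y) + real n * ln (1 / (1 - y)))"
    using lin unfolding link ref .
  finally have "\<bar>?I - ?R\<bar> \<le> (real n * (2 * M' ^ 3) + (real k * ln (1 / y) + real n * ln (1 / (1 - y)))) / \<beta>"
    using \<beta> by (simp add: pos_le_divide_eq mult.commute)
  then show ?thesis unfolding M'_def .
qed

text \<open>The row means are collected once per row on every path and average to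
  \<open>real n * env_clip_mean P M\<close>; the horizontal steps of bounded weights cost at most
  \<open>real k * M\<close>.\<close>

lemma clipped_last_passage:
  assumes M: "0 \<le> M" and \<beta>: "0 < \<beta>" and y: "0 < y" "y < 1"
  shows "integrable (joint_law P) (\<lambda>u. last_passage (\<lambda>z. clip M (snd u z)) k n)"
    and "\<bar>(\<integral>u. last_passage (\<lambda>z. clip M (snd u z)) k n \<partial>joint_law P)
      - (real n * env_clip_mean P M + sqrt (env_clip_var P M) * (2 * ref_passage half n k - real n))\<bar>
    \<le> real k * M + (real n * (2 * (2 * M * \<beta>) ^ 3) + (real k * ln (1 / y) + real n * ln (1 / (1 - y)))) / \<beta>"
proof -
  let ?T = "\<lambda>u. last_passage (\<lambda>z. clip M (snd u z)) k n"
  let ?A = "\<lambda>u. passage (\<lambda>j i. clip M (snd u (i, j))) n k"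
  let ?I = "\<lambda>u. passage (\<lambda>j i. clip M (snd u (i, j)) - clip_mean M (fst u j)) n k"
  let ?S = "\<lambda>u. \<Sum>j<n. clip_mean M (fst u j)"
  have Xm: "(\<lambda>u. snd u z) \<in> borel_measurable (joint_law P)" for z
    by (rule joint_comp_measurable[OF iid]) (simp add: weight_space_def)
  have cm: "(\<lambda>u. clip M (snd u z)) \<in> borel_measurable (joint_law P)" for z
    by (rule measurable_compose[OF Xm clip_measurable])
  have Tm: "?T \<in> borel_measurable (joint_law P)" by (rule measurable_last_passage) (rule cm)
  have cb: "- M \<le> clip M v" "clip M v \<le> M" "\<bar>clip M v\<bar> \<le> M" for v using clip_bound[OF M, of v] by (auto simp: abs_le_iff)
  have TA: "\<bar>?T u - ?A u\<bar> \<le> real k * M" for u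
  proof -
    have "?A u - real k * M \<le> ?T u" by (rule last_passage_ge) (rule cb)
    moreover have "?T u \<le> ?A u + passage (\<lambda>i j. clip M (snd u (i, j))) k n" by (rule last_passage_le)
    moreover have "passage (\<lambda>i j. clip M (snd u (i, j))) k n \<le> real k * M"
      using passage_abs_le[of "\<lambda>i j. clip M (snd u (i, j))" M k n] cb by (simp add: abs_le_iff)
    ultimately show ?thesis by linarith
  qed
  have Ab: "\<bar>?A u\<bar> \<le> real n * M" for u by (rule passage_abs_le) (rule cb)
  have iA: "integrable (joint_law P) ?A"
    by (rule integrable_bounded[OF J.prob_space_axioms _ Ab]) (rule measurable_prof, auto intro: cm)
  show iT: "integrable (joint_law P) ?T"
  proof (rule integrable_bounded[OF J.prob_space_axioms Tm])
    fix u show "\<bar>?T u\<bar> \<le> real n * M + real k * M" using TA[of u] Ab[of u] by linarith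
  qed
  have cmb: "\<bar>clip_mean M D\<bar> \<le> M" if "D \<in> space (prob_algebra borel)" for D
    using clip_mean_bound[of D M] that M by (simp add: space_prob_algebra)
  note env = integral_joint_env[OF clip_mean_measurable cmb]
  have iS: "integrable (joint_law P) ?S" by (intro Bochner_Integration.integrable_sum env(2))
  have ES: "(\<integral>u. ?S u \<partial>joint_law P) = real n * env_clip_mean P M"
    by (simp add: env env_clip_mean_def)
  have split: "?A u = ?I u + ?S u" for u
    using prof_add_const[of "\<lambda>j i. clip M (snd u (i, j)) - clip_mean M (fst u j)" "\<lambda>j. clip_mean M (fst u j)" "\<lambda>_. 0" 0 n k] by simp
  have EA: "(\<integral>u. ?A u \<partial>joint_law P) = (\<integral>u. ?I u \<partial>joint_law P) + real n * env_clip_mean P M"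
  proof -
    have "?I = (\<lambda>u. ?A u - ?S u)" using split by (auto simp: fun_eq_iff)
    then have "(\<integral>u. ?I u \<partial>joint_law P) = (\<integral>u. ?A u \<partial>joint_law P) - (\<integral>u. ?S u \<partial>joint_law P)"
      using iA iS by simp
    then show ?thesis unfolding ES by simp
  qed
  have "\<bar>(\<integral>u. ?T u - ?A u \<partial>joint_law P)\<bar> \<le> (\<integral>u. real k * M \<partial>joint_law P)"
    by (rule order_trans[OF integral_abs_bound integral_mono]) (use iT iA TA in auto)
  then have "\<bar>(\<integral>u. ?T u \<partial>joint_law P) - (\<integral>u. ?A u \<partial>joint_law P)\<bar> \<le> real k * M"
    using iT iA by (simp add: J.prob_space)
  then show "\<bar>(\<integral>u. ?T u \<partial>joint_law P) - (real n * env_clip_mean P M + sqrt (env_clip_var P M) * (2 * ref_passage half n k - real n))\<bar>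
    \<le> real k * M + (real n * (2 * (2 * M * \<beta>) ^ 3) + (real k * ln (1 / y) + real n * ln (1 / (1 - y)))) / \<beta>"
    using centered_passage[OF M \<beta> y, of n k] EA by linarith
qed

end

section \<open>Moments\<close>

lemma tail_set_simps: "tail_set 1 x = {x<..}" "tail_set (- 1) x = {..<- x}"
  by (auto simp: tail_set_def)

lemma nn_integral_reflect:
  fixes f :: "real \<Rightarrow> ennreal"
  assumes [measurable]: "f \<in> borel_measurable borel"
  shows "(\<integral>\<^sup>+x\<in>{0..}. f x \<partial>lborel) = (\<integral>\<^sup>+x\<in>{..0}. f (- x) \<partial>lborel)"
proof -
  have "(\<integral>\<^sup>+x\<in>{0..}. f x \<partial>lborel) = (\<integral>\<^sup>+x. f (- x) * indicator {0..} (- x) \<partial>lborel)"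
    by (subst nn_integral_real_affine[where c = "- 1" and t = 0]) auto
  also have "\<dots> = (\<integral>\<^sup>+x\<in>{..0}. f (- x) \<partial>lborel)"
    by (intro nn_integral_cong) (auto simp: indicator_def)
  finally show ?thesis .
qed

lemma excess_square_layers: "ennreal ((excess s 0 v)\<^sup>2) = (\<integral>\<^sup>+x. ennreal (2 * x) * ennreal (of_bool (0 \<le> x \<and> v \<in> tail_set s x)) \<partial>lborel)"
proof -
  have "(\<integral>\<^sup>+x. ennreal (2 * x) * ennreal (of_bool (0 \<le> x \<and> v \<in> tail_set s x)) \<partial>lborel)
      = (\<integral>\<^sup>+x. ennreal (2 * x) * indicator {0..s * v} x \<partial>lborel)"
    \<comment> \<open>The levels form an interval that is open at \<open>s * v\<close>, the
      integration rule uses the closed one; a single point is a null set.\<close>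
    by (rule nn_integral_cong_AE, rule AE_mp[OF AE_lborel_singleton[of "s * v"]])
       (auto intro!: AE_I2 simp: indicator_def tail_set_def)
  also have "\<dots> = ennreal ((excess s 0 v)\<^sup>2)"
  proof (cases "0 \<le> s * v")
    case True
    have "(\<integral>\<^sup>+x. ennreal (2 * x) * indicator {0..s * v} x \<partial>lborel) = ennreal ((s * v)\<^sup>2 - 0\<^sup>2)"
      by (rule nn_integral_FTC_Icc[where F = "\<lambda>x. x\<^sup>2"]) (use True in \<open>auto intro!: derivative_eq_intros\<close>)
    then show ?thesis using True by (simp add: excess_def)
  next
    case False
    then show ?thesis by (simp add: excess_def)
  qed
  finally show ?thesis ..
qed

context
  fixes P :: "(nat \<Rightarrow> real measure) measure"
  assumes iid: "iid_env P"
begin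

interpretation EL: prob_space "env_law P" by (rule prob_space_env_law[OF iid])
interpretation P: prob_space P by (rule iidD(1)[OF iid])
interpretation J: prob_space "joint_law P" by (rule joint_law_measure(2)[OF iid])

lemma integral_env_component:
  fixes h :: "real measure \<Rightarrow> real"
  assumes "h \<in> borel_measurable (prob_algebra borel)"
  shows "(\<integral>F. h (F 0) \<partial>P) = (\<integral>D. h D \<partial>env_law P)"
  unfolding iidD(4)[OF iid, of 0, symmetric] by (rule integral_distr[symmetric, OF env_component_measurable[OF iid] assms])

lemma cdf_component: "integrable P (\<lambda>F. cdf (F 0) x)" "F \<in> space P \<Longrightarrow> measure (F 0) {x<..} = 1 - cdf (F 0) x"
proof -
  show "integrable P (\<lambda>F. cdf (F 0) x)"
  proof (rule P.integrable_const_bound[where B = 1])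
    show "AE F in P. norm (cdf (F 0) x) \<le> 1" using env_measure_le_1[OF iid] by (simp add: cdf_def)
    show "(\<lambda>F. cdf (F 0) x) \<in> borel_measurable P" unfolding cdf_def by (rule env_measure_measurable[OF iid]) simp
  qed
  assume "F \<in> space P"
  then have D: "prob_space (F 0)" "sets (F 0) = sets borel" by (auto simp: env_space_P[OF iid] space_env)
  interpret D: prob_space "F 0" by fact
  have "space (F 0) - {..x} = {x<..}" using space_borelD[OF D(2)] by auto
  then show "measure (F 0) {x<..} = 1 - cdf (F 0) x"
    using D.prob_compl[of "{..x}"] D(2) by (simp add: cdf_def)
qed

lemma tail_prob_eq: "tail_prob P s x = (\<integral>F. measure (F 0) (tail_set s x) \<partial>P)"
  unfolding tail_prob_def mean_prob_def by (rule integral_env_component[symmetric]) (rule measure_prob_measurable, simp)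

text \<open>The tail set is the open half-line below \<open>x\<close> and the distribution function
  counts the closed one. An inequality is enough, since the lower tail assumptions are only used for
  finiteness.\<close>

lemma lower_tail_le: "F \<in> space P \<Longrightarrow> measure (F 0) (tail_set (- 1) (- x)) \<le> cdf (F 0) x"
proof -
  assume "F \<in> space P"
  then have D: "prob_space (F 0)" "sets (F 0) = sets borel" by (auto simp: env_space_P[OF iid] space_env)
  interpret D: prob_space "F 0" by fact
  show "measure (F 0) (tail_set (- 1) (- x)) \<le> cdf (F 0) x"
    unfolding cdf_def tail_set_simps by (rule D.finite_measure_mono) (auto simp: D(2))
qed

section \<open>Moments at a single site\<close>

lemma nn_integral_site:
  assumes h: "h \<in> borel_measurable borel"
  shows "(\<integral>\<^sup>+u. h (snd u (0, 0)) \<partial>joint_law P) = (\<integral>\<^sup>+D. \<integral>\<^sup>+v. h v \<partial>D \<partial>env_law P)"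
proof -
  have "(\<lambda>u. h (snd u (0, 0))) \<in> borel_measurable (env_space \<Otimes>\<^sub>M weight_space)"
    unfolding weight_space_def by (rule measurable_compose[OF _ h]) measurable
  then have "(\<integral>\<^sup>+u. h (snd u (0, 0)) \<partial>joint_law P) = (\<integral>\<^sup>+F. \<integral>\<^sup>+X. h (X (0, 0)) \<partial>quenched_law F \<partial>P)"
    by (subst joint_law_measure(3)[OF iid]) auto
  also have "\<dots> = (\<integral>\<^sup>+F. \<integral>\<^sup>+v. h v \<partial>F 0 \<partial>P)"
  proof (rule nn_integral_cong)
    fix F assume "F \<in> space P"
    then have F: "prob_space (F j)" "sets (F j) = sets borel" for j by (auto simp: env_space_P[OF iid] space_env)
    define N where "N = (\<lambda>(i :: nat, j). F j)"
    have N: "prob_space (N z)" for z using F by (simp add: N_def split_beta')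
    interpret N: prob_space "N z" for z by (rule N)
    interpret Q: product_prob_space N UNIV ..
    have "distr (PiM UNIV N) (N (0, 0)) (\<lambda>\<omega>. \<omega> (0, 0)) = N (0, 0)" by (rule Q.PiM_component) simp
    moreover have "(\<integral>\<^sup>+v. h v \<partial>distr (PiM UNIV N) (N (0, 0)) (\<lambda>\<omega>. \<omega> (0, 0))) = (\<integral>\<^sup>+X. h (X (0, 0)) \<partial>PiM UNIV N)"
    proof (rule nn_integral_distr)
      show "(\<lambda>\<omega>. \<omega> (0, 0)) \<in> PiM UNIV N \<rightarrow>\<^sub>M N (0, 0)" by (rule measurable_component_singleton) simp
      show "h \<in> borel_measurable (distr (PiM UNIV N) (N (0, 0)) (\<lambda>\<omega>. \<omega> (0, 0)))"
        using h by (simp add: N_def measurable_cong_sets[OF F(2) refl])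
    qed
    ultimately show "(\<integral>\<^sup>+X. h (X (0, 0)) \<partial>quenched_law F) = (\<integral>\<^sup>+v. h v \<partial>F 0)"
      unfolding quenched_law_def by (simp add: N_def)
  qed
  also have "\<dots> = (\<integral>\<^sup>+D. \<integral>\<^sup>+v. h v \<partial>D \<partial>env_law P)"
    by (rule nn_integral_env_law[OF iid])
       (rule measurable_compose[OF measurable_prob_algebraD[OF measurable_ident_sets[OF refl]] nn_integral_measurable_subprob_algebra], rule h)
  finally show ?thesis .
qed

lemma site_layers:
  assumes [measurable]: "g \<in> borel_measurable borel"
  shows "(\<integral>\<^sup>+u. \<integral>\<^sup>+x. g x * ennreal (of_bool (M \<le> x \<and> snd u (0, 0) \<in> tail_set s x)) \<partial>lborel \<partial>joint_law P)
    = (\<integral>\<^sup>+x\<in>{M..}. g x * ennreal (tail_prob P s x) \<partial>lborel)"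
proof -
  interpret pair_sigma_finite "joint_law P" lborel ..
  have "(\<lambda>(u, x). g x * ennreal (of_bool (M \<le> x \<and> snd u (0, 0) \<in> tail_set s x))) \<in> borel_measurable (joint_law P \<Otimes>\<^sub>M lborel)"
  proof -
    have "(\<lambda>q. g (snd q)) \<in> borel_measurable (joint_law P \<Otimes>\<^sub>M lborel)"
      by (rule measurable_compose[OF measurable_snd]) simp
    then show ?thesis
      using measurable_compose[OF layer_measurable[OF iid, of M "(0, 0)" s] measurable_ennreal]
      unfolding split_beta' by (rule borel_measurable_times_ennreal)
  qed
  from Fubini'[OF this]
  have "(\<integral>\<^sup>+u. \<integral>\<^sup>+x. g x * ennreal (of_bool (M \<le> x \<and> snd u (0, 0) \<in> tail_set s x)) \<partial>lborel \<partial>joint_law P)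
    = (\<integral>\<^sup>+x. \<integral>\<^sup>+u. g x * ennreal (of_bool (M \<le> x \<and> snd u (0, 0) \<in> tail_set s x)) \<partial>joint_law P \<partial>lborel)" by simp
  also have "\<dots> = (\<integral>\<^sup>+x\<in>{M..}. g x * ennreal (tail_prob P s x) \<partial>lborel)"
  proof (rule nn_integral_cong)
    fix x :: real
    have ind: "(\<integral>\<^sup>+u. indicator (tail_set s x) (snd u (0, 0)) \<partial>joint_law P) = ennreal (tail_prob P s x)"
    proof -
      have "(\<integral>\<^sup>+u. indicator (tail_set s x) (snd u (0, 0)) \<partial>joint_law P) = (\<integral>\<^sup>+D. \<integral>\<^sup>+v. indicator (tail_set s x) v \<partial>D \<partial>env_law P)"
        by (rule nn_integral_site) simp
      also have "\<dots> = (\<integral>\<^sup>+D. ennreal (measure D (tail_set s x)) \<partial>env_law P)"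
      proof (rule nn_integral_cong)
        fix D assume "D \<in> space (env_law P)"
        then have D: "prob_space D" "sets D = sets borel" using env_law_D[OF iid] by auto
        interpret D: prob_space D by fact
        show "(\<integral>\<^sup>+v. indicator (tail_set s x) v \<partial>D) = ennreal (measure D (tail_set s x))"
          using D(2) by (simp add: D.emeasure_eq_measure)
      qed
      finally show ?thesis by (simp add: nn_integral_mean_prob[OF iid] tail_prob_def)
    qed
    have "(\<lambda>u. snd u (0, 0)) \<in> borel_measurable (joint_law P)"
      by (rule joint_comp_measurable[OF iid]) (simp add: weight_space_def)
    then have m: "(\<lambda>u. indicator (tail_set s x) (snd u (0, 0)) :: ennreal) \<in> borel_measurable (joint_law P)"
      by (rule measurable_compose) simp
    have "(\<integral>\<^sup>+u. g x * ennreal (of_bool (M \<le> x \<and> snd u (0, 0) \<in> tail_set s x)) \<partial>joint_law P)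
        = (\<integral>\<^sup>+u. (g x * indicator {M..} x) * indicator (tail_set s x) (snd u (0, 0)) \<partial>joint_law P)"
      by (intro nn_integral_cong) (auto simp: indicator_def)
    also have "\<dots> = (g x * indicator {M..} x) * ennreal (tail_prob P s x)"
      by (subst nn_integral_cmult[OF m]) (simp add: ind)
    finally show "(\<integral>\<^sup>+u. g x * ennreal (of_bool (M \<le> x \<and> snd u (0, 0) \<in> tail_set s x)) \<partial>joint_law P)
        = g x * ennreal (tail_prob P s x) * indicator {M..} x" by (simp add: mult_ac)
  qed
  finally show ?thesis .
qed

lemma nn_integral_excess: "(\<integral>\<^sup>+D. \<integral>\<^sup>+v. ennreal (excess s M v) \<partial>D \<partial>env_law P) = tail_mean P s M"
  using site_layers[of "\<lambda>_. 1" M s] nn_integral_site[of "\<lambda>v. ennreal (excess s M v)"]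
  by (simp add: excess_layers[symmetric] tail_mean_def)

context
  assumes tails: "tail_assumptions P"
begin

text \<open>Translates the tail assumptions into \<open>tail_sqrt\<close> and
  \<open>tail_supint\<close>: equality for the upper tail, reflection and domination for the lower
  one.\<close>

lemma tails_finite_0:
  assumes "s = 1 \<or> s = - 1"
  shows "tail_sqrt P s 0 < \<infinity> \<and> tail_supint P s 0 < \<infinity>"
  using assms
proof
  assume s: "s = 1"
  have 1: "tail_prob P 1 x = 1 - (\<integral>F. cdf (F 0) x \<partial>P)" for x
  proof -
    have "tail_prob P 1 x = (\<integral>F. 1 - cdf (F 0) x \<partial>P)"
      unfolding tail_prob_eq tail_set_simps by (rule Bochner_Integration.integral_cong[OF refl]) (rule cdf_component)
    then show ?thesis using cdf_component(1) by (simp add: P.prob_space)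
  qed
  have 2: "ennreal (tail_sup P 1 x) = esssup P (\<lambda>F. ennreal (1 - cdf (F 0) x))" for x
    unfolding ennreal_tail_sup[OF iid] tail_set_simps
    by (rule esssup_AE_cong) (use cdf_component in \<open>auto intro!: AE_I2 borel_measurable_diff measurable_compose[OF _ measurable_ennreal] env_measure_measurable[OF iid]\<close>)
  show ?thesis using tails unfolding tail_assumptions_def tail_sqrt_def tail_supint_def s 1 2 by blast
next
  assume s: "s = - 1"
  have "tail_sqrt P (- 1) 0 = (\<integral>\<^sup>+x\<in>{..0}. ennreal (sqrt (tail_prob P (- 1) (- x))) \<partial>lborel)"
    unfolding tail_sqrt_def by (rule nn_integral_reflect) (use tail_prob_measurable[OF iid, of "- 1"] in measurable)
  also have "\<dots> \<le> (\<integral>\<^sup>+x\<in>{..0}. ennreal (sqrt (\<integral>F. cdf (F 0) x \<partial>P)) \<partial>lborel)"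
  proof (intro nn_integral_mono mult_right_mono ennreal_leI real_sqrt_le_mono)
    fix x show "tail_prob P (- 1) (- x) \<le> (\<integral>F. cdf (F 0) x \<partial>P)"
      unfolding tail_prob_eq
    proof (rule integral_mono)
      show "integrable P (\<lambda>F. cdf (F 0) x)" by (rule cdf_component)
      show "measure (F 0) (tail_set (- 1) (- x)) \<le> cdf (F 0) x" if "F \<in> space P" for F by (rule lower_tail_le[OF that])
      show "integrable P (\<lambda>F. measure (F 0) (tail_set (- 1) (- x)))"
        by (rule P.integrable_const_bound[where B = 1])
           (use env_measure_le_1[OF iid] env_measure_measurable[OF iid] in auto)
    qed
  qed simp
  finally have 1: "tail_sqrt P (- 1) 0 < \<infinity>" using tails unfolding tail_assumptions_def by (auto intro: le_less_trans)
  have "tail_supint P (- 1) 0 = (\<integral>\<^sup>+x\<in>{..0}. ennreal (tail_sup P (- 1) (- x)) \<partial>lborel)"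
    unfolding tail_supint_def by (rule nn_integral_reflect) (use tail_sup_measurable[OF iid, of "- 1"] in measurable)
  also have "\<dots> \<le> (\<integral>\<^sup>+x\<in>{..0}. esssup P (\<lambda>F. ennreal (cdf (F 0) x)) \<partial>lborel)"
  proof (intro nn_integral_mono mult_right_mono)
    fix x show "ennreal (tail_sup P (- 1) (- x)) \<le> esssup P (\<lambda>F. ennreal (cdf (F 0) x))"
      unfolding ennreal_tail_sup[OF iid]
      by (rule esssup_AE_mono) (use lower_tail_le cdf_component(1) env_measure_measurable[OF iid] in \<open>auto intro!: ennreal_leI\<close>)
  qed simp
  finally have "tail_supint P (- 1) 0 < \<infinity>" using tails unfolding tail_assumptions_def by (auto intro: le_less_trans)
  with 1 show ?thesis by (simp add: s)
qed

lemma tails_finite: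
  assumes "s = 1 \<or> s = - 1" "0 \<le> M"
  shows "tail_sqrt P s M < \<infinity> \<and> tail_supint P s M < \<infinity>"
proof -
  have "tail_sqrt P s M \<le> tail_sqrt P s 0" "tail_supint P s M \<le> tail_supint P s 0"
    unfolding tail_sqrt_def tail_supint_def using assms(2)
    by (intro nn_integral_mono; auto simp: indicator_def)+
  then show ?thesis using tails_finite_0[OF assms(1)] by (auto intro: le_less_trans)
qed

lemma tail_sqrt_tendsto_0:
  assumes "s = 1 \<or> s = - 1"
  shows "(\<lambda>m. enn2real (tail_sqrt P s (real m))) \<longlonglongrightarrow> 0"
proof -
  have [measurable]: "(\<lambda>x. ennreal (sqrt (tail_prob P s x))) \<in> borel_measurable lborel"
    using tail_prob_measurable[OF iid, of s] by measurable
  have "(\<lambda>m. tail_sqrt P s (real m)) \<longlonglongrightarrow> integral\<^sup>N lborel (\<lambda>_ :: real. 0)"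
    unfolding tail_sqrt_def
  proof (rule nn_integral_dominated_convergence[where w = "\<lambda>x. ennreal (sqrt (tail_prob P s x)) * indicator {0..} x"
        and u = "\<lambda>m x. ennreal (sqrt (tail_prob P s x)) * indicator {real m..} x" and u' = "\<lambda>_. 0"])
    show "AE x in lborel. (\<lambda>m. ennreal (sqrt (tail_prob P s x)) * indicator {real m..} x) \<longlonglongrightarrow> 0"
    proof (rule AE_I2)
      fix x :: real
      obtain m0 :: nat where "x < real m0" using reals_Archimedean2 by blast
      then have "eventually (\<lambda>m. ennreal (sqrt (tail_prob P s x)) * indicator {real m..} x = 0) sequentially"
        unfolding eventually_sequentially by (intro exI[of _ m0]) (auto simp: indicator_def)
      then show "(\<lambda>m. ennreal (sqrt (tail_prob P s x)) * indicator {real m..} x) \<longlonglongrightarrow> 0"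
        by (rule tendsto_eventually)
    qed
    show "(\<integral>\<^sup>+x\<in>{0..}. ennreal (sqrt (tail_prob P s x)) \<partial>lborel) < \<infinity>"
      using tails_finite_0[OF assms] by (simp add: tail_sqrt_def)
  qed (auto simp: indicator_def)
  then have "(\<lambda>m. tail_sqrt P s (real m)) \<longlonglongrightarrow> ennreal 0" by simp
  from tendsto_enn2real[OF this] show ?thesis by simp
qed

text \<open>The root of the tail is decreasing, so its integral over \<open>{0..x}\<close> is at
  least \<open>x\<close> times its value at \<open>x\<close>.\<close>

lemma sqrt_tail_prob_le:
  assumes s: "s = 1 \<or> s = - 1" and x: "0 \<le> x"
  shows "x * sqrt (tail_prob P s x) \<le> enn2real (tail_sqrt P s 0)"
proof -
  have "ennreal (x * sqrt (tail_prob P s x)) = (\<integral>\<^sup>+y. ennreal (sqrt (tail_prob P s x)) * indicator {0..x} y \<partial>lborel)"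
    using x tail_prob_bounds[OF iid, of s x] by (subst nn_integral_cmult_indicator) (simp_all add: ennreal_mult mult.commute)
  also have "\<dots> \<le> tail_sqrt P s 0"
    unfolding tail_sqrt_def
    by (intro nn_integral_mono) (auto simp: indicator_def intro!: ennreal_leI antimonoD[OF tail_prob_antimono[OF iid]])
  also have "\<dots> = ennreal (enn2real (tail_sqrt P s 0))" using tails_finite_0[OF s] by (simp add: ennreal_enn2real)
  finally show ?thesis by (simp add: ennreal_le_iff)
qed

text \<open>By levels the second moment is the integral of 2 x p_x. Splitting p_x into two roots, x
  sqrt p_x is bounded by \<open>sqrt_tail_prob_le\<close> and the other root is integrable. In this
  way the tail assumptions yield second moments.\<close>

lemma nn_integral_excess_square:
  assumes s: "s = 1 \<or> s = - 1"
  shows "(\<integral>\<^sup>+D. \<integral>\<^sup>+v. ennreal ((excess s 0 v)\<^sup>2) \<partial>D \<partial>env_law P) < \<infinity>"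
proof -
  define S where "S = enn2real (tail_sqrt P s 0)"
  have S0: "0 \<le> S" by (simp add: S_def)
  have [measurable]: "(\<lambda>x. ennreal (sqrt (tail_prob P s x))) \<in> borel_measurable lborel"
    using tail_prob_measurable[OF iid, of s] by measurable
  have "(\<integral>\<^sup>+D. \<integral>\<^sup>+v. ennreal ((excess s 0 v)\<^sup>2) \<partial>D \<partial>env_law P) = (\<integral>\<^sup>+u. ennreal ((excess s 0 (snd u (0, 0)))\<^sup>2) \<partial>joint_law P)"
    by (rule nn_integral_site[symmetric]) measurable
  also have "\<dots> = (\<integral>\<^sup>+x\<in>{0..}. ennreal (2 * x) * ennreal (tail_prob P s x) \<partial>lborel)"
    unfolding excess_square_layers by (rule site_layers) measurable
  also have "\<dots> \<le> (\<integral>\<^sup>+x. ennreal (2 * S) * (ennreal (sqrt (tail_prob P s x)) * indicator {0..} x) \<partial>lborel)"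
  proof (rule nn_integral_mono)
    fix x :: real
    show "ennreal (2 * x) * ennreal (tail_prob P s x) * indicator {0..} x \<le> ennreal (2 * S) * (ennreal (sqrt (tail_prob P s x)) * indicator {0..} x)"
    proof (cases "0 \<le> x")
      case True
      define q where "q = sqrt (tail_prob P s x)"
      have q: "0 \<le> q" "tail_prob P s x = q * q" using tail_prob_bounds[OF iid, of s x] by (simp_all add: q_def)
      have "x * q \<le> S" using sqrt_tail_prob_le[OF s True] by (simp add: q_def S_def)
      then have "2 * x * (q * q) \<le> 2 * S * q" using q mult_right_mono[of "x * q" S q] by (simp add: mult_ac)
      then show ?thesis using True q S0
        by (simp add: q_def[symmetric] ennreal_mult[symmetric] ennreal_leI del: real_sqrt_mult_self)
    qed simp
  qed
  also have "\<dots> = ennreal (2 * S) * tail_sqrt P s 0"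
    unfolding tail_sqrt_def by (rule nn_integral_cmult) measurable
  also have "\<dots> < \<infinity>" using tails_finite_0[OF s] by (simp add: ennreal_mult_less_top)
  finally show ?thesis .
qed

end

end

section \<open>Truncated moments of a single distribution\<close>

context
  fixes D :: "real measure"
  assumes D: "prob_space D" "sets D = sets borel" and sq: "integrable D (\<lambda>v. v\<^sup>2)"
begin

interpretation D: prob_space D by (rule D)

lemma id_borel_D: "(\<lambda>v. v) \<in> borel_measurable D"
  by (rule borel_D[OF D order_refl]) simp

lemma id_integrable: "integrable D (\<lambda>v. v)"
  by (rule D.square_integrable_imp_integrable[OF id_borel_D sq])

lemma abs_clip_le: "0 \<le> M \<Longrightarrow> \<bar>clip M v\<bar> \<le> \<bar>v\<bar>"
  by (auto simp: clip_def)

lemma clip_sq_le: "0 \<le> M \<Longrightarrow> (clip M v)\<^sup>2 \<le> v\<^sup>2"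
  using power_mono[OF abs_clip_le[of M v], of 2] by simp

lemma clip_var_le_second_moment: "0 \<le> M \<Longrightarrow> clip_var M D \<le> (\<integral>v. v\<^sup>2 \<partial>D)"
proof -
  assume M: "0 \<le> M"
  have "clip_var M D \<le> (\<integral>v. (clip M v)\<^sup>2 \<partial>D)" by (simp add: clip_var_eq[OF D M])
  also have "\<dots> \<le> (\<integral>v. v\<^sup>2 \<partial>D)"
    by (rule integral_mono[OF clip_sq_integrable[OF D M] sq]) (rule clip_sq_le[OF M])
  finally show ?thesis .
qed

lemma clip_tendsto: "(\<lambda>m. clip (real m) v) \<longlonglongrightarrow> v"
proof -
  obtain m0 :: nat where "\<bar>v\<bar> < real m0" using reals_Archimedean2 by blast
  then have "eventually (\<lambda>m. clip (real m) v = v) sequentially"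
    unfolding eventually_sequentially by (intro exI[of _ m0]) (auto simp: clip_def)
  then show ?thesis by (rule tendsto_eventually)
qed

lemma clip_var_tendsto: "(\<lambda>m. clip_var (real m) D) \<longlonglongrightarrow> dist_var D"
proof -
  have "(\<lambda>m. \<integral>v. (clip (real m) v)\<^sup>2 \<partial>D) \<longlonglongrightarrow> (\<integral>v. v\<^sup>2 \<partial>D)"
  proof (rule integral_dominated_convergence[where w = "\<lambda>v. v\<^sup>2"])
    show "(\<lambda>v. v\<^sup>2) \<in> borel_measurable D" using sq by (rule borel_measurable_integrable)
    show "(\<lambda>v. (clip (real m) v)\<^sup>2) \<in> borel_measurable D" for m
      using clip_sq_integrable[OF D, of "real m"] by (simp add: borel_measurable_integrable)
    show "AE v in D. (\<lambda>m. (clip (real m) v)\<^sup>2) \<longlonglongrightarrow> v\<^sup>2"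
      by (intro AE_I2 tendsto_power clip_tendsto)
    show "AE v in D. norm ((clip (real m) v)\<^sup>2) \<le> v\<^sup>2" for m
      using clip_sq_le[of "real m"] by (intro AE_I2) simp
  qed (rule sq)
  moreover have "(\<lambda>m. clip_mean (real m) D) \<longlonglongrightarrow> dist_mean D"
    unfolding clip_mean_def dist_mean_def
  proof (rule integral_dominated_convergence[where w = "\<lambda>v. \<bar>v\<bar>"])
    show "(\<lambda>v. clip (real m) v) \<in> borel_measurable D" for m
      by (rule borel_D[OF D order_refl]) (rule clip_measurable)
    show "AE v in D. (\<lambda>m. clip (real m) v) \<longlonglongrightarrow> v"
      by (intro AE_I2 clip_tendsto)
    show "AE v in D. norm (clip (real m) v) \<le> \<bar>v\<bar>" for m
      using abs_clip_le[of "real m"] by (intro AE_I2) simp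
  qed (use id_integrable id_borel_D in auto)
  ultimately have "(\<lambda>m. (\<integral>v. (clip (real m) v)\<^sup>2 \<partial>D) - (clip_mean (real m) D)\<^sup>2) \<longlonglongrightarrow> (\<integral>v. v\<^sup>2 \<partial>D) - (dist_mean D)\<^sup>2"
    by (intro tendsto_diff tendsto_power)
  moreover have "dist_var D = (\<integral>v. v\<^sup>2 \<partial>D) - (dist_mean D)\<^sup>2"
    unfolding dist_var_def dist_mean_def by (rule D.variance_eq[OF id_integrable sq])
  ultimately show ?thesis by (simp add: clip_var_eq[OF D])
qed

lemma excess_integrable: "s = 1 \<or> s = - 1 \<Longrightarrow> 0 \<le> M \<Longrightarrow> integrable D (excess s M)"
proof (rule Bochner_Integration.integrable_bound[OF id_integrable])
  show "excess s M \<in> borel_measurable D" by (rule borel_D[OF D order_refl]) (rule excess_measurable)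
qed (auto simp: excess_def)

lemma dist_mean_split:
  assumes M: "0 \<le> M"
  shows "dist_mean D = clip_mean M D + (\<integral>v. excess 1 M v \<partial>D) - (\<integral>v. excess (- 1) M v \<partial>D)"
proof -
  have "dist_mean D = (\<integral>v. clip M v + excess 1 M v - excess (- 1) M v \<partial>D)"
    unfolding dist_mean_def using clip_excess[OF M] by simp
  then show ?thesis
    using clip_integrable[OF D M] excess_integrable[OF _ M] by (simp add: clip_mean_def)
qed

end

lemma nn_integral_prob_measurable:
  assumes "h \<in> borel_measurable borel"
  shows "(\<lambda>D. \<integral>\<^sup>+v. h v \<partial>D) \<in> borel_measurable (prob_algebra (borel :: real measure))"
  by (rule measurable_compose[OF measurable_prob_algebraD[OF measurable_ident_sets[OF refl]] nn_integral_measurable_subprob_algebra])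
     (rule assms)

lemma dist_mean_measurable: "dist_mean \<in> borel_measurable (prob_algebra borel)"
  unfolding dist_mean_def[abs_def] by (rule integral_prob_measurable) simp

text \<open>The integrand depends on \<open>D\<close> through its mean, so measurability is obtained
  from the kernel version for nonnegative integrands and then transferred to the Bochner
  integral.\<close>

lemma dist_var_measurable: "dist_var \<in> borel_measurable (prob_algebra borel)"
proof -
  define V where "V D = (\<integral>\<^sup>+v. ennreal ((v - dist_mean D)\<^sup>2) \<partial>D)" for D
  have "(\<lambda>(D, v). ennreal ((v - dist_mean D)\<^sup>2)) \<in> borel_measurable (prob_algebra borel \<Otimes>\<^sub>M (borel :: real measure))"
    using dist_mean_measurable unfolding split_beta' by measurable
  then have V: "V \<in> borel_measurable (prob_algebra borel)"
    unfolding V_def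
    by (rule nn_integral_measurable_subprob_algebra2) (rule measurable_prob_algebraD[OF measurable_ident_sets[OF refl]])
  have "dist_var D = enn2real (V D)" if "D \<in> space (prob_algebra borel)" for D
    unfolding dist_var_def V_def
    by (rule integral_eq_nn_integral) (use that in \<open>auto simp: space_prob_algebra measurable_cong_sets[of D borel]\<close>)
  then show ?thesis using V by (subst measurable_cong) auto
qed

context
  fixes P :: "(nat \<Rightarrow> real measure) measure"
  assumes iid: "iid_env P" and tails: "tail_assumptions P"
begin

interpretation EL: prob_space "env_law P" by (rule prob_space_env_law[OF iid])
interpretation P: prob_space P by (rule iidD(1)[OF iid])

lemma nn_integral_measurable_env_law:
  "h \<in> borel_measurable borel \<Longrightarrow> (\<lambda>D. \<integral>\<^sup>+v. h v \<partial>D) \<in> borel_measurable (env_law P)"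
  unfolding measurable_cong_sets[OF sets_env_law[OF iid] refl] by (rule nn_integral_prob_measurable)

lemma second_moment_finite: "(\<integral>\<^sup>+D. \<integral>\<^sup>+v. ennreal (v\<^sup>2) \<partial>D \<partial>env_law P) < \<infinity>"
proof -
  let ?e = "\<lambda>s v. ennreal ((excess s 0 v)\<^sup>2)"
  have m: "?e s \<in> borel_measurable borel" for s by measurable
  have "(\<integral>\<^sup>+D. \<integral>\<^sup>+v. ennreal (v\<^sup>2) \<partial>D \<partial>env_law P) = (\<integral>\<^sup>+D. (\<integral>\<^sup>+v. ?e 1 v \<partial>D) + (\<integral>\<^sup>+v. ?e (- 1) v \<partial>D) \<partial>env_law P)"
  proof (rule nn_integral_cong)
    fix D assume "D \<in> space (env_law P)"
    then have D: "sets D = sets borel" using env_law_D[OF iid] by auto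
    have sq: "v\<^sup>2 = (excess 1 0 v)\<^sup>2 + (excess (- 1) 0 v)\<^sup>2" for v
      by (simp add: excess_def max_def)
    have "ennreal (v\<^sup>2) = ?e 1 v + ?e (- 1) v" for v
      unfolding sq[of v] by (rule ennreal_plus) auto
    then have "(\<integral>\<^sup>+v. ennreal (v\<^sup>2) \<partial>D) = (\<integral>\<^sup>+v. ?e 1 v + ?e (- 1) v \<partial>D)" by (rule nn_integral_cong)
    also have "\<dots> = (\<integral>\<^sup>+v. ?e 1 v \<partial>D) + (\<integral>\<^sup>+v. ?e (- 1) v \<partial>D)"
      by (rule nn_integral_add) (use m in \<open>simp_all add: measurable_cong_sets[OF D refl]\<close>)
    finally show "(\<integral>\<^sup>+v. ennreal (v\<^sup>2) \<partial>D) = (\<integral>\<^sup>+v. ?e 1 v \<partial>D) + (\<integral>\<^sup>+v. ?e (- 1) v \<partial>D)" .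
  qed
  also have "\<dots> = (\<integral>\<^sup>+D. \<integral>\<^sup>+v. ?e 1 v \<partial>D \<partial>env_law P) + (\<integral>\<^sup>+D. \<integral>\<^sup>+v. ?e (- 1) v \<partial>D \<partial>env_law P)"
    by (rule nn_integral_add; rule nn_integral_measurable_env_law[OF m])
  also have "\<dots> < \<infinity>" using nn_integral_excess_square[OF iid tails] by simp
  finally show ?thesis .
qed

lemma second_moment_AE: "AE D in env_law P. prob_space D \<and> sets D = sets borel \<and> integrable D (\<lambda>v. v\<^sup>2)"
proof -
  have "AE D in env_law P. (\<integral>\<^sup>+v. ennreal (v\<^sup>2) \<partial>D) \<noteq> \<infinity>"
    by (rule nn_integral_PInf_AE[OF nn_integral_measurable_env_law]) (use second_moment_finite in auto)
  then show ?thesis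
  proof (rule AE_mp, intro AE_I2 impI)
    fix D assume Din: "D \<in> space (env_law P)" and fin: "(\<integral>\<^sup>+v. ennreal (v\<^sup>2) \<partial>D) \<noteq> \<infinity>"
    have D: "prob_space D" "sets D = sets borel" using env_law_D[OF iid Din] by auto
    have "integrable D (\<lambda>v. v\<^sup>2)"
    proof (rule integrableI_nonneg)
      show "(\<lambda>v. v\<^sup>2) \<in> borel_measurable D" by (simp add: measurable_cong_sets[OF D(2) refl])
      show "(\<integral>\<^sup>+v. ennreal (v\<^sup>2) \<partial>D) < \<infinity>" using fin by (simp add: top.not_eq_extremum)
    qed simp
    with D show "prob_space D \<and> sets D = sets borel \<and> integrable D (\<lambda>v. v\<^sup>2)" by simp
  qed
qed

lemma second_moment_integrable: "integrable (env_law P) (\<lambda>D. \<integral>v. v\<^sup>2 \<partial>D)"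
proof (rule integrableI_nonneg)
  show "(\<lambda>D. \<integral>v. v\<^sup>2 \<partial>D) \<in> borel_measurable (env_law P)"
    by (rule env_law_measurable[OF iid], rule integral_prob_measurable) measurable
  have "(\<integral>\<^sup>+D. ennreal (\<integral>v. v\<^sup>2 \<partial>D) \<partial>env_law P) = (\<integral>\<^sup>+D. \<integral>\<^sup>+v. ennreal (v\<^sup>2) \<partial>D \<partial>env_law P)"
    by (rule nn_integral_cong_AE, rule AE_mp[OF second_moment_AE]) (auto intro!: AE_I2 nn_integral_eq_integral[symmetric])
  then show "(\<integral>\<^sup>+D. ennreal (\<integral>v. v\<^sup>2 \<partial>D) \<partial>env_law P) < \<infinity>" using second_moment_finite by simp
qed simp

text \<open>Dominated convergence twice: inside almost every distribution, and over the environment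
  with the averaged second moment as majorant. This identifies the limiting \<sigma>.\<close>

lemma env_clip_var_tendsto: "(\<lambda>m. env_clip_var P (real m)) \<longlonglongrightarrow> (\<integral>F. dist_var (F 0) \<partial>P)"
  unfolding integral_env_component[OF iid dist_var_measurable] env_clip_var_def
proof (rule integral_dominated_convergence[where w = "\<lambda>D. \<integral>v. v\<^sup>2 \<partial>D"])
  show "dist_var \<in> borel_measurable (env_law P)" by (rule env_law_measurable[OF iid dist_var_measurable])
  show "clip_var (real m) \<in> borel_measurable (env_law P)" for m by (rule clip_var_measurable[OF iid]) simp
  show "AE D in env_law P. (\<lambda>m. clip_var (real m) D) \<longlonglongrightarrow> dist_var D"
    by (rule AE_mp[OF second_moment_AE]) (auto intro!: AE_I2 clip_var_tendsto)
  show "AE D in env_law P. norm (clip_var (real m) D) \<le> (\<integral>v. v\<^sup>2 \<partial>D)" for m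
  proof (rule AE_mp[OF second_moment_AE], intro AE_I2 impI)
    fix D :: "real measure" assume D: "prob_space D \<and> sets D = sets borel \<and> integrable D (\<lambda>v. v\<^sup>2)"
    have "0 \<le> clip_var (real m) D" by (rule clip_var_bounds) (use D in auto)
    moreover have "clip_var (real m) D \<le> (\<integral>v. v\<^sup>2 \<partial>D)" by (rule clip_var_le_second_moment) (use D in auto)
    ultimately show "norm (clip_var (real m) D) \<le> (\<integral>v. v\<^sup>2 \<partial>D)" by simp
  qed
qed (rule second_moment_integrable)

lemma excess_mean:
  assumes s: "s = 1 \<or> s = - 1" and M: "0 \<le> M"
  shows "integrable (env_law P) (\<lambda>D. \<integral>v. excess s M v \<partial>D)"
    and "(\<integral>D. \<integral>v. excess s M v \<partial>D \<partial>env_law P) = enn2real (tail_mean P s M)"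
proof -
  have m: "(\<lambda>D. \<integral>v. excess s M v \<partial>D) \<in> borel_measurable (env_law P)"
    by (rule env_law_measurable[OF iid], rule integral_prob_measurable) measurable
  have nn: "0 \<le> (\<integral>v. excess s M v \<partial>D)" for D by (rule integral_nonneg_AE) (simp add: excess_nonneg)
  have eq: "(\<integral>\<^sup>+D. ennreal (\<integral>v. excess s M v \<partial>D) \<partial>env_law P) = tail_mean P s M"
    unfolding nn_integral_excess[OF iid, symmetric]
    by (rule nn_integral_cong_AE, rule AE_mp[OF second_moment_AE])
       (auto intro!: AE_I2 nn_integral_eq_integral[symmetric] excess_integrable s M excess_nonneg)
  have "tail_mean P s M < \<infinity>"
    using tail_mean_le_sqrt[OF iid, of s M] tails_finite[OF iid tails s M] by (auto intro: le_less_trans)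
  then show i: "integrable (env_law P) (\<lambda>D. \<integral>v. excess s M v \<partial>D)"
    by (intro integrableI_nonneg m) (use nn eq in auto)
  show "(\<integral>D. \<integral>v. excess s M v \<partial>D \<partial>env_law P) = enn2real (tail_mean P s M)"
    unfolding eq[symmetric] using nn by (subst nn_integral_eq_integral[OF i]) (auto intro: integral_nonneg_AE)
qed

text \<open>The change of mean under truncation is exactly the centering term of
  \<open>last_passage_truncation\<close>, so the leading constant is the untruncated mean at every
  height.\<close>

lemma mean_split:
  assumes M: "0 \<le> M"
  shows "(\<integral>F. dist_mean (F 0) \<partial>P) = env_clip_mean P M + enn2real (tail_mean P 1 M) - enn2real (tail_mean P (- 1) M)"
proof -
  have "(\<integral>F. dist_mean (F 0) \<partial>P) = (\<integral>D. dist_mean D \<partial>env_law P)"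
    by (rule integral_env_component[OF iid dist_mean_measurable])
  also have "\<dots> = (\<integral>D. clip_mean M D + (\<integral>v. excess 1 M v \<partial>D) - (\<integral>v. excess (- 1) M v \<partial>D) \<partial>env_law P)"
  proof (rule integral_cong_AE)
    show "dist_mean \<in> borel_measurable (env_law P)" by (rule env_law_measurable[OF iid dist_mean_measurable])
    show "AE D in env_law P. dist_mean D = clip_mean M D + (\<integral>v. excess 1 M v \<partial>D) - (\<integral>v. excess (- 1) M v \<partial>D)"
      by (rule AE_mp[OF second_moment_AE]) (auto intro!: AE_I2 dist_mean_split M)
  qed (use clip_mean_integrable[OF iid M] excess_mean(1)[OF _ M] in auto)
  also have "\<dots> = env_clip_mean P M + enn2real (tail_mean P 1 M) - enn2real (tail_mean P (- 1) M)"
    using clip_mean_integrable[OF iid M] excess_mean[OF _ M] by (simp add: env_clip_mean_def)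
  finally show ?thesis .
qed

end

section \<open>The limit shape near the axis\<close>

text \<open>Convergence in L^1 carries over to expectations. Hence \<open>\<Psi> \<alpha> 1\<close>
  is a limit of mean passage times, and all estimates can be made in expectation.\<close>

lemma mean_tendsto:
  fixes f :: "nat \<Rightarrow> 'a \<Rightarrow> real"
  assumes M: "prob_space M" and f: "\<And>n. f n \<in> borel_measurable M"
    and lim: "(\<lambda>n. \<integral>\<^sup>+u. ennreal \<bar>f n u - c\<bar> \<partial>M) \<longlonglongrightarrow> 0"
  shows "(\<lambda>n. \<integral>u. f n u \<partial>M) \<longlonglongrightarrow> c"
proof -
  interpret prob_space M by (rule M)
  define e where "e n = (\<integral>\<^sup>+u. ennreal \<bar>f n u - c\<bar> \<partial>M)" for n
  have "eventually (\<lambda>n. e n < 1) sequentially"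
    using order_tendstoD(2)[OF lim, of 1] by (simp add: e_def)
  then have "eventually (\<lambda>n. \<bar>(\<integral>u. f n u \<partial>M) - c\<bar> \<le> enn2real (e n)) sequentially"
  proof eventually_elim
    case (elim n)
    have "e n < \<infinity>" using elim by (rule less_le_trans) simp
    then have i: "integrable M (\<lambda>u. f n u - c)"
      by (intro integrableI_bounded) (use f in \<open>simp_all add: e_def\<close>)
    then have "integrable M (\<lambda>u. (f n u - c) + c)" by (intro Bochner_Integration.integrable_add) auto
    then have "integrable M (f n)" by simp
    then have "(\<integral>u. f n u \<partial>M) - c = (\<integral>u. f n u - c \<partial>M)" by (simp add: prob_space)
    also have "\<bar>\<dots>\<bar> \<le> (\<integral>u. \<bar>f n u - c\<bar> \<partial>M)" by (rule integral_abs_bound)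
    also have "\<dots> = enn2real (e n)"
      unfolding e_def by (rule integral_eq_nn_integral) (use f in auto)
    finally show ?case .
  qed
  then have "eventually (\<lambda>n. norm ((\<integral>u. f n u \<partial>M) - c) \<le> enn2real (e n)) sequentially" by simp
  moreover have "e \<longlonglongrightarrow> ennreal 0" using lim unfolding e_def by simp
  then have "(\<lambda>n. enn2real (e n)) \<longlonglongrightarrow> 0" by (rule tendsto_enn2real) simp
  ultimately have "(\<lambda>n. (\<integral>u. f n u \<partial>M) - c) \<longlonglongrightarrow> 0" by (rule Lim_null_comparison)
  then show ?thesis by (rule LIM_zero_cancel)
qed

lemma floor_ratio_tendsto:
  assumes "0 < \<alpha>"
  shows "(\<lambda>n. real (nat \<lfloor>real n * \<alpha>\<rfloor>) / real n) \<longlonglongrightarrow> \<alpha>"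
proof (rule tendsto_sandwich)
  have fl: "real n * \<alpha> - 1 \<le> real (nat \<lfloor>real n * \<alpha>\<rfloor>)" "real (nat \<lfloor>real n * \<alpha>\<rfloor>) \<le> real n * \<alpha>" for n
  proof -
    have "0 \<le> real n * \<alpha>" using assms by simp
    then have "real (nat \<lfloor>real n * \<alpha>\<rfloor>) = of_int \<lfloor>real n * \<alpha>\<rfloor>" by simp
    then show "real n * \<alpha> - 1 \<le> real (nat \<lfloor>real n * \<alpha>\<rfloor>)" "real (nat \<lfloor>real n * \<alpha>\<rfloor>) \<le> real n * \<alpha>"
      by linarith+
  qed
  have pos: "eventually (\<lambda>n :: nat. 0 < n) sequentially" by (rule eventually_gt_at_top)
  show "eventually (\<lambda>n. \<alpha> - 1 / real n \<le> real (nat \<lfloor>real n * \<alpha>\<rfloor>) / real n) sequentially"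
    using pos
  proof eventually_elim
    case (elim n)
    have "\<alpha> - 1 / real n = (real n * \<alpha> - 1) / real n" using elim by (simp add: diff_divide_distrib)
    also have "\<dots> \<le> real (nat \<lfloor>real n * \<alpha>\<rfloor>) / real n" by (rule divide_right_mono[OF fl(1)]) simp
    finally show ?case .
  qed
  show "eventually (\<lambda>n. real (nat \<lfloor>real n * \<alpha>\<rfloor>) / real n \<le> \<alpha>) sequentially"
    using pos by eventually_elim (use fl in \<open>simp add: pos_divide_le_eq mult.commute\<close>)
  show "(\<lambda>n. \<alpha> - 1 / real n) \<longlonglongrightarrow> \<alpha>"
    using tendsto_diff[OF tendsto_const[of \<alpha>] lim_1_over_n] by simp
qed simp

text \<open>The bounds of \<open>ref_passage_le\<close> and \<open>ref_passage_ge\<close> divided by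
  \<open>n\<close>: there R / n tends to \<alpha> / 2 and A / n to sqrt \<alpha>. The limiting error
  is of order \<alpha>^(3/4), smaller than sqrt \<alpha>.\<close>

lemma ref_passage_asymp:
  fixes \<alpha> :: real
  assumes \<alpha>: "0 < \<alpha>" "\<alpha> < 1"
  defines "k \<equiv> \<lambda>n. nat \<lfloor>real n * \<alpha>\<rfloor>"
  obtains \<delta> where "\<delta> \<longlonglongrightarrow> \<alpha> / 2 + sqrt (\<alpha> * sqrt \<alpha>)"
    "eventually (\<lambda>n. \<bar>ref_passage half n (k n) - (real n / 2 + sqrt (real n * real (Suc (k n))))\<bar> \<le> real n * \<delta> n) sequentially"
proof -
  define A where "A n = sqrt (real n * real (Suc (k n)))" for n
  define R where "R n = real (Suc (k n)) / 2 + sqrt (real n) * (ln (real (k n + n + 2)) + 3) + A n / (2 * real (Suc (k n)))" for n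
  have a: "(\<lambda>n. real (k n) / real n) \<longlonglongrightarrow> \<alpha>" unfolding k_def by (rule floor_ratio_tendsto[OF \<alpha>(1)])
  then have a1: "(\<lambda>n. real (Suc (k n)) / real n) \<longlonglongrightarrow> \<alpha>"
    using tendsto_add[OF a lim_1_over_n] by (simp add: add_divide_distrib add.commute)
  have pos: "eventually (\<lambda>n :: nat. 0 < n) sequentially" by (rule eventually_gt_at_top)
  have A: "(\<lambda>n. A n / real n) \<longlonglongrightarrow> sqrt \<alpha>"
  proof (rule Lim_transform_eventually[OF tendsto_real_sqrt[OF a1]])
    show "eventually (\<lambda>n. sqrt (real (Suc (k n)) / real n) = A n / real n) sequentially"
      using pos
    proof eventually_elim
      case (elim n)
      have "real (Suc (k n)) / real n = (real n * real (Suc (k n))) / (real n)\<^sup>2" using elim by (simp add: power2_eq_square)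
      then show ?case by (simp add: A_def real_sqrt_divide)
    qed
  qed
  \<comment> \<open>The hypotheses of \<open>ref_passage_ge\<close>: positive \<alpha> makes
    \<open>k n\<close> large, and \<alpha> below 1 leaves fewer columns than rows.\<close>
  have kn: "eventually (\<lambda>n. 3 \<le> k n \<and> Suc (k n) < n) sequentially"
  proof -
    have "eventually (\<lambda>n. 3 \<le> real n * \<alpha>) sequentially" "eventually (\<lambda>n. real n * \<alpha> + 1 < real n) sequentially"
      using \<alpha> by real_asymp+
    then show ?thesis
    proof eventually_elim
      case (elim n)
      have "real (k n) \<le> real n * \<alpha>" using \<alpha> by (simp add: k_def)
      moreover have "3 \<le> k n" using elim(1) by (simp add: k_def le_nat_floor le_floor_iff nat_le_iff le_nat_iff)
      ultimately show ?case using elim(2) by linarith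
    qed
  qed
  have log: "(\<lambda>n. (ln (real (k n + n + 2)) + 3) / sqrt (real n)) \<longlonglongrightarrow> 0"
  proof (rule tendsto_sandwich[of "\<lambda>_. 0"])
    show "eventually (\<lambda>n. 0 \<le> (ln (real (k n + n + 2)) + 3) / sqrt (real n)) sequentially" by simp
    show "eventually (\<lambda>n. (ln (real (k n + n + 2)) + 3) / sqrt (real n) \<le> (ln (2 * real n + 2) + 3) / sqrt (real n)) sequentially"
      using kn by eventually_elim (intro divide_right_mono add_right_mono ln_mono; simp)
    show "(\<lambda>n. (ln (2 * real n + 2) + 3) / sqrt (real n)) \<longlonglongrightarrow> 0" by real_asymp
  qed simp
  have inv: "(\<lambda>n. A n / real n / (2 * (real (Suc (k n)) / real n)) * (1 / real n)) \<longlonglongrightarrow> sqrt \<alpha> / (2 * \<alpha>) * 0"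
    by (intro tendsto_mult tendsto_divide tendsto_const A a1 lim_1_over_n) (use \<alpha> in simp)
  have R: "(\<lambda>n. R n / real n) \<longlonglongrightarrow> \<alpha> / 2"
  proof (rule Lim_transform_eventually)
    show "(\<lambda>n. real (Suc (k n)) / real n / 2 + (ln (real (k n + n + 2)) + 3) / sqrt (real n) + A n / real n / (2 * (real (Suc (k n)) / real n)) * (1 / real n)) \<longlonglongrightarrow> \<alpha> / 2"
      using tendsto_add[OF tendsto_add[OF tendsto_divide[OF a1 tendsto_const[of 2]] log] inv] by simp
    show "eventually (\<lambda>n. real (Suc (k n)) / real n / 2 + (ln (real (k n + n + 2)) + 3) / sqrt (real n) + A n / real n / (2 * (real (Suc (k n)) / real n)) * (1 / real n) = R n / real n) sequentially"
      using pos
    proof eventually_elim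
      case (elim n)
      have e1: "x / sqrt (real n) = sqrt (real n) * x / real n" for x
      proof -
        have "sqrt (real n) * x / real n = (sqrt (real n) / real n) * x" by simp
        also have "\<dots> = inverse (sqrt (real n)) * x" by (subst sqrt_divide_self_eq) simp_all
        also have "\<dots> = x / sqrt (real n)" by (simp add: divide_inverse mult.commute)
        finally show ?thesis ..
      qed
      have e2: "A n / real n / (2 * (y / real n)) * (1 / real n) = A n / (2 * y) / real n" for y
        using elim by simp
      have e3: "y / real n / 2 = y / 2 / real n" for y by simp
      show ?case by (simp only: R_def add_divide_distrib[of _ _ "real n"] e1 e2 e3)
    qed
  qed
  define \<delta> where "\<delta> n = R n / real n + sqrt (2 * (R n / real n) * (A n / real n))" for n
  show ?thesis
  proof
    have "(\<lambda>n. R n / real n + sqrt (2 * (R n / real n) * (A n / real n))) \<longlonglongrightarrow> \<alpha> / 2 + sqrt (2 * (\<alpha> / 2) * sqrt \<alpha>)"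
      by (intro tendsto_add tendsto_real_sqrt tendsto_mult tendsto_const R A)
    then show "\<delta> \<longlonglongrightarrow> \<alpha> / 2 + sqrt (\<alpha> * sqrt \<alpha>)" by (simp add: \<delta>_def[abs_def])
    show "eventually (\<lambda>n. \<bar>ref_passage half n (k n) - (real n / 2 + sqrt (real n * real (Suc (k n))))\<bar> \<le> real n * \<delta> n) sequentially"
      using kn
    proof eventually_elim
      case (elim n)
      have n: "0 < real n" using elim by simp
      have "2 * (R n / real n) * (A n / real n) = 2 * R n * A n / (real n)\<^sup>2" by (simp add: power2_eq_square)
      then have "sqrt (2 * (R n / real n) * (A n / real n)) = sqrt (2 * R n * A n) / real n"
        by (simp add: real_sqrt_divide)
      then have eq: "real n * \<delta> n = R n + sqrt (2 * R n * A n)" using n by (simp add: \<delta>_def distrib_left)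
      have "real n / 2 + A n - R n - sqrt (2 * R n * A n) \<le> ref_passage half n (k n)"
        unfolding R_def A_def by (rule ref_passage_ge) (use elim in auto)
      moreover have "ref_passage half n (k n) \<le> real n / 2 + A n" unfolding A_def by (rule ref_passage_le)
      moreover have "0 \<le> R n" unfolding R_def A_def by simp
      moreover from this have "0 \<le> sqrt (2 * R n * A n)" unfolding A_def by simp
      ultimately show ?case unfolding eq A_def[symmetric] by (simp add: abs_le_iff)
    qed
  qed
qed

text \<open>The limit in \<open>n\<close> is taken for fixed \<alpha>, \<open>M\<close> and \<beta>.
  In order: truncation in rows and columns, each giving 2 sqrt \<alpha> \<tau>; the essential
  suprema; horizontal steps of clipped weights; exchange and smoothing; the error of the fair
  model.\<close>

lemma limit_shape_bound:
  fixes \<Psi> :: "real \<Rightarrow> real \<Rightarrow> real"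
  assumes iid: "iid_env P" and tails: "tail_assumptions P" and shape: "is_limit_shape P \<Psi>"
    and \<alpha>: "0 < \<alpha>" "\<alpha> < 1" and M: "0 \<le> M" and \<beta>: "0 < \<beta>"
  defines "\<tau> \<equiv> enn2real (tail_sqrt P 1 M) + enn2real (tail_sqrt P (- 1) M)"
    and "b \<equiv> enn2real (tail_supint P 1 M) + enn2real (tail_supint P (- 1) M)"
    and "\<sigma> \<equiv> sqrt (env_clip_var P M)"
  shows "\<bar>\<Psi> \<alpha> 1 - ((\<integral>F. dist_mean (F 0) \<partial>P) + 2 * \<sigma> * sqrt \<alpha>)\<bar>
    \<le> 4 * sqrt \<alpha> * \<tau> + \<alpha> * b + (\<alpha> * M + (2 * (2 * M * \<beta>) ^ 3 + (\<alpha> * ln (1 / \<alpha>) + ln (1 / (1 - \<alpha>)))) / \<beta>)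
      + 2 * \<sigma> * (\<alpha> / 2 + sqrt (\<alpha> * sqrt \<alpha>))"
proof -
  define \<mu> where "\<mu> = (\<integral>F. dist_mean (F 0) \<partial>P)"
  define k where "k n = nat \<lfloor>real n * \<alpha>\<rfloor>" for n
  obtain \<delta> where \<delta>: "\<delta> \<longlonglongrightarrow> \<alpha> / 2 + sqrt (\<alpha> * sqrt \<alpha>)"
    and ref: "eventually (\<lambda>n. \<bar>ref_passage half n (k n) - (real n / 2 + sqrt (real n * real (Suc (k n))))\<bar> \<le> real n * \<delta> n) sequentially"
    unfolding k_def by (rule ref_passage_asymp[OF \<alpha>])
  define T where "T n = (\<integral>u. last_passage (snd u) (k n) n \<partial>joint_law P)" for n
  define A where "A n = sqrt (real n * real (Suc (k n)))" for n
  define B where "B n = sqrt (real (k n) * real (Suc n))" for n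
  define L where "L = 2 * (2 * M * \<beta>) ^ 3 + ln (1 / (1 - \<alpha>))"
  have \<sigma>0: "0 \<le> \<sigma>" unfolding \<sigma>_def using env_clip_var_bounds(1)[OF iid M] by simp
  have lim_T: "(\<lambda>n. T n / real n) \<longlonglongrightarrow> \<Psi> \<alpha> 1"
  proof -
    have Xm: "(\<lambda>u. snd u z) \<in> borel_measurable (joint_law P)" for z
      by (rule joint_comp_measurable[OF iid]) (simp add: weight_space_def)
    have "(\<lambda>n. \<integral>u. last_passage (snd u) (k n) n / real n \<partial>joint_law P) \<longlonglongrightarrow> \<Psi> \<alpha> 1"
    proof (rule mean_tendsto[OF joint_law_measure(2)[OF iid]])
      show "(\<lambda>u. last_passage (snd u) (k n) n / real n) \<in> borel_measurable (joint_law P)" for n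
        by (intro borel_measurable_divide measurable_last_passage Xm) simp
      show "(\<lambda>n. \<integral>\<^sup>+u. ennreal \<bar>last_passage (snd u) (k n) n / real n - \<Psi> \<alpha> 1\<bar> \<partial>joint_law P) \<longlonglongrightarrow> 0"
        using shape[unfolded is_limit_shape_def, rule_format, of \<alpha> 1] \<alpha>(1) by (simp add: k_def split_beta')
    qed
    then show ?thesis by (simp add: T_def)
  qed
  have a: "(\<lambda>n. real (k n) / real n) \<longlonglongrightarrow> \<alpha>" unfolding k_def by (rule floor_ratio_tendsto[OF \<alpha>(1)])
  have pos: "eventually (\<lambda>n :: nat. 0 < n) sequentially" by (rule eventually_gt_at_top)
  have sqrt_div: "sqrt x / real n = sqrt (x / real n / real n)" if "0 < n" for x and n :: nat
    using that by (simp add: real_sqrt_divide field_simps)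
  have lim_A: "(\<lambda>n. A n / real n) \<longlonglongrightarrow> sqrt \<alpha>"
  proof (rule Lim_transform_eventually)
    show "(\<lambda>n. sqrt (real (k n) / real n + 1 / real n)) \<longlonglongrightarrow> sqrt \<alpha>"
      using tendsto_real_sqrt[OF tendsto_add[OF a lim_1_over_n]] by simp
    show "eventually (\<lambda>n. sqrt (real (k n) / real n + 1 / real n) = A n / real n) sequentially"
      using pos by eventually_elim (simp add: A_def sqrt_div add_divide_distrib add.commute)
  qed
  have lim_B: "(\<lambda>n. B n / real n) \<longlonglongrightarrow> sqrt \<alpha>"
  proof (rule Lim_transform_eventually)
    show "(\<lambda>n. sqrt (real (k n) / real n * (1 + 1 / real n))) \<longlonglongrightarrow> sqrt \<alpha>"
      using tendsto_real_sqrt[OF tendsto_mult[OF a tendsto_add[OF tendsto_const[of 1] lim_1_over_n]]] by simp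
    show "eventually (\<lambda>n. sqrt (real (k n) / real n * (1 + 1 / real n)) = B n / real n) sequentially"
      using pos by eventually_elim (simp add: B_def sqrt_div field_simps)
  qed
  define E where "E n = (2 * (A n / real n) + 2 * (B n / real n)) * \<tau> + real (k n) / real n * b
    + (real (k n) / real n * M + (L + real (k n) / real n * ln (1 / \<alpha>)) / \<beta>) + 2 * \<sigma> * \<delta> n" for n
  have "eventually (\<lambda>n. \<bar>T n / real n - (\<mu> + 2 * \<sigma> * (A n / real n))\<bar> \<le> E n) sequentially"
    using pos ref
  proof eventually_elim
    case (elim n)
    have n: "0 < real n" using elim by simp
    let ?C = "\<integral>u. last_passage (\<lambda>z. clip M (snd u z)) (k n) n \<partial>joint_law P"
    \<comment> \<open>The entropy parameter \<open>y\<close> is set to \<alpha>, which for small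
      \<alpha> is close to the optimal k / (k + n).\<close>
    note C = clipped_last_passage[OF iid M \<beta> \<alpha>, of "k n" n]
    have 1: "\<bar>T n - ?C - real n * (enn2real (tail_mean P 1 M) - enn2real (tail_mean P (- 1) M))\<bar> \<le> (2 * A n + 2 * B n) * \<tau> + real (k n) * b"
      unfolding T_def A_def B_def \<tau>_def b_def
      by (rule last_passage_truncation[OF iid M _ C(1)]) (rule tails_finite[OF iid tails _ M])
    have 2: "\<bar>?C - (real n * env_clip_mean P M + \<sigma> * (2 * ref_passage half n (k n) - real n))\<bar>
      \<le> real (k n) * M + (real n * (2 * (2 * M * \<beta>) ^ 3) + (real (k n) * ln (1 / \<alpha>) + real n * ln (1 / (1 - \<alpha>)))) / \<beta>"
      unfolding \<sigma>_def by (rule C(2))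
    have "\<sigma> * (2 * ref_passage half n (k n) - real n) - 2 * \<sigma> * A n = 2 * \<sigma> * (ref_passage half n (k n) - (real n / 2 + A n))"
      by (simp add: algebra_simps)
    then have 3: "\<bar>\<sigma> * (2 * ref_passage half n (k n) - real n) - 2 * \<sigma> * A n\<bar> \<le> 2 * \<sigma> * (real n * \<delta> n)"
      using elim(2) \<sigma>0 by (simp add: abs_mult mult_left_mono A_def)
    have 4: "real n * \<mu> = real n * env_clip_mean P M + real n * (enn2real (tail_mean P 1 M) - enn2real (tail_mean P (- 1) M))"
      unfolding \<mu>_def mean_split[OF iid tails M] by (simp add: algebra_simps)
    have "\<bar>T n - (real n * \<mu> + 2 * \<sigma> * A n)\<bar> \<le> (2 * A n + 2 * B n) * \<tau> + real (k n) * b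
       + (real (k n) * M + (real n * (2 * (2 * M * \<beta>) ^ 3) + (real (k n) * ln (1 / \<alpha>) + real n * ln (1 / (1 - \<alpha>)))) / \<beta>)
       + 2 * \<sigma> * (real n * \<delta> n)"
      using 1 2 3 4 by linarith
    also have "\<dots> = real n * E n"
      using n \<beta> by (simp add: E_def L_def field_simps)
    finally have 5: "\<bar>T n - (real n * \<mu> + 2 * \<sigma> * A n)\<bar> \<le> real n * E n" .
    have "T n / real n - (\<mu> + 2 * \<sigma> * (A n / real n)) = (T n - (real n * \<mu> + 2 * \<sigma> * A n)) / real n"
      using n by (simp add: field_simps)
    then show ?case using 5 n by (simp add: pos_divide_le_eq mult.commute)
  qed
  moreover have "(\<lambda>n. \<bar>T n / real n - (\<mu> + 2 * \<sigma> * (A n / real n))\<bar>) \<longlonglongrightarrow> \<bar>\<Psi> \<alpha> 1 - (\<mu> + 2 * \<sigma> * sqrt \<alpha>)\<bar>"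
    by (intro tendsto_rabs tendsto_diff tendsto_add tendsto_mult tendsto_const lim_T lim_A)
  moreover have "E \<longlonglongrightarrow> (2 * sqrt \<alpha> + 2 * sqrt \<alpha>) * \<tau> + \<alpha> * b + (\<alpha> * M + (L + \<alpha> * ln (1 / \<alpha>)) / \<beta>) + 2 * \<sigma> * (\<alpha> / 2 + sqrt (\<alpha> * sqrt \<alpha>))"
    unfolding E_def by (intro tendsto_add tendsto_mult tendsto_divide tendsto_const a lim_A lim_B \<delta>) (use \<beta> in simp)
  ultimately have "\<bar>\<Psi> \<alpha> 1 - (\<mu> + 2 * \<sigma> * sqrt \<alpha>)\<bar>
    \<le> (2 * sqrt \<alpha> + 2 * sqrt \<alpha>) * \<tau> + \<alpha> * b + (\<alpha> * M + (L + \<alpha> * ln (1 / \<alpha>)) / \<beta>) + 2 * \<sigma> * (\<alpha> / 2 + sqrt (\<alpha> * sqrt \<alpha>))"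
    by (intro tendsto_le[OF sequentially_bot]) auto
  then show ?thesis unfolding \<mu>_def L_def by (simp add: add_ac)
qed

theorem theorem4p1p1:
  fixes P :: "(nat \<Rightarrow> real measure) measure" and \<Psi> :: "real \<Rightarrow> real \<Rightarrow> real" and \<mu> \<sigma> :: real
  assumes "iid_env P"
    and "tail_assumptions P"
    and "is_limit_shape P \<Psi>"
    and "\<mu> = (\<integral>F. dist_mean (F 0) \<partial>P)"
    and "\<sigma> = sqrt (\<integral>F. dist_var (F 0) \<partial>P)"
  shows "(\<lambda>\<alpha>. \<Psi> \<alpha> 1 - (\<mu> + 2 * \<sigma> * sqrt \<alpha>)) \<in> o[at_right 0](\<lambda>\<alpha>. sqrt \<alpha>)"
proof (rule landau_o.smallI)
  fix c :: real assume c: "0 < c"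
  note iid = assms(1) and tails = assms(2) and shape = assms(3)
  define \<tau> where "\<tau> m = enn2real (tail_sqrt P 1 (real m)) + enn2real (tail_sqrt P (- 1) (real m))" for m
  define s where "s m = sqrt (env_clip_var P (real m))" for m
  have "\<tau> \<longlonglongrightarrow> 0 + 0"
    unfolding \<tau>_def by (intro tendsto_add tail_sqrt_tendsto_0[OF iid tails]) auto
  \<comment> \<open>The error is shared in thirds: \<open>4 * \<tau> m\<close>,
    \<open>G \<alpha>\<close> and \<open>2 * \<bar>s m - \<sigma>\<bar>\<close> are each to be below
    \<open>c / 3\<close>.\<close>
  then have \<tau>: "eventually (\<lambda>m. \<tau> m < c / 12) sequentially" using c by (intro order_tendstoD) auto
  have "s \<longlonglongrightarrow> \<sigma>"
    unfolding s_def assms(5) by (intro tendsto_real_sqrt env_clip_var_tendsto[OF iid tails])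
  then have s: "eventually (\<lambda>m. \<bar>s m - \<sigma>\<bar> < c / 6) sequentially"
    using c tendstoD[of s \<sigma> sequentially "c / 6"] by (simp add: dist_real_def)
  obtain m where m: "\<tau> m < c / 12" "\<bar>s m - \<sigma>\<bar> < c / 6"
    using eventually_happens'[OF sequentially_bot eventually_conj[OF \<tau> s]] by auto
  \<comment> \<open>From here on the height is fixed and only \<alpha> varies.\<close>
  define M where "M = real m"
  define b where "b = enn2real (tail_supint P 1 M) + enn2real (tail_supint P (- 1) M)"
  \<comment> \<open>The errors that vanish with \<alpha> at fixed height, divided by sqrt \<alpha>;
    the constant 16 is 2 times 2^3 from the exchange bound.\<close>
  define G where "G \<alpha> = b * sqrt \<alpha> + (M * sqrt \<alpha> + (16 * M ^ 3 * \<alpha> powr (1 / 4)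
      + (\<alpha> powr (1 / 8) * ln (1 / \<alpha>) + ln (1 / (1 - \<alpha>)) / \<alpha> powr (7 / 8)))) + 2 * s m * (sqrt \<alpha> / 2 + \<alpha> powr (1 / 4))" for \<alpha>
  have "(G \<longlongrightarrow> b * 0 + (M * 0 + (16 * M ^ 3 * 0 + (0 + 0))) + 2 * s m * (0 / 2 + 0)) (at_right 0)"
    unfolding G_def by (intro tendsto_add tendsto_mult tendsto_const tendsto_divide; (real_asymp | simp))
  then have "eventually (\<lambda>\<alpha>. G \<alpha> < c / 3) (at_right 0)" using c by (intro order_tendstoD) auto
  moreover have "eventually (\<lambda>\<alpha> :: real. 0 < \<alpha> \<and> \<alpha> < 1) (at_right 0)"
    unfolding eventually_at_right_field by (intro exI[of _ 1]) auto
  ultimately show "eventually (\<lambda>\<alpha>. norm (\<Psi> \<alpha> 1 - (\<mu> + 2 * \<sigma> * sqrt \<alpha>)) \<le> c * norm (sqrt \<alpha>)) (at_right 0)"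
  proof eventually_elim
    case (elim \<alpha>)
    then have \<alpha>: "0 < \<alpha>" "\<alpha> < 1" and G: "G \<alpha> < c / 3" by auto
    \<comment> \<open>The exchange error \<beta>^2 and the entropy error \<alpha> ln (1 / \<alpha>)
      / \<beta> must both be of smaller order than sqrt \<alpha>, so the exponent has to lie
      strictly between 1/4 and 1/2; 3/8 is the midpoint.\<close>
    define \<beta> where "\<beta> = \<alpha> powr (3 / 8)"
    have \<beta>: "0 < \<beta>" using \<alpha> by (simp add: \<beta>_def)
    have r: "sqrt \<alpha> = \<alpha> powr (1 / 2)" "\<alpha> = \<alpha> powr 1" using \<alpha> by (simp_all add: powr_half_sqrt)
    have 1: "\<alpha> = sqrt \<alpha> * sqrt \<alpha>" using \<alpha> by simp
    have 2: "\<beta> ^ 3 / \<beta> = sqrt \<alpha> * \<alpha> powr (1 / 4)"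
    proof -
      have "\<beta> ^ 3 / \<beta> = \<beta> * \<beta>" using \<beta> by (simp add: power3_eq_cube)
      also have "\<dots> = sqrt \<alpha> * \<alpha> powr (1 / 4)" unfolding \<beta>_def r(1) by (simp flip: powr_add)
      finally show ?thesis .
    qed
    have 3: "\<alpha> / \<beta> = sqrt \<alpha> * \<alpha> powr (1 / 8)"
    proof -
      have "sqrt \<alpha> * \<alpha> powr (1 / 8) * \<beta> = \<alpha>" unfolding \<beta>_def r(1) using \<alpha> by (simp flip: powr_add)
      then show ?thesis using \<beta> by (simp add: divide_eq_eq)
    qed
    have 4: "1 / \<beta> = sqrt \<alpha> / \<alpha> powr (7 / 8)"
      unfolding \<beta>_def r(1) by (simp flip: powr_diff) (simp add: powr_minus_divide)
    have 5: "sqrt (\<alpha> * sqrt \<alpha>) = sqrt \<alpha> * \<alpha> powr (1 / 4)"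
    proof -
      have "sqrt (sqrt \<alpha>) = (\<alpha> powr (1 / 2)) powr (1 / 2)" using \<alpha> by (simp add: powr_half_sqrt)
      then show ?thesis using \<alpha> by (simp add: real_sqrt_mult powr_powr)
    qed
    have "\<bar>\<Psi> \<alpha> 1 - (\<mu> + 2 * s m * sqrt \<alpha>)\<bar>
      \<le> 4 * sqrt \<alpha> * \<tau> m + \<alpha> * b + (\<alpha> * M + (2 * (2 * M * \<beta>) ^ 3 + (\<alpha> * ln (1 / \<alpha>) + ln (1 / (1 - \<alpha>)))) / \<beta>)
        + 2 * s m * (\<alpha> / 2 + sqrt (\<alpha> * sqrt \<alpha>))"
      unfolding assms(4) \<tau>_def s_def b_def M_def[symmetric]
      by (rule limit_shape_bound[OF iid tails shape \<alpha> _ \<beta>]) (simp add: M_def)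
    also have "\<dots> = sqrt \<alpha> * (4 * \<tau> m + G \<alpha>)"
    proof -
      have "(2 * (2 * M * \<beta>) ^ 3 + (\<alpha> * ln (1 / \<alpha>) + ln (1 / (1 - \<alpha>)))) / \<beta>
          = 16 * M ^ 3 * (\<beta> ^ 3 / \<beta>) + (\<alpha> / \<beta> * ln (1 / \<alpha>) + 1 / \<beta> * ln (1 / (1 - \<alpha>)))"
        by (simp add: power_mult_distrib add_divide_distrib)
      also have "\<dots> = sqrt \<alpha> * (16 * M ^ 3 * \<alpha> powr (1 / 4) + (\<alpha> powr (1 / 8) * ln (1 / \<alpha>) + ln (1 / (1 - \<alpha>)) / \<alpha> powr (7 / 8)))"
        unfolding 2 3 4 by (simp add: distrib_left mult_ac)
      finally have 6: "(2 * (2 * M * \<beta>) ^ 3 + (\<alpha> * ln (1 / \<alpha>) + ln (1 / (1 - \<alpha>)))) / \<beta>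
          = sqrt \<alpha> * (16 * M ^ 3 * \<alpha> powr (1 / 4) + (\<alpha> powr (1 / 8) * ln (1 / \<alpha>) + ln (1 / (1 - \<alpha>)) / \<alpha> powr (7 / 8)))" .
      have 7: "\<alpha> * x = sqrt \<alpha> * (x * sqrt \<alpha>)" "\<alpha> / 2 = sqrt \<alpha> * (sqrt \<alpha> / 2)" for x using \<alpha> by simp_all
      show ?thesis unfolding 5 6 G_def 7(1)[of b] 7(1)[of M] 7(2) by (simp add: distrib_left mult_ac)
    qed
    finally have I: "\<bar>\<Psi> \<alpha> 1 - (\<mu> + 2 * s m * sqrt \<alpha>)\<bar> \<le> sqrt \<alpha> * (4 * \<tau> m + G \<alpha>)" .
    have "\<Psi> \<alpha> 1 - (\<mu> + 2 * \<sigma> * sqrt \<alpha>) = (\<Psi> \<alpha> 1 - (\<mu> + 2 * s m * sqrt \<alpha>)) + sqrt \<alpha> * (2 * (s m - \<sigma>))"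
      by (simp add: algebra_simps)
    also have "\<bar>\<dots>\<bar> \<le> sqrt \<alpha> * (4 * \<tau> m + G \<alpha>) + sqrt \<alpha> * (2 * \<bar>s m - \<sigma>\<bar>)"
    proof (rule order_trans[OF abs_triangle_ineq add_mono[OF I]])
      show "\<bar>sqrt \<alpha> * (2 * (s m - \<sigma>))\<bar> \<le> sqrt \<alpha> * (2 * \<bar>s m - \<sigma>\<bar>)"
        unfolding abs_mult using \<alpha> by simp
    qed
    also have "\<dots> = sqrt \<alpha> * (4 * \<tau> m + G \<alpha> + 2 * \<bar>s m - \<sigma>\<bar>)" by (simp add: distrib_left)
    also have "\<dots> \<le> sqrt \<alpha> * c" using m G \<alpha> by (intro mult_left_mono) auto
    finally show ?case using \<alpha> by (simp add: mult.commute)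
  qed
qed

end
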